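(* Let $n\le t$ be positive integers. Let $S\subseteq\mathbb{R}^n$ be a $\Pi_n^{\pm}$-invariant subspace arrangement with affine components $S_1,\dots,S_k$, and let $\mathcal{M}:=\sigma^{-1}(S)\subseteq\mathbb{R}^{n\times t}$ be the induced real variety. Then $\mathrm{EDdegree}(\mathcal{M})=k$. Moreover, a generic data point $Y\in\mathbb{R}^{n\times t}$ has exactly $k$ ED critical points with respect to $\mathcal{M}$: for any decomposition $Y=U\,\mathrm{Diag}(\sigma(Y))\,V^\top$ with $U\in O(n)$ and $V\in O(t)$, the set of ED critical points of $Y$ with respect to $\mathcal{M}$ is precisely $$\{U\,\mathrm{Diag}(x)\,V^\top \ :\ x \text{ is the orthogonal projection of } \sigma(Y) \text{ onto } S_i \text{ for some } i\in\{1,\dots,k\}\}.$$ In particular, all ED critical points of such $Y$ with respect to $\mathcal{M}$ are real.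
   Context: A subspace arrangement is a set $S\subseteq\mathbb{R}^n$ that is a union of finitely many affine subspaces $S_1,\dots,S_k$ of $\mathbb{R}^n$; when the representation is chosen so that $S_i\not\subseteq S_j$ for all distinct $i,j$, the $S_i$ are called the affine components of $S$. The topology is the Zariski topology. A property holds for a generic (general) point of a variety $\mathcal{V}$ over $\mathbb{R}$ or $\mathbb{C}$ if the set of points of $\mathcal{V}$ where it holds contains a Zariski-open dense subset of $\mathcal{V}$. For a real algebraic variety $\mathcal{V}\subseteq\mathbb{R}^m$, $\mathcal{V}_{\mathbb{C}}\subseteq\mathbb{C}^m$ is its Zariski closure in $\mathbb{C}^m$. $O(s)$ is the group of real orthogonal $s\times s$ matrices. $\Pi_n^{\pm}$ is the group of signed permutations acting on $\mathbb{R}^n$. For $x\in\mathbb{C}^n$, $\mathrm{Diag}(x)$ is the $n\times t$ matrix with $(i,i)$ entry $x_i$ for $i=1,\dots,n$ and all other entries $0$. The map $\sigma:\mathbb{R}^{n\times t}\to\mathbb{R}^n$ sends a matrix to its vector of singular values in nonincreasing order. For $S$ a $\Pi_n^\pm$-invariant real variety, $\sigma^{-1}(S)$ is a real variety (known fact). $\mathcal{W}^{\mathrm{reg}}$ is the set of regular points of a variety $\mathcal{W}$: if $\mathcal{W}$ has irreducible components $\mathcal{W}_i$, it is the union of the $\mathcal{W}_i^{\mathrm{reg}}$ minus the points lying in two distinct components. For $Q\subseteq\mathbb{C}^m$, $Q^\perp=\{v\in\mathbb{C}^m: v^\top w=0\ \text{for all } w\in Q\}$ (on $\mathbb{C}^{n\times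 t}$ the bilinear form is $\mathrm{trace}(AB^\top)$). For a real variety $\mathcal{V}\subseteq\mathbb{R}^m$ and $y\in\mathbb{C}^m$, an ED critical point of $y$ with respect to $\mathcal{V}$ is a point $x\in\mathcal{V}_{\mathbb{C}}^{\mathrm{reg}}$ with $y-x\in\mathcal{T}_{\mathcal{V}_{\mathbb{C}}}(x)^\perp$, where $\mathcal{T}_{\mathcal{V}_{\mathbb{C}}}(x)$ is the tangent space of $\mathcal{V}_{\mathbb{C}}$ at $x$. For generic $y\in\mathbb{C}^m$ the number of ED critical points is a constant (known fact), called $\mathrm{EDdegree}(\mathcal{V})$. *)

theory Defs
  imports "HOL-Analysis.Analysis"
begin

section \<open>The Zariski topology on affine space\<close>

text \<open>
  Polynomial functions on affine space over a field. The fields used below are the real and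
  the complex numbers; these are infinite, so polynomials and polynomial functions agree.
\<close>

inductive poly_fun :: "('a::field ^ 'm \<Rightarrow> 'a) \<Rightarrow> bool" where
  poly_fun_const: "poly_fun (\<lambda>x. c)"
| poly_fun_coord: "poly_fun (\<lambda>x. x $ i)"
| poly_fun_add: "poly_fun f \<Longrightarrow> poly_fun g \<Longrightarrow> poly_fun (\<lambda>x. f x + g x)"
| poly_fun_mult: "poly_fun f \<Longrightarrow> poly_fun g \<Longrightarrow> poly_fun (\<lambda>x. f x * g x)"

definition zero_set :: "('a::field ^ 'm \<Rightarrow> 'a) set \<Rightarrow> ('a ^ 'm) set" where
  "zero_set F = {x. \<forall>f\<in>F. f x = 0}"

definition zariski :: "('a::field ^ 'm) topology" where
  "zariski = topology (\<lambda>U. \<exists>F. (\<forall>f\<in>F. poly_fun f) \<and> U = - zero_set F)"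

lemma istopology_zariski:
  "istopology (\<lambda>U :: ('a::field ^ 'm) set. \<exists>F. (\<forall>f\<in>F. poly_fun f) \<and> U = - zero_set F)"
  unfolding istopology_def
proof (intro conjI allI impI)
  fix S T :: "('a ^ 'm) set"
  assume "\<exists>F. (\<forall>f\<in>F. poly_fun f) \<and> S = - zero_set F"
    and "\<exists>F. (\<forall>f\<in>F. poly_fun f) \<and> T = - zero_set F"
  then obtain F G where F: "\<forall>f\<in>F. poly_fun f" "S = - zero_set F"
    and G: "\<forall>f\<in>G. poly_fun f" "T = - zero_set G"
    by blast
  let ?H = "{\<lambda>x. f x * g x |f g. f \<in> F \<and> g \<in> G}"
  have "\<forall>h\<in>?H. poly_fun h"
    using F G poly_fun_mult by blast
  moreover have "S \<inter> T = - zero_set ?H"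
    unfolding F G zero_set_def by fastforce
  ultimately show "\<exists>F. (\<forall>f\<in>F. poly_fun f) \<and> S \<inter> T = - zero_set F"
    by blast
next
  fix K :: "('a ^ 'm) set set"
  assume "\<forall>U\<in>K. \<exists>F. (\<forall>f\<in>F. poly_fun f) \<and> U = - zero_set F"
  then obtain F where F: "\<And>U. U \<in> K \<Longrightarrow> (\<forall>f\<in>F U. poly_fun f) \<and> U = - zero_set (F U)"
    by metis
  have "\<forall>f\<in>(\<Union>U\<in>K. F U). poly_fun f"
    using F by blast
  moreover have "\<Union>K = - zero_set (\<Union>U\<in>K. F U)"
  proof -
    have "\<Union>K = (\<Union>U\<in>K. - zero_set (F U))"
      using F by auto
    then show ?thesis
      by (auto simp: zero_set_def)
  qed
  ultimately show "\<exists>F. (\<forall>f\<in>F. poly_fun f) \<and> \<Union>K = - zero_set F"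
    by blast
qed

lemma openin_zariski:
  "openin zariski U \<longleftrightarrow> (\<exists>F. (\<forall>f\<in>F. poly_fun f) \<and> U = - zero_set F)"
  unfolding zariski_def topology_inverse'[OF istopology_zariski] ..

lemma topspace_zariski: "topspace (zariski :: ('a::field ^ 'm) topology) = UNIV"
proof -
  have "openin zariski (UNIV :: ('a ^ 'm) set)"
    unfolding openin_zariski
    by (rule exI[of _ "{\<lambda>x. 1}"]) (auto simp: zero_set_def intro: poly_fun_const)
  then show ?thesis
    using openin_subset by blast
qed

lemma closedin_zariski:
  "closedin zariski Z \<longleftrightarrow> (\<exists>F. (\<forall>f\<in>F. poly_fun f) \<and> Z = zero_set F)"
  by (auto simp: closedin_def topspace_zariski openin_zariski Compl_eq_Diff_UNIV[symmetric])

definition generic_in :: "('a::field ^ 'm) set \<Rightarrow> ('a ^ 'm \<Rightarrow> bool) \<Rightarrow> bool" where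
  "generic_in V P \<longleftrightarrow>
     (\<exists>U. openin (subtopology zariski V) U \<and> subtopology zariski V closure_of U = V \<and>
          U \<subseteq> {y \<in> V. P y})"


section \<open>Irreducible components, dimension, tangent spaces and regular points\<close>

definition zariski_irreducible :: "('a::field ^ 'm) set \<Rightarrow> bool" where
  "zariski_irreducible Z \<longleftrightarrow> Z \<noteq> {} \<and>
     (\<forall>A B. closedin zariski A \<and> closedin zariski B \<and> Z \<subseteq> A \<union> B \<longrightarrow> Z \<subseteq> A \<or> Z \<subseteq> B)"

definition irreducible_components :: "('a::field ^ 'm) set \<Rightarrow> ('a ^ 'm) set set" where
  "irreducible_components W =
     {Z. zariski_irreducible Z \<and> Z \<subseteq> W \<and>
         (\<forall>Z'. zariski_irreducible Z' \<and> Z \<subseteq> Z' \<and> Z' \<subseteq> W \<longrightarrow> Z' = Z)}"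

text \<open>The Krull dimension of a Zariski-closed set, via chains of irreducible closed subsets.\<close>

definition variety_dim :: "('a::field ^ 'm) set \<Rightarrow> enat" where
  "variety_dim W =
     Sup {enat d |d. \<exists>Z :: nat \<Rightarrow> ('a ^ 'm) set.
            (\<forall>i\<le>d. zariski_irreducible (Z i) \<and> closedin zariski (Z i) \<and> Z i \<subseteq> W) \<and>
            (\<forall>i<d. Z i \<subset> Z (Suc i))}"

text \<open>
  The kernel of the differentials at \<open>x\<close> of all polynomials vanishing on \<open>W\<close>. The Frechet
  derivative of a complex polynomial function is complex-linear, and its value at \<open>v\<close> is the
  sum of the products of the partial derivatives at \<open>x\<close> with the coordinates of \<open>v\<close>.
\<close>

definition tangent_space :: "(complex ^ 'm) set \<Rightarrow> complex ^ 'm \<Rightarrow> (complex ^ 'm) set" where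
  "tangent_space W x =
     {v. \<forall>f. poly_fun f \<and> (\<forall>w\<in>W. f w = 0) \<longrightarrow> frechet_derivative f (at x) v = 0}"

text \<open>Here \<open>vec.dim\<close> is the dimension over the complex numbers.\<close>

definition regular_points_irreducible :: "(complex ^ 'm) set \<Rightarrow> (complex ^ 'm) set" where
  "regular_points_irreducible Z = {x \<in> Z. enat (vec.dim (tangent_space Z x)) = variety_dim Z}"

definition regular_points :: "(complex ^ 'm) set \<Rightarrow> (complex ^ 'm) set" where
  "regular_points W =
     (\<Union>Z\<in>irreducible_components W. regular_points_irreducible Z) -
     {x. \<exists>Z\<in>irreducible_components W. \<exists>Z'\<in>irreducible_components W. Z \<noteq> Z' \<and> x \<in> Z \<and> x \<in> Z'}"


section \<open>Euclidean distance degree\<close>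

text \<open>The orthogonal complement for the bilinear (not the Hermitian) form.\<close>

definition bilinear_perp :: "(complex ^ 'm) set \<Rightarrow> (complex ^ 'm) set" where
  "bilinear_perp Q = {v. \<forall>w\<in>Q. (\<Sum>i\<in>UNIV. v $ i * w $ i) = 0}"

definition complex_vec :: "real ^ 'm \<Rightarrow> complex ^ 'm" where
  "complex_vec x = (\<chi> i. complex_of_real (x $ i))"

definition complexification :: "(real ^ 'm) set \<Rightarrow> (complex ^ 'm) set" where
  "complexification V = zariski closure_of (complex_vec ` V)"

definition ED_critical_points :: "(real ^ 'm) set \<Rightarrow> complex ^ 'm \<Rightarrow> (complex ^ 'm) set" where
  "ED_critical_points V y =
     {x \<in> regular_points (complexification V).
        y - x \<in> bilinear_perp (tangent_space (complexification V) x)}"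

definition EDdegree :: "(real ^ 'm) set \<Rightarrow> nat" where
  "EDdegree V =
     (THE d. generic_in UNIV
        (\<lambda>y. finite (ED_critical_points V y) \<and> card (ED_critical_points V y) = d))"


section \<open>Matrices and singular values\<close>

text \<open>
  Identifies \<open>n \<times> t\<close> matrices with vectors indexed by pairs; the form \<open>trace (A B\<^sup>T)\<close>
  becomes the standard bilinear form.
\<close>

definition mat_vec :: "'a ^ 't ^ 'n \<Rightarrow> 'a ^ ('n \<times> 't)" where
  "mat_vec A = (\<chi> p. A $ fst p $ snd p)"

text \<open>
  Row and column indices range over two linearly ordered finite types. An entry is diagonal
  if its row and its column have the same position in the respective order.
\<close>

definition Diag :: "real ^ 'n::{finite,linorder} \<Rightarrow> real ^ 't::{finite,linorder} ^ 'n::{finite,linorder}" where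
  "Diag x = (\<chi> i j. if card {..<i} = card {..<j} then x $ i else 0)"

text \<open>
  The square roots, in nonincreasing order, of the eigenvalues of \<open>A A\<^sup>T\<close> counted with
  multiplicity. For \<open>A\<close> with at most as many rows as columns these are all the singular values.
\<close>

definition singular_values :: "real ^ 't ^ 'n::{finite,linorder} \<Rightarrow> real ^ 'n::{finite,linorder}" where
  "singular_values A =
     (THE s. (\<forall>i. 0 \<le> s $ i) \<and> (\<forall>i j. i \<le> j \<longrightarrow> s $ j \<le> s $ i) \<and>
        (\<forall>z. det (mat z - A ** transpose A) = (\<Prod>i\<in>UNIV. z - (s $ i)\<^sup>2)))"


section \<open>Signed permutations and subspace arrangements\<close>

definition signed_permutations :: "(real ^ 'n \<Rightarrow> real ^ 'n) set" where
  "signed_permutations =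
     {\<lambda>x. \<chi> i. e i * x $ p i |e p. (\<forall>i. e i = 1 \<or> e i = -1) \<and> bij p}"

definition signed_perm_invariant :: "(real ^ 'n) set \<Rightarrow> bool" where
  "signed_perm_invariant S \<longleftrightarrow> (\<forall>g\<in>signed_permutations. g ` S = S)"

text \<open>\<open>affine\<close> admits the empty set, which is not an affine subspace here.\<close>

definition subspace_arrangement ::
    "(real ^ 'n) set \<Rightarrow> nat \<Rightarrow> (nat \<Rightarrow> (real ^ 'n) set) \<Rightarrow> bool" where
  "subspace_arrangement S k C \<longleftrightarrow>
     S = (\<Union>i\<in>{1..k}. C i) \<and>
     (\<forall>i\<in>{1..k}. affine (C i) \<and> C i \<noteq> {}) \<and>
     (\<forall>i\<in>{1..k}. \<forall>j\<in>{1..k}. i \<noteq> j \<longrightarrow> \<not> C i \<subseteq> C j)"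

definition is_orthogonal_projection ::
    "(real ^ 'n) set \<Rightarrow> real ^ 'n \<Rightarrow> real ^ 'n \<Rightarrow> bool" where
  "is_orthogonal_projection A y x \<longleftrightarrow> x \<in> A \<and> (\<forall>a\<in>A. orthogonal (y - x) (a - x))"

end

theory Submission
  imports Defs "HOL-Computational_Algebra.Fundamental_Theorem_Algebra"
begin

text \<open>
  The variety \<open>M\<close> consists of the matrices \<open>U Diag(x) V\<^sup>T\<close> with \<open>x \<in> S\<close> and orthogonal \<open>U\<close>, \<open>V\<close>. Over the
  complex numbers, let \<open>Z i\<close> be the closure of the set of matrices \<open>U Diag(x) V\<^sup>T\<close> where \<open>x\<close> runs through the
  \<open>i\<close>-th complexified affine component, and \<open>U\<close>, \<open>V\<close> run through the Cayley transforms of skew-symmetric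
  matrices. The union \<open>W\<close> of the \<open>Z i\<close> is the complexification of \<open>M\<close>: every orthogonal matrix is a Cayley
  transform times a diagonal matrix of signs, the signs preserve \<open>S\<close>, and the real parameters are
  Zariski-dense among the complex ones.

  Suppose that the data point is \<open>Y = U Diag(s) V\<^sup>T\<close>, where the entries of \<open>s\<close> are nonzero with distinct
  squares. By invariance take \<open>Y = Diag(s)\<close>. A critical point \<open>X\<close> is orthogonal to its own orbit directions
  \<open>A X + X B\<^sup>T\<close>, with \<open>A\<close> and \<open>B\<close> skew-symmetric. These directions are tangent to \<open>W\<close>, so \<open>Y\<close> is orthogonal to
  them, and this forces \<open>X\<close> to be diagonal, say \<open>X = Diag(x)\<close>. Then \<open>x\<close> lies on a component of \<open>S\<close>, and
  criticality along the directions of this component makes \<open>x\<close> the orthogonal projection of \<open>s\<close> onto it.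
  For generic \<open>s\<close> all \<open>k\<close> projections are critical and distinct (\<open>critical_points_W\<close>).

  The work lies in what surrounds this computation.

  First, the regular points require the dimension, the tangent spaces and the irreducible components
  of \<open>W\<close>. The dimension of a rationally parametrized variety is the generic rank of its parametrization
  (\<open>trdeg_le_rank\<close>, \<open>variety_dim_ge_rank\<close>), and generic tangent spaces are no larger than the
  transcendence degree (\<open>trdeg_le_imp_tangent_dim_le\<close>). Hence \<open>Z i\<close> is regular at generic points, with the
  image of the differential as tangent space.

  Second, a diagonal matrix in \<open>Z i\<close> must have its diagonal in the \<open>i\<close>-th component up to a signed
  permutation (\<open>diag_in_Z_imp\<close>), although \<open>Z i\<close> is only a closure. Polynomials on diagonals that are invariant
  under signed permutations extend to polynomials on matrices that are invariant under orthogonal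
  matrices on both sides (\<open>invariant_extension\<close>), and such extensions separate \<open>Z i\<close> from the other diagonal
  matrices. It follows that the \<open>Z i\<close> are the irreducible components of \<open>W\<close> (\<open>irreducible_components_W\<close>).

  Third, a generic complex matrix has a singular value decomposition over the complex numbers
  (\<open>complex_singular_value_decomposition\<close>), and genericity of its singular values is a polynomial
  condition on the matrix, again by extension of invariants (\<open>invariant_product_extension\<close>). This yields
  the count for generic complex data. A real matrix always has a real decomposition, so the same
  description shows that its critical points are real.
\<close>

section \<open>Polynomial functions\<close>

lemma poly_fun_sum:
  assumes "\<And>a. a \<in> A \<Longrightarrow> poly_fun (f a)"
  shows "poly_fun (\<lambda>x. \<Sum>a\<in>A. f a x)"
  using assms
  by (induction A rule: infinite_finite_induct) (auto intro: poly_fun_const poly_fun_add)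

lemma poly_fun_prod:
  assumes "\<And>a. a \<in> A \<Longrightarrow> poly_fun (f a)"
  shows "poly_fun (\<lambda>x. \<Prod>a\<in>A. f a x)"
  using assms
  by (induction A rule: infinite_finite_induct) (auto intro: poly_fun_const poly_fun_mult)

lemma poly_fun_power:
  assumes "poly_fun f" shows "poly_fun (\<lambda>x. f x ^ k)"
  by (induction k) (auto intro: poly_fun_const poly_fun_mult assms)

lemma poly_fun_uminus:
  assumes "poly_fun f" shows "poly_fun (\<lambda>x. - f x)"
  using poly_fun_mult[OF poly_fun_const[of "-1"] assms] by simp

lemma poly_fun_diff:
  assumes "poly_fun f" "poly_fun g" shows "poly_fun (\<lambda>x. f x - g x)"
  using poly_fun_add[OF assms(1) poly_fun_uminus[OF assms(2)]] by simp

lemma poly_fun_compose: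
  assumes "poly_fun f" "\<And>i. poly_fun (\<lambda>u. \<Psi> u $ i)"
  shows "poly_fun (\<lambda>u. f (\<Psi> u))"
  using assms by (induction rule: poly_fun.induct) (auto intro: poly_fun.intros)

lemma poly_fun_det:
  fixes M :: "'a::field ^ 'm \<Rightarrow> 'a ^ 'k ^ 'k"
  assumes "\<And>i j. poly_fun (\<lambda>x. M x $ i $ j)"
  shows "poly_fun (\<lambda>x. det (M x))"
  unfolding det_def by (intro poly_fun_sum poly_fun_mult poly_fun_const poly_fun_prod assms)

lemmas poly_fun_intros =
  poly_fun_const poly_fun_coord poly_fun_add poly_fun_mult poly_fun_sum poly_fun_prod
  poly_fun_power poly_fun_uminus poly_fun_diff poly_fun_det

lemma poly_fun_on_line:
  assumes "poly_fun f"
  shows "\<exists>q::'a::field poly. \<forall>z. f (u + z *s v) = poly q z"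
  using assms
proof (induction rule: poly_fun.induct)
  case (poly_fun_const c)
  show ?case by (rule exI[of _ "[:c:]"]) simp
next
  case (poly_fun_coord i)
  show ?case by (rule exI[of _ "[:u $ i, v $ i:]"]) (simp add: algebra_simps)
next
  case (poly_fun_add f g)
  then show ?case by (metis poly_add)
next
  case (poly_fun_mult f g)
  then show ?case by (metis poly_mult)
qed

lemma poly_fun_nonzero_common2:
  fixes f g :: "'a::field_char_0 ^ 'm \<Rightarrow> 'a"
  assumes f: "poly_fun f" "f a \<noteq> 0" and g: "poly_fun g" "g b \<noteq> 0"
  shows "\<exists>x. f x \<noteq> 0 \<and> g x \<noteq> 0"
proof -
  obtain p where p: "\<forall>z. f (a + z *s (b - a)) = poly p z" using poly_fun_on_line[OF f(1)] by blast
  obtain q where q: "\<forall>z. g (a + z *s (b - a)) = poly q z" using poly_fun_on_line[OF g(1)] by blast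
  have "poly p 0 \<noteq> 0" using p[rule_format, of 0] f(2) by simp
  moreover have "poly q 1 \<noteq> 0" using q[rule_format, of 1] g(2) by simp
  ultimately have "p * q \<noteq> 0" by auto
  then have "finite {z. poly (p * q) z = 0}" by (rule poly_roots_finite)
  then obtain z where "poly (p * q) z \<noteq> 0"
    using infinite_UNIV_char_0[where 'a='a] by (metis (mono_tags, lifting) UNIV_I finite_subset mem_Collect_eq subsetI)
  then show ?thesis using p q by (intro exI[of _ "a + z *s (b - a)"]) auto
qed

lemma poly_fun_nonzero_common:
  fixes f :: "'i \<Rightarrow> 'a::field_char_0 ^ 'm \<Rightarrow> 'a"
  assumes "finite I" "\<And>i. i \<in> I \<Longrightarrow> poly_fun (f i)" "\<And>i. i \<in> I \<Longrightarrow> \<exists>x. f i x \<noteq> 0"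
  shows "\<exists>x. \<forall>i\<in>I. f i x \<noteq> 0"
proof -
  have "\<exists>x. (\<Prod>i\<in>I. f i x) \<noteq> 0"
    using assms
  proof (induction I rule: finite_induct)
    case (insert i I)
    obtain a where a: "f i a \<noteq> 0" using insert.prems by auto
    obtain b where b: "(\<Prod>i\<in>I. f i b) \<noteq> 0" using insert by auto
    have "\<exists>x. f i x \<noteq> 0 \<and> (\<Prod>i\<in>I. f i x) \<noteq> 0"
      by (rule poly_fun_nonzero_common2[where a=a and b=b]) (use a b insert.prems in \<open>auto intro!: poly_fun_prod\<close>)
    then show ?case using insert by simp
  qed auto
  then show ?thesis using assms(1) by auto
qed

text \<open>The real points are Zariski dense: along a complex line through two real points a
  polynomial is determined by its values at real parameters.\<close>

lemma poly_fun_zero_on_reals: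
  fixes f :: "complex ^ 'm \<Rightarrow> complex"
  assumes f: "poly_fun f" and z: "\<And>x. f (complex_vec x) = 0"
  shows "f u = 0"
proof -
  define a where "a = (\<chi> i. Re (u $ i))"
  define b where "b = (\<chi> i. Im (u $ i))"
  obtain q where q: "\<forall>z. f (complex_vec a + z *s complex_vec b) = poly q z"
    using poly_fun_on_line[OF f] by blast
  have "poly q (of_real r) = 0" for r
  proof -
    have "complex_vec a + of_real r *s complex_vec b = complex_vec (a + r *s b)"
      by (simp add: vec_eq_iff complex_vec_def)
    then show ?thesis using z q by metis
  qed
  then have "range complex_of_real \<subseteq> {z. poly q z = 0}" by auto
  moreover have "infinite (range complex_of_real)"
    by (metis range_inj_infinite injI of_real_eq_iff infinite_UNIV_char_0 finite_imageD)
  ultimately have "q = 0" using poly_roots_finite finite_subset by blast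
  moreover have "u = complex_vec a + \<i> *s complex_vec b"
    by (simp add: vec_eq_iff complex_vec_def a_def b_def complex_eq)
  ultimately show ?thesis using q by simp
qed

lemma poly_fun_real_and_imaginary_part:
  fixes f :: "complex ^ 'm \<Rightarrow> complex"
  assumes "poly_fun f"
  shows "\<exists>a b. poly_fun a \<and> poly_fun b \<and> (\<forall>x. f (complex_vec x) = Complex (a x) (b x))"
  using assms
proof (induction rule: poly_fun.induct)
  case (poly_fun_const c)
  show ?case by (rule exI[of _ "\<lambda>x. Re c"], rule exI[of _ "\<lambda>x. Im c"]) (auto intro: poly_fun_intros)
next
  case (poly_fun_coord i)
  show ?case by (rule exI[of _ "\<lambda>x. x $ i"], rule exI[of _ "\<lambda>x. 0"])
    (auto intro: poly_fun_intros simp: complex_vec_def complex_eq_iff)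
next
  case (poly_fun_add f g)
  then obtain a b a' b' where *: "poly_fun a" "poly_fun b" "\<forall>x. f (complex_vec x) = Complex (a x) (b x)"
    "poly_fun a'" "poly_fun b'" "\<forall>x. g (complex_vec x) = Complex (a' x) (b' x)" by blast
  show ?case
    by (rule exI[of _ "\<lambda>x. a x + a' x"], rule exI[of _ "\<lambda>x. b x + b' x"]) (use * in \<open>auto intro: poly_fun_intros simp: complex_eq_iff\<close>)
next
  case (poly_fun_mult f g)
  then obtain a b a' b' where *: "poly_fun a" "poly_fun b" "\<forall>x. f (complex_vec x) = Complex (a x) (b x)"
    "poly_fun a'" "poly_fun b'" "\<forall>x. g (complex_vec x) = Complex (a' x) (b' x)" by blast
  show ?case
    by (rule exI[of _ "\<lambda>x. a x * a' x - b x * b' x"], rule exI[of _ "\<lambda>x. a x * b' x + b x * a' x"])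
      (use * in \<open>auto intro!: poly_fun_intros simp: complex_eq_iff\<close>)
qed

section \<open>Zariski closures, generic points and irreducible sets\<close>

lemma zariski_closure_of_eq:
  "zariski closure_of P = {x. \<forall>f. poly_fun f \<and> (\<forall>p\<in>P. f p = 0) \<longrightarrow> f x = 0}" (is "_ = ?C")
proof
  have "closedin zariski ?C"
    unfolding closedin_zariski zero_set_def
    by (rule exI[of _ "{f. poly_fun f \<and> (\<forall>p\<in>P. f p = 0)}"]) auto
  then show "zariski closure_of P \<subseteq> ?C" by (rule closure_of_minimal[rotated]) auto
next
  have "closedin zariski (zariski closure_of P)" by simp
  then obtain F where F: "\<forall>f\<in>F. poly_fun f" "zariski closure_of P = zero_set F"
    unfolding closedin_zariski by blast
  have "P \<subseteq> zariski closure_of P" by (rule closure_of_subset) (simp add: topspace_zariski)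
  then have "P \<subseteq> zero_set F" using F(2) by simp
  then have "x \<in> zero_set F" if "x \<in> ?C" for x
    using that F(1) by (auto simp: zero_set_def subset_eq)
  then show "?C \<subseteq> zariski closure_of P" using F(2) by auto
qed

lemma zariski_closure_subset: "P \<subseteq> zariski closure_of P"
  by (rule closure_of_subset) (simp add: topspace_zariski)

lemma vanishes_on_closure_iff:
  assumes "poly_fun f"
  shows "(\<forall>x\<in>zariski closure_of P. f x = 0) \<longleftrightarrow> (\<forall>x\<in>P. f x = 0)"
  using assms zariski_closure_subset[of P] by (auto simp: zariski_closure_of_eq)

lemma closedin_zariski_separating_poly:
  assumes "closedin zariski Z" "x \<notin> Z"
  obtains f where "poly_fun f" "\<forall>z\<in>Z. f z = 0" "f x \<noteq> 0"
  using assms unfolding closedin_zariski zero_set_def by blast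

lemma generic_in_UNIV_I:
  fixes q :: "'a::field_char_0 ^ 'm \<Rightarrow> 'a"
  assumes q: "poly_fun q" "q a \<noteq> 0" and P: "\<And>y. q y \<noteq> 0 \<Longrightarrow> P y"
  shows "generic_in UNIV P"
  unfolding generic_in_def
proof (intro exI conjI)
  have sub: "subtopology zariski UNIV = (zariski :: ('a ^ 'm) topology)"
    by (metis subtopology_topspace topspace_zariski)
  show "openin (subtopology zariski UNIV) {y. q y \<noteq> 0}"
    unfolding sub openin_zariski zero_set_def by (rule exI[of _ "{q}"]) (use q in auto)
  have "x \<in> zariski closure_of {y. q y \<noteq> 0}" for x
  proof -
    have "f x = 0" if f: "poly_fun f" "\<And>p. q p \<noteq> 0 \<Longrightarrow> f p = 0" for f
      using poly_fun_nonzero_common2[OF f(1) _ q, of x] f(2) by blast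
    then show ?thesis by (auto simp: zariski_closure_of_eq)
  qed
  then show "subtopology zariski UNIV closure_of {y. q y \<noteq> 0} = UNIV" unfolding sub by auto
  show "{y. q y \<noteq> 0} \<subseteq> {y \<in> UNIV. P y}" using P by auto
qed

lemma generic_in_UNIV_common:
  assumes "generic_in (UNIV :: ('a::field_char_0 ^ 'm) set) P" "generic_in UNIV Q"
  shows "\<exists>y. P y \<and> Q y"
proof -
  have sub: "subtopology zariski UNIV = (zariski :: ('a ^ 'm) topology)"
    by (metis subtopology_topspace topspace_zariski)
  obtain U where U: "openin zariski U" "zariski closure_of U = UNIV" "U \<subseteq> {y. P y}"
    using assms(1) unfolding generic_in_def sub by auto
  obtain U' where U': "openin zariski U'" "zariski closure_of U' = UNIV" "U' \<subseteq> {y. Q y}"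
    using assms(2) unfolding generic_in_def sub by auto
  have "U \<noteq> {}" using U(2) by auto
  then obtain x where x: "x \<in> U" by auto
  have "x \<in> zariski closure_of U'" using U' by auto
  then have "\<exists>y. y \<in> U' \<and> y \<in> U" using U(1) x unfolding in_closure_of by blast
  then show ?thesis using U U' by auto
qed

lemma zariski_irreducible_closure:
  assumes "P \<noteq> {}"
    and dom: "\<And>f g. poly_fun f \<Longrightarrow> poly_fun g \<Longrightarrow> \<forall>x\<in>P. f x * g x = 0 \<Longrightarrow>
       (\<forall>x\<in>P. f x = 0) \<or> (\<forall>x\<in>P. g x = 0)"
  shows "zariski_irreducible (zariski closure_of P)"
  unfolding zariski_irreducible_def
proof (intro conjI allI impI)
  show "zariski closure_of P \<noteq> {}" using assms(1) zariski_closure_subset[of P] by auto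
  fix A B assume *: "closedin zariski A \<and> closedin zariski B \<and> zariski closure_of P \<subseteq> A \<union> B"
  show "zariski closure_of P \<subseteq> A \<or> zariski closure_of P \<subseteq> B"
  proof (rule ccontr)
    assume "\<not> ?thesis"
    then have "\<not> P \<subseteq> A" "\<not> P \<subseteq> B" using * closure_of_minimal by blast+
    then obtain a b where ab: "a \<in> P" "a \<notin> A" "b \<in> P" "b \<notin> B" by auto
    obtain f where f: "poly_fun f" "\<forall>z\<in>A. f z = 0" "f a \<noteq> 0"
      using closedin_zariski_separating_poly[of A a] * ab by blast
    obtain g where g: "poly_fun g" "\<forall>z\<in>B. g z = 0" "g b \<noteq> 0"
      using closedin_zariski_separating_poly[of B b] * ab by blast
    have "P \<subseteq> A \<union> B" using * zariski_closure_subset[of P] by auto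
    then have "\<forall>x\<in>P. f x * g x = 0" using f g by auto
    then show False using dom[OF f(1) g(1)] f g ab by blast
  qed
qed

lemma zariski_irreducible_domain:
  assumes "zariski_irreducible Z" "poly_fun f" "poly_fun g" "\<forall>x\<in>Z. f x * g x = 0"
  shows "(\<forall>x\<in>Z. f x = 0) \<or> (\<forall>x\<in>Z. g x = 0)"
proof -
  have "closedin zariski (zero_set {f})" "closedin zariski (zero_set {g})"
    unfolding closedin_zariski using assms by (metis singletonD)+
  then have "closedin zariski {x. f x = 0}" "closedin zariski {x. g x = 0}"
    by (simp_all add: zero_set_def)
  moreover have "Z \<subseteq> {x. f x = 0} \<union> {x. g x = 0}" using assms by auto
  ultimately have "Z \<subseteq> {x. f x = 0} \<or> Z \<subseteq> {x. g x = 0}"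
    using assms(1) unfolding zariski_irreducible_def by blast
  then show ?thesis by auto
qed

lemma zariski_irreducible_finite_union:
  assumes Z: "zariski_irreducible Z" and "finite I" "\<And>i. i \<in> I \<Longrightarrow> closedin zariski (A i)"
    and "Z \<subseteq> (\<Union>i\<in>I. A i)"
  shows "\<exists>i\<in>I. Z \<subseteq> A i"
  using assms(2-)
proof (induction I rule: finite_induct)
  case empty
  then show ?case using Z unfolding zariski_irreducible_def by auto
next
  case (insert i I)
  have "closedin zariski (\<Union>i\<in>I. A i)" using insert by (intro closedin_Union) auto
  then have "Z \<subseteq> A i \<or> Z \<subseteq> (\<Union>i\<in>I. A i)"
    using Z insert.prems unfolding zariski_irreducible_def by (auto simp: closedin_def)
  then show ?case using insert by auto
qed

section \<open>Complex differentiability\<close>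

text \<open>Complex differentiability in several variables, in terms of the real Frechet derivative that
  enters the definition of the tangent space.\<close>

definition cdiff :: "(complex ^ 'p \<Rightarrow> complex) \<Rightarrow> complex ^ 'p \<Rightarrow> bool" where
  "cdiff f u \<longleftrightarrow> f differentiable at u \<and>
     (\<forall>c v. frechet_derivative f (at u) (c *s v) = c * frechet_derivative f (at u) v)"

lemma cdiffI:
  assumes "(f has_derivative f') (at u)" "\<And>c v. f' (c *s v) = c * f' v"
  shows "cdiff f u"
  using assms frechet_derivative_at[OF assms(1)] unfolding cdiff_def differentiable_def by metis

lemma cdiff_has_derivative: "cdiff f u \<Longrightarrow> (f has_derivative frechet_derivative f (at u)) (at u)"
  unfolding cdiff_def by (simp add: frechet_derivative_works)

lemma cdiff_scale: "cdiff f u \<Longrightarrow> frechet_derivative f (at u) (c *s v) = c * frechet_derivative f (at u) v"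
  unfolding cdiff_def by blast

lemma cdiff_const: "cdiff (\<lambda>x. c) u"
  by (rule cdiffI[where f' = "\<lambda>v. 0"]) auto

lemma cdiff_coord: "cdiff (\<lambda>x. x $ i) u"
  by (rule cdiffI[where f' = "\<lambda>v. v $ i"]) (auto intro: bounded_linear_imp_has_derivative bounded_linear_vec_nth)

lemma frechet_derivative_const_eq: "frechet_derivative (\<lambda>x. c) (at u) v = 0"
  by (simp add: frechet_derivative_const)

lemma frechet_derivative_coord_eq: "frechet_derivative (\<lambda>x::complex^'p. x $ i) (at u) v = v $ i"
  by (metis bounded_linear_imp_has_derivative bounded_linear_vec_nth frechet_derivative_at)

lemma cdiff_add:
  assumes "cdiff f u" "cdiff g u"
  shows "cdiff (\<lambda>x. f x + g x) u"
    and "frechet_derivative (\<lambda>x. f x + g x) (at u) v = frechet_derivative f (at u) v + frechet_derivative g (at u) v"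
proof -
  have *: "((\<lambda>x. f x + g x) has_derivative
    (\<lambda>v. frechet_derivative f (at u) v + frechet_derivative g (at u) v)) (at u)"
    by (intro derivative_intros cdiff_has_derivative assms)
  show "cdiff (\<lambda>x. f x + g x) u"
    by (rule cdiffI[OF *]) (simp add: cdiff_scale assms algebra_simps)
  show "frechet_derivative (\<lambda>x. f x + g x) (at u) v = frechet_derivative f (at u) v + frechet_derivative g (at u) v"
    using frechet_derivative_at[OF *] by metis
qed

lemma cdiff_mult:
  assumes "cdiff f u" "cdiff g u"
  shows "cdiff (\<lambda>x. f x * g x) u"
    and "frechet_derivative (\<lambda>x. f x * g x) (at u) v = f u * frechet_derivative g (at u) v + frechet_derivative f (at u) v * g u"
proof -
  have *: "((\<lambda>x. f x * g x) has_derivative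
    (\<lambda>v. f u * frechet_derivative g (at u) v + frechet_derivative f (at u) v * g u)) (at u)"
    by (intro derivative_intros cdiff_has_derivative assms)
  show "cdiff (\<lambda>x. f x * g x) u"
    by (rule cdiffI[OF *]) (simp add: cdiff_scale assms algebra_simps)
  show "frechet_derivative (\<lambda>x. f x * g x) (at u) v = f u * frechet_derivative g (at u) v + frechet_derivative f (at u) v * g u"
    using frechet_derivative_at[OF *] by metis
qed

lemma cdiff_poly_fun: "poly_fun f \<Longrightarrow> cdiff f u"
  by (induction rule: poly_fun.induct) (auto intro: cdiff_const cdiff_coord cdiff_add cdiff_mult)

lemma cdiff_inverse:
  assumes "cdiff f u" "f u \<noteq> 0"
  shows "cdiff (\<lambda>x. inverse (f x)) u"
proof (rule cdiffI)
  show "((\<lambda>x. inverse (f x)) has_derivative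
    (\<lambda>v. - (inverse (f u) * frechet_derivative f (at u) v * inverse (f u)))) (at u)"
    by (rule Deriv.has_derivative_inverse) (use assms cdiff_has_derivative in auto)
qed (simp add: cdiff_scale assms)

lemma cdiff_transform:
  assumes "cdiff f u" "open D" "u \<in> D" "\<And>x. x \<in> D \<Longrightarrow> f x = g x"
  shows "cdiff g u" "frechet_derivative g (at u) = frechet_derivative f (at u)"
proof -
  have *: "(g has_derivative frechet_derivative f (at u)) (at u)"
    by (rule has_derivative_transform_within_open[OF cdiff_has_derivative[OF assms(1)] assms(2,3)])
      (use assms in auto)
  show "cdiff g u" by (rule cdiffI[OF *]) (simp add: cdiff_scale assms)
  show "frechet_derivative g (at u) = frechet_derivative f (at u)" using frechet_derivative_at[OF *] by simp
qed


section \<open>Algebraic independence\<close>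

text \<open>Polynomials in the variables \<open>0, ..., q - 1\<close>, as functions of a sequence. Sequences keep all
  numbers of variables in one type, so that induction on \<open>q\<close> is possible.\<close>

inductive npoly :: "nat \<Rightarrow> ((nat \<Rightarrow> complex) \<Rightarrow> complex) \<Rightarrow> bool" for q where
  npoly_const: "npoly q (\<lambda>a. c)"
| npoly_var: "i < q \<Longrightarrow> npoly q (\<lambda>a. a i)"
| npoly_add: "npoly q F \<Longrightarrow> npoly q G \<Longrightarrow> npoly q (\<lambda>a. F a + G a)"
| npoly_mult: "npoly q F \<Longrightarrow> npoly q G \<Longrightarrow> npoly q (\<lambda>a. F a * G a)"

lemma npoly_cong: "npoly q F \<Longrightarrow> (\<And>i. i < q \<Longrightarrow> a i = b i) \<Longrightarrow> F a = F b"
  by (induction rule: npoly.induct) auto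

lemma npoly_Suc: "npoly q F \<Longrightarrow> npoly (Suc q) F"
  by (induction rule: npoly.induct) (auto intro: npoly.intros)

lemma npoly_sum: "(\<And>x. x \<in> A \<Longrightarrow> npoly q (f x)) \<Longrightarrow> npoly q (\<lambda>a. \<Sum>x\<in>A. f x a)"
  by (induction A rule: infinite_finite_induct) (auto intro: npoly.intros)

lemma npoly_prod: "(\<And>x. x \<in> A \<Longrightarrow> npoly q (f x)) \<Longrightarrow> npoly q (\<lambda>a. \<Prod>x\<in>A. f x a)"
  by (induction A rule: infinite_finite_induct) (auto intro: npoly.intros)

lemma npoly_power: "npoly q f \<Longrightarrow> npoly q (\<lambda>a. f a ^ k)"
  by (induction k) (auto intro: npoly.intros)

text \<open>The Horner form singles out the last variable, so that a polynomial relation can be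
  divided by it or differentiated with respect to it.\<close>

inductive horner :: "nat \<Rightarrow> nat \<Rightarrow> ((nat \<Rightarrow> complex) \<Rightarrow> complex) \<Rightarrow> bool" for q where
  horner_base: "npoly q g \<Longrightarrow> horner q 0 g"
| horner_step: "horner q k F \<Longrightarrow> npoly q g \<Longrightarrow> horner q (Suc k) (\<lambda>a. F a * a q + g a)"

inductive_cases horner_0E: "horner q 0 F"
inductive_cases horner_SucE: "horner q (Suc k) F"

lemma horner_Suc: "horner q k F \<Longrightarrow> horner q (Suc k) F"
proof (induction rule: horner.induct)
  case (horner_base g)
  have "horner q (Suc 0) (\<lambda>a. 0 * a q + g a)"
    by (intro horner.intros npoly_const horner_base)
  then show ?case by simp
qed (intro horner.intros)

lemma horner_mono: "horner q k F \<Longrightarrow> k \<le> l \<Longrightarrow> horner q l F"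
  by (induction l) (auto simp: le_Suc_eq intro: horner_Suc)

lemma horner_add: "horner q k F \<Longrightarrow> horner q k G \<Longrightarrow> horner q k (\<lambda>a. F a + G a)"
proof (induction k arbitrary: F G)
  case 0
  then show ?case by (auto elim!: horner_0E intro!: horner_base npoly_add)
next
  case (Suc k)
  obtain F1 f where F: "F = (\<lambda>a. F1 a * a q + f a)" "horner q k F1" "npoly q f"
    using Suc.prems(1) by (auto elim: horner_SucE)
  obtain G1 g where G: "G = (\<lambda>a. G1 a * a q + g a)" "horner q k G1" "npoly q g"
    using Suc.prems(2) by (auto elim: horner_SucE)
  have "horner q (Suc k) (\<lambda>a. (F1 a + G1 a) * a q + (f a + g a))"
    using F G by (intro horner_step Suc.IH npoly_add)
  then show ?case by (simp add: F(1) G(1) algebra_simps)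
qed

lemma horner_scale: "horner q k F \<Longrightarrow> npoly q g \<Longrightarrow> horner q k (\<lambda>a. g a * F a)"
proof (induction rule: horner.induct)
  case (horner_base f)
  then show ?case by (intro horner.intros npoly_mult)
next
  case (horner_step k F f)
  have "horner q (Suc k) (\<lambda>a. (g a * F a) * a q + (g a * f a))"
    using horner_step by (intro horner.horner_step npoly_mult) auto
  then show ?case by (simp add: algebra_simps)
qed

lemma horner_mult_var:
  assumes "horner q k F" shows "horner q (Suc k) (\<lambda>a. F a * a q)"
  using horner_step[OF assms npoly_const[of q 0]] by simp

lemma horner_mult: "horner q k F \<Longrightarrow> horner q l G \<Longrightarrow> \<exists>m. horner q m (\<lambda>a. F a * G a)"
proof (induction arbitrary: rule: horner.induct)
  case (horner_base f)
  then show ?case using horner_scale by blast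
next
  case (horner_step k F f)
  then obtain m where m: "horner q m (\<lambda>a. F a * G a)" by auto
  have "horner q (Suc m + l) (\<lambda>a. F a * G a * a q)"
    by (rule horner_mono[OF horner_mult_var[OF m]]) simp
  moreover have "horner q (Suc m + l) (\<lambda>a. f a * G a)"
    by (rule horner_mono[OF horner_scale]) (use horner_step in auto)
  ultimately have "horner q (Suc m + l) (\<lambda>a. F a * G a * a q + f a * G a)"
    by (rule horner_add)
  then show ?case by (intro exI[of _ "Suc m + l"]) (simp add: algebra_simps)
qed

lemma npoly_imp_horner: "npoly (Suc q) F \<Longrightarrow> \<exists>k. horner q k F"
proof (induction rule: npoly.induct)
  case (npoly_const c)
  then show ?case using horner_base npoly.npoly_const by blast
next
  case (npoly_var i)
  show ?case
  proof (cases "i = q")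
    case True
    have "horner q (Suc 0) (\<lambda>a. 1 * a q + 0)" by (intro horner.intros npoly.npoly_const)
    then show ?thesis using True by auto
  next
    case False
    then show ?thesis using npoly_var horner_base npoly.npoly_var by (metis less_antisym)
  qed
next
  case (npoly_add F G)
  then obtain k l where "horner q k F" "horner q l G" by auto
  then have "horner q (max k l) F" "horner q (max k l) G" by (auto intro: horner_mono)
  then show ?case using horner_add by blast
next
  case (npoly_mult F G)
  then show ?case using horner_mult by blast
qed

lemma horner_imp_npoly: "horner q k F \<Longrightarrow> npoly (Suc q) F"
proof (induction rule: horner.induct)
  case (horner_step k F g)
  then show ?case
    by (intro npoly_add npoly_mult npoly_Suc[OF horner_step(2)] npoly_var[of q "Suc q"]) auto
qed (rule npoly_Suc)

definition eval_list :: "('x \<Rightarrow> complex) list \<Rightarrow> 'x \<Rightarrow> nat \<Rightarrow> complex" where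
  "eval_list fs u = (\<lambda>i. (fs ! i) u)"

definition alg_indep :: "'x set \<Rightarrow> ('x \<Rightarrow> complex) list \<Rightarrow> bool" where
  "alg_indep D fs \<longleftrightarrow>
     (\<forall>G. npoly (length fs) G \<and> (\<forall>u\<in>D. G (eval_list fs u) = 0) \<longrightarrow> (\<forall>a. G a = 0))"

definition subalgebra :: "('x \<Rightarrow> complex) set \<Rightarrow> bool" where
  "subalgebra R \<longleftrightarrow> (\<forall>c. (\<lambda>u. c) \<in> R) \<and>
     (\<forall>f\<in>R. \<forall>g\<in>R. (\<lambda>u. f u + g u) \<in> R \<and> (\<lambda>u. f u * g u) \<in> R)"

definition domain_on :: "'x set \<Rightarrow> ('x \<Rightarrow> complex) set \<Rightarrow> bool" where
  "domain_on D R \<longleftrightarrow> D \<noteq> {} \<and> (\<forall>f\<in>R. \<forall>g\<in>R. (\<forall>u\<in>D. f u * g u = 0) \<longrightarrow>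
     (\<forall>u\<in>D. f u = 0) \<or> (\<forall>u\<in>D. g u = 0))"

definition derivation_at :: "'x \<Rightarrow> ('x \<Rightarrow> complex) set \<Rightarrow> (('x \<Rightarrow> complex) \<Rightarrow> complex) \<Rightarrow> bool" where
  "derivation_at u R d \<longleftrightarrow> (\<forall>c. d (\<lambda>x. c) = 0) \<and>
     (\<forall>f\<in>R. \<forall>g\<in>R. d (\<lambda>x. f x + g x) = d f + d g \<and>
        d (\<lambda>x. f x * g x) = f u * d g + d f * g u)"

lemma domain_on_mult_nonzero:
  assumes "domain_on D R" "f \<in> R" "g \<in> R" "\<exists>u\<in>D. f u \<noteq> 0" "\<exists>u\<in>D. g u \<noteq> 0"
  shows "\<exists>u\<in>D. f u * g u \<noteq> 0"
proof (rule ccontr)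
  assume "\<not> ?thesis"
  then have "\<forall>u\<in>D. f u * g u = 0" by blast
  then show False using assms unfolding domain_on_def by blast
qed

lemma subalgebra_poly_fun: "subalgebra {f. poly_fun f}"
  unfolding subalgebra_def by (auto intro: poly_fun_intros)

lemma eval_list_append_cong:
  assumes "npoly (length fs) G"
  shows "G (eval_list (fs @ gs) u) = G (eval_list fs u)"
  by (rule npoly_cong[OF assms]) (simp add: eval_list_def nth_append)

lemma eval_list_last: "eval_list (fs @ [f]) u (length fs) = f u"
  by (simp add: eval_list_def)

lemma npoly_eval_in_subalgebra:
  assumes "subalgebra R" "set fs \<subseteq> R" "npoly (length fs) G"
  shows "(\<lambda>u. G (eval_list fs u)) \<in> R"
  using assms(3)
proof (induction rule: npoly.induct)
  case (npoly_var i)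
  then show ?case using assms(2) by (auto simp: eval_list_def)
qed (use assms(1) in \<open>auto simp: subalgebra_def\<close>)

lemma horner_eval_in_subalgebra:
  assumes "subalgebra R" "set fs \<subseteq> R" "f \<in> R" "horner (length fs) k G"
  shows "(\<lambda>u. G (eval_list (fs @ [f]) u)) \<in> R"
  by (rule npoly_eval_in_subalgebra[OF assms(1)])
    (use assms horner_imp_npoly[OF assms(4)] in auto)

lemma derivation_npoly_zero:
  assumes d: "derivation_at u R d" and R: "subalgebra R" "set fs \<subseteq> R"
    and z: "\<And>f. f \<in> set fs \<Longrightarrow> d f = 0" and G: "npoly (length fs) G"
  shows "d (\<lambda>x. G (eval_list fs x)) = 0"
  using G
proof (induction rule: npoly.induct)
  case (npoly_const c)
  then show ?case using d by (simp add: derivation_at_def)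
next
  case (npoly_var i)
  then show ?case using z by (simp add: eval_list_def)
next
  case (npoly_add F G)
  then show ?case using d npoly_eval_in_subalgebra[OF R] by (simp add: derivation_at_def)
next
  case (npoly_mult F G)
  then show ?case using d npoly_eval_in_subalgebra[OF R] by (simp add: derivation_at_def)
qed

lemma alg_indep_Nil: "D \<noteq> {} \<Longrightarrow> alg_indep D []"
  unfolding alg_indep_def by (auto intro: npoly_cong[of 0, THEN trans])

lemma alg_indep_mono: "alg_indep D fs \<Longrightarrow> D \<subseteq> D' \<Longrightarrow> alg_indep D' fs"
  unfolding alg_indep_def by blast

lemma alg_indep_snocD: "alg_indep D (fs @ [f]) \<Longrightarrow> alg_indep D fs"
  unfolding alg_indep_def using eval_list_append_cong npoly_Suc by fastforce

text \<open>A function that vanishes on a subset, but not on the whole irreducible set, is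
  transcendental over any functions that are independent on the subset: restriction of a relation to
  the subset kills its constant term, and then one may divide by the new function.\<close>

lemma alg_indep_snoc_vanishing:
  assumes ind: "alg_indep D' fs" and "D' \<subseteq> D" and f0: "\<And>u. u \<in> D' \<Longrightarrow> f u = 0"
    and f1: "u1 \<in> D" "f u1 \<noteq> 0" and R: "subalgebra R" "domain_on D R" "set fs \<subseteq> R" "f \<in> R"
  shows "alg_indep D (fs @ [f])"
proof -
  have "\<forall>a. G a = 0" if "horner (length fs) k G" "\<forall>u\<in>D. G (eval_list (fs @ [f]) u) = 0" for k G
    using that
  proof (induction k arbitrary: G)
    case 0
    then have "npoly (length fs) G" by (auto elim: horner_0E)
    then show ?case using ind 0 \<open>D' \<subseteq> D\<close> unfolding alg_indep_def
      using eval_list_append_cong by (metis subsetD)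
  next
    case (Suc k)
    obtain F g where G: "G = (\<lambda>a. F a * a (length fs) + g a)" "horner (length fs) k F" "npoly (length fs) g"
      using Suc.prems(1) by (auto elim: horner_SucE)
    have "g (eval_list fs u) = 0" if "u \<in> D'" for u
    proof -
      have "G (eval_list (fs @ [f]) u) = 0" using Suc.prems(2) that \<open>D' \<subseteq> D\<close> by auto
      then show ?thesis using f0[OF that] by (simp add: G(1) eval_list_last eval_list_append_cong[OF G(3)])
    qed
    then have g0: "\<forall>a. g a = 0" using ind G(3) unfolding alg_indep_def by blast
    have "\<forall>u\<in>D. F (eval_list (fs @ [f]) u) * f u = 0"
      using Suc.prems(2) by (simp add: G(1) g0 eval_list_last)
    moreover have "(\<lambda>u. F (eval_list (fs @ [f]) u)) \<in> R"
      by (rule horner_eval_in_subalgebra[OF R(1,3,4) G(2)])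
    ultimately have "\<forall>u\<in>D. F (eval_list (fs @ [f]) u) = 0"
      using R f1 unfolding domain_on_def by (metis (no_types, lifting))
    then have "\<forall>a. F a = 0" by (rule Suc.IH[OF G(2)])
    then show ?case by (simp add: G(1) g0)
  qed
  then show ?thesis unfolding alg_indep_def using npoly_imp_horner by fastforce
qed

text \<open>The derivative \<open>P'\<close> of a Horner form with respect to its last variable has smaller degree, and
  it governs every derivation that kills the other variables.\<close>

lemma horner_derivative:
  assumes "horner (length fs) (Suc k) P"
  shows "\<exists>P'. horner (length fs) k P' \<and>
     (\<forall>a z. ((\<lambda>z. P (a(length fs := z))) has_field_derivative P' (a(length fs := z))) (at z)) \<and>
     (\<forall>u R d f. derivation_at u R d \<and> subalgebra R \<and> set fs \<subseteq> R \<and> f \<in> R \<and> (\<forall>g\<in>set fs. d g = 0) \<longrightarrow>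
        d (\<lambda>x. P (eval_list (fs @ [f]) x)) = P' (eval_list (fs @ [f]) u) * d f)"
  using assms
proof (induction k arbitrary: P)
  case 0
  let ?q = "length fs"
  obtain F g where P: "P = (\<lambda>a. F a * a ?q + g a)" "horner ?q 0 F" "npoly ?q g"
    using 0 by (auto elim: horner_SucE)
  have F: "npoly ?q F" using P(2) by (auto elim: horner_0E)
  have upd: "F (a(?q := z)) = F a" "g (a(?q := z)) = g a" for a z
    by (rule npoly_cong[OF F] npoly_cong[OF P(3)], simp)+
  have "((\<lambda>z. P (a(?q := z))) has_field_derivative F (a(?q := z))) (at z)" for a z
    unfolding P(1) upd by (auto intro!: derivative_eq_intros)
  moreover have "d (\<lambda>x. P (eval_list (fs @ [f]) x)) = F (eval_list (fs @ [f]) u) * d f"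
    if d: "derivation_at u R d" and R: "subalgebra R" "set fs \<subseteq> R" "f \<in> R" "\<forall>g\<in>set fs. d g = 0" for u R d f
  proof -
    have *: "(\<lambda>x. F (eval_list fs x)) \<in> R" "(\<lambda>x. g (eval_list fs x)) \<in> R"
      "d (\<lambda>x. F (eval_list fs x)) = 0" "d (\<lambda>x. g (eval_list fs x)) = 0"
      using npoly_eval_in_subalgebra[OF R(1,2)] derivation_npoly_zero[OF d R(1,2)] F P(3) R(4) by auto
    have "(\<lambda>x. F (eval_list fs x) * f x) \<in> R" using * R by (auto simp: subalgebra_def)
    then show ?thesis
      using * d R(3)
      by (simp add: P(1) eval_list_last eval_list_append_cong[OF F] eval_list_append_cong[OF P(3)]
          derivation_at_def)
  qed
  ultimately show ?case using P(2) by blast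
next
  case (Suc k)
  let ?q = "length fs"
  obtain F g where P: "P = (\<lambda>a. F a * a ?q + g a)" "horner ?q (Suc k) F" "npoly ?q g"
    using Suc.prems by (auto elim: horner_SucE)
  obtain F' where F': "horner ?q k F'"
    "\<And>a z. ((\<lambda>z. F (a(?q := z))) has_field_derivative F' (a(?q := z))) (at z)"
    "\<And>u R d f. derivation_at u R d \<Longrightarrow> subalgebra R \<Longrightarrow> set fs \<subseteq> R \<Longrightarrow> f \<in> R \<Longrightarrow> (\<forall>g\<in>set fs. d g = 0) \<Longrightarrow>
        d (\<lambda>x. F (eval_list (fs @ [f]) x)) = F' (eval_list (fs @ [f]) u) * d f"
    using Suc.IH[OF P(2)] by blast
  define P' where "P' = (\<lambda>a. F' a * a ?q + F a)"
  have "horner ?q (Suc k) P'"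
    unfolding P'_def by (intro horner_add horner_mult_var F'(1) P(2))
  moreover have "((\<lambda>z. P (a(?q := z))) has_field_derivative P' (a(?q := z))) (at z)" for a z
  proof -
    have upd: "g (a(?q := z)) = g a" for z by (rule npoly_cong[OF P(3)]) simp
    show ?thesis unfolding P(1) P'_def upd
      by (auto intro!: derivative_eq_intros F'(2) simp: mult.commute)
  qed
  moreover have "d (\<lambda>x. P (eval_list (fs @ [f]) x)) = P' (eval_list (fs @ [f]) u) * d f"
    if d: "derivation_at u R d" and R: "subalgebra R" "set fs \<subseteq> R" "f \<in> R" "\<forall>g\<in>set fs. d g = 0" for u R d f
  proof -
    have 1: "(\<lambda>x. g (eval_list fs x)) \<in> R" "d (\<lambda>x. g (eval_list fs x)) = 0"
      using npoly_eval_in_subalgebra[OF R(1,2)] derivation_npoly_zero[OF d R(1,2)] P(3) R(4) by auto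
    have 2: "(\<lambda>x. F (eval_list (fs @ [f]) x)) \<in> R"
      by (rule horner_eval_in_subalgebra[OF R(1-3) P(2)])
    have 3: "d (\<lambda>x. F (eval_list (fs @ [f]) x)) = F' (eval_list (fs @ [f]) u) * d f"
      by (rule F'(3)[OF d R])
    have 4: "(\<lambda>x. F (eval_list (fs @ [f]) x) * f x) \<in> R" using 2 R by (auto simp: subalgebra_def)
    have "d (\<lambda>x. F (eval_list (fs @ [f]) x) * f x + g (eval_list fs x)) =
      d (\<lambda>x. F (eval_list (fs @ [f]) x) * f x)"
      using d 4 1 by (simp add: derivation_at_def)
    also have "\<dots> = F (eval_list (fs @ [f]) u) * d f + F' (eval_list (fs @ [f]) u) * d f * f u"
      using d 2 3 R(3) by (simp add: derivation_at_def)
    finally show ?thesis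
      by (simp add: P(1) P'_def eval_list_last eval_list_append_cong[OF P(3)] algebra_simps)
  qed
  ultimately show ?case by blast
qed

text \<open>If \<open>f\<close> is algebraic over independent functions, then at a generic point every derivation
  that kills those functions kills \<open>f\<close>: differentiate a relation of minimal degree in \<open>f\<close>. This
  uses characteristic 0.\<close>

lemma algebraic_imp_derivation_zero:
  assumes ind: "alg_indep D fs" and dep: "\<not> alg_indep D (fs @ [f])"
    and R: "subalgebra R" "set fs \<subseteq> R" "f \<in> R"
  shows "\<exists>h\<in>R. (\<exists>u\<in>D. h u \<noteq> 0) \<and>
     (\<forall>u\<in>D. \<forall>d. h u \<noteq> 0 \<and> derivation_at u R d \<and> (\<forall>g\<in>R. (\<forall>x\<in>D. g x = 0) \<longrightarrow> d g = 0) \<and>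
        (\<forall>g\<in>set fs. d g = 0) \<longrightarrow> d f = 0)"
proof -
  let ?q = "length fs"
  define rel where "rel k P \<longleftrightarrow> horner ?q k P \<and> (\<forall>u\<in>D. P (eval_list (fs @ [f]) u) = 0) \<and> (\<exists>a. P a \<noteq> 0)" for k P
  obtain G where G: "npoly (Suc ?q) G" "\<forall>u\<in>D. G (eval_list (fs @ [f]) u) = 0" "\<exists>a. G a \<noteq> 0"
    using dep unfolding alg_indep_def by auto
  then have "\<exists>k P. rel k P" using npoly_imp_horner[OF G(1)] unfolding rel_def by blast
  then obtain k where k: "\<exists>P. rel k P" "\<And>l. l < k \<Longrightarrow> \<not> (\<exists>P. rel l P)"
    using exists_least_iff[of "\<lambda>k. \<exists>P. rel k P"] by blast
  then obtain P where P: "horner ?q k P" "\<forall>u\<in>D. P (eval_list (fs @ [f]) u) = 0" "\<exists>a. P a \<noteq> 0"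
    unfolding rel_def by blast
  have npoly_False: False if "npoly ?q P"
    using ind that P(2,3) eval_list_append_cong[OF that] unfolding alg_indep_def by metis
  obtain l where l: "k = Suc l"
  proof (cases k)
    case 0
    then have "npoly ?q P" using P(1) by (auto elim: horner_0E)
    then show ?thesis using npoly_False by blast
  qed
  obtain P' where P': "horner ?q l P'"
    "\<And>a z. ((\<lambda>z. P (a(?q := z))) has_field_derivative P' (a(?q := z))) (at z)"
    "\<And>u R d f. derivation_at u R d \<Longrightarrow> subalgebra R \<Longrightarrow> set fs \<subseteq> R \<Longrightarrow> f \<in> R \<Longrightarrow> (\<forall>g\<in>set fs. d g = 0) \<Longrightarrow>
        d (\<lambda>x. P (eval_list (fs @ [f]) x)) = P' (eval_list (fs @ [f]) u) * d f"
    using horner_derivative[of fs l P] P(1) l by blast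
  define h where "h = (\<lambda>u. P' (eval_list (fs @ [f]) u))"
  have "\<exists>a. P' a \<noteq> 0"
  proof (rule ccontr)
    assume "\<not> ?thesis"
    then have *: "((\<lambda>z. P (a(?q := z))) has_field_derivative 0) (at z)" for a z using P'(2) by metis
    have const: "P (a(?q := z)) = P (a(?q := 0))" for a z
      using has_field_derivative_zero_constant[of UNIV "\<lambda>z. P (a(?q := z))"] * by (metis UNIV_I convex_UNIV)
    obtain F g where Fg: "P = (\<lambda>a. F a * a ?q + g a)" "npoly ?q g"
      using P(1) l by (auto elim: horner_SucE)
    have "P a = g a" for a
    proof -
      have "P a = P (a(?q := 0))" using const[of a "a ?q"] by simp
      also have "\<dots> = g (a(?q := 0))" by (simp add: Fg(1))
      also have "\<dots> = g a" by (rule npoly_cong[OF Fg(2)]) simp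
      finally show ?thesis .
    qed
    then have "npoly ?q P" using Fg(2) by (simp add: ext[of P g])
    then show False by (rule npoly_False)
  qed
  then have "\<exists>u\<in>D. h u \<noteq> 0"
    using k(2)[of l] P'(1) l unfolding rel_def h_def by blast
  moreover have "h \<in> R" unfolding h_def by (rule horner_eval_in_subalgebra[OF R P'(1)])
  moreover have "d f = 0"
    if u: "u \<in> D" "h u \<noteq> 0" "derivation_at u R d" "\<forall>g\<in>R. (\<forall>x\<in>D. g x = 0) \<longrightarrow> d g = 0" "\<forall>g\<in>set fs. d g = 0" for u d
  proof -
    have "d (\<lambda>x. P (eval_list (fs @ [f]) x)) = 0"
      by (rule u(4)[rule_format, OF horner_eval_in_subalgebra[OF R P(1)]]) (use P(2) in auto)
    then have "h u * d f = 0" using P'(3)[OF u(3) R u(5)] unfolding h_def by simp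
    then show ?thesis using u(2) by simp
  qed
  ultimately show ?thesis by blast
qed

text \<open>Enlarging an independent family by members of a finite list \<open>cs\<close> as far as possible makes
  all of \<open>cs\<close> algebraic over it.\<close>

lemma generic_derivation_zero:
  assumes ind: "alg_indep D fs" and R: "subalgebra R" "domain_on D R" "set fs \<subseteq> R" "\<And>c. c \<in> C \<Longrightarrow> x c \<in> R"
    and "finite C"
  shows "\<exists>cs h. distinct cs \<and> set cs \<subseteq> C \<and> alg_indep D (fs @ map x cs) \<and> h \<in> R \<and> (\<exists>u\<in>D. h u \<noteq> 0) \<and>
     (\<forall>u\<in>D. \<forall>d. h u \<noteq> 0 \<and> derivation_at u R d \<and> (\<forall>g\<in>R. (\<forall>x\<in>D. g x = 0) \<longrightarrow> d g = 0) \<and>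
        (\<forall>g\<in>set fs. d g = 0) \<and> (\<forall>c\<in>set cs. d (x c) = 0) \<longrightarrow> (\<forall>c\<in>C. d (x c) = 0))"
proof -
  define ok where "ok cs \<longleftrightarrow> distinct cs \<and> set cs \<subseteq> C \<and> alg_indep D (fs @ map x cs)" for cs
  have "ok []" using ind by (simp add: ok_def)
  moreover have "\<forall>cs. ok cs \<longrightarrow> length cs < Suc (card C)"
    unfolding ok_def using \<open>finite C\<close> by (metis card_mono distinct_card less_Suc_eq_le)
  ultimately obtain cs where cs: "ok cs" "\<And>cs'. ok cs' \<Longrightarrow> length cs' \<le> length cs"
    using ex_has_greatest_nat[of ok "[]" length] by blast
  let ?F = "fs @ map x cs"
  have FR: "set ?F \<subseteq> R" using R cs(1) by (auto simp: ok_def)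
  define good where "good c h \<longleftrightarrow> h \<in> R \<and> (\<exists>u\<in>D. h u \<noteq> 0) \<and>
     (\<forall>u\<in>D. \<forall>d. h u \<noteq> 0 \<and> derivation_at u R d \<and> (\<forall>g\<in>R. (\<forall>x\<in>D. g x = 0) \<longrightarrow> d g = 0) \<and>
        (\<forall>g\<in>set ?F. d g = 0) \<longrightarrow> d (x c) = 0)" for c h
  have "\<exists>h. good c h" if c: "c \<in> C - set cs" for c
    unfolding good_def Bex_def[of R, symmetric]
  proof (rule algebraic_imp_derivation_zero)
    show "alg_indep D ?F" using cs by (simp add: ok_def)
    have "\<not> ok (cs @ [c])" using cs(2) by fastforce
    then show "\<not> alg_indep D (?F @ [x c])" using cs(1) c by (auto simp: ok_def)
  qed (use R FR c in auto)
  then have "\<forall>c\<in>C - set cs. \<exists>h. good c h" by blast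
  then obtain h where good: "\<forall>c\<in>C - set cs. good c (h c)" using bchoice[of "C - set cs" good] by blast
  then have h: "\<And>c. c \<in> C - set cs \<Longrightarrow> h c \<in> R" "\<And>c. c \<in> C - set cs \<Longrightarrow> \<exists>u\<in>D. h c u \<noteq> 0"
    "\<And>c u d. c \<in> C - set cs \<Longrightarrow> u \<in> D \<Longrightarrow> h c u \<noteq> 0 \<Longrightarrow> derivation_at u R d \<Longrightarrow>
       (\<forall>g\<in>R. (\<forall>x\<in>D. g x = 0) \<longrightarrow> d g = 0) \<Longrightarrow> (\<forall>g\<in>set ?F. d g = 0) \<Longrightarrow> d (x c) = 0"
    unfolding good_def by simp_all
  have prodR: "(\<lambda>u. \<Prod>c\<in>A. h c u) \<in> R \<and> (\<exists>u\<in>D. (\<Prod>c\<in>A. h c u) \<noteq> 0)" if "A \<subseteq> C - set cs" for A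
  proof -
    have "finite A" using that \<open>finite C\<close> by (meson finite_Diff finite_subset)
    then show ?thesis using that
    proof (induction A rule: finite_induct)
      case empty
      then show ?case using R by (auto simp: subalgebra_def domain_on_def)
    next
      case (insert c A)
      have 1: "(\<lambda>u. \<Prod>c\<in>A. h c u) \<in> R" "\<exists>u\<in>D. (\<Prod>c\<in>A. h c u) \<noteq> 0" "h c \<in> R" "\<exists>u\<in>D. h c u \<noteq> 0"
        using insert h by auto
      then have "(\<lambda>u. h c u * (\<Prod>c\<in>A. h c u)) \<in> R" using R by (auto simp: subalgebra_def)
      moreover have "\<exists>u\<in>D. h c u * (\<Prod>c\<in>A. h c u) \<noteq> 0"
        by (rule domain_on_mult_nonzero[OF R(2) 1(3,1,4,2)])
      ultimately show ?case using insert by simp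
    qed
  qed
  let ?h = "\<lambda>u. \<Prod>c\<in>C - set cs. h c u"
  have "\<forall>u\<in>D. \<forall>d. ?h u \<noteq> 0 \<and> derivation_at u R d \<and> (\<forall>g\<in>R. (\<forall>x\<in>D. g x = 0) \<longrightarrow> d g = 0) \<and>
        (\<forall>g\<in>set fs. d g = 0) \<and> (\<forall>c\<in>set cs. d (x c) = 0) \<longrightarrow> (\<forall>c\<in>C. d (x c) = 0)"
  proof (intro ballI allI impI, elim conjE)
    fix u d c assume *: "u \<in> D" "?h u \<noteq> 0" "derivation_at u R d" "\<forall>g\<in>R. (\<forall>x\<in>D. g x = 0) \<longrightarrow> d g = 0"
      "\<forall>g\<in>set fs. d g = 0" "\<forall>c\<in>set cs. d (x c) = 0" "c \<in> C"
    show "d (x c) = 0"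
    proof (cases "c \<in> set cs")
      case False
      then have "h c u \<noteq> 0" using *(2,7) \<open>finite C\<close> by auto
      then show ?thesis using h(3)[of c u d] * False by auto
    qed (use * in auto)
  qed
  moreover have "distinct cs" "set cs \<subseteq> C" "alg_indep D ?F" using cs(1) unfolding ok_def by auto
  moreover have "?h \<in> R" "\<exists>u\<in>D. ?h u \<noteq> 0" using prodR[of "C - set cs"] by auto
  ultimately show ?thesis by (intro exI[of _ cs] exI[of _ ?h] conjI)
qed

text \<open>The transcendence degree of the polynomial functions on \<open>Z\<close> is at most \<open>r\<close>. It bounds the length of
  chains, and it can be computed from a parametrization.\<close>

definition trdeg_le :: "(complex ^ 'm) set \<Rightarrow> nat \<Rightarrow> bool" where
  "trdeg_le Z r \<longleftrightarrow> (\<forall>fs. length fs = Suc r \<and> (\<forall>f\<in>set fs. poly_fun f) \<longrightarrow> \<not> alg_indep Z fs)"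

lemma trdeg_le_mono: "trdeg_le Z r \<Longrightarrow> r \<le> s \<Longrightarrow> trdeg_le Z s"
proof (induction s)
  case (Suc s)
  show ?case
  proof (cases "r = Suc s")
    case False
    then have le: "trdeg_le Z s" using Suc by simp
    show ?thesis unfolding trdeg_le_def
    proof (intro allI impI notI, elim conjE)
      fix fs assume fs: "length fs = Suc (Suc s)" "\<forall>f\<in>set fs. poly_fun f" "alg_indep Z fs"
      obtain gs g where g: "fs = gs @ [g]" using fs(1) by (cases fs rule: rev_cases) auto
      show False using le fs alg_indep_snocD[of Z gs g] unfolding trdeg_le_def g by auto
    qed
  qed (use Suc in simp)
qed simp

lemma domain_on_poly_fun: "zariski_irreducible Z \<Longrightarrow> domain_on Z {f. poly_fun f}"
  unfolding domain_on_def using zariski_irreducible_domain by (auto simp: zariski_irreducible_def)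

text \<open>Each step of a chain contributes a polynomial that vanishes on the smaller set but not on the
  larger one.\<close>

lemma chain_imp_alg_indep:
  assumes "\<And>i. i \<le> d \<Longrightarrow> zariski_irreducible (Z i)" "\<And>i. i \<le> d \<Longrightarrow> closedin zariski (Z i)"
    and "\<And>i. i < d \<Longrightarrow> Z i \<subset> Z (Suc i)"
  shows "\<exists>fs. length fs = d \<and> (\<forall>f\<in>set fs. poly_fun f) \<and> alg_indep (Z d) fs"
  using assms
proof (induction d)
  case 0
  then show ?case using alg_indep_Nil[of "Z 0"] by (auto simp: zariski_irreducible_def)
next
  case (Suc d)
  obtain fs where fs: "length fs = d" "\<forall>f\<in>set fs. poly_fun f" "alg_indep (Z d) fs" using Suc by force
  have sub: "Z d \<subset> Z (Suc d)" using Suc by auto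
  then obtain x where x: "x \<in> Z (Suc d)" "x \<notin> Z d" by auto
  obtain f where f: "poly_fun f" "\<forall>z\<in>Z d. f z = 0" "f x \<noteq> 0"
    using closedin_zariski_separating_poly[OF _ x(2)] Suc by auto
  have "alg_indep (Z (Suc d)) (fs @ [f])"
  proof (rule alg_indep_snoc_vanishing[OF fs(3)])
    show "domain_on (Z (Suc d)) {f. poly_fun f}" using Suc by (intro domain_on_poly_fun) auto
    show "x \<in> Z (Suc d)" "f x \<noteq> 0" using x f by auto
  qed (use f sub fs subalgebra_poly_fun in auto)
  then show ?case using fs f by (intro exI[of _ "fs @ [f]"]) auto
qed

lemma trdeg_le_imp_variety_dim_le:
  fixes Z :: "(complex ^ 'm) set"
  assumes "trdeg_le Z r"
  shows "variety_dim Z \<le> enat r"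
  unfolding variety_dim_def
proof (rule Sup_least, clarify)
  fix d and C :: "nat \<Rightarrow> (complex ^ 'm) set"
  assume C: "\<forall>i\<le>d. zariski_irreducible (C i) \<and> closedin zariski (C i) \<and> C i \<subseteq> Z" "\<forall>i<d. C i \<subset> C (Suc i)"
  obtain fs where fs: "length fs = d" "\<forall>f\<in>set fs. poly_fun f" "alg_indep (C d) fs"
    using chain_imp_alg_indep[of d C] C by auto
  show "enat d \<le> enat r"
  proof (rule ccontr)
    assume "\<not> enat d \<le> enat r"
    then have "Suc r \<le> d" by simp
    then obtain s where s: "d = Suc s" "r \<le> s" by (cases d) auto
    have "trdeg_le Z s" using trdeg_le_mono[OF assms s(2)] .
    moreover have "alg_indep Z fs" using alg_indep_mono[OF fs(3)] C by auto
    ultimately show False using fs s unfolding trdeg_le_def by auto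
  qed
qed

lemma trdeg_le_closure:
  assumes "\<And>fs. length fs = Suc r \<Longrightarrow> (\<And>f. f \<in> set fs \<Longrightarrow> poly_fun f) \<Longrightarrow> \<not> alg_indep P fs"
  shows "trdeg_le (zariski closure_of P) r"
  unfolding trdeg_le_def
proof (intro allI impI notI, elim conjE)
  fix fs assume fs: "length fs = Suc r" "\<forall>f\<in>set fs. poly_fun f" "alg_indep (zariski closure_of P) fs"
  have "\<not> alg_indep P fs" by (rule assms) (use fs in auto)
  then obtain G where G: "npoly (length fs) G" "\<forall>u\<in>P. G (eval_list fs u) = 0" "\<not> (\<forall>a. G a = 0)"
    unfolding alg_indep_def by blast
  have "(\<lambda>u. G (eval_list fs u)) \<in> {f. poly_fun f}"
    by (rule npoly_eval_in_subalgebra[OF subalgebra_poly_fun]) (use fs G in auto)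
  then have "\<forall>u\<in>zariski closure_of P. G (eval_list fs u) = 0"
    using vanishes_on_closure_iff[of "\<lambda>u. G (eval_list fs u)" P] G(2) by simp
  then show False using fs(3) G unfolding alg_indep_def by blast
qed

text \<open>The projection to the coordinates in \<open>K\<close> is injective on \<open>T\<close>.\<close>

lemma dim_le_card_coords:
  fixes T :: "('a::field ^ 'm) set"
  assumes T: "vec.subspace T" and inj: "\<And>v. v \<in> T \<Longrightarrow> \<forall>c\<in>K. v $ c = 0 \<Longrightarrow> v = 0"
  shows "vec.dim T \<le> card K"
proof -
  define p :: "'a ^ 'm \<Rightarrow> 'a ^ 'm" where "p v = (\<chi> c. if c \<in> K then v $ c else 0)" for v
  have lin: "Vector_Spaces.linear (*s) (*s) p"
    by unfold_locales (auto simp: p_def vec_eq_iff algebra_simps)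
  have "inj_on p T"
  proof (rule inj_onI)
    fix v w assume vw: "v \<in> T" "w \<in> T" "p v = p w"
    have "v - w \<in> T" using T vw vec.subspace_diff by blast
    moreover have "\<forall>c\<in>K. (v - w) $ c = 0" using vw(3) by (auto simp: p_def vec_eq_iff split: if_splits)
    ultimately show "v = w" using inj by force
  qed
  moreover have "vec.span T = T" using T by simp
  ultimately have "vec.dim (p ` T) = vec.dim T" using vec.dim_image_eq[OF lin] by metis
  moreover have "p ` T \<subseteq> vec.span ((\<lambda>c. axis c 1) ` K)"
  proof clarify
    fix v
    have "p v = (\<Sum>c\<in>K. v $ c *s axis c 1)"
      by (auto simp: vec_eq_iff p_def axis_def if_distrib sum.If_cases Int_def cong: if_cong)
    moreover have "(\<Sum>c\<in>K. v $ c *s axis c 1) \<in> vec.span ((\<lambda>c. axis c 1) ` K)"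
      by (rule vec.span_sum, rule vec.span_scale, rule vec.span_base, rule imageI)
    ultimately show "p v \<in> vec.span ((\<lambda>c. axis c 1) ` K)" by simp
  qed
  then have "vec.dim (p ` T) \<le> card ((\<lambda>c. axis c (1::'a)) ` K)"
    by (rule vec.dim_le_card) simp
  moreover have "card ((\<lambda>c. axis c (1::'a)) ` K) \<le> card K" by (rule card_image_le) simp
  ultimately show ?thesis by linarith
qed

lemma tangent_space_subspace: "vec.subspace (tangent_space W x)"
  unfolding vec.subspace_def tangent_space_def
proof (safe)
  fix f :: "complex ^ 'a \<Rightarrow> complex" assume f: "poly_fun f"
  have d: "(f has_derivative frechet_derivative f (at x)) (at x)"
    by (rule cdiff_has_derivative[OF cdiff_poly_fun[OF f]])
  interpret bounded_linear "frechet_derivative f (at x)" by (rule has_derivative_bounded_linear[OF d])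
  show "frechet_derivative f (at x) 0 = 0" by (rule zero)
  { fix v w assume *: "\<forall>w\<in>W. f w = 0" "\<forall>f. poly_fun f \<and> (\<forall>w\<in>W. f w = 0) \<longrightarrow> frechet_derivative f (at x) v = 0"
      "\<forall>f. poly_fun f \<and> (\<forall>w\<in>W. f w = 0) \<longrightarrow> frechet_derivative f (at x) w = 0"
    show "frechet_derivative f (at x) (v + w) = 0" using * f by (simp add: add) }
  { fix c v assume *: "\<forall>w\<in>W. f w = 0" "\<forall>f. poly_fun f \<and> (\<forall>w\<in>W. f w = 0) \<longrightarrow> frechet_derivative f (at x) v = 0"
    show "frechet_derivative f (at x) (c *s v) = 0"
      using * f cdiff_scale[OF cdiff_poly_fun[OF f]] by simp }
qed

lemma derivation_at_frechet:
  assumes "\<And>f. f \<in> R \<Longrightarrow> cdiff f u"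
  shows "derivation_at u R (\<lambda>f. frechet_derivative f (at u) v)"
  unfolding derivation_at_def
  by (simp add: cdiff_add(2) cdiff_mult(2) assms frechet_derivative_const_eq)

text \<open>Differentiation along a tangent vector is a derivation. Generically it is determined by its
  values on a transcendence basis chosen among the coordinates, so these coordinates separate the
  tangent vectors.\<close>

lemma trdeg_le_imp_tangent_dim_le:
  fixes Z :: "(complex ^ 'm) set"
  assumes Z: "zariski_irreducible Z" and tr: "trdeg_le Z r"
  shows "\<exists>h. poly_fun h \<and> (\<exists>x\<in>Z. h x \<noteq> 0) \<and> (\<forall>x\<in>Z. h x \<noteq> 0 \<longrightarrow> vec.dim (tangent_space Z x) \<le> r)"
proof -
  have "Z \<noteq> {}" using Z by (auto simp: zariski_irreducible_def)
  have "\<exists>cs h. distinct cs \<and> set cs \<subseteq> UNIV \<and> alg_indep Z ([] @ map (\<lambda>c x. x $ c) cs) \<and> h \<in> {f. poly_fun f} \<and>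
     (\<exists>u\<in>Z. h u \<noteq> 0) \<and>
     (\<forall>u\<in>Z. \<forall>d. h u \<noteq> 0 \<and> derivation_at u {f. poly_fun f} d \<and>
       (\<forall>g\<in>{f. poly_fun f}. (\<forall>x\<in>Z. g x = 0) \<longrightarrow> d g = 0) \<and>
        (\<forall>g\<in>set []. d g = 0) \<and> (\<forall>c\<in>set cs. d (\<lambda>x. x $ c) = 0) \<longrightarrow> (\<forall>c\<in>UNIV. d (\<lambda>x. x $ c) = 0))"
    by (rule generic_derivation_zero[OF alg_indep_Nil[OF \<open>Z \<noteq> {}\<close>] subalgebra_poly_fun domain_on_poly_fun[OF Z]])
      (auto intro: poly_fun_coord)
  then obtain cs h where cs: "distinct cs" "alg_indep Z ([] @ map (\<lambda>c x. x $ c) cs)"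
    and h: "h \<in> {f. poly_fun f}" "\<exists>u\<in>Z. h u \<noteq> 0"
    and *: "\<forall>u\<in>Z. \<forall>d. h u \<noteq> 0 \<and> derivation_at u {f. poly_fun f} d \<and>
       (\<forall>g\<in>{f. poly_fun f}. (\<forall>x\<in>Z. g x = 0) \<longrightarrow> d g = 0) \<and>
        (\<forall>g\<in>set []. d g = 0) \<and> (\<forall>c\<in>set cs. d (\<lambda>x. x $ c) = 0) \<longrightarrow> (\<forall>c\<in>UNIV. d (\<lambda>x. x $ c) = 0)"
    by (elim exE conjE) (rule that)
  have len: "length cs \<le> r"
  proof (rule ccontr)
    assume "\<not> ?thesis"
    then obtain s where s: "length cs = Suc s" "r \<le> s" by (cases "length cs") auto
    have "trdeg_le Z s" by (rule trdeg_le_mono[OF tr s(2)])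
    then show False
      using cs s unfolding trdeg_le_def
      by (auto dest!: spec[of _ "map (\<lambda>c x. x $ c) cs"] intro: poly_fun_coord)
  qed
  have "vec.dim (tangent_space Z x) \<le> r" if x: "x \<in> Z" "h x \<noteq> 0" for x
  proof -
    have "vec.dim (tangent_space Z x) \<le> card (set cs)"
    proof (rule dim_le_card_coords[OF tangent_space_subspace])
      fix v assume v: "v \<in> tangent_space Z x" "\<forall>c\<in>set cs. v $ c = 0"
      have "derivation_at x {f. poly_fun f} (\<lambda>f. frechet_derivative f (at x) v)"
        by (rule derivation_at_frechet) (auto intro: cdiff_poly_fun)
      moreover have "\<forall>g\<in>{f. poly_fun f}. (\<forall>x\<in>Z. g x = 0) \<longrightarrow> frechet_derivative g (at x) v = 0"
        using v by (auto simp: tangent_space_def)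
      ultimately have "\<forall>c\<in>UNIV. frechet_derivative (\<lambda>x. x $ c) (at x) v = 0"
        using *[rule_format, of x "\<lambda>f. frechet_derivative f (at x) v"] x v(2)
        by (simp add: frechet_derivative_coord_eq)
      then show "v = 0" by (simp add: frechet_derivative_coord_eq vec_eq_iff)
    qed
    then show ?thesis using len cs(1) by (simp add: distinct_card)
  qed
  then show ?thesis using h by auto
qed


section \<open>Counting: rational functions of few variables are dependent\<close>

text \<open>Gaussian elimination: a homogeneous system with more unknowns than equations has a nonzero
  solution.\<close>

lemma nontrivial_linear_relation:
  fixes v :: "'j \<Rightarrow> 'i \<Rightarrow> 'a::field"
  assumes "finite I" "finite J" "card I < card J"
  shows "\<exists>c. (\<exists>j\<in>J. c j \<noteq> 0) \<and> (\<forall>i\<in>I. (\<Sum>j\<in>J. c j * v j i) = 0)"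
  using assms
proof (induction I arbitrary: J v rule: finite_induct)
  case empty
  then have "J \<noteq> {}" by auto
  then show ?case by (intro exI[of _ "\<lambda>j. 1"]) auto
next
  case (insert i0 I)
  show ?case
  proof (cases "\<forall>j\<in>J. v j i0 = 0")
    case True
    have "card I < card J" using insert by simp
    then obtain c where "\<exists>j\<in>J. c j \<noteq> 0" "\<forall>i\<in>I. (\<Sum>j\<in>J. c j * v j i) = 0"
      using insert.IH[of J v] insert.prems by blast
    then show ?thesis using True by (intro exI[of _ c]) auto
  next
    case False
    then obtain j0 where j0: "j0 \<in> J" "v j0 i0 \<noteq> 0" by auto
    define w where "w j i = v j i - v j i0 / v j0 i0 * v j0 i" for j i
    have "card I < card (J - {j0})" using insert j0 by simp
    then obtain c where c: "\<exists>j\<in>J - {j0}. c j \<noteq> 0" "\<forall>i\<in>I. (\<Sum>j\<in>J - {j0}. c j * w j i) = 0"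
      using insert.IH[of "J - {j0}" w] insert.prems by blast
    define d where "d j = (if j = j0 then - (\<Sum>j\<in>J - {j0}. c j * v j i0 / v j0 i0) else c j)" for j
    have eq: "(\<Sum>j\<in>J. d j * v j i) = (\<Sum>j\<in>J - {j0}. c j * w j i)" for i
    proof -
      have "(\<Sum>j\<in>J. d j * v j i) = d j0 * v j0 i + (\<Sum>j\<in>J - {j0}. d j * v j i)"
        using j0 insert.prems by (simp add: sum.remove)
      also have "(\<Sum>j\<in>J - {j0}. d j * v j i) = (\<Sum>j\<in>J - {j0}. c j * v j i)"
        by (rule sum.cong) (auto simp: d_def)
      also have "d j0 * v j0 i = - (\<Sum>j\<in>J - {j0}. c j * (v j i0 / v j0 i0 * v j0 i))"
        by (simp add: d_def sum_distrib_right mult.assoc)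
      finally show ?thesis by (simp add: w_def algebra_simps sum_subtractf)
    qed
    have "w j i0 = 0" for j using j0 by (simp add: w_def)
    then have "\<forall>i\<in>insert i0 I. (\<Sum>j\<in>J. d j * v j i) = 0" using c eq by simp
    moreover have "\<exists>j\<in>J. d j \<noteq> 0" using c by (auto simp: d_def)
    ultimately show ?thesis by blast
  qed
qed

text \<open>Restriction to lines bounds the degree in each variable without a notion of multivariate
  degree.\<close>

definition line_degree_le :: "nat \<Rightarrow> (complex ^ 'p \<Rightarrow> complex) \<Rightarrow> bool" where
  "line_degree_le b f \<longleftrightarrow> (\<forall>u v. \<exists>q. degree q \<le> b \<and> (\<forall>z. f (u + z *s v) = poly q z))"

lemma line_degree_le_mono: "line_degree_le b f \<Longrightarrow> b \<le> b' \<Longrightarrow> line_degree_le b' f"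
  unfolding line_degree_le_def using le_trans by blast

lemma line_degree_le_const: "line_degree_le b (\<lambda>u. c)"
  unfolding line_degree_le_def by (intro allI exI[of _ "[:c:]"]) simp

lemma line_degree_le_add:
  assumes "line_degree_le b f" "line_degree_le b g"
  shows "line_degree_le b (\<lambda>u. f u + g u)"
  unfolding line_degree_le_def
proof (intro allI)
  fix u v
  obtain p q where "degree p \<le> b" "\<forall>z. f (u + z *s v) = poly p z" "degree q \<le> b" "\<forall>z. g (u + z *s v) = poly q z"
    using assms unfolding line_degree_le_def by metis
  then show "\<exists>q. degree q \<le> b \<and> (\<forall>z. f (u + z *s v) + g (u + z *s v) = poly q z)"
    by (intro exI[of _ "p + q"]) (auto intro: degree_add_le)
qed

lemma line_degree_le_mult:
  assumes "line_degree_le b f" "line_degree_le b' g"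
  shows "line_degree_le (b + b') (\<lambda>u. f u * g u)"
  unfolding line_degree_le_def
proof (intro allI)
  fix u v
  obtain p q where *: "degree p \<le> b" "\<forall>z. f (u + z *s v) = poly p z" "degree q \<le> b'" "\<forall>z. g (u + z *s v) = poly q z"
    using assms unfolding line_degree_le_def by metis
  then have "degree (p * q) \<le> b + b'" using degree_mult_le[of p q] by linarith
  then show "\<exists>q. degree q \<le> b + b' \<and> (\<forall>z. f (u + z *s v) * g (u + z *s v) = poly q z)"
    using * by (intro exI[of _ "p * q"]) auto
qed

lemma line_degree_le_sum:
  "(\<And>a. a \<in> A \<Longrightarrow> line_degree_le b (f a)) \<Longrightarrow> line_degree_le b (\<lambda>u. \<Sum>a\<in>A. f a u)"
  by (induction A rule: infinite_finite_induct) (auto intro: line_degree_le_const line_degree_le_add)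

lemma line_degree_le_power: "line_degree_le b f \<Longrightarrow> line_degree_le (k * b) (\<lambda>u. f u ^ k)"
  by (induction k) (auto intro: line_degree_le_const dest: line_degree_le_mult)

lemma line_degree_le_prod:
  "finite A \<Longrightarrow> (\<And>a. a \<in> A \<Longrightarrow> line_degree_le b (f a)) \<Longrightarrow> line_degree_le (card A * b) (\<lambda>u. \<Prod>a\<in>A. f a u)"
  by (induction A rule: finite_induct) (auto intro: line_degree_le_const dest: line_degree_le_mult)

lemma poly_fun_line_degree: "poly_fun f \<Longrightarrow> \<exists>b. line_degree_le b f"
proof (induction rule: poly_fun.induct)
  case (poly_fun_coord i)
  have "line_degree_le 1 (\<lambda>x. x $ i)"
    unfolding line_degree_le_def
    by (intro allI, rule_tac x = "[:u $ i, v $ i:]" in exI) (auto simp: algebra_simps)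
  then show ?case by blast
next
  case (poly_fun_add f g)
  then obtain b b' where "line_degree_le b f" "line_degree_le b' g" by auto
  then have "line_degree_le (max b b') f" "line_degree_le (max b b') g" by (auto intro: line_degree_le_mono)
  then show ?case using line_degree_le_add by blast
qed (use line_degree_le_const line_degree_le_mult in blast)+

text \<open>In one variable, a polynomial of degree at most \<open>b\<close> with \<open>b + 1\<close> zeros is zero. Applied to one
  coordinate after the other, this frees the coordinates from the grid.\<close>

lemma grid_determines:
  fixes f :: "complex ^ 'p \<Rightarrow> complex"
  assumes f: "line_degree_le b f" and z: "\<And>u. (\<And>i. u $ i \<in> of_nat ` {..b}) \<Longrightarrow> f u = 0"
  shows "f u = 0"
proof -
  have "\<forall>u :: complex ^ 'p. (\<forall>i. i \<notin> A \<longrightarrow> u $ i \<in> of_nat ` {..b}) \<longrightarrow> f u = 0" if "finite A" for A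
    using that
  proof (induction A rule: finite_induct)
    case empty
    then show ?case using z by auto
  next
    case (insert j A)
    show ?case
    proof (intro allI impI)
      fix u :: "complex ^ 'p" assume u: "\<forall>i. i \<notin> insert j A \<longrightarrow> u $ i \<in> of_nat ` {..b}"
      define w where "w = u - u $ j *s axis j 1"
      obtain q where q: "degree q \<le> b" "\<forall>z. f (w + z *s axis j 1) = poly q z"
        using f unfolding line_degree_le_def by blast
      have "poly q (of_nat k) = 0" if "k \<le> b" for k
      proof -
        have "f (w + of_nat k *s axis j 1) = 0"
          by (rule insert.IH[rule_format]) (use u that in \<open>auto simp: w_def axis_def\<close>)
        then show ?thesis using q by simp
      qed
      then have sub: "of_nat ` {..b} \<subseteq> {z. poly q z = 0}" by auto
      have "q = 0"
      proof (rule ccontr)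
        assume "q \<noteq> 0"
        then have "card {z. poly q z = 0} \<le> b" "finite {z. poly q z = 0}"
          using card_poly_roots_bound[of q] poly_roots_finite q(1) by (auto intro: le_trans)
        moreover have "card ((of_nat :: nat \<Rightarrow> complex) ` {..b}) = Suc b"
          by (subst card_image) (auto simp: inj_on_def)
        ultimately show False using card_mono[OF _ sub] by simp
      qed
      then have "f (w + (u $ j) *s axis j 1) = 0" using q by simp
      then show "f u = 0" by (simp add: w_def)
    qed
  qed
  from this[of UNIV] show ?thesis by simp
qed

lemma digits_sum:
  fixes M :: nat
  assumes "M > 0"
  shows "N < M ^ k \<Longrightarrow> (\<Sum>i<k. (N div M ^ i mod M) * M ^ i) = N"
proof (induction k arbitrary: N)
  case (Suc k)
  have "N div M < M ^ k" using Suc.prems assms by (simp add: less_mult_imp_div_less mult.commute)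
  then have IH: "(\<Sum>i<k. (N div M div M ^ i mod M) * M ^ i) = N div M" by (rule Suc.IH)
  have "(\<Sum>i<Suc k. (N div M ^ i mod M) * M ^ i) = N mod M + (\<Sum>i<k. (N div M ^ Suc i mod M) * M ^ Suc i)"
    by (subst sum.lessThan_Suc_shift) simp
  also have "(\<Sum>i<k. (N div M ^ Suc i mod M) * M ^ Suc i) = M * (\<Sum>i<k. (N div M div M ^ i mod M) * M ^ i)"
    by (simp add: sum_distrib_left div_mult2_eq mult_ac)
  finally show ?case using IH by simp
qed simp

section \<open>Rational functions\<close>

text \<open>The ring of polynomials localized at \<open>\<delta>\<close>. Values where \<open>\<delta>\<close> vanishes are left arbitrary.\<close>

definition rational_on :: "(complex ^ 'p \<Rightarrow> complex) \<Rightarrow> (complex ^ 'p \<Rightarrow> complex) \<Rightarrow> bool" where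
  "rational_on \<delta> f \<longleftrightarrow> (\<exists>N g. poly_fun g \<and> (\<forall>u. \<delta> u \<noteq> 0 \<longrightarrow> f u * \<delta> u ^ N = g u))"

lemma rational_on_poly: "poly_fun f \<Longrightarrow> rational_on \<delta> f"
  unfolding rational_on_def by (intro exI[of _ 0] exI[of _ f]) auto

lemma rational_on_const: "rational_on \<delta> (\<lambda>u. c)"
  by (intro rational_on_poly poly_fun_const)

context
  fixes \<delta> :: "complex ^ 'p \<Rightarrow> complex"
  assumes \<delta>: "poly_fun \<delta>"
begin

lemma rational_on_raise:
  assumes "poly_fun g" "\<forall>u. \<delta> u \<noteq> 0 \<longrightarrow> f u * \<delta> u ^ N = g u" "N \<le> M"
  shows "\<exists>g'. poly_fun g' \<and> (\<forall>u. \<delta> u \<noteq> 0 \<longrightarrow> f u * \<delta> u ^ M = g' u)"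
proof (intro exI conjI allI impI)
  show "poly_fun (\<lambda>u. g u * \<delta> u ^ (M - N))" by (intro poly_fun_intros assms \<delta>)
  fix u assume "\<delta> u \<noteq> 0"
  then have "f u * \<delta> u ^ N * \<delta> u ^ (M - N) = g u * \<delta> u ^ (M - N)" using assms by simp
  then show "f u * \<delta> u ^ M = g u * \<delta> u ^ (M - N)" using assms(3) by (simp add: mult.assoc flip: power_add)
qed

lemma rational_on_add:
  assumes "rational_on \<delta> f" "rational_on \<delta> g" shows "rational_on \<delta> (\<lambda>u. f u + g u)"
proof -
  obtain N p M q where *: "poly_fun p" "\<forall>u. \<delta> u \<noteq> 0 \<longrightarrow> f u * \<delta> u ^ N = p u"
    "poly_fun q" "\<forall>u. \<delta> u \<noteq> 0 \<longrightarrow> g u * \<delta> u ^ M = q u"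
    using assms unfolding rational_on_def by blast
  obtain p' where p': "poly_fun p'" "\<forall>u. \<delta> u \<noteq> 0 \<longrightarrow> f u * \<delta> u ^ (N + M) = p' u"
    using rational_on_raise[OF *(1,2), of "N + M"] by auto
  obtain q' where q': "poly_fun q'" "\<forall>u. \<delta> u \<noteq> 0 \<longrightarrow> g u * \<delta> u ^ (N + M) = q' u"
    using rational_on_raise[OF *(3,4), of "N + M"] by auto
  show ?thesis unfolding rational_on_def
    by (intro exI[of _ "N + M"] exI[of _ "\<lambda>u. p' u + q' u"])
      (use p' q' in \<open>auto intro: poly_fun_intros simp: distrib_right\<close>)
qed

lemma rational_on_mult:
  assumes "rational_on \<delta> f" "rational_on \<delta> g" shows "rational_on \<delta> (\<lambda>u. f u * g u)"
proof -
  obtain N p M q where *: "poly_fun p" "\<forall>u. \<delta> u \<noteq> 0 \<longrightarrow> f u * \<delta> u ^ N = p u"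
    "poly_fun q" "\<forall>u. \<delta> u \<noteq> 0 \<longrightarrow> g u * \<delta> u ^ M = q u"
    using assms unfolding rational_on_def by blast
  have "f u * g u * \<delta> u ^ (N + M) = p u * q u" if "\<delta> u \<noteq> 0" for u
  proof -
    have "f u * g u * \<delta> u ^ (N + M) = (f u * \<delta> u ^ N) * (g u * \<delta> u ^ M)" by (simp add: power_add)
    then show ?thesis using * that by simp
  qed
  then show ?thesis unfolding rational_on_def
    by (intro exI[of _ "N + M"] exI[of _ "\<lambda>u. p u * q u"]) (use * in \<open>auto intro: poly_fun_intros\<close>)
qed

lemma rational_on_sum:
  "(\<And>a. a \<in> A \<Longrightarrow> rational_on \<delta> (f a)) \<Longrightarrow> rational_on \<delta> (\<lambda>u. \<Sum>a\<in>A. f a u)"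
  by (induction A rule: infinite_finite_induct) (auto intro: rational_on_const rational_on_add)

lemma rational_on_prod:
  "(\<And>a. a \<in> A \<Longrightarrow> rational_on \<delta> (f a)) \<Longrightarrow> rational_on \<delta> (\<lambda>u. \<Prod>a\<in>A. f a u)"
  by (induction A rule: infinite_finite_induct) (auto intro: rational_on_const rational_on_mult)

lemma rational_on_det:
  fixes M :: "complex ^ 'p \<Rightarrow> complex ^ 'k ^ 'k"
  assumes "\<And>i j. rational_on \<delta> (\<lambda>x. M x $ i $ j)"
  shows "rational_on \<delta> (\<lambda>x. det (M x))"
  unfolding det_def by (intro rational_on_sum rational_on_mult rational_on_const rational_on_prod assms)

lemma rational_on_divide:
  assumes "rational_on \<delta> f" "poly_fun d" "poly_fun e" "\<And>u. \<delta> u = d u * e u"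
  shows "rational_on \<delta> (\<lambda>u. f u / d u)"
proof -
  obtain N p where *: "poly_fun p" "\<forall>u. \<delta> u \<noteq> 0 \<longrightarrow> f u * \<delta> u ^ N = p u"
    using assms unfolding rational_on_def by blast
  show ?thesis unfolding rational_on_def
  proof (intro exI conjI allI impI)
    show "poly_fun (\<lambda>u. p u * e u)" by (intro poly_fun_intros * assms)
    fix u assume u: "\<delta> u \<noteq> 0"
    then have "d u \<noteq> 0" using assms by auto
    then show "f u / d u * \<delta> u ^ Suc N = p u * e u"
      using *(2)[rule_format, OF u] assms(4)[of u] by (simp add: field_simps)
  qed
qed

lemma rational_on_compose:
  assumes "poly_fun f" "\<And>i. rational_on \<delta> (\<lambda>u. \<Psi> u $ i)"
  shows "rational_on \<delta> (\<lambda>u. f (\<Psi> u))"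
  using assms(1)
  by (induction rule: poly_fun.induct) (auto intro: rational_on_const assms rational_on_add rational_on_mult)

lemma subalgebra_rational_on: "subalgebra {f. rational_on \<delta> f}"
  unfolding subalgebra_def by (auto intro: rational_on_const rational_on_add rational_on_mult)

lemma domain_on_rational_on:
  assumes "\<exists>u. \<delta> u \<noteq> 0"
  shows "domain_on {u. \<delta> u \<noteq> 0} {f. rational_on \<delta> f}"
  unfolding domain_on_def
proof (intro conjI ballI impI)
  show "{u. \<delta> u \<noteq> 0} \<noteq> {}" using assms by auto
  fix f g assume "f \<in> {f. rational_on \<delta> f}" "g \<in> {f. rational_on \<delta> f}" and z: "\<forall>u\<in>{u. \<delta> u \<noteq> 0}. f u * g u = 0"
  then obtain N p M q where *: "poly_fun p" "\<forall>u. \<delta> u \<noteq> 0 \<longrightarrow> f u * \<delta> u ^ N = p u"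
    "poly_fun q" "\<forall>u. \<delta> u \<noteq> 0 \<longrightarrow> g u * \<delta> u ^ M = q u"
    unfolding rational_on_def by blast
  show "(\<forall>u\<in>{u. \<delta> u \<noteq> 0}. f u = 0) \<or> (\<forall>u\<in>{u. \<delta> u \<noteq> 0}. g u = 0)"
  proof (rule ccontr)
    assume "\<not> ?thesis"
    then obtain a b where ab: "\<delta> a \<noteq> 0" "f a \<noteq> 0" "\<delta> b \<noteq> 0" "g b \<noteq> 0" by auto
    have "p a \<noteq> 0" "q b \<noteq> 0" using * ab by (metis mult_eq_0_iff power_not_zero)+
    then obtain x where "p x \<noteq> 0" "q x * \<delta> x \<noteq> 0"
      using poly_fun_nonzero_common2[of p a "\<lambda>x. q x * \<delta> x" b] *(1,3) \<delta> ab by (auto intro: poly_fun_intros)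
    then have "f x \<noteq> 0" "g x \<noteq> 0" "\<delta> x \<noteq> 0" using * by (metis mult_zero_left mult_zero_right)+
    then show False using z by auto
  qed
qed

lemma open_nonvanishing: "open {u. \<delta> u \<noteq> 0}"
proof -
  have "continuous_on UNIV \<delta>"
    by (intro differentiable_imp_continuous_on)
      (use cdiff_poly_fun[OF \<delta>] in \<open>auto simp: differentiable_on_def cdiff_def\<close>)
  then have "open (\<delta> -` (- {0}))" by (rule open_vimage[rotated]) auto
  then show ?thesis by (simp add: vimage_def)
qed

lemma cdiff_rational_on:
  assumes "rational_on \<delta> f" "\<delta> u \<noteq> 0"
  shows "cdiff f u"
proof -
  obtain N p where *: "poly_fun p" "\<forall>u. \<delta> u \<noteq> 0 \<longrightarrow> f u * \<delta> u ^ N = p u"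
    using assms unfolding rational_on_def by blast
  have "cdiff (\<lambda>u. p u * inverse (\<delta> u ^ N)) u"
    by (intro cdiff_mult(1) cdiff_inverse cdiff_poly_fun poly_fun_intros * \<delta>) (use assms in auto)
  then show ?thesis
    by (rule cdiff_transform(1)[OF _ open_nonvanishing]) (use assms * in \<open>auto simp: field_simps\<close>)
qed

lemma frechet_derivative_rational_zero:
  fixes f :: "complex ^ 'p \<Rightarrow> complex"
  assumes "\<And>u. \<delta> u \<noteq> 0 \<Longrightarrow> f u = 0" "\<delta> u \<noteq> 0"
  shows "frechet_derivative f (at u) v = 0"
proof -
  have "frechet_derivative f (at u) = frechet_derivative (\<lambda>u. 0) (at u)"
    by (rule cdiff_transform(2)[OF cdiff_const[of 0] open_nonvanishing]) (use assms in auto)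
  then show ?thesis by (simp add: frechet_derivative_const)
qed

end

lemma poly_fun_frechet_derivative:
  fixes f :: "complex ^ 'm \<Rightarrow> complex"
  shows "poly_fun f \<Longrightarrow> poly_fun (\<lambda>u. frechet_derivative f (at u) v)"
proof (induction rule: poly_fun.induct)
  case (poly_fun_add f g)
  have "(\<lambda>u. frechet_derivative (\<lambda>a. f a + g a) (at u) v) =
    (\<lambda>u. frechet_derivative f (at u) v + frechet_derivative g (at u) v)"
    by (rule ext, rule cdiff_add(2)) (use poly_fun_add.hyps in \<open>auto intro: cdiff_poly_fun\<close>)
  then show ?case using poly_fun_add by (simp add: poly_fun_intros)
next
  case (poly_fun_mult f g)
  have "(\<lambda>u. frechet_derivative (\<lambda>a. f a * g a) (at u) v) =
    (\<lambda>u. f u * frechet_derivative g (at u) v + frechet_derivative f (at u) v * g u)"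
    by (rule ext, rule cdiff_mult(2)) (use poly_fun_mult.hyps in \<open>auto intro: cdiff_poly_fun\<close>)
  then show ?case using poly_fun_mult by (simp add: poly_fun_intros)
qed (auto simp: frechet_derivative_const_eq frechet_derivative_coord_eq intro: poly_fun_intros)

lemma rational_on_frechet_derivative:
  assumes \<delta>: "poly_fun \<delta>" and f: "rational_on \<delta> f"
  shows "rational_on \<delta> (\<lambda>u. frechet_derivative f (at u) v)"
proof -
  obtain N p where p: "poly_fun p" "\<forall>u. \<delta> u \<noteq> 0 \<longrightarrow> f u * \<delta> u ^ N = p u"
    using f unfolding rational_on_def by blast
  define e where "e = (\<lambda>u. \<delta> u ^ N)"
  have e: "poly_fun e" unfolding e_def by (intro poly_fun_intros \<delta>)
  have "frechet_derivative f (at u) v * \<delta> u ^ (2 * N) =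
     frechet_derivative p (at u) v * e u - p u * frechet_derivative e (at u) v" if u: "\<delta> u \<noteq> 0" for u
  proof -
    have "cdiff (\<lambda>u. f u * e u) u" by (intro cdiff_mult(1) cdiff_poly_fun e cdiff_rational_on[OF \<delta> f u])
    then have "frechet_derivative p (at u) v = frechet_derivative (\<lambda>u. f u * e u) (at u) v"
      using cdiff_transform(2)[of "\<lambda>u. f u * e u" u "{u. \<delta> u \<noteq> 0}" p] open_nonvanishing[OF \<delta>] u p
      by (auto simp: e_def)
    also have "\<dots> = f u * frechet_derivative e (at u) v + frechet_derivative f (at u) v * e u"
      by (rule cdiff_mult(2)[OF cdiff_rational_on[OF \<delta> f u] cdiff_poly_fun[OF e]])
    finally have "frechet_derivative p (at u) v * e u - p u * frechet_derivative e (at u) v =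
      frechet_derivative f (at u) v * (e u * e u) + (f u * e u - p u) * frechet_derivative e (at u) v"
      by (simp add: algebra_simps)
    moreover have "f u * e u = p u" using p u by (simp add: e_def)
    ultimately show ?thesis by (simp add: e_def mult_2 power_add)
  qed
  then show ?thesis unfolding rational_on_def
    by (intro exI[of _ "2 * N"] exI[of _ "\<lambda>u. frechet_derivative p (at u) v * e u - p u * frechet_derivative e (at u) v"])
      (auto intro!: poly_fun_intros poly_fun_frechet_derivative p e)
qed

text \<open>A counting argument. Take the monomials in \<open>p + 1\<close> rational functions of \<open>p\<close> variables with
  exponents at most \<open>m\<close>, all multiplied by one common denominator. They are \<open>(m + 1) ^ (p + 1)\<close>
  polynomials of degree \<open>O(m)\<close> in each variable, hence determined by their values at \<open>O(m ^ p)\<close> grid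
  points. For large \<open>m\<close> there are more monomials than points, so some combination vanishes.\<close>

lemma rational_functions_dependent:
  fixes \<delta> :: "complex ^ 'p \<Rightarrow> complex"
  assumes \<delta>: "poly_fun \<delta>" and fs: "length fs = Suc CARD('p)" "\<forall>f\<in>set fs. rational_on \<delta> f"
  shows "\<not> alg_indep {u. \<delta> u \<noteq> 0} fs"
proof -
  define p where "p = CARD('p)"
  have "\<exists>N. \<forall>f\<in>set fs. \<exists>g. poly_fun g \<and> (\<forall>u. \<delta> u \<noteq> 0 \<longrightarrow> f u * \<delta> u ^ N = g u)"
    using fs(2)
  proof (induction fs)
    case (Cons f fs)
    then obtain N where N: "\<forall>f\<in>set fs. \<exists>g. poly_fun g \<and> (\<forall>u. \<delta> u \<noteq> 0 \<longrightarrow> f u * \<delta> u ^ N = g u)" by auto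
    obtain M g where g: "poly_fun g" "\<forall>u. \<delta> u \<noteq> 0 \<longrightarrow> f u * \<delta> u ^ M = g u"
      using Cons.prems unfolding rational_on_def by auto
    show ?case
    proof (intro exI[of _ "N + M"] ballI)
      fix f' assume "f' \<in> set (f # fs)"
      then consider "f' = f" | "f' \<in> set fs" by auto
      then show "\<exists>g. poly_fun g \<and> (\<forall>u. \<delta> u \<noteq> 0 \<longrightarrow> f' u * \<delta> u ^ (N + M) = g u)"
      proof cases
        case 1
        then show ?thesis using rational_on_raise[OF \<delta> g, of "N + M"] by simp
      next
        case 2
        then obtain g' where "poly_fun g'" "\<forall>u. \<delta> u \<noteq> 0 \<longrightarrow> f' u * \<delta> u ^ N = g' u" using N by blast
        from rational_on_raise[OF \<delta> this, of "N + M"] show ?thesis by simp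
      qed
    qed
  qed simp
  then obtain N where "\<forall>f\<in>set fs. \<exists>g. poly_fun g \<and> (\<forall>u. \<delta> u \<noteq> 0 \<longrightarrow> f u * \<delta> u ^ N = g u)" by blast
  then have "\<forall>i\<in>{..p}. \<exists>g. poly_fun g \<and> (\<forall>u. \<delta> u \<noteq> 0 \<longrightarrow> (fs ! i) u * \<delta> u ^ N = g u)"
    using fs(1) by (simp add: p_def less_Suc_eq_le)
  then obtain g where g: "\<forall>i\<in>{..p}. poly_fun (g i) \<and> (\<forall>u. \<delta> u \<noteq> 0 \<longrightarrow> (fs ! i) u * \<delta> u ^ N = g i u)"
    by (rule bchoice[THEN exE])
  obtain b0 where b0: "line_degree_le b0 \<delta>" using poly_fun_line_degree[OF \<delta>] by blast
  have "\<forall>i\<in>{..p}. \<exists>b. line_degree_le b (g i)" using g poly_fun_line_degree by blast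
  then obtain bs where bs: "\<forall>i\<in>{..p}. line_degree_le (bs i) (g i)" by (rule bchoice[THEN exE])
  define b where "b = b0 + (\<Sum>i\<le>p. bs i)"
  have bd: "line_degree_le b \<delta>" by (rule line_degree_le_mono[OF b0]) (simp add: b_def)
  have bg: "line_degree_le b (g i)" if "i \<le> p" for i
    by (rule line_degree_le_mono[of "bs i"])
      (use bs that member_le_sum[of i "{..p}" bs] in \<open>auto simp: b_def\<close>)
  \<comment> \<open>\<open>B * m\<close> bounds the degrees below, and \<open>m\<close> is large enough for \<open>(B * m + 1) ^ p < (m + 1) ^ (p + 1)\<close>. A number
    \<open>K < (m + 1) ^ (p + 1)\<close> encodes a tuple of exponents through its digits in base \<open>m + 1\<close>.\<close>
  define B where "B = Suc p * (b + N * b)"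
  define m where "m = Suc B ^ p"
  define dig where "dig K i = K div Suc m ^ i mod Suc m" for K i :: nat
  have dig_le: "dig K i \<le> m" for K i by (simp add: dig_def less_Suc_eq_le[symmetric])
  define F where "F K = (\<lambda>u. \<Prod>i\<le>p. g i u ^ dig K i * \<delta> u ^ (N * (m - dig K i)))" for K
  have degF: "line_degree_le (B * m) (F K)" for K
  proof -
    have "line_degree_le (m * b + N * m * b) (\<lambda>u. g i u ^ dig K i * \<delta> u ^ (N * (m - dig K i)))" if "i \<le> p" for i
      by (rule line_degree_le_mono[OF line_degree_le_mult[OF line_degree_le_power[OF bg[OF that]] line_degree_le_power[OF bd]]])
        (use dig_le in \<open>auto intro!: add_mono mult_le_mono\<close>)
    then have "line_degree_le (card {..p} * (m * b + N * m * b)) (F K)"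
      unfolding F_def by (intro line_degree_le_prod) auto
    then show ?thesis by (simp add: B_def algebra_simps)
  qed
  define grid where "grid = {u :: complex ^ 'p. \<forall>i. u $ i \<in> of_nat ` {..B * m}}"
  have grid_card: "finite grid" "card grid \<le> (B * m + 1) ^ p"
  proof -
    let ?E = "PiE (UNIV :: 'p set) (\<lambda>_. {..B * m})"
    have sub: "grid \<subseteq> (\<lambda>\<alpha>. (\<chi> i. of_nat (\<alpha> i)) :: complex ^ 'p) ` ?E"
    proof
      fix u assume "u \<in> grid"
      then have "\<forall>i. \<exists>k\<le>B * m. u $ i = of_nat k" unfolding grid_def by auto
      then obtain \<alpha> where "\<forall>i. \<alpha> i \<le> B * m \<and> u $ i = of_nat (\<alpha> i)" by metis
      then show "u \<in> (\<lambda>\<alpha>. \<chi> i. of_nat (\<alpha> i)) ` ?E"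
        by (intro image_eqI[of _ _ \<alpha>]) (auto simp: vec_eq_iff)
    qed
    have fin: "finite ?E" by (intro finite_PiE) auto
    then show "finite grid" using sub finite_subset by blast
    have "card grid \<le> card ((\<lambda>\<alpha>. \<chi> i. of_nat (\<alpha> i)) ` ?E :: (complex ^ 'p) set)" using sub fin by (intro card_mono) auto
    also have "\<dots> \<le> card ?E" by (rule card_image_le[OF fin])
    also have "\<dots> = (B * m + 1) ^ p" by (simp add: card_PiE p_def)
    finally show "card grid \<le> (B * m + 1) ^ p" .
  qed
  have "(B * m + 1) ^ p \<le> (Suc B * Suc m) ^ p" by (intro power_mono) auto
  also have "\<dots> = m * Suc m ^ p" by (simp only: power_mult_distrib m_def)
  also have "\<dots> < Suc m ^ Suc p" by simp
  finally have "card grid < card {..<Suc m ^ Suc p}" using grid_card(2) by simp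
  then obtain c where c: "\<exists>K\<in>{..<Suc m ^ Suc p}. c K \<noteq> 0" "\<forall>u\<in>grid. (\<Sum>K<Suc m ^ Suc p. c K * F K u) = 0"
    using nontrivial_linear_relation[OF grid_card(1), of "{..<Suc m ^ Suc p}" F] by blast
  have zero: "(\<Sum>K<Suc m ^ Suc p. c K * F K u) = 0" for u
  proof (rule grid_determines[where f = "\<lambda>u. \<Sum>K<Suc m ^ Suc p. c K * F K u"])
    show "line_degree_le (B * m) (\<lambda>u. \<Sum>K<Suc m ^ Suc p. c K * F K u)"
    proof (rule line_degree_le_sum)
      fix K
      show "line_degree_le (B * m) (\<lambda>u. c K * F K u)"
        using line_degree_le_mult[OF line_degree_le_const[of 0 "c K"] degF[of K]] by simp
    qed
  qed (use c in \<open>auto simp: grid_def\<close>)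
  define G where "G = (\<lambda>a :: nat \<Rightarrow> complex. \<Sum>K<Suc m ^ Suc p. c K * (\<Prod>i\<le>p. a i ^ dig K i))"
  have "npoly (Suc p) G"
    unfolding G_def by (intro npoly_sum npoly_mult npoly_const npoly_prod npoly_power npoly_var) auto
  moreover have "G (eval_list fs u) = 0" if u: "\<delta> u \<noteq> 0" for u
  proof -
    have "F K u = (\<Prod>i\<le>p. (fs ! i) u ^ dig K i) * \<delta> u ^ (N * m * Suc p)" for K
    proof -
      have "g i u ^ dig K i * \<delta> u ^ (N * (m - dig K i)) = (fs ! i) u ^ dig K i * \<delta> u ^ (N * m)" if "i \<le> p" for i
      proof -
        have "g i u ^ dig K i = (fs ! i) u ^ dig K i * \<delta> u ^ (N * dig K i)"
          using g u that by (metis atMost_iff power_mult power_mult_distrib)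
        moreover have "N * dig K i + N * (m - dig K i) = N * m" using dig_le by (simp flip: distrib_left)
        ultimately show ?thesis by (simp add: mult.assoc flip: power_add)
      qed
      then have "F K u = (\<Prod>i\<le>p. (fs ! i) u ^ dig K i * \<delta> u ^ (N * m))" unfolding F_def by (intro prod.cong) auto
      then show ?thesis by (simp add: prod.distrib power_mult[symmetric] power_add mult.commute)
    qed
    then have "G (eval_list fs u) * \<delta> u ^ (N * m * Suc p) = 0"
      using zero[of u] by (simp add: G_def eval_list_def sum_distrib_right mult.assoc)
    then show ?thesis using u by simp
  qed
  \<comment> \<open>The substitution \<open>a i = z ^ (m + 1) ^ i\<close> turns distinct monomials into distinct powers of \<open>z\<close>.\<close>
  moreover have "\<exists>a. G a \<noteq> 0"
  proof (rule ccontr)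
    assume neg: "\<not> ?thesis"
    define P where "P = (\<Sum>K<Suc m ^ Suc p. monom (c K) K)"
    have "poly P z = 0" for z
    proof -
      have "(\<Prod>i\<le>p. (z ^ (Suc m ^ i)) ^ dig K i) = z ^ K" if "K < Suc m ^ Suc p" for K
      proof -
        have "(\<Prod>i\<le>p. (z ^ (Suc m ^ i)) ^ dig K i) = z ^ (\<Sum>i<Suc p. dig K i * Suc m ^ i)"
          by (simp add: power_sum lessThan_Suc_atMost power_mult[symmetric] mult.commute)
        also have "(\<Sum>i<Suc p. dig K i * Suc m ^ i) = K"
          unfolding dig_def by (rule digits_sum[OF _ that]) simp
        finally show ?thesis .
      qed
      then have "poly P z = G (\<lambda>i. z ^ (Suc m ^ i))"
        by (simp add: P_def G_def poly_sum poly_monom)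
      then show ?thesis using neg by auto
    qed
    then have "P = 0" using poly_all_0_iff_0 by blast
    then have "coeff P K = 0" for K by simp
    moreover have "coeff P K = c K" if "K < Suc m ^ Suc p" for K
      using that unfolding P_def by (simp add: coeff_sum if_distrib sum.If_cases cong: if_cong)
    ultimately show False using c(1) by auto
  qed
  ultimately show ?thesis unfolding alg_indep_def using fs(1) by (auto simp: p_def)
qed


section \<open>Dimension and tangent spaces of rationally parametrized varieties\<close>

definition jac :: "(complex ^ 'p \<Rightarrow> complex ^ 'm) \<Rightarrow> complex ^ 'p \<Rightarrow> complex ^ 'p \<Rightarrow> complex ^ 'm" where
  "jac \<Psi> u v = (\<chi> b. frechet_derivative (\<lambda>u. \<Psi> u $ b) (at u) v)"

lemma jac_linear:
  assumes "\<And>b. cdiff (\<lambda>u. \<Psi> u $ b) u"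
  shows "Vector_Spaces.linear (*s) (*s) (jac \<Psi> u)"
proof -
  have "bounded_linear (frechet_derivative (\<lambda>u. \<Psi> u $ b) (at u))" for b
    using cdiff_has_derivative[OF assms] has_derivative_bounded_linear by blast
  then have "frechet_derivative (\<lambda>u. \<Psi> u $ b) (at u) (v + w) =
    frechet_derivative (\<lambda>u. \<Psi> u $ b) (at u) v + frechet_derivative (\<lambda>u. \<Psi> u $ b) (at u) w" for b v w
    by (simp add: linear_simps)
  then show ?thesis
    by unfold_locales (auto simp: jac_def vec_eq_iff cdiff_scale[OF assms] algebra_simps)
qed

lemma poly_fun_chain_rule:
  fixes \<Psi> :: "complex ^ 'p \<Rightarrow> complex ^ 'm"
  assumes f: "poly_fun f" and \<Psi>: "\<And>b. cdiff (\<lambda>u. \<Psi> u $ b) u"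
  shows "cdiff (\<lambda>u. f (\<Psi> u)) u \<and>
    frechet_derivative (\<lambda>u. f (\<Psi> u)) (at u) v = frechet_derivative f (at (\<Psi> u)) (jac \<Psi> u v)"
  using f
proof (induction rule: poly_fun.induct)
  case (poly_fun_const c)
  then show ?case by (simp add: cdiff_const frechet_derivative_const_eq)
next
  case (poly_fun_coord i)
  then show ?case using \<Psi> by (simp add: frechet_derivative_coord_eq jac_def)
next
  case (poly_fun_add f g)
  have "cdiff f (\<Psi> u)" "cdiff g (\<Psi> u)" using poly_fun_add cdiff_poly_fun by auto
  then show ?case
    using poly_fun_add cdiff_add[of "\<lambda>u. f (\<Psi> u)" u "\<lambda>u. g (\<Psi> u)"] cdiff_add(2)[of f "\<Psi> u" g] by auto
next
  case (poly_fun_mult f g)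
  have "cdiff f (\<Psi> u)" "cdiff g (\<Psi> u)" using poly_fun_mult cdiff_poly_fun by auto
  then show ?case
    using poly_fun_mult cdiff_mult[of "\<lambda>u. f (\<Psi> u)" u "\<lambda>u. g (\<Psi> u)"] cdiff_mult(2)[of f "\<Psi> u" g] by auto
qed

lemma cdiff_affine_chain_rule:
  fixes L :: "complex ^ 'p \<Rightarrow> complex ^ 'q"
  assumes f: "cdiff f (u0 + L u)" and L: "Vector_Spaces.linear (*s) (*s) L"
  shows "cdiff (\<lambda>u. f (u0 + L u)) u"
    and "frechet_derivative (\<lambda>u. f (u0 + L u)) (at u) v = frechet_derivative f (at (u0 + L u)) (L v)"
proof -
  interpret L: Vector_Spaces.linear "(*s)" "(*s)" L by fact
  have "linear L"
  proof (rule linearI)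
    fix r :: real and x
    have "r *\<^sub>R x = of_real r *s x" for x :: "complex ^ 'r" 
      by (simp add: vec_eq_iff) (simp add: scaleR_conv_of_real)
    then show "L (r *\<^sub>R x) = r *\<^sub>R L x"
      by (metis L.scale)
  qed (rule L.add)
  then have "bounded_linear L" by (simp add: linear_conv_bounded_linear)
  then have "((\<lambda>u. u0 + L u) has_derivative L) (at u)"
    by (auto intro!: derivative_eq_intros bounded_linear_imp_has_derivative)
  from has_derivative_compose[OF this cdiff_has_derivative[OF f]]
  have *: "((\<lambda>u. f (u0 + L u)) has_derivative (\<lambda>v. frechet_derivative f (at (u0 + L u)) (L v))) (at u)" .
  show "cdiff (\<lambda>u. f (u0 + L u)) u" by (rule cdiffI[OF *]) (simp add: L.scale cdiff_scale[OF f])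
  show "frechet_derivative (\<lambda>u. f (u0 + L u)) (at u) v = frechet_derivative f (at (u0 + L u)) (L v)"
    using frechet_derivative_at[OF *] by metis
qed

lemma linear_component:
  fixes f :: "'a::field ^ 'p \<Rightarrow> 'a ^ 'm"
  assumes "Vector_Spaces.linear (*s) (*s) f"
  shows "f x $ i = (\<Sum>b\<in>UNIV. matrix f $ i $ b * x $ b)"
proof -
  have "f x = matrix f *v x" by (rule matrix_works[OF assms, symmetric])
  then have "f x $ i = (matrix f *v x) $ i" by (rule arg_cong)
  also have "\<dots> = (\<Sum>b\<in>UNIV. matrix f $ i $ b * x $ b)" unfolding matrix_vector_mult_def by simp
  finally show ?thesis .
qed

lemma linear_inj_onI:
  fixes f :: "'a::field ^ 'p \<Rightarrow> 'a ^ 'm"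
  assumes f: "Vector_Spaces.linear (*s) (*s) f" and T: "vec.subspace T"
    and z: "\<And>v. v \<in> T \<Longrightarrow> f v = 0 \<Longrightarrow> v = 0"
  shows "inj_on f T"
proof (rule inj_onI)
  interpret f: Vector_Spaces.linear "(*s)" "(*s)" f by (rule f)
  fix v w assume vw: "v \<in> T" "w \<in> T" "f v = f w"
  have "v - w \<in> T" by (rule vec.subspace_diff[OF T vw(1,2)])
  moreover have "f (v - w) = 0" using vw(3) by (simp add: f.diff)
  ultimately have "v - w = 0" by (rule z)
  then show "v = w" by simp
qed

lemma dim_image_inj:
  fixes f :: "'a::field ^ 'p \<Rightarrow> 'a ^ 'm"
  assumes f: "Vector_Spaces.linear (*s) (*s) f" and T: "vec.subspace T" and inj: "inj_on f T"
  shows "vec.dim (f ` T) = vec.dim T"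
proof (rule vec.dim_image_eq[OF f])
  have "vec.span T = T" using T by (simp add: vec.span_eq_iff)
  then show "inj_on f (vec.span T)" using inj by (rule ssubst)
qed

lemma axes_independent: "vec.independent ((\<lambda>i. axis i (1::'a::field)) ` A :: ('a ^ 'p) set)"
  by (rule vec.independent_mono[OF independent_cart_basis]) (auto simp: cart_basis_def)

lemma card_axes: "card ((\<lambda>i. axis i (1::'a::field)) ` A :: ('a ^ 'p) set) = card A"
  by (rule card_image) (auto simp: inj_on_def axis_eq_axis)

lemma alg_indep_take: "alg_indep D fs \<Longrightarrow> alg_indep D (take k fs)"
proof (induction fs arbitrary: k rule: rev_induct)
  case (snoc f fs)
  then show ?case using alg_indep_snocD[OF snoc.prems] by (cases "k \<le> length fs") auto
qed simp

locale rational_param =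
  fixes \<Psi> :: "complex ^ 'p \<Rightarrow> complex ^ 'm" and \<delta> :: "complex ^ 'p \<Rightarrow> complex"
  assumes poly_denominator: "poly_fun \<delta>" and nonempty: "\<exists>u. \<delta> u \<noteq> 0"
    and rational: "\<And>b. rational_on \<delta> (\<lambda>u. \<Psi> u $ b)"
begin

definition "params = {u. \<delta> u \<noteq> 0}"
definition "variety = zariski closure_of (\<Psi> ` params)"

lemma cdiff_param: "u \<in> params \<Longrightarrow> cdiff (\<lambda>u. \<Psi> u $ b) u"
  using cdiff_rational_on[OF poly_denominator rational] by (simp add: params_def)

lemma irreducible: "zariski_irreducible variety"
  unfolding variety_def
proof (rule zariski_irreducible_closure)
  show "\<Psi> ` params \<noteq> {}" using nonempty by (auto simp: params_def)
  fix f g assume fg: "poly_fun f" "poly_fun g" "\<forall>x\<in>\<Psi> ` params. f x * g x = 0"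
  have "(\<lambda>u. f (\<Psi> u)) \<in> {f. rational_on \<delta> f}" "(\<lambda>u. g (\<Psi> u)) \<in> {f. rational_on \<delta> f}"
    using rational_on_compose[OF poly_denominator] fg rational by auto
  then show "(\<forall>x\<in>\<Psi> ` params. f x = 0) \<or> (\<forall>x\<in>\<Psi> ` params. g x = 0)"
    using domain_on_rational_on[OF poly_denominator nonempty] fg(3) unfolding domain_on_def params_def by auto
qed

lemma closed: "closedin zariski variety"
  unfolding variety_def by simp

lemma nonvanishing_pullback:
  assumes "poly_fun h" "\<exists>x\<in>variety. h x \<noteq> 0"
  shows "\<exists>u\<in>params. h (\<Psi> u) \<noteq> 0"
  using assms vanishes_on_closure_iff[OF assms(1), of "\<Psi> ` params"] unfolding variety_def by auto

lemma jac_in_tangent_space: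
  assumes "u \<in> params"
  shows "jac \<Psi> u v \<in> tangent_space variety (\<Psi> u)"
  unfolding tangent_space_def
proof (clarify)
  fix f assume f: "poly_fun f" "\<forall>w\<in>variety. f w = 0"
  have "frechet_derivative (\<lambda>u. f (\<Psi> u)) (at u) v = 0"
    by (rule frechet_derivative_rational_zero[OF poly_denominator])
      (use f assms zariski_closure_subset[of "\<Psi> ` params"] in \<open>auto simp: params_def variety_def\<close>)
  then show "frechet_derivative f (at (\<Psi> u)) (jac \<Psi> u v) = 0"
    using poly_fun_chain_rule[OF f(1), of \<Psi> u v] cdiff_param[OF assms] by simp
qed

text \<open>More functions than the rank of the parametrization are dependent: otherwise they could
  be complemented by coordinates to more independent rational functions than there are
  parameters.\<close>

lemma trdeg_le_rank:
  assumes rank: "\<And>u. u \<in> params \<Longrightarrow> vec.dim (range (jac \<Psi> u)) \<le> r"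
  shows "trdeg_le variety r"
  unfolding variety_def
proof (rule trdeg_le_closure, rule notI)
  fix fs assume fs: "length fs = Suc r" "\<And>f. f \<in> set fs \<Longrightarrow> poly_fun f" "alg_indep (\<Psi> ` params) fs"
  let ?R = "{f. rational_on \<delta> f}"
  let ?fs = "map (\<lambda>f u. f (\<Psi> u)) fs"
  have ev: "G (eval_list ?fs u) = G (eval_list fs (\<Psi> u))" if "npoly (length fs) G" for G u
    by (rule npoly_cong[OF that]) (auto simp: eval_list_def)
  have ind: "alg_indep params ?fs"
    unfolding alg_indep_def
  proof (intro allI impI, elim conjE)
    fix G a assume G: "npoly (length ?fs) G" "\<forall>u\<in>params. G (eval_list ?fs u) = 0"
    have G': "npoly (length fs) G" using G(1) by simp
    have "G (eval_list fs x) = 0" if "x \<in> \<Psi> ` params" for x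
      using that G(2) ev[OF G'] by (elim imageE) simp
    then show "G a = 0" using fs(3) G' unfolding alg_indep_def by blast
  qed
  have sa: "subalgebra ?R" by (rule subalgebra_rational_on[OF poly_denominator])
  have dom: "domain_on params ?R" using domain_on_rational_on[OF poly_denominator nonempty] by (simp add: params_def)
  have fR: "set ?fs \<subseteq> ?R" using rational_on_compose[OF poly_denominator] fs(2) rational by auto
  have "\<exists>cs h. distinct cs \<and> set cs \<subseteq> (UNIV :: 'p set) \<and> alg_indep params (?fs @ map (\<lambda>c x. x $ c) cs) \<and> h \<in> ?R \<and>
     (\<exists>u\<in>params. h u \<noteq> 0) \<and>
     (\<forall>u\<in>params. \<forall>d. h u \<noteq> 0 \<and> derivation_at u ?R d \<and> (\<forall>g\<in>?R. (\<forall>x\<in>params. g x = 0) \<longrightarrow> d g = 0) \<and>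
        (\<forall>g\<in>set ?fs. d g = 0) \<and> (\<forall>c\<in>set cs. d (\<lambda>x. x $ c) = 0) \<longrightarrow> (\<forall>c\<in>UNIV. d (\<lambda>x. x $ c) = 0))"
    by (rule generic_derivation_zero[OF ind sa dom fR]) (auto intro: rational_on_poly poly_fun_coord)
  then obtain cs and h :: "complex ^ 'p \<Rightarrow> complex" where cs: "distinct cs" "alg_indep params (?fs @ map (\<lambda>c x. x $ c) (cs :: 'p list))"
    and h: "\<exists>u\<in>params. h u \<noteq> 0"
    and *: "\<forall>u\<in>params. \<forall>d. h u \<noteq> 0 \<and> derivation_at u ?R d \<and> (\<forall>g\<in>?R. (\<forall>x\<in>params. g x = 0) \<longrightarrow> d g = 0) \<and>
        (\<forall>g\<in>set ?fs. d g = 0) \<and> (\<forall>c\<in>set cs. d (\<lambda>x. x $ c) = 0) \<longrightarrow> (\<forall>c\<in>UNIV. d (\<lambda>x. x $ c) = 0)"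
    by (elim exE conjE) (rule that)
  obtain u where u: "u \<in> params" "h u \<noteq> 0" using h by blast
  have lin: "Vector_Spaces.linear (*s) (*s) (jac \<Psi> u)" by (rule jac_linear[OF cdiff_param[OF u(1)]])
  interpret J: Vector_Spaces.linear "(*s)" "(*s)" "jac \<Psi> u" by (rule lin)
  let ?T = "{v :: complex ^ 'p. \<forall>c\<in>set cs. v $ c = 0}"
  have T: "vec.subspace ?T" by (auto simp: vec.subspace_def)
  have "v = 0" if v: "v \<in> ?T" "jac \<Psi> u v = 0" for v
  proof -
    have "derivation_at u ?R (\<lambda>f. frechet_derivative f (at u) v)"
      by (rule derivation_at_frechet) (use cdiff_rational_on[OF poly_denominator] u(1) in \<open>auto simp: params_def\<close>)
    moreover have "\<forall>g\<in>?R. (\<forall>x\<in>params. g x = 0) \<longrightarrow> frechet_derivative g (at u) v = 0"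
      using frechet_derivative_rational_zero[OF poly_denominator] u(1) by (auto simp: params_def)
    moreover have "\<forall>g\<in>set ?fs. frechet_derivative g (at u) v = 0"
    proof clarsimp
      fix f assume "f \<in> set fs"
      then have f: "poly_fun f" by (rule fs(2))
      have "frechet_derivative (\<lambda>u. f (\<Psi> u)) (at u) v = frechet_derivative f (at (\<Psi> u)) (jac \<Psi> u v)"
        using poly_fun_chain_rule[OF f, of \<Psi> u v] cdiff_param[OF u(1)] by simp
      also have "\<dots> = frechet_derivative f (at (\<Psi> u)) (0 *s 0)" by (simp add: v)
      also have "\<dots> = 0" using cdiff_scale[OF cdiff_poly_fun[OF f]] by (metis mult_zero_left)
      finally show "frechet_derivative (\<lambda>u. f (\<Psi> u)) (at u) v = 0" .
    qed
    ultimately have "\<forall>c\<in>UNIV. frechet_derivative (\<lambda>x. x $ c) (at u) v = 0"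
      using *[rule_format, of u "\<lambda>f. frechet_derivative f (at u) v"] u v(1)
      by (simp add: frechet_derivative_coord_eq)
    then show "v = 0" by (simp add: frechet_derivative_coord_eq vec_eq_iff)
  qed
  then have "vec.dim (jac \<Psi> u ` ?T) = vec.dim ?T"
    by (intro dim_image_inj[OF lin T] linear_inj_onI[OF lin T]) auto
  moreover have "vec.dim (jac \<Psi> u ` ?T) \<le> vec.dim (range (jac \<Psi> u))" by (rule vec.dim_subset) auto
  moreover have "card (- set cs) \<le> vec.dim ?T"
  proof -
    have "(\<lambda>i. axis i 1) ` (- set cs) \<subseteq> ?T" by (auto simp: axis_def)
    then show ?thesis
      using vec.independent_card_le_dim[OF _ axes_independent[of "- set cs"], of ?T] by (simp add: card_axes)
  qed
  ultimately have "CARD('p) - length cs \<le> r"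
    using rank[OF u(1)] cs(1) by (simp add: Compl_eq_Diff_UNIV card_Diff_subset distinct_card)
  then have len: "length (?fs @ map (\<lambda>c x. x $ c) cs) \<ge> Suc CARD('p)" using fs(1) by simp
  let ?gs = "take (Suc CARD('p)) (?fs @ map (\<lambda>c x. x $ c) cs)"
  have "alg_indep params ?gs" by (rule alg_indep_take[OF cs(2)])
  moreover have "\<not> alg_indep params ?gs"
    unfolding params_def
  proof (rule rational_functions_dependent[OF poly_denominator])
    show "length ?gs = Suc CARD('p)" using len by simp
    have "set (?fs @ map (\<lambda>c x. x $ c) cs) \<subseteq> ?R"
      using fR by (auto intro: rational_on_poly poly_fun_coord)
    then show "\<forall>f\<in>set ?gs. rational_on \<delta> f" using set_take_subset by fast
  qed
  ultimately show False by blast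
qed

text \<open>Injectivity of the differential on a subspace \<open>Q\<close> is an open condition: with a left inverse \<open>P\<close>
  of the differential on \<open>Q\<close> at \<open>u0\<close>, the operator \<open>1 + P (jac u - jac u0)\<close> is the identity at
  \<open>u0\<close>, and on \<open>Q\<close> it kills what the differential at \<open>u\<close> kills.\<close>

lemma injective_jac_open:
  assumes u0: "u0 \<in> params" and Q: "vec.subspace Q" and inj: "inj_on (jac \<Psi> u0) Q"
  shows "\<exists>h. rational_on \<delta> h \<and> h u0 \<noteq> 0 \<and> (\<forall>u\<in>params. h u \<noteq> 0 \<longrightarrow> inj_on (jac \<Psi> u) Q)"
proof -
  have lin0: "Vector_Spaces.linear (*s) (*s) (jac \<Psi> u0)" by (rule jac_linear[OF cdiff_param[OF u0]])
  obtain P where P: "Vector_Spaces.linear (*s) (*s) P" "\<forall>v\<in>Q. P (jac \<Psi> u0 v) = v"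
    using vec.linear_exists_left_inverse_on[OF lin0 Q inj] by blast
  interpret P: Vector_Spaces.linear "(*s)" "(*s)" P by (rule P(1))
  define A where "A u v = v + P (jac \<Psi> u v) - P (jac \<Psi> u0 v)" for u v
  have linA: "Vector_Spaces.linear (*s) (*s) (A u)" if "u \<in> params" for u
  proof -
    interpret J: Vector_Spaces.linear "(*s)" "(*s)" "jac \<Psi> u" by (rule jac_linear[OF cdiff_param[OF that]])
    interpret J0: Vector_Spaces.linear "(*s)" "(*s)" "jac \<Psi> u0" by (rule lin0)
    have add: "A u (v + w) = A u v + A u w" for v w
      unfolding A_def J.add J0.add P.add by simp
    have scale: "A u (c *s v) = c *s A u v" for c v
      unfolding A_def J.scale J0.scale P.scale by (simp add: vec_eq_iff algebra_simps)
    show ?thesis by unfold_locales (fact add scale)+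
  qed
  define h where "h u = det (matrix (A u))" for u
  have "rational_on \<delta> h"
    unfolding h_def
  proof (rule rational_on_det[OF poly_denominator])
    fix i j
    have "matrix (A u) $ i $ j = (axis j 1 $ i - P (jac \<Psi> u0 (axis j 1)) $ i) +
      (\<Sum>b\<in>UNIV. matrix P $ i $ b * frechet_derivative (\<lambda>u. \<Psi> u $ b) (at u) (axis j 1))" for u
    proof -
      have "matrix (A u) $ i $ j = axis j 1 $ i - P (jac \<Psi> u0 (axis j 1)) $ i + P (jac \<Psi> u (axis j 1)) $ i"
        by (simp add: matrix_def A_def)
      also have "P (jac \<Psi> u (axis j 1)) $ i =
        (\<Sum>b\<in>UNIV. matrix P $ i $ b * frechet_derivative (\<lambda>u. \<Psi> u $ b) (at u) (axis j 1))"
        unfolding linear_component[OF P(1), of "jac \<Psi> u (axis j 1)"] by (simp only: jac_def vec_lambda_beta)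
      finally show ?thesis .
    qed
    then have "(\<lambda>u. matrix (A u) $ i $ j) = (\<lambda>u. (axis j 1 $ i - P (jac \<Psi> u0 (axis j 1)) $ i) +
      (\<Sum>b\<in>UNIV. matrix P $ i $ b * frechet_derivative (\<lambda>u. \<Psi> u $ b) (at u) (axis j 1)))"
      by (rule ext)
    moreover have "rational_on \<delta> \<dots>"
      by (intro rational_on_add rational_on_sum rational_on_mult rational_on_const poly_denominator
          rational_on_frechet_derivative rational)
    ultimately show "rational_on \<delta> (\<lambda>u. matrix (A u) $ i $ j)" by simp
  qed
  moreover have "h u0 \<noteq> 0"
  proof -
    have "A u0 = (\<lambda>v. v)" by (auto simp: A_def)
    then have "matrix (A u0) = mat 1" using matrix_id_mat_1 by (simp add: id_def)
    then show ?thesis by (simp add: h_def)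
  qed
  moreover have "inj_on (jac \<Psi> u) Q" if u: "u \<in> params" "h u \<noteq> 0" for u
  proof (rule inj_onI)
    fix v w assume vw: "v \<in> Q" "w \<in> Q" "jac \<Psi> u v = jac \<Psi> u w"
    interpret J: Vector_Spaces.linear "(*s)" "(*s)" "jac \<Psi> u" by (rule jac_linear[OF cdiff_param[OF u(1)]])
    have "v - w \<in> Q" using vw Q vec.subspace_diff by blast
    moreover have "jac \<Psi> u (v - w) = 0" using vw by (simp add: J.diff)
    ultimately have "A u (v - w) = 0" using P by (simp add: A_def P.zero)
    then have "matrix (A u) *v (v - w) = 0" using matrix_works[OF linA[OF u(1)]] by simp
    moreover have "invertible (matrix (A u))" using u(2) by (simp add: h_def invertible_det_nz)
    ultimately have "v - w = 0" by (metis matrix_left_invertible_ker invertible_def)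
    then show "v = w" by simp
  qed
  ultimately show ?thesis by blast
qed

text \<open>The parametrization restricted to an affine subspace through \<open>u0\<close>. The same type of parameters
  serves for subspaces of all dimensions.\<close>

lemma slice_rational_param:
  assumes u0: "u0 \<in> params" and L: "Vector_Spaces.linear (*s) (*s) (L :: complex ^ 'p \<Rightarrow> complex ^ 'p)"
  shows "rational_param (\<lambda>u. \<Psi> (u0 + L u)) (\<lambda>u. \<delta> (u0 + L u))"
proof
  interpret L: Vector_Spaces.linear "(*s)" "(*s)" L by (rule L)
  have Li: "L u $ i = (\<Sum>b\<in>UNIV. matrix L $ i $ b * u $ b)" for u i
    by (rule linear_component[OF L])
  have aff: "poly_fun (\<lambda>u. (u0 + L u) $ i)" for i
    unfolding vector_add_component Li by (intro poly_fun_intros)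
  show "poly_fun (\<lambda>u. \<delta> (u0 + L u))" by (rule poly_fun_compose[OF poly_denominator aff])
  show "\<exists>u. \<delta> (u0 + L u) \<noteq> 0" using u0 by (intro exI[of _ 0]) (simp add: L.zero params_def)
  fix b
  obtain N g where "poly_fun g" "\<forall>u. \<delta> u \<noteq> 0 \<longrightarrow> \<Psi> u $ b * \<delta> u ^ N = g u"
    using rational[of b] unfolding rational_on_def by blast
  then show "rational_on (\<lambda>u. \<delta> (u0 + L u)) (\<lambda>u. \<Psi> (u0 + L u) $ b)"
    unfolding rational_on_def by (intro exI[of _ N] exI[of _ "\<lambda>u. g (u0 + L u)"]) (auto intro: poly_fun_compose aff)
qed

lemma jac_slice:
  assumes "u0 + L u \<in> params" and L: "Vector_Spaces.linear (*s) (*s) (L :: complex ^ 'p \<Rightarrow> complex ^ 'p)"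
  shows "jac (\<lambda>u. \<Psi> (u0 + L u)) u v = jac \<Psi> (u0 + L u) (L v)"
  unfolding jac_def vec_eq_iff using cdiff_affine_chain_rule(2)[OF cdiff_param[OF assms(1)] L] by simp

text \<open>Images of slices by affine subspaces of increasing dimension form a chain. It is strict
  because the \<open>j\<close>-th slice has transcendence degree exactly \<open>j\<close>: at most \<open>j\<close> by counting
  parameters, and not less, since its tangent spaces have dimension at least \<open>j\<close>.\<close>

lemma variety_dim_ge_rank:
  assumes u0: "u0 \<in> params" and rank: "r \<le> vec.dim (range (jac \<Psi> u0))"
  shows "enat r \<le> variety_dim variety"
proof -
  have lin0: "Vector_Spaces.linear (*s) (*s) (jac \<Psi> u0)" by (rule jac_linear[OF cdiff_param[OF u0]])
  interpret J0: Vector_Spaces.linear "(*s)" "(*s)" "jac \<Psi> u0" by (rule lin0)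
  obtain B0 where B0: "B0 \<subseteq> range (jac \<Psi> u0)" "vec.independent B0" "card B0 = vec.dim (range (jac \<Psi> u0))"
    using vec.basis_exists by metis
  obtain B where B: "B \<subseteq> B0" "card B = r" "finite B"
    using rank B0(3) vec.finiteI_independent[OF B0(2)] by (metis obtain_subset_with_card_n)
  have indB: "vec.independent B" using vec.independent_mono[OF B0(2) B(1)] .
  have "\<forall>b\<in>B. \<exists>v. jac \<Psi> u0 v = b" using B(1) B0(1) by blast
  then obtain pre where pre: "\<forall>b\<in>B. jac \<Psi> u0 (pre b) = b" by (rule bchoice[THEN exE])
  obtain enum where enum: "bij_betw enum {..<r} B" using B(2,3) ex_bij_betw_nat_finite lessThan_atLeast0 by metis
  define e where "e k = pre (enum k)" for k
  have je: "jac \<Psi> u0 (e k) = enum k" if "k < r" for k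
    using enum pre that by (auto simp: e_def bij_betw_def)
  have inj_enum: "inj_on enum {..<r}" using enum by (simp add: bij_betw_def)
  have rp: "r \<le> CARD('p)"
  proof -
    have "r \<le> vec.dim (range (jac \<Psi> u0))" by (rule rank)
    also have "\<dots> \<le> vec.dim (UNIV :: (complex ^ 'p) set)" by (rule vec.dim_image_le[OF lin0])
    finally show ?thesis by (simp add: card_cart_basis)
  qed
  obtain idx :: "'p \<Rightarrow> nat" where idx: "bij_betw idx UNIV {..<CARD('p)}"
    using ex_bij_betw_finite_nat[of "UNIV :: 'p set"] lessThan_atLeast0 by (metis finite)
  define L where "L j u = (\<Sum>i\<in>UNIV. if idx i < j then u $ i *s e (idx i) else 0)" for j and u :: "complex ^ 'p"
  have linL: "Vector_Spaces.linear (*s) (*s) (L j)" for j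
  proof -
    have "L j (v + w) = L j v + L j w" for v w
      unfolding L_def sum.distrib[symmetric] by (rule sum.cong) (auto simp: vec.scale_left_distrib)
    moreover have "L j (c *s v) = c *s L j v" for c v
      unfolding L_def vec.scale_sum_right by (rule sum.cong) auto
    ultimately show ?thesis by unfold_locales auto
  qed
  have rangeL: "range (L j) = vec.span (e ` {..<j})" if "j \<le> r" for j
  proof
    show "range (L j) \<subseteq> vec.span (e ` {..<j})"
    proof clarify
      fix u
      have "(if idx i < j then u $ i *s e (idx i) else 0) \<in> vec.span (e ` {..<j})" for i
        by (cases "idx i < j") (auto intro: vec.span_scale[OF vec.span_base] vec.span_zero)
      then show "L j u \<in> vec.span (e ` {..<j})" unfolding L_def by (rule vec.span_sum)
    qed
    have "e k \<in> range (L j)" if k: "k < j" for k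
    proof -
      have "k < CARD('p)" using k \<open>j \<le> r\<close> rp by simp
      then obtain i where i: "idx i = k" using idx by (metis bij_betw_iff_bijections lessThan_iff)
      have "L j (axis i 1) = (\<Sum>i'\<in>UNIV. if i' = i then e k else 0)"
        unfolding L_def by (intro sum.cong) (use k in \<open>auto simp: axis_def i\<close>)
      then have "e k = L j (axis i 1)" by simp
      then show ?thesis by (rule range_eqI)
    qed
    then have "e ` {..<j} \<subseteq> range (L j)" by auto
    moreover have "vec.subspace (range (L j))"
    proof -
      interpret Lj: Vector_Spaces.linear "(*s)" "(*s)" "L j" by (rule linL)
      show ?thesis by (rule Lj.subspace_image) simp
    qed
    ultimately show "vec.span (e ` {..<j}) \<subseteq> range (L j)" by (rule vec.span_minimal)
  qed
  let ?\<Psi> = "\<lambda>j u. \<Psi> (u0 + L j u)"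
  let ?\<delta> = "\<lambda>j u. \<delta> (u0 + L j u)"
  have sl: "rational_param (?\<Psi> j) (?\<delta> j)" for j by (rule slice_rational_param[OF u0 linL])
  define W where "W j = rational_param.variety (?\<Psi> j) (?\<delta> j)" for j
  have par: "u \<in> rational_param.params (?\<delta> j) \<longleftrightarrow> u0 + L j u \<in> params" for u j
    by (simp add: rational_param.params_def[OF sl] params_def)
  have tr_le: "trdeg_le (W j) j" if "j \<le> r" for j
    unfolding W_def
  proof (rule rational_param.trdeg_le_rank[OF sl])
    fix u assume "u \<in> rational_param.params (?\<delta> j)"
    then have u: "u0 + L j u \<in> params" by (simp add: par)
    have "range (jac (?\<Psi> j) u) = jac \<Psi> (u0 + L j u) ` (L j ` UNIV)"
      using jac_slice[OF u linL] by auto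
    then have "vec.dim (range (jac (?\<Psi> j) u)) \<le> vec.dim (range (L j))"
      using vec.dim_image_le[OF jac_linear[OF cdiff_param[OF u]]] by simp
    also have "\<dots> \<le> card (e ` {..<j})" unfolding rangeL[OF that] by (rule vec.dim_le_card) auto
    also have "\<dots> \<le> j" using card_image_le[of "{..<j}" e] by simp
    finally show "vec.dim (range (jac (?\<Psi> j) u)) \<le> j" .
  qed
  have tr_nle: "\<not> trdeg_le (W (Suc j)) j" if j: "Suc j \<le> r" for j
  proof
    assume tr: "trdeg_le (W (Suc j)) j"
    have irr: "zariski_irreducible (W (Suc j))" unfolding W_def by (rule rational_param.irreducible[OF sl])
    obtain h where h: "poly_fun h" "\<exists>x\<in>W (Suc j). h x \<noteq> 0"
      "\<forall>x\<in>W (Suc j). h x \<noteq> 0 \<longrightarrow> vec.dim (tangent_space (W (Suc j)) x) \<le> j"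
      using trdeg_le_imp_tangent_dim_le[OF irr tr] by blast
    obtain a where a: "a \<in> rational_param.params (?\<delta> (Suc j))" "h (?\<Psi> (Suc j) a) \<noteq> 0"
      using rational_param.nonvanishing_pullback[OF sl h(1)] h(2) unfolding W_def by blast
    let ?Q = "range (L (Suc j))"
    have eQ: "?Q = vec.span (e ` {..<Suc j})" by (rule rangeL[OF j])
    have Q: "vec.subspace ?Q" unfolding eQ by simp
    have img: "jac \<Psi> u0 ` e ` {..<Suc j} = enum ` {..<Suc j}"
      using je j by (force simp: image_image)
    have ind: "vec.independent (enum ` {..<Suc j})"
      by (rule vec.independent_mono[OF indB]) (use enum j in \<open>auto simp: bij_betw_def\<close>)
    have inj0: "inj_on (jac \<Psi> u0) ?Q"
    proof -
      have "inj_on (jac \<Psi> u0) (e ` {..<Suc j})"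
      proof (rule inj_onI)
        fix a b assume ab: "a \<in> e ` {..<Suc j}" "b \<in> e ` {..<Suc j}" "jac \<Psi> u0 a = jac \<Psi> u0 b"
        then obtain x y where xy: "a = e x" "b = e y" "x < Suc j" "y < Suc j" by auto
        then have "enum x = enum y" using ab(3) je j by auto
        then have "x = y" using inj_onD[OF inj_enum, of x y] xy j by auto
        then show "a = b" using xy by simp
      qed
      then show ?thesis using J0.inj_on_span_iff_independent_image[of "e ` {..<Suc j}"] ind img eQ by simp
    qed
    have dimQ: "Suc j \<le> vec.dim ?Q"
    proof -
      have "card (enum ` {..<Suc j}) = Suc j"
        by (subst card_image) (use inj_enum j in \<open>auto intro: inj_on_subset\<close>)
      then have "Suc j = vec.dim (jac \<Psi> u0 ` e ` {..<Suc j})"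
        using vec.dim_eq_card_independent[OF ind] img by simp
      also have "\<dots> \<le> vec.dim (e ` {..<Suc j})" by (rule vec.dim_image_le[OF lin0])
      finally show ?thesis unfolding eQ by simp
    qed
    obtain g where g: "rational_on \<delta> g" "g u0 \<noteq> 0" "\<forall>u\<in>params. g u \<noteq> 0 \<longrightarrow> inj_on (jac \<Psi> u) ?Q"
      using injective_jac_open[OF u0 Q inj0] by blast
    interpret S: rational_param "?\<Psi> (Suc j)" "?\<delta> (Suc j)" by (rule sl)
    interpret Lj: Vector_Spaces.linear "(*s)" "(*s)" "L (Suc j)" by (rule linL)
    have "rational_on (?\<delta> (Suc j)) (\<lambda>u. g (u0 + L (Suc j) u))"
    proof -
      have Li: "L (Suc j) u $ i = (\<Sum>b\<in>UNIV. matrix (L (Suc j)) $ i $ b * u $ b)" for u i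
        by (rule linear_component[OF linL])
      have aff: "poly_fun (\<lambda>u. (u0 + L (Suc j) u) $ i)" for i
        unfolding vector_add_component Li by (intro poly_fun_intros)
      obtain N q where "poly_fun q" "\<forall>u. \<delta> u \<noteq> 0 \<longrightarrow> g u * \<delta> u ^ N = q u"
        using g(1) unfolding rational_on_def by blast
      then show ?thesis
        unfolding rational_on_def
        by (intro exI[of _ N] exI[of _ "\<lambda>u. q (u0 + L (Suc j) u)"]) (auto intro: poly_fun_compose aff)
    qed
    then have gR: "(\<lambda>u. g (u0 + L (Suc j) u)) \<in> {f. rational_on (?\<delta> (Suc j)) f}" by simp
    have hR: "(\<lambda>u. h (?\<Psi> (Suc j) u)) \<in> {f. rational_on (?\<delta> (Suc j)) f}"
      using rational_on_compose[OF S.poly_denominator h(1)] S.rational by simp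
    have "\<exists>u\<in>S.params. g (u0 + L (Suc j) u) * h (?\<Psi> (Suc j) u) \<noteq> 0"
    proof (rule domain_on_mult_nonzero[OF _ gR hR])
      show "domain_on S.params {f. rational_on (?\<delta> (Suc j)) f}"
        using domain_on_rational_on[OF S.poly_denominator S.nonempty] by (simp add: S.params_def)
      show "\<exists>u\<in>S.params. g (u0 + L (Suc j) u) \<noteq> 0"
        by (rule bexI[of _ 0]) (use g u0 in \<open>auto simp: par Lj.zero\<close>)
    qed (use a in auto)
    then obtain u where u: "u \<in> S.params" "g (u0 + L (Suc j) u) \<noteq> 0" "h (?\<Psi> (Suc j) u) \<noteq> 0" by auto
    let ?u = "u0 + L (Suc j) u"
    have up: "?u \<in> params" using u(1) by (simp add: par)
    have "inj_on (jac \<Psi> ?u) ?Q" using g(3) up u(2) by blast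
    then have "vec.dim (jac \<Psi> ?u ` ?Q) = vec.dim ?Q"
      by (rule dim_image_inj[OF jac_linear[OF cdiff_param[OF up]] Q])
    moreover have "jac \<Psi> ?u ` ?Q \<subseteq> tangent_space (W (Suc j)) (?\<Psi> (Suc j) u)"
      using S.jac_in_tangent_space[OF u(1)] jac_slice[OF up linL] unfolding W_def by auto
    then have "vec.dim (jac \<Psi> ?u ` ?Q) \<le> vec.dim (tangent_space (W (Suc j)) (?\<Psi> (Suc j) u))"
      by (rule vec.dim_subset)
    moreover have "?\<Psi> (Suc j) u \<in> W (Suc j)"
      unfolding W_def S.variety_def by (rule subsetD[OF zariski_closure_subset]) (use u(1) in simp)
    then have "vec.dim (tangent_space (W (Suc j)) (?\<Psi> (Suc j) u)) \<le> j" using h(3) u(3) by blast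
    ultimately show False using dimQ by linarith
  qed
  have sub: "W j \<subseteq> W k" if "j \<le> k" "k \<le> r" for j k
  proof -
    have LL: "range (L j) \<subseteq> range (L k)" unfolding rangeL[OF that(2)] rangeL[OF le_trans[OF that]]
      by (rule vec.span_mono) (use that in auto)
    have "?\<Psi> j ` rational_param.params (?\<delta> j) \<subseteq> ?\<Psi> k ` rational_param.params (?\<delta> k)"
    proof (rule image_subsetI)
      fix u assume u: "u \<in> rational_param.params (?\<delta> j)"
      obtain w where w: "L j u = L k w" using LL by blast
      have "w \<in> rational_param.params (?\<delta> k)" using u by (simp add: par w)
      then show "?\<Psi> j u \<in> ?\<Psi> k ` rational_param.params (?\<delta> k)" unfolding w by (rule imageI)
    qed
    then show ?thesis unfolding W_def rational_param.variety_def[OF sl] by (rule closure_of_mono)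
  qed
  have sub_all: "W j \<subseteq> variety" for j
  proof -
    have "?\<Psi> j ` rational_param.params (?\<delta> j) \<subseteq> \<Psi> ` params" by (auto simp: par)
    then show ?thesis unfolding W_def rational_param.variety_def[OF sl] variety_def by (rule closure_of_mono)
  qed
  show ?thesis
    unfolding variety_dim_def
  proof (rule Sup_upper, intro CollectI exI conjI)
    show "enat r = enat r" ..
    show "\<forall>i\<le>r. zariski_irreducible (W i) \<and> closedin zariski (W i) \<and> W i \<subseteq> variety"
      using sub_all rational_param.irreducible[OF sl] rational_param.closed[OF sl] unfolding W_def by blast
    show "\<forall>i<r. W i \<subset> W (Suc i)"
    proof (intro allI impI psubsetI)
      fix i assume i: "i < r"
      show "W i \<subseteq> W (Suc i)" by (rule sub) (use i in auto)
      have "trdeg_le (W i) i" "\<not> trdeg_le (W (Suc i)) i" using tr_le tr_nle i by auto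
      then show "W i \<noteq> W (Suc i)" by auto
    qed
  qed
qed

end


section \<open>The Cayley transform\<close>

lemma transpose_add: "transpose (A + B) = transpose A + transpose B"
  by (simp add: transpose_def vec_eq_iff)

lemma transpose_diff: "transpose (A - B) = transpose A - transpose B"
  by (simp add: transpose_def vec_eq_iff)

lemma transpose_uminus: "transpose (- A) = - transpose A"
  by (simp add: transpose_def vec_eq_iff)

lemma matrix_mul_uminus_left: "(- A) ** B = - (A ** (B :: 'a::ring_1 ^ _ ^ _))"
  by (simp add: matrix_matrix_mult_def vec_eq_iff sum_negf)

lemma matrix_mul_uminus_right: "A ** (- B) = - (A ** (B :: 'a::ring_1 ^ _ ^ _))"
  by (simp add: matrix_matrix_mult_def vec_eq_iff sum_negf)

lemma matrix_mul_diff_left: "(A - B) ** C = A ** C - B ** (C :: 'a::ring_1 ^ _ ^ _)"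
  by (simp add: matrix_matrix_mult_def vec_eq_iff sum_subtractf algebra_simps)

lemma matrix_mul_diff_right: "A ** (B - C) = A ** B - A ** (C :: 'a::ring_1 ^ _ ^ _)"
  by (simp add: matrix_matrix_mult_def vec_eq_iff sum_subtractf algebra_simps)

lemma matrix_mul_add_left: "(A + B) ** C = A ** C + B ** (C :: 'a::semiring_1 ^ _ ^ _)"
  by (simp add: matrix_matrix_mult_def vec_eq_iff sum.distrib algebra_simps)

lemma matrix_mul_add_right: "A ** (B + C) = A ** B + A ** (C :: 'a::semiring_1 ^ _ ^ _)"
  by (simp add: matrix_matrix_mult_def vec_eq_iff sum.distrib algebra_simps)

lemma mat_mul_left: "(mat c ** A) $ i $ j = c * A $ i $ j" for A :: "'a::semiring_1 ^ 'm ^ 'n"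
  by (simp add: matrix_matrix_mult_def mat_def if_distrib if_distribR cong: if_cong)

lemma mat_mul_right: "(A ** mat c) $ i $ j = A $ i $ j * c" for A :: "'a::semiring_1 ^ 'm ^ 'n"
  by (simp add: matrix_matrix_mult_def mat_def if_distrib if_distribR cong: if_cong)

lemma mat_commute: "mat c ** A = A ** mat c" for A :: "'a::comm_semiring_1 ^ 'n ^ 'n"
  by (simp add: vec_eq_iff mat_mul_left mat_mul_right mult.commute)

lemma matrix_cancel_right:
  fixes A B C :: "'a::field ^ 'n ^ 'n"
  assumes "det C \<noteq> 0" "A ** C = B ** C" shows "A = B"
proof -
  obtain C' where "C ** C' = mat 1" using assms(1) by (auto simp: invertible_det_nz[symmetric] invertible_def)
  then show ?thesis using assms(2) by (metis matrix_mul_assoc matrix_mul_rid)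
qed

lemma matrix_cancel_left:
  fixes A B C :: "'a::field ^ 'n ^ 'n"
  assumes "det C \<noteq> 0" "C ** A = C ** B" shows "A = B"
proof -
  obtain C' where "C' ** C = mat 1" using assms(1) by (auto simp: invertible_det_nz[symmetric] invertible_def)
  then show ?thesis using assms(2) by (metis matrix_mul_assoc matrix_mul_lid)
qed

lemma orthogonal_matrixI:
  fixes A :: "'a::field ^ 'n ^ 'n"
  assumes "transpose A ** A = mat 1" shows "orthogonal_matrix A"
  using assms matrix_left_right_inverse[of "transpose A" A] by (simp add: orthogonal_matrix_def)

lemma orthogonal_matrix_mult:
  fixes A B :: "'a::field ^ 'n ^ 'n"
  assumes "orthogonal_matrix A" "orthogonal_matrix B" shows "orthogonal_matrix (A ** B)"
proof (rule orthogonal_matrixI)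
  have "transpose (A ** B) ** (A ** B) = transpose B ** (transpose A ** A) ** B"
    by (simp add: matrix_transpose_mul matrix_mul_assoc)
  then show "transpose (A ** B) ** (A ** B) = mat 1" using assms by (simp add: orthogonal_matrix_def)
qed

lemma det_mat: "det (mat c :: 'a::field ^ 'n ^ 'n) = c ^ CARD('n)"
  by (subst det_diagonal) (auto simp: mat_def)

definition skew :: "'a::field ^ 'n ^ 'n \<Rightarrow> bool" where
  "skew A \<longleftrightarrow> transpose A = - A"

text \<open>Normalized so that the derivative at 0 is the identity.\<close>

definition cayley :: "'a::field ^ 'n ^ 'n \<Rightarrow> 'a ^ 'n ^ 'n" where
  "cayley A = (mat 2 + A) ** matrix_inv (mat 2 - A)"

lemma matrix_inv_det:
  fixes A :: "'a::field ^ 'n ^ 'n"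
  assumes "det A \<noteq> 0"
  shows "A ** matrix_inv A = mat 1" "matrix_inv A ** A = mat 1"
proof -
  have "\<exists>A'. A ** A' = mat 1 \<and> A' ** A = mat 1"
    using assms by (simp add: invertible_det_nz[symmetric] invertible_def)
  from someI_ex[OF this] show "A ** matrix_inv A = mat 1" "matrix_inv A ** A = mat 1"
    by (auto simp: matrix_inv_def)
qed

lemma cayley_mult:
  assumes "det (mat 2 - A) \<noteq> 0" shows "cayley A ** (mat 2 - A) = mat 2 + A"
  unfolding cayley_def using matrix_inv_det(2)[OF assms] by (metis matrix_mul_assoc matrix_mul_rid)

lemma cayley_eqI:
  assumes "det (mat 2 - A) \<noteq> 0" "B ** (mat 2 - A) = mat 2 + A" shows "B = cayley A"
  by (rule matrix_cancel_right[OF assms(1)]) (simp add: assms(2) cayley_mult[OF assms(1)])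

lemma skew_det: "skew A \<Longrightarrow> det (mat 2 + A) = det (mat 2 - A)"
  using det_transpose[of "mat 2 - A"] by (simp add: skew_def transpose_diff transpose_mat)

lemma mat2_commute: "(mat 2 - A) ** (mat 2 + A) = (mat 2 + A) ** (mat 2 - A)" for A :: "'a::field ^ 'n ^ 'n"
  using mat_commute[of 2 A]
  by (simp add: matrix_mul_add_left matrix_mul_add_right matrix_mul_diff_left matrix_mul_diff_right)

lemma cayley_orthogonal:
  fixes A :: "'a::field ^ 'n ^ 'n"
  assumes A: "skew A" and d: "det (mat 2 - A) \<noteq> 0"
  shows "orthogonal_matrix (cayley A)"
proof (rule orthogonal_matrixI)
  let ?C = "cayley A" let ?Q = "mat 2 - A" let ?R = "mat 2 + A"
  have dR: "det ?R \<noteq> 0" using d skew_det[OF A] by simp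
  have tr: "transpose ?Q = ?R" "transpose ?R = ?Q" using A by (auto simp: skew_def transpose_diff transpose_add transpose_mat)
  have C: "?C ** ?Q = ?R" by (rule cayley_mult[OF d])
  have "?R ** transpose ?C = ?Q" using arg_cong[OF C, of transpose] by (simp add: matrix_transpose_mul tr)
  then have "?R ** (transpose ?C ** ?C ** ?Q) = ?Q ** ?R" using C by (metis matrix_mul_assoc)
  also have "\<dots> = ?R ** (mat 1 ** ?Q)" by (simp add: mat2_commute)
  finally have "transpose ?C ** ?C ** ?Q = mat 1 ** ?Q" by (rule matrix_cancel_left[OF dR])
  then show "transpose ?C ** ?C = mat 1" by (rule matrix_cancel_right[OF d])
qed

lemma skew_uminus: "skew A \<Longrightarrow> skew (- A)"
  by (simp add: skew_def transpose_uminus)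

lemma cayley_uminus:
  fixes A :: "'a::field ^ 'n ^ 'n"
  assumes A: "skew A" and d: "det (mat 2 - A) \<noteq> 0"
  shows "cayley (- A) ** cayley A = mat 1" "cayley A ** cayley (- A) = mat 1"
proof -
  have d': "det (mat 2 - (- A)) \<noteq> 0" using d skew_det[OF A] by simp
  have "cayley (- A) ** cayley A ** (mat 2 - A) = cayley (- A) ** (mat 2 - (- A))"
    using cayley_mult[OF d] by (simp add: matrix_mul_assoc[symmetric])
  also have "\<dots> = mat 1 ** (mat 2 - A)" using cayley_mult[OF d'] by simp
  finally show *: "cayley (- A) ** cayley A = mat 1" by (rule matrix_cancel_right[OF d])
  then show "cayley A ** cayley (- A) = mat 1" by (simp add: matrix_left_right_inverse)
qed

lemma cayley_0: "cayley 0 = (mat 1 :: 'a::field_char_0 ^ 'n ^ 'n)"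
proof -
  have "det (mat 2 - 0 :: 'a ^ 'n ^ 'n) \<noteq> 0" by (simp add: det_mat)
  from cayley_eqI[OF this, of "mat 1"] show ?thesis by simp
qed

text \<open>The inverse transform \<open>B \<mapsto> 2 (1 + B)\<^sup>-\<^sup>1 (B - 1)\<close>.\<close>

lemma orthogonal_imp_cayley:
  fixes B :: "'a::field_char_0 ^ 'n ^ 'n"
  assumes B: "orthogonal_matrix B" and d: "det (mat 1 + B) \<noteq> 0"
  obtains A where "skew A" "det (mat 2 - A) \<noteq> 0" "B = cayley A"
proof -
  let ?P = "mat 1 + B"
  define A where "A = mat 2 ** (matrix_inv ?P ** (B - mat 1))"
  have PA: "?P ** A = mat 2 ** (B - mat 1)"
  proof -
    have "?P ** A = mat 2 ** (?P ** matrix_inv ?P ** (B - mat 1))"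
      unfolding A_def by (metis mat_commute matrix_mul_assoc)
    then show ?thesis by (simp add: matrix_inv_det[OF d])
  qed
  have two: "mat 2 ** X = X + X" for X :: "'a ^ 'n ^ 'n" by (simp add: vec_eq_iff mat_mul_left)
  have two': "X ** mat 2 = X + X" for X :: "'a ^ 'n ^ 'n" by (simp add: vec_eq_iff mat_mul_right)
  have PQ: "?P ** (mat 2 - A) = mat 2 + mat 2"
    unfolding matrix_mul_diff_right PA two two' by (simp add: vec_eq_iff mat_def)
  have dQ: "det (mat 2 - A) \<noteq> 0"
  proof -
    have "mat 2 + mat 2 = (mat 4 :: 'a ^ 'n ^ 'n)" by (simp add: vec_eq_iff mat_def)
    then have "det ?P * det (mat 2 - A) = det (mat 4 :: 'a ^ 'n ^ 'n)" using PQ by (metis det_mul)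
    then show ?thesis by (metis det_mat mult_eq_0_iff power_not_zero zero_neq_numeral)
  qed
  have comm: "?P ** (B - mat 1) = (B - mat 1) ** ?P"
    by (simp add: matrix_mul_diff_left matrix_mul_diff_right matrix_mul_add_left matrix_mul_add_right)
  have AP: "A ** ?P = mat 2 ** (B - mat 1)"
  proof (rule matrix_cancel_left[OF d])
    have "?P ** (A ** ?P) = mat 2 ** (B - mat 1) ** ?P" by (simp add: PA matrix_mul_assoc)
    also have "\<dots> = mat 2 ** (?P ** (B - mat 1))" by (simp add: comm matrix_mul_assoc)
    also have "\<dots> = ?P ** (mat 2 ** (B - mat 1))" by (metis mat_commute matrix_mul_assoc)
    finally show "?P ** (A ** ?P) = ?P ** (mat 2 ** (B - mat 1))" .
  qed
  have "B ** (mat 2 - A) = mat 2 + A"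
  proof -
    have "B + B - B ** A - (mat 2 + A) = mat 2 ** (B - mat 1) - ?P ** A"
      unfolding two matrix_mul_add_left matrix_mul_lid by (simp add: vec_eq_iff mat_def)
    then show ?thesis by (simp add: PA matrix_mul_diff_right two')
  qed
  then have cay: "B = cayley A" by (rule cayley_eqI[OF dQ])
  have "skew A"
    unfolding skew_def
  proof (rule matrix_cancel_left[OF d])
    have "B ** transpose B = mat 1" using B by (simp add: orthogonal_matrix_def)
    moreover have "transpose (A ** ?P) = transpose (mat 2 ** (B - mat 1))" by (simp add: AP)
    then have "(mat 1 + transpose B) ** transpose A = (transpose B - mat 1) ** mat 2"
      by (simp add: matrix_transpose_mul transpose_add transpose_diff transpose_mat)
    then have "B ** ((mat 1 + transpose B) ** transpose A) = B ** ((transpose B - mat 1) ** mat 2)" by simp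
    ultimately have "(B + mat 1) ** transpose A = (mat 1 - B) ** mat 2"
      by (simp add: matrix_mul_assoc matrix_mul_add_right matrix_mul_diff_right)
    moreover have "?P ** (- A) = - (mat 2 ** (B - mat 1))" by (simp add: matrix_mul_uminus_right PA)
    ultimately show "?P ** transpose A = ?P ** (- A)"
      by (simp add: add.commute two two')
  qed
  then show ?thesis using that dQ cay by blast
qed

definition diag_mat :: "('n \<Rightarrow> 'a::zero) \<Rightarrow> 'a ^ 'n ^ 'n" where
  "diag_mat d = (\<chi> i j. if i = j then d i else 0)"

lemma diag_mat_mult_left: "(diag_mat d ** A) $ i $ j = d i * A $ i $ j" for A :: "'a::semiring_1 ^ 'm ^ 'n"
  by (simp add: matrix_matrix_mult_def diag_mat_def if_distrib if_distribR cong: if_cong)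

lemma diag_mat_mult_right: "(A ** diag_mat d) $ i $ j = A $ i $ j * d j" for A :: "'a::semiring_1 ^ 'n ^ 'm"
  by (simp add: matrix_matrix_mult_def diag_mat_def if_distrib if_distribR cong: if_cong)

definition signs :: "('n \<Rightarrow> 'a::field) set" where "signs = {d. \<forall>i. d i = 1 \<or> d i = -1}"

lemma signs_PiE: "signs = PiE UNIV (\<lambda>_. {1, -1})"
  by (auto simp: signs_def)

lemma sign_square: "d \<in> signs \<Longrightarrow> d i * d i = 1"
  by (cases "d i = 1") (auto simp: signs_def)

lemma transpose_diag_mat: "transpose (diag_mat d) = diag_mat d"
  by (auto simp: transpose_def diag_mat_def vec_eq_iff)

lemma diag_mat_sign_square: "d \<in> signs \<Longrightarrow> diag_mat d ** diag_mat d = mat 1"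
  unfolding vec_eq_iff diag_mat_mult_left by (auto simp: diag_mat_def mat_def sign_square)

lemma diag_mat_orthogonal: "d \<in> signs \<Longrightarrow> orthogonal_matrix (diag_mat d)"
  by (simp add: orthogonal_matrix_def transpose_diag_mat diag_mat_sign_square)

text \<open>As a function of a diagonal matrix \<open>D\<close>, \<open>det (D + U)\<close> has degree at most 1 in each diagonal
  entry, and the product of all entries occurs with coefficient 1. The sum over all signs, weighted by
  their product, extracts this coefficient.\<close>

lemma exists_signs_det_nonzero:
  fixes U :: "'a::field_char_0 ^ 'n ^ 'n"
  shows "\<exists>d\<in>signs. det (diag_mat d + U) \<noteq> 0"
proof (rule ccontr)
  assume "\<not> ?thesis"
  then have "(\<Sum>d\<in>signs. (\<Prod>i\<in>UNIV. d i) * det (diag_mat d + U)) = 0" by simp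
  moreover have "(\<Sum>d\<in>signs. (\<Prod>i\<in>UNIV. d i) * det (diag_mat d + U)) = 2 ^ CARD('n)"
  proof -
    have "(\<Sum>d\<in>signs. (\<Prod>i\<in>UNIV. d i) * det (diag_mat d + U)) =
      (\<Sum>p\<in>{p. p permutes UNIV}. of_int (sign p) *
        (\<Sum>d\<in>signs. \<Prod>i\<in>UNIV. d i * (diag_mat d + U) $ i $ p i))"
      unfolding det_def sum_distrib_left by (subst sum.swap) (simp add: prod.distrib mult_ac)
    also have "\<dots> = (\<Sum>p\<in>{p. p permutes (UNIV :: 'n set)}. of_int (sign p) * (\<Prod>i\<in>UNIV. if i = p i then 2 else 0))"
    proof (intro sum.cong refl arg_cong2[where f = "(*)"])
      fix p :: "'n \<Rightarrow> 'n"
      have "(\<Sum>d\<in>signs. \<Prod>i\<in>UNIV. d i * (diag_mat d + U) $ i $ p i) =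
        (\<Sum>d\<in>PiE UNIV (\<lambda>_. {1, -1}). \<Prod>i\<in>UNIV. d i * ((if i = p i then d i else 0) + U $ i $ p i))"
        by (simp add: signs_PiE diag_mat_def)
      also have "\<dots> = (\<Prod>i\<in>UNIV. \<Sum>e\<in>{1, -1}. e * ((if i = p i then e else 0) + U $ i $ p i))"
        by (subst prod_sum_PiE) auto
      also have "\<dots> = (\<Prod>i\<in>UNIV. if i = p i then 2 else 0)"
        by (intro prod.cong) (auto simp: one_neq_neg_one)
      finally show "(\<Sum>d\<in>signs. \<Prod>i\<in>UNIV. d i * (diag_mat d + U) $ i $ p i) = (\<Prod>i\<in>UNIV. if i = p i then 2 else 0)" .
    qed
    also have "\<dots> = (\<Sum>p\<in>{id}. of_int (sign p) * (\<Prod>i\<in>(UNIV :: 'n set). if i = p i then 2 else 0))"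
    proof (rule sum.mono_neutral_right)
      show "\<forall>p\<in>{p. p permutes (UNIV :: 'n set)} - {id}. of_int (sign p) * (\<Prod>i\<in>UNIV. if i = p i then 2 else (0::'a)) = 0"
      proof
        fix p :: "'n \<Rightarrow> 'n" assume "p \<in> {p. p permutes UNIV} - {id}"
        then obtain i where "i \<noteq> p i" by (metis DiffE eq_id_iff singletonI)
        then show "of_int (sign p) * (\<Prod>i\<in>UNIV. if i = p i then 2 else (0::'a)) = 0"
          by (intro mult_eq_0_iff[THEN iffD2] disjI2 prod_zero) auto
      qed
    qed (auto simp: permutes_id finite_permutations)
    finally show ?thesis by simp
  qed
  ultimately show False by simp
qed

text \<open>Cayley transforms miss the orthogonal matrices with eigenvalue \<open>-1\<close>, in particular those of
  determinant \<open>-1\<close>. Signs remove this eigenvalue, and on diagonal matrices they act as signed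
  permutations do.\<close>

lemma orthogonal_cayley_signs:
  fixes U :: "'a::field_char_0 ^ 'n ^ 'n"
  assumes U: "orthogonal_matrix U"
  obtains A d where "skew A" "det (mat 2 - A) \<noteq> 0" "d \<in> signs" "U = cayley A ** diag_mat d"
proof -
  obtain d where d: "d \<in> signs" "det (diag_mat d + U) \<noteq> (0::'a)" using exists_signs_det_nonzero by blast
  let ?B = "U ** diag_mat d"
  have "orthogonal_matrix ?B" by (intro orthogonal_matrix_mult U diag_mat_orthogonal d)
  moreover have "det (mat 1 + ?B) \<noteq> 0"
  proof -
    have "mat 1 + ?B = (diag_mat d + U) ** diag_mat d"
      by (simp add: matrix_mul_add_left diag_mat_sign_square d)
    moreover have "det (diag_mat d) \<noteq> (0::'a)"
      using arg_cong[OF diag_mat_sign_square[OF d(1)], of det] by (auto simp: det_mul)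
    ultimately show ?thesis using d by (simp add: det_mul)
  qed
  ultimately obtain A where A: "skew A" "det (mat 2 - A) \<noteq> 0" "?B = cayley A"
    using orthogonal_imp_cayley by blast
  have "U = ?B ** diag_mat d" using diag_mat_sign_square[OF d(1)] by (simp flip: matrix_mul_assoc)
  then show ?thesis using that A d by metis
qed

section \<open>The action on matrices\<close>

definition unvec :: "'a ^ ('n \<times> 't) \<Rightarrow> 'a ^ 't ^ 'n" where
  "unvec x = (\<chi> i j. x $ (i, j))"

lemma unvec_mat_vec [simp]: "unvec (mat_vec A) = A"
  by (simp add: unvec_def mat_vec_def vec_eq_iff)

lemma mat_vec_unvec [simp]: "mat_vec (unvec x) = x"
  by (simp add: unvec_def mat_vec_def vec_eq_iff)

lemma unvec_add: "unvec (x + y) = unvec x + unvec y" by (simp add: unvec_def vec_eq_iff)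
lemma unvec_inject: "unvec x = unvec y \<longleftrightarrow> x = y" by (metis mat_vec_unvec)

definition act :: "'a::field ^ 'n ^ 'n \<Rightarrow> 'a ^ 't ^ 't \<Rightarrow> 'a ^ ('n \<times> 't) \<Rightarrow> 'a ^ ('n \<times> 't)" where
  "act U V x = mat_vec (U ** unvec x ** transpose V)"

lemma unvec_act: "unvec (act U V x) = U ** unvec x ** transpose V"
  by (simp add: act_def)

lemma act_component:
  "act U V x $ p = (\<Sum>l\<in>UNIV. (\<Sum>k\<in>UNIV. U $ fst p $ k * x $ (k, l)) * V $ snd p $ l)"
  by (simp add: act_def mat_vec_def matrix_matrix_mult_def unvec_def transpose_def)

lemma act_act: "act U V (act U' V' x) = act (U ** U') (V ** V') x"
  by (simp add: act_def matrix_transpose_mul matrix_mul_assoc)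

lemma act_id [simp]: "act (mat 1) (mat 1) x = x"
  by (simp add: act_def transpose_mat)

lemma act_add: "act U V (x + y) = act U V x + act U V y"
  by (simp add: act_component vec_eq_iff sum.distrib algebra_simps)

lemma act_diff: "act U V (x - y) = act U V x - act U V y"
  by (simp add: act_component vec_eq_iff sum_subtractf algebra_simps)

lemma act_scale: "act U V (c *s x) = c *s act U V x"
  by (simp add: act_component vec_eq_iff sum_distrib_left sum_distrib_right mult_ac)

lemma linear_act: "Vector_Spaces.linear (*s) (*s) (act U V)"
  by unfold_locales (auto simp: act_add act_scale)

lemma poly_fun_act: "poly_fun (\<lambda>x. act U V x $ p)"
  unfolding act_component by (intro poly_fun_intros)

definition bil :: "'a::field ^ 'm \<Rightarrow> 'a ^ 'm \<Rightarrow> 'a" where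
  "bil x y = (\<Sum>i\<in>UNIV. x $ i * y $ i)"

lemma bil_add: "bil x (y + z) = bil x y + bil x z"
  by (simp add: bil_def sum.distrib algebra_simps)

lemma bil_diff_left: "bil (x - y) z = bil x z - bil y z"
  by (simp add: bil_def sum_subtractf algebra_simps)

lemma bil_pairs: "bil x y = (\<Sum>i\<in>UNIV. \<Sum>j\<in>UNIV. x $ (i, j) * y $ (i, j))" for x :: "'a::field ^ ('n::finite \<times> 't::finite)"
  by (simp add: bil_def sum.cartesian_product UNIV_Times_UNIV[symmetric] split_def del: UNIV_Times_UNIV)

lemma bil_act: "bil (act U V x) y = bil x (act (transpose U) (transpose V) y)"
proof -
  have "bil (act U V x) y = (\<Sum>i\<in>UNIV. \<Sum>j\<in>UNIV. \<Sum>l\<in>UNIV. \<Sum>k\<in>UNIV. U $ i $ k * x $ (k, l) * V $ j $ l * y $ (i, j))"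
    by (simp add: bil_pairs act_component sum_distrib_right)
  also have "\<dots> = (\<Sum>k\<in>UNIV. \<Sum>l\<in>UNIV. \<Sum>j\<in>UNIV. \<Sum>i\<in>UNIV. U $ i $ k * x $ (k, l) * V $ j $ l * y $ (i, j))"
    by (subst sum.swap, subst (2) sum.swap, subst (3) sum.swap, subst sum.swap, subst (2) sum.swap, subst sum.swap)
      (rule refl)
  also have "\<dots> = bil x (act (transpose U) (transpose V) y)"
    by (simp add: bil_pairs act_component transpose_def sum_distrib_left sum_distrib_right mult_ac)
  finally show ?thesis .
qed

lemma bil_act_act:
  assumes "orthogonal_matrix U" "orthogonal_matrix V"
  shows "bil (act U V x) (act U V y) = bil x y"
  using assms by (simp add: bil_act act_act orthogonal_matrix_def)

text \<open>The derivative of \<open>act\<close> at the identity: the direction in which the orbit of \<open>x\<close> leaves \<open>x\<close>.\<close>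

definition lie_act :: "'a::field ^ 'n ^ 'n \<Rightarrow> 'a ^ 't ^ 't \<Rightarrow> 'a ^ ('n \<times> 't) \<Rightarrow> 'a ^ ('n \<times> 't)" where
  "lie_act A B x = mat_vec (A ** unvec x + unvec x ** transpose B)"


section \<open>Parametrization of orbits by pairs of Cayley transforms\<close>

text \<open>The parameter space consists of two square matrices, of which only the skew-symmetric parts
  matter, and a vector.\<close>

definition genA :: "'a::field ^ (('n::finite \<times> 'n) + (('t::finite \<times> 't) + 'n)) \<Rightarrow> 'a ^ 'n ^ 'n" where
  "genA u = (\<chi> i j. u $ Inl (i, j) - u $ Inl (j, i))"

definition genB :: "'a::field ^ (('n::finite \<times> 'n) + (('t::finite \<times> 't) + 'n)) \<Rightarrow> 'a ^ 't ^ 't" where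
  "genB u = (\<chi> i j. u $ Inr (Inl (i, j)) - u $ Inr (Inl (j, i)))"

definition genY :: "'a::field ^ (('n::finite \<times> 'n) + (('t::finite \<times> 't) + 'n)) \<Rightarrow> 'a ^ 'n" where
  "genY u = (\<chi> i. u $ Inr (Inr i))"

lemma skew_genA: "skew (genA u)" and skew_genB: "skew (genB u)"
  by (auto simp: skew_def genA_def genB_def transpose_def vec_eq_iff)

lemma skew_component:
  assumes "skew A" shows "A $ j $ i = - (A $ i $ j)"
proof -
  have "transpose A $ i $ j = (- A) $ i $ j" using assms by (simp only: skew_def)
  then show ?thesis by (simp add: transpose_def)
qed

lemma gen_surj:
  fixes A :: "'a::field_char_0 ^ 'n ^ 'n" and B :: "'a ^ 't ^ 't"
  assumes "skew A" "skew B"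
  obtains u where "genA u = A" "genB u = B" "genY u = y"
proof -
  have *: "A $ i $ j / 2 - A $ j $ i / 2 = A $ i $ j" "B $ k $ l / 2 - B $ l $ k / 2 = B $ k $ l" for i j k l
    using skew_component[OF assms(1), of j i] skew_component[OF assms(2), of l k] by simp_all
  define u :: "'a ^ (('n::finite \<times> 'n) + (('t::finite \<times> 't) + 'n))" where
    "u = (\<chi> p. case p of Inl (i, j) \<Rightarrow> A $ i $ j / 2 | Inr (Inl (i, j)) \<Rightarrow> B $ i $ j / 2 | Inr (Inr i) \<Rightarrow> y $ i)"
  show ?thesis by (rule that[of u]) (simp_all add: u_def genA_def genB_def genY_def vec_eq_iff *)
qed

text \<open>The third component of the parameter moves the base point along the range of \<open>G\<close>.\<close>

definition orbit_param :: "complex ^ ('n::finite \<times> 't::finite) \<Rightarrow> complex ^ 'n::finite ^ ('n::finite \<times> 't::finite) \<Rightarrow>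
    complex ^ (('n::finite \<times> 'n) + (('t::finite \<times> 't) + 'n)) \<Rightarrow> complex ^ ('n::finite \<times> 't::finite)" where
  "orbit_param x0 G u = act (cayley (genA u)) (cayley (genB u)) (x0 + G *v genY u)"

definition orbit_den :: "complex ^ (('n::finite \<times> 'n) + (('t::finite \<times> 't) + 'n)) \<Rightarrow> complex" where
  "orbit_den u = det (mat 2 - genA u) * det (mat 2 - genB u)"

lemma rational_on_cong:
  "rational_on \<delta> f \<Longrightarrow> (\<And>u. \<delta> u \<noteq> 0 \<Longrightarrow> f u = g u) \<Longrightarrow> rational_on \<delta> g"
  unfolding rational_on_def by metis

lemma matrix_inv_component:
  fixes M :: "'a::field ^ 'n ^ 'n"
  assumes "det M \<noteq> 0"
  shows "matrix_inv M $ k $ l = det (\<chi> i j. if j = k then axis l 1 $ i else M $ i $ j) / det M"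
proof -
  have "M *v (matrix_inv M *v axis l 1) = axis l 1"
    by (simp add: matrix_vector_mul_assoc matrix_inv_det[OF assms])
  then have "matrix_inv M *v axis l 1 = (\<chi> k. det (\<chi> i j. if j = k then axis l 1 $ i else M $ i $ j) / det M)"
    using cramer[OF assms] by blast
  moreover have "(matrix_inv M *v axis l 1) $ k = matrix_inv M $ k $ l"
    by (simp add: matrix_vector_mult_def axis_def if_distrib cong: if_cong)
  ultimately show ?thesis by simp
qed

text \<open>By Cramer's rule the entries of the inverse have the denominator \<open>det (mat 2 - M u)\<close>.\<close>

lemma rational_cayley:
  fixes M :: "complex ^ 'p \<Rightarrow> complex ^ 'k ^ 'k"
  assumes M: "\<And>i j. poly_fun (\<lambda>u. M u $ i $ j)" and e: "poly_fun e"
    and \<delta>: "\<And>u. \<delta> u = det (mat 2 - M u) * e u"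
  shows "rational_on \<delta> (\<lambda>u. cayley (M u) $ i $ j)"
proof -
  have M2: "poly_fun (\<lambda>u. (mat 2 - M u) $ i $ j)" "poly_fun (\<lambda>u. (mat 2 + M u) $ i $ j)" for i j
    by (simp_all add: M poly_fun_intros)
  have d: "poly_fun \<delta>" unfolding \<delta> by (intro poly_fun_intros M2 e)
  have "rational_on \<delta> (\<lambda>u. \<Sum>k\<in>UNIV. (mat 2 + M u) $ i $ k *
     (det (\<chi> a b. if b = k then axis j 1 $ a else (mat 2 - M u) $ a $ b) / det (mat 2 - M u)))"
  proof (intro rational_on_sum[OF d] rational_on_mult[OF d] rational_on_divide[OF d _ _ e \<delta>] rational_on_poly M2)
    fix k
    show "poly_fun (\<lambda>x. det (\<chi> a b. if b = k then axis j 1 $ a else (mat 2 - M x) $ a $ b))"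
    proof (rule poly_fun_det)
      fix a b
      show "poly_fun (\<lambda>x. (\<chi> a b. if b = k then axis j 1 $ a else (mat 2 - M x) $ a $ b) $ a $ b)"
        using M2(1)[of a b] poly_fun_const by (cases "b = k") auto
    qed
    show "poly_fun (\<lambda>u. det (mat 2 - M u))" by (intro poly_fun_det M2)
  qed
  then show ?thesis
  proof (rule rational_on_cong)
    fix u assume "\<delta> u \<noteq> 0"
    then have "det (mat 2 - M u) \<noteq> 0" by (simp add: \<delta>)
    then show "(\<Sum>k\<in>UNIV. (mat 2 + M u) $ i $ k *
     (det (\<chi> a b. if b = k then axis j 1 $ a else (mat 2 - M u) $ a $ b) / det (mat 2 - M u))) = cayley (M u) $ i $ j"
      by (simp add: cayley_def matrix_matrix_mult_def matrix_inv_component)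
  qed
qed

lemma poly_fun_genA: "poly_fun (\<lambda>u. genA u $ i $ j)"
  unfolding genA_def vec_lambda_beta by (intro poly_fun_intros)

lemma poly_fun_genB: "poly_fun (\<lambda>u. genB u $ i $ j)"
  unfolding genB_def vec_lambda_beta by (intro poly_fun_intros)

lemma poly_fun_genY: "poly_fun (\<lambda>u. genY u $ i)"
  unfolding genY_def vec_lambda_beta by (intro poly_fun_intros)

lemma gen_0: "genA 0 = 0" "genB 0 = 0" "genY 0 = 0"
  by (simp_all add: genA_def genB_def genY_def vec_eq_iff)

lemma orbit_den_nonzero: "genA u = 0 \<Longrightarrow> genB u = 0 \<Longrightarrow> orbit_den u \<noteq> 0"
  by (simp add: orbit_den_def gen_0 det_mat)

lemma poly_fun_orbit_den: "poly_fun orbit_den"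
  unfolding orbit_den_def
  by (intro poly_fun_mult poly_fun_det; simp; intro poly_fun_intros poly_fun_genA poly_fun_genB)

lemma rational_cayley_genA: "rational_on orbit_den (\<lambda>u. cayley (genA u) $ i $ j)"
proof (rule rational_cayley[OF poly_fun_genA])
  show "poly_fun (\<lambda>u. det (mat 2 - genB u))"
    by (intro poly_fun_det; simp; intro poly_fun_intros poly_fun_genB)
qed (simp add: orbit_den_def)

lemma rational_cayley_genB: "rational_on orbit_den (\<lambda>u. cayley (genB u) $ i $ j)"
proof (rule rational_cayley[OF poly_fun_genB])
  show "poly_fun (\<lambda>u. det (mat 2 - genA u))"
    by (intro poly_fun_det; simp; intro poly_fun_intros poly_fun_genA)
qed (simp add: orbit_den_def)

lemmas rational_cayley_gen = rational_cayley_genA rational_cayley_genB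

lemma poly_fun_gen_affine: "poly_fun (\<lambda>u. (x0 + G *v genY u) $ p)"
  unfolding vector_add_component matrix_vector_mult_def vec_lambda_beta by (intro poly_fun_intros poly_fun_genY)

lemma rational_param_orbit: "rational_param (orbit_param x0 G) orbit_den"
proof
  show "poly_fun orbit_den" by (rule poly_fun_orbit_den)
  show "\<exists>u. orbit_den u \<noteq> 0" using orbit_den_nonzero[of 0] gen_0 by blast
  show "rational_on orbit_den (\<lambda>u. orbit_param x0 G u $ b)" for b
    unfolding orbit_param_def act_component
    by (intro rational_on_sum rational_on_mult poly_fun_orbit_den rational_cayley_gen rational_on_poly poly_fun_gen_affine)
qed

section \<open>The differential of the parametrization\<close>

definition dmat :: "(complex ^ 'p \<Rightarrow> complex ^ 'k ^ 'l) \<Rightarrow> complex ^ 'p \<Rightarrow> complex ^ 'p \<Rightarrow> complex ^ 'k ^ 'l" where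
  "dmat M u v = (\<chi> i j. frechet_derivative (\<lambda>u. M u $ i $ j) (at u) v)"

definition cdiff_mat :: "(complex ^ 'p \<Rightarrow> complex ^ 'k ^ 'l) \<Rightarrow> complex ^ 'p \<Rightarrow> bool" where
  "cdiff_mat M u \<longleftrightarrow> (\<forall>i j. cdiff (\<lambda>u. M u $ i $ j) u)"

lemma cdiff_sum:
  assumes "\<And>a. a \<in> A \<Longrightarrow> cdiff (f a) u"
  shows "cdiff (\<lambda>x. \<Sum>a\<in>A. f a x) u \<and>
    frechet_derivative (\<lambda>x. \<Sum>a\<in>A. f a x) (at u) v = (\<Sum>a\<in>A. frechet_derivative (f a) (at u) v)"
  using assms
proof (induction A rule: infinite_finite_induct)
  case (insert a A)
  then show ?case using cdiff_add[of "f a" u "\<lambda>x. \<Sum>a\<in>A. f a x"] by auto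
qed (auto simp: cdiff_const frechet_derivative_const_eq)

lemma dmat_mult:
  assumes "cdiff_mat M u" "cdiff_mat N u"
  shows "cdiff_mat (\<lambda>u. M u ** N u) u"
    and "dmat (\<lambda>u. M u ** N u) u v = dmat M u v ** N u + M u ** dmat N u v"
proof -
  have 1: "cdiff (\<lambda>u. M u $ i $ k * N u $ k $ j) u" for i j k
    by (rule cdiff_mult(1)) (use assms in \<open>auto simp: cdiff_mat_def\<close>)
  have 2: "frechet_derivative (\<lambda>u. M u $ i $ k * N u $ k $ j) (at u) v =
    M u $ i $ k * dmat N u v $ k $ j + dmat M u v $ i $ k * N u $ k $ j" for i j k
    using cdiff_mult(2)[of "\<lambda>u. M u $ i $ k" u "\<lambda>u. N u $ k $ j" v] assms by (auto simp: cdiff_mat_def dmat_def)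
  have 3: "cdiff (\<lambda>u. \<Sum>k\<in>UNIV. M u $ i $ k * N u $ k $ j) u \<and>
    frechet_derivative (\<lambda>u. \<Sum>k\<in>UNIV. M u $ i $ k * N u $ k $ j) (at u) v =
    (\<Sum>k\<in>UNIV. M u $ i $ k * dmat N u v $ k $ j + dmat M u v $ i $ k * N u $ k $ j)" for i j
    using cdiff_sum[of UNIV "\<lambda>k u. M u $ i $ k * N u $ k $ j" u v] 1 unfolding 2 by simp
  show "cdiff_mat (\<lambda>u. M u ** N u) u"
    unfolding cdiff_mat_def matrix_matrix_mult_def using 3 by simp
  have "frechet_derivative (\<lambda>u. \<Sum>k\<in>UNIV. M u $ i $ k * N u $ k $ j) (at u) v =
    (dmat M u v ** N u + M u ** dmat N u v) $ i $ j" for i j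
    using 3[of i j] by (simp add: matrix_matrix_mult_def sum.distrib)
  then show "dmat (\<lambda>u. M u ** N u) u v = dmat M u v ** N u + M u ** dmat N u v"
    unfolding vec_eq_iff by (simp add: dmat_def[of "\<lambda>u. M u ** N u"]) (simp add: matrix_matrix_mult_def)
qed

lemma dmat_transpose: "dmat (\<lambda>u. transpose (M u)) u v = transpose (dmat M u v)"
  by (simp add: dmat_def transpose_def vec_eq_iff)

lemma cdiff_mat_transpose: "cdiff_mat M u \<Longrightarrow> cdiff_mat (\<lambda>u. transpose (M u)) u"
  by (simp add: cdiff_mat_def transpose_def)

lemma dmat_eqI:
  assumes "open D" "u \<in> D" "\<And>u. u \<in> D \<Longrightarrow> M u = N u" "cdiff_mat M u"
  shows "dmat M u v = dmat N u v"
proof -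
  have "frechet_derivative (\<lambda>u. N u $ i $ j) (at u) = frechet_derivative (\<lambda>u. M u $ i $ j) (at u)" for i j
    by (rule cdiff_transform(2)[of _ u D]) (use assms in \<open>auto simp: cdiff_mat_def\<close>)
  then show ?thesis by (simp add: dmat_def)
qed

lemma dmat_const: "dmat (\<lambda>u. M) u v = 0"
  by (simp add: dmat_def vec_eq_iff frechet_derivative_const_eq)

text \<open>Left-translated to the identity, the differential of an orthogonal-matrix-valued
  function is skew-symmetric.\<close>

lemma dmat_orthogonal:
  assumes D: "open D" "u \<in> D" and orth: "\<And>u. u \<in> D \<Longrightarrow> orthogonal_matrix (M u)" and c: "cdiff_mat M u"
  obtains w where "skew w" "dmat M u v = M u ** w"
proof -
  let ?w = "transpose (M u) ** dmat M u v"
  have "dmat (\<lambda>u. transpose (M u) ** M u) u v = dmat (\<lambda>u. mat 1) u v"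
    by (rule dmat_eqI[OF D]) (use orth dmat_mult(1)[OF cdiff_mat_transpose[OF c] c] in \<open>auto simp: orthogonal_matrix_def\<close>)
  then have "transpose (dmat M u v) ** M u + transpose (M u) ** dmat M u v = 0"
    using dmat_mult(2)[OF cdiff_mat_transpose[OF c] c, of v] by (simp add: dmat_transpose dmat_const)
  then have "transpose (dmat M u v) ** M u = - ?w" by (simp add: eq_neg_iff_add_eq_0)
  then have "skew ?w" by (simp add: skew_def matrix_transpose_mul)
  moreover have "dmat M u v = M u ** ?w" using orth[OF D(2)] by (simp add: matrix_mul_assoc orthogonal_matrix_def)
  ultimately show ?thesis using that by blast
qed

lemma cdiff_cayley_gen:
  assumes "orbit_den u \<noteq> 0"
  shows "cdiff_mat (\<lambda>u. cayley (genA u)) u" "cdiff_mat (\<lambda>u. cayley (genB u)) u"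
  using cdiff_rational_on[OF poly_fun_orbit_den rational_cayley_genA assms]
    cdiff_rational_on[OF poly_fun_orbit_den rational_cayley_genB assms]
  by (simp_all add: cdiff_mat_def)

lemma cdiff_mat_poly: "(\<And>i j. poly_fun (\<lambda>u. M u $ i $ j)) \<Longrightarrow> cdiff_mat M u"
  by (simp add: cdiff_mat_def cdiff_poly_fun)

lemma frechet_derivative_diff_coords:
  "frechet_derivative (\<lambda>u::complex^'p. u $ a - u $ b) (at u) v = v $ a - v $ b"
proof -
  have "((\<lambda>u::complex^'p. u $ a - u $ b) has_derivative (\<lambda>v. v $ a - v $ b)) (at u)"
    by (intro has_derivative_diff bounded_linear_imp_has_derivative bounded_linear_vec_nth)
  from frechet_derivative_at[OF this] show ?thesis by metis
qed

lemma dmat_genA: "dmat (\<lambda>u. genA u) u v = genA v" and dmat_genB: "dmat (\<lambda>u. genB u) u v = genB v"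
  by (simp_all add: dmat_def genA_def genB_def frechet_derivative_diff_coords vec_eq_iff)

lemma dmat_add_const:
  assumes "cdiff_mat M u"
  shows "dmat (\<lambda>u. c + M u) u v = dmat M u v" "dmat (\<lambda>u. c - M u) u v = - dmat M u v"
    "cdiff_mat (\<lambda>u. c + M u) u" "cdiff_mat (\<lambda>u. c - M u) u"
proof -
  have c: "cdiff (\<lambda>u. M u $ i $ j) u" for i j using assms by (simp add: cdiff_mat_def)
  have n: "cdiff (\<lambda>u. -1 * M u $ i $ j) u" for i j by (intro cdiff_mult(1) cdiff_const c)
  have n': "frechet_derivative (\<lambda>u. -1 * M u $ i $ j) (at u) v = - frechet_derivative (\<lambda>u. M u $ i $ j) (at u) v" for i j
    using cdiff_mult(2)[OF cdiff_const[of "-1" u] c[of i j], of v] by (simp only: frechet_derivative_const_eq) simp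
  show "dmat (\<lambda>u. c + M u) u v = dmat M u v" "cdiff_mat (\<lambda>u. c + M u) u"
    using cdiff_add[OF cdiff_const c] by (simp_all add: dmat_def cdiff_mat_def vec_eq_iff frechet_derivative_const_eq)
  have eq: "(\<lambda>u. (c - M u) $ i $ j) = (\<lambda>u. c $ i $ j + -1 * M u $ i $ j)" for i j by auto
  show "cdiff_mat (\<lambda>u. c - M u) u" unfolding cdiff_mat_def eq by (intro allI cdiff_add(1) cdiff_const n)
  have "frechet_derivative (\<lambda>u. (c - M u) $ i $ j) (at u) v = - frechet_derivative (\<lambda>u. M u $ i $ j) (at u) v" for i j
    unfolding eq cdiff_add(2)[OF cdiff_const n] n' frechet_derivative_const_eq by simp
  then show "dmat (\<lambda>u. c - M u) u v = - dmat M u v" unfolding dmat_def vec_eq_iff by (simp del: vector_minus_component)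
qed

text \<open>Differentiate \<open>cayley (M u) ** (mat 2 - M u) = mat 2 + M u\<close>.\<close>

lemma dmat_cayley_at_0:
  fixes M :: "complex ^ 'p \<Rightarrow> complex ^ 'k ^ 'k"
  assumes D: "open D" "u \<in> D" "\<And>u. u \<in> D \<Longrightarrow> det (mat 2 - M u) \<noteq> 0"
    and c: "cdiff_mat (\<lambda>u. cayley (M u)) u" and M: "cdiff_mat M u" "M u = 0"
  shows "dmat (\<lambda>u. cayley (M u)) u v = dmat M u v"
proof -
  have "dmat (\<lambda>u. cayley (M u) ** (mat 2 - M u)) u v = dmat (\<lambda>u. mat 2 + M u) u v"
    by (rule dmat_eqI[OF D(1,2)]) (use D cayley_mult dmat_mult(1)[OF c dmat_add_const(4)[OF M(1)]] in auto)
  then have "dmat (\<lambda>u. cayley (M u)) u v ** mat 2 = dmat M u v + dmat M u v"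
    using dmat_mult(2)[OF c dmat_add_const(4)[OF M(1)], of "mat 2" v]
    by (simp add: dmat_add_const[OF M(1)] M(2) cayley_0 diff_eq_eq)
  then show ?thesis unfolding vec_eq_iff mat_mul_right by simp
qed

lemma jac_orbit:
  fixes x0 :: "complex ^ ('n::finite \<times> 't::finite)" and G :: "complex ^ 'n ^ ('n \<times> 't)"
  assumes u: "orbit_den u \<noteq> 0"
  defines "F \<equiv> \<lambda>u. x0 + G *v genY u" and "U \<equiv> \<lambda>u. cayley (genA u)" and "V \<equiv> \<lambda>u. cayley (genB u)"
  shows "unvec (jac (orbit_param x0 G) u v) = dmat U u v ** unvec (F u) ** transpose (V u) +
    U u ** unvec (G *v genY v) ** transpose (V u) + U u ** unvec (F u) ** transpose (dmat V u v)"
proof -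
  have cU: "cdiff_mat U u" and cV: "cdiff_mat V u"
    using cdiff_cayley_gen[OF u] by (simp_all add: U_def V_def)
  have cF: "cdiff_mat (\<lambda>u. unvec (F u)) u"
    by (rule cdiff_mat_poly) (simp only: unvec_def F_def vec_lambda_beta poly_fun_gen_affine)
  have dF: "dmat (\<lambda>u. unvec (F u)) u v = unvec (G *v genY v)"
  proof -
    have "frechet_derivative (\<lambda>u. F u $ p) (at u) v = (G *v genY v) $ p" for p
    proof -
      have "frechet_derivative (\<lambda>u. G $ p $ k * genY u $ k) (at u) v = G $ p $ k * genY v $ k" for k
        using cdiff_mult(2)[OF cdiff_const[of "G $ p $ k" u] cdiff_poly_fun[OF poly_fun_genY, of k u], of v]
        by (simp add: frechet_derivative_const_eq genY_def frechet_derivative_coord_eq)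
      moreover have c1: "cdiff (\<lambda>u. G $ p $ k * genY u $ k) u" for k
        by (intro cdiff_poly_fun poly_fun_intros poly_fun_genY)
      ultimately have s: "cdiff (\<lambda>u. \<Sum>k\<in>UNIV. G $ p $ k * genY u $ k) u \<and>
        frechet_derivative (\<lambda>u. \<Sum>k\<in>UNIV. G $ p $ k * genY u $ k) (at u) v = (\<Sum>k\<in>UNIV. G $ p $ k * genY v $ k)"
        using cdiff_sum[of UNIV "\<lambda>k u. G $ p $ k * genY u $ k" u v] by simp
      have "(\<lambda>u. F u $ p) = (\<lambda>u. x0 $ p + (\<Sum>k\<in>UNIV. G $ p $ k * genY u $ k))"
        by (simp add: F_def matrix_vector_mult_def)
      then show ?thesis
        using cdiff_add(2)[OF cdiff_const[of "x0 $ p" u] conjunct1[OF s], of v] s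
        by (simp add: frechet_derivative_const_eq matrix_vector_mult_def)
    qed
    then show ?thesis by (simp add: dmat_def unvec_def)
  qed
  have "unvec (jac (orbit_param x0 G) u v) = dmat (\<lambda>u. unvec (orbit_param x0 G u)) u v"
    by (simp add: dmat_def jac_def unvec_def vec_eq_iff)
  also have "(\<lambda>u. unvec (orbit_param x0 G u)) = (\<lambda>u. U u ** unvec (F u) ** transpose (V u))"
    by (simp add: orbit_param_def unvec_act U_def V_def F_def)
  finally show ?thesis
    using dmat_mult(2)[OF dmat_mult(1)[OF cU cF] cdiff_mat_transpose[OF cV], of v] dmat_mult(2)[OF cU cF, of v]
    by (simp add: dF dmat_transpose matrix_mul_add_left)
qed

lemma orbit_den_det: "orbit_den u \<noteq> 0 \<longleftrightarrow> det (mat 2 - genA u) \<noteq> 0 \<and> det (mat 2 - genB u) \<noteq> 0"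
  by (simp add: orbit_den_def)

lemma jac_orbit_general:
  assumes u: "orbit_den u \<noteq> 0"
  obtains A B where "skew A" "skew B"
    "jac (orbit_param x0 G) u v =
      act (cayley (genA u)) (cayley (genB u)) (lie_act A B (x0 + G *v genY u) + G *v genY v)"
proof -
  let ?U = "\<lambda>u. cayley (genA u)" and ?V = "\<lambda>u. cayley (genB u)" let ?D = "{u. orbit_den u \<noteq> 0}"
  have D: "open ?D" "u \<in> ?D" using open_nonvanishing[OF poly_fun_orbit_den] u by auto
  have orth: "orthogonal_matrix (?U u)" "orthogonal_matrix (?V u)" if "u \<in> ?D" for u
    using that by (auto simp: orbit_den_det intro!: cayley_orthogonal skew_genA skew_genB)
  have cU: "cdiff_mat ?U u" and cV: "cdiff_mat ?V u"
    by (rule cdiff_cayley_gen[OF u])+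
  obtain A where A: "skew A" "dmat ?U u v = ?U u ** A" using dmat_orthogonal[OF D orth(1) cU] by blast
  obtain B where B: "skew B" "dmat ?V u v = ?V u ** B" using dmat_orthogonal[OF D orth(2) cV] by blast
  have "unvec (jac (orbit_param x0 G) u v) =
    unvec (act (?U u) (?V u) (lie_act A B (x0 + G *v genY u) + G *v genY v))"
    unfolding jac_orbit[OF u] A(2) B(2)
    by (simp add: unvec_act lie_act_def unvec_add matrix_mul_add_left matrix_mul_add_right matrix_transpose_mul matrix_mul_assoc)
  then show ?thesis using that A B by (simp add: unvec_inject)
qed

lemma jac_orbit_at_0:
  assumes u: "genA u = 0" "genB u = 0"
  shows "jac (orbit_param x0 G) u v = lie_act (genA v) (genB v) (x0 + G *v genY u) + G *v genY v"
proof -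
  let ?U = "\<lambda>u. cayley (genA u)" and ?V = "\<lambda>u. cayley (genB u)" let ?D = "{u. orbit_den u \<noteq> 0}"
  have u': "orbit_den u \<noteq> 0" by (rule orbit_den_nonzero[OF u])
  have D: "open ?D" "u \<in> ?D" using open_nonvanishing[OF poly_fun_orbit_den] u' by auto
  have cU: "cdiff_mat ?U u" and cV: "cdiff_mat ?V u"
    by (rule cdiff_cayley_gen[OF u'])+
  have "dmat ?U u v = genA v"
    using dmat_cayley_at_0[OF D _ cU _ u(1)] by (auto simp: orbit_den_det dmat_genA intro: cdiff_mat_poly poly_fun_genA)
  moreover have "dmat ?V u v = genB v"
    using dmat_cayley_at_0[OF D _ cV _ u(2)] by (auto simp: orbit_den_det dmat_genB intro: cdiff_mat_poly poly_fun_genB)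
  ultimately have "unvec (jac (orbit_param x0 G) u v) = unvec (lie_act (genA v) (genB v) (x0 + G *v genY u) + G *v genY v)"
    unfolding jac_orbit[OF u'] by (simp add: u cayley_0 transpose_mat lie_act_def unvec_add)
  then show ?thesis by (simp add: unvec_inject)
qed

lemma tangent_space_mono: "W \<subseteq> W' \<Longrightarrow> tangent_space W x \<subseteq> tangent_space W' x"
  unfolding tangent_space_def by blast

text \<open>For \<open>G = 0\<close> the parametrization describes the orbit of \<open>x\<close>, and its differential at the origin
  produces all orbit directions.\<close>

lemma lie_act_in_tangent_space:
  fixes W :: "(complex ^ ('n::finite \<times> 't::finite)) set"
  assumes W: "closedin zariski W"
    and inv: "\<And>A B. skew A \<Longrightarrow> skew B \<Longrightarrow> det (mat 2 - A) \<noteq> 0 \<Longrightarrow> det (mat 2 - B) \<noteq> 0 \<Longrightarrow> act (cayley A) (cayley B) x \<in> W"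
    and AB: "skew A" "skew B"
  shows "lie_act A B x \<in> tangent_space W x"
proof -
  let ?\<Psi> = "orbit_param x (0 :: complex ^ 'n::finite ^ ('n::finite \<times> 't::finite))"
  interpret P: rational_param ?\<Psi> orbit_den by (rule rational_param_orbit)
  have "?\<Psi> ` P.params \<subseteq> W"
  proof (rule image_subsetI)
    fix u :: "complex ^ (('n::finite \<times> 'n) + (('t::finite \<times> 't) + 'n))" assume u: "u \<in> P.params"
    then have "act (cayley (genA u)) (cayley (genB u)) x \<in> W"
      by (intro inv skew_genA skew_genB) (auto simp: P.params_def orbit_den_det)
    then show "?\<Psi> u \<in> W" by (simp add: orbit_param_def)
  qed
  then have sub: "P.variety \<subseteq> W" unfolding P.variety_def by (rule closure_of_minimal[OF _ W])
  obtain v :: "complex ^ (('n::finite \<times> 'n) + (('t::finite \<times> 't) + 'n))" where v: "genA v = A" "genB v = B" "genY v = 0"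
    using gen_surj[OF AB] .
  have z: "(0 :: complex ^ (('n::finite \<times> 'n) + (('t::finite \<times> 't) + 'n))) \<in> P.params"
    using orbit_den_nonzero[of 0] by (simp add: P.params_def gen_0)
  have "jac ?\<Psi> 0 v = lie_act A B x" using jac_orbit_at_0[of 0 x 0 v] by (simp add: gen_0 v)
  moreover have "?\<Psi> 0 = x" by (simp add: orbit_param_def gen_0 cayley_0)
  ultimately have "lie_act A B x \<in> tangent_space P.variety x" using P.jac_in_tangent_space[OF z, of v] by simp
  then show ?thesis using tangent_space_mono[OF sub] by blast
qed

lemma det_one_plus_cayley:
  fixes A :: "complex ^ 'k ^ 'k"
  assumes "det (mat 2 - A) \<noteq> 0"
  shows "det (mat 1 + cayley A) \<noteq> 0"
proof -
  have four: "mat 2 + mat 2 = (mat 4 :: complex ^ 'k ^ 'k)" by (simp add: vec_eq_iff mat_def)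
  have "(mat 1 + cayley A) ** (mat 2 - A) = mat 2 + mat 2"
    using cayley_mult[OF assms] by (simp add: matrix_mul_add_left)
  then have "det (mat 1 + cayley A) * det (mat 2 - A) = 4 ^ CARD('k)" by (metis det_mul det_mat four)
  then show ?thesis by auto
qed

text \<open>A product of two Cayley transforms is again one unless it has the eigenvalue \<open>-1\<close>, and
  generically it does not.\<close>

lemma orbit_variety_invariant:
  fixes x0 :: "complex ^ ('n::finite \<times> 't::finite)"
  assumes A: "skew A" "det (mat 2 - A) \<noteq> 0" and B: "skew B" "det (mat 2 - B) \<noteq> 0"
    and x: "x \<in> rational_param.variety (orbit_param x0 G) orbit_den"
  shows "act (cayley A) (cayley B) x \<in> rational_param.variety (orbit_param x0 G) orbit_den"
proof -
  interpret P: rational_param "orbit_param x0 G" orbit_den by (rule rational_param_orbit)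
  have "f (act (cayley A) (cayley B) x) = 0"
    if f: "poly_fun f" "\<forall>x\<in>orbit_param x0 G ` P.params. f x = 0" for f
  proof -
    let ?fa = "\<lambda>x. f (act (cayley A) (cayley B) x)"
    have fa: "poly_fun ?fa" by (rule poly_fun_compose[OF f(1) poly_fun_act])
    let ?U = "\<lambda>u. cayley A ** cayley (genA u)" and ?V = "\<lambda>u. cayley B ** cayley (genB u)"
    define h where "h u = det (mat 1 + ?U u) * det (mat 1 + ?V u)" for u :: "complex ^ (('n::finite \<times> 'n) + (('t::finite \<times> 't) + 'n))"
    have hR: "h \<in> {f. rational_on orbit_den f}"
      unfolding h_def mem_Collect_eq
      by (intro rational_on_mult rational_on_det poly_fun_orbit_den; simp add: matrix_matrix_mult_def;
          intro rational_on_add rational_on_sum rational_on_mult rational_on_const poly_fun_orbit_den rational_cayley_gen)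
    have gR: "(\<lambda>u. ?fa (orbit_param x0 G u)) \<in> {f. rational_on orbit_den f}"
      using rational_on_compose[OF poly_fun_orbit_den fa P.rational] by simp
    have "?fa (orbit_param x0 G u) * h u = 0" if u: "u \<in> P.params" for u
    proof (cases "h u = 0")
      case False
      have ud: "det (mat 2 - genA u) \<noteq> 0" "det (mat 2 - genB u) \<noteq> 0"
        using u by (auto simp: P.params_def orbit_den_det)
      have "orthogonal_matrix (?U u)" "orthogonal_matrix (?V u)"
        by (intro orthogonal_matrix_mult cayley_orthogonal A B ud skew_genA skew_genB)+
      moreover have "det (mat 1 + ?U u) \<noteq> 0" "det (mat 1 + ?V u) \<noteq> 0" using False by (auto simp: h_def)
      ultimately obtain A' B' where A': "skew A'" "det (mat 2 - A') \<noteq> 0" "?U u = cayley A'"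
        and B': "skew B'" "det (mat 2 - B') \<noteq> 0" "?V u = cayley B'"
        by (metis orthogonal_imp_cayley)
      obtain u' where u': "genA u' = A'" "genB u' = B'" "genY u' = genY u" using gen_surj[OF A'(1) B'(1)] .
      have "u' \<in> P.params" using A' B' by (simp add: P.params_def orbit_den_det u')
      moreover have "act (cayley A) (cayley B) (orbit_param x0 G u) = orbit_param x0 G u'"
        by (simp add: orbit_param_def act_act A' B' u')
      ultimately show ?thesis using f(2) by simp
    qed simp
    moreover have "\<exists>u\<in>P.params. h u \<noteq> 0"
    proof (rule bexI)
      show "h 0 \<noteq> 0" using A B by (simp add: h_def gen_0 cayley_0 det_one_plus_cayley)
      show "0 \<in> P.params" using orbit_den_nonzero[of 0] by (simp add: P.params_def gen_0)
    qed
    ultimately have "\<forall>u\<in>P.params. ?fa (orbit_param x0 G u) = 0"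
      using domain_on_mult_nonzero[OF _ gR hR, of P.params] domain_on_rational_on[OF P.poly_denominator P.nonempty]
      by (auto simp: P.params_def)
    then have "\<forall>x\<in>orbit_param x0 G ` P.params. ?fa x = 0" by blast
    then have "\<forall>x\<in>P.variety. ?fa x = 0"
      unfolding P.variety_def using vanishes_on_closure_iff[OF fa] by blast
    then show ?thesis using x by blast
  qed
  then show ?thesis unfolding P.variety_def zariski_closure_of_eq by blast
qed


section \<open>Extension of invariant polynomials from diagonal matrices\<close>

text \<open>The rectangular matrix with the entries of \<open>y\<close> on its diagonal, where \<open>\<iota>\<close> says which column meets the
  diagonal in a given row. This
  relates the two index types by an injection alone.\<close>

definition diag_vec :: "('n \<Rightarrow> 't) \<Rightarrow> 'a::zero ^ 'n::finite \<Rightarrow> 'a ^ ('n \<times> 't::finite)" where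
  "diag_vec \<iota> y = (\<chi> p. if snd p = \<iota> (fst p) then y $ fst p else 0)"

primrec mat_pow :: "'a::semiring_1 ^ 'n ^ 'n \<Rightarrow> nat \<Rightarrow> 'a ^ 'n ^ 'n" where
  "mat_pow W 0 = mat 1"
| "mat_pow W (Suc k) = W ** mat_pow W k"

text \<open>The polynomial \<open>p\<close> evaluated at \<open>W\<close>. The explicit bound \<open>N\<close> on the degree makes the entries visibly
  polynomial in the coefficients of \<open>p\<close> and the entries of \<open>W\<close>.\<close>

definition mat_poly :: "nat \<Rightarrow> 'a::comm_ring_1 poly \<Rightarrow> 'a ^ 'n ^ 'n \<Rightarrow> 'a ^ 'n ^ 'n" where
  "mat_poly N p W = (\<chi> i j. \<Sum>k\<le>N. coeff p k * mat_pow W k $ i $ j)"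

lemma mat_pow_eigen:
  fixes W :: "'a::field ^ 'n ^ 'n"
  assumes "W *v u = c *s u" shows "mat_pow W k *v u = c ^ k *s u"
proof (induction k)
  case (Suc k)
  have "mat_pow W (Suc k) *v u = W *v (c ^ k *s u)"
    by (simp add: Suc matrix_vector_mul_assoc[symmetric])
  also have "\<dots> = c ^ Suc k *s u" by (simp add: vec.scale vector_scalar_commute assms mult.commute)
  finally show ?case .
qed simp

lemma poly_bounded_degree: "degree p \<le> N \<Longrightarrow> poly (p :: 'a::field poly) c = (\<Sum>k\<le>N. coeff p k * c ^ k)"
  unfolding poly_altdef by (rule sum.mono_neutral_left) (auto simp: coeff_eq_0)

lemma mat_poly_eigen:
  fixes W :: "'a::field ^ 'n ^ 'n"
  assumes "W *v u = c *s u" "degree p \<le> N" shows "mat_poly N p W *v u = poly p c *s u"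
proof -
  have "(mat_poly N p W *v u) $ i = (\<Sum>k\<le>N. coeff p k * (mat_pow W k *v u) $ i)" for i
    by (simp add: mat_poly_def matrix_vector_mult_def sum_distrib_left sum_distrib_right mult.assoc)
      (rule sum.swap)
  then show ?thesis
    by (simp add: vec_eq_iff mat_pow_eigen[OF assms(1)] poly_bounded_degree[OF assms(2)] sum_distrib_right mult.assoc)
qed

lemma mat_pow_conjugate:
  fixes U :: "'a::field ^ 'n ^ 'n"
  assumes U: "orthogonal_matrix U"
  shows "mat_pow (U ** diag_mat d ** transpose U) k = U ** diag_mat (\<lambda>i. d i ^ k) ** transpose U"
proof (induction k)
  case 0
  have "diag_mat (\<lambda>i. 1) = (mat 1 :: 'a ^ 'n ^ 'n)" by (simp add: diag_mat_def mat_def)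
  then show ?case using U by (simp add: orthogonal_matrix_def)
next
  case (Suc k)
  have "mat_pow (U ** diag_mat d ** transpose U) (Suc k) =
    U ** diag_mat d ** (transpose U ** U) ** diag_mat (\<lambda>i. d i ^ k) ** transpose U"
    by (simp add: Suc matrix_mul_assoc)
  also have "\<dots> = U ** (diag_mat d ** diag_mat (\<lambda>i. d i ^ k)) ** transpose U"
  proof -
    have "transpose U ** U = mat 1" using U by (simp add: orthogonal_matrix_def)
    then show ?thesis by (simp only: matrix_mul_assoc matrix_mul_rid)
  qed
  also have "diag_mat d ** diag_mat (\<lambda>i. d i ^ k) = diag_mat (\<lambda>i. d i ^ Suc k)"
    unfolding vec_eq_iff diag_mat_mult_left by (simp add: diag_mat_def)
  finally show ?case .
qed

lemma conjugate_diag_component: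
  "(U ** diag_mat d ** transpose U) $ a $ b = (\<Sum>i\<in>UNIV. U $ a $ i * d i * U $ b $ i)"
  for U :: "'a::field ^ 'n ^ 'n"
  by (simp add: matrix_matrix_mult_def[of "U ** diag_mat d"] diag_mat_mult_right transpose_def)

lemma mat_poly_conjugate:
  fixes U :: "'a::field ^ 'n ^ 'n"
  assumes U: "orthogonal_matrix U" and p: "degree p \<le> N"
  shows "mat_poly N p (U ** diag_mat d ** transpose U) = U ** diag_mat (\<lambda>i. poly p (d i)) ** transpose U"
proof -
  have "(\<Sum>k\<le>N. coeff p k * (\<Sum>i\<in>UNIV. U $ a $ i * d i ^ k * U $ b $ i)) =
    (\<Sum>i\<in>UNIV. U $ a $ i * (\<Sum>k\<le>N. coeff p k * d i ^ k) * U $ b $ i)" for a b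
    by (simp add: sum_distrib_left sum_distrib_right mult_ac) (rule sum.swap)
  then show ?thesis
    by (simp add: mat_poly_def mat_pow_conjugate[OF U] vec_eq_iff conjugate_diag_component poly_bounded_degree[OF p])
qed

lemma det_orthogonal_conjugate:
  fixes U :: "'a::field ^ 'n ^ 'n"
  assumes U: "orthogonal_matrix U"
  shows "det (U ** diag_mat d ** transpose U) = (\<Prod>i\<in>UNIV. d i)"
proof -
  have "det U * det (transpose U) = 1" using U by (metis det_I det_mul orthogonal_matrix_def)
  then have "det (U ** diag_mat d ** transpose U) = det (diag_mat d)" by (simp add: det_mul)
  also have "\<dots> = (\<Prod>i\<in>UNIV. d i)" by (subst det_diagonal) (auto simp: diag_mat_def)
  finally show ?thesis .
qed

lemma poly_fun_mat_pow:
  assumes "\<And>i j. poly_fun (\<lambda>x. W x $ i $ j)"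
  shows "poly_fun (\<lambda>x. mat_pow (W x) k $ i $ j)"
proof (induction k arbitrary: i j)
  case (Suc k)
  then show ?case by (simp add: matrix_matrix_mult_def) (intro poly_fun_intros assms)
qed (simp add: mat_def poly_fun_const)

definition gram :: "'a::comm_semiring_1 ^ ('n::finite \<times> 't::finite) \<Rightarrow> 'a ^ 'n ^ 'n" where
  "gram x = unvec x ** transpose (unvec x)"

lemma poly_fun_gram: "poly_fun (\<lambda>x :: 'a::field ^ ('n::finite \<times> 't::finite). gram x $ i $ j)"
  unfolding gram_def matrix_matrix_mult_def unvec_def transpose_def vec_lambda_beta
  by (intro poly_fun_intros)

lemma gram_act:
  fixes U :: "'a::field ^ 'n::finite ^ 'n" and V :: "'a ^ 't::finite ^ 't"
  assumes V: "orthogonal_matrix V"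
  shows "gram (act U V x) = U ** gram x ** transpose U"
proof -
  have "gram (act U V x) = U ** unvec x ** (transpose V ** V) ** transpose (unvec x) ** transpose U"
    by (simp add: gram_def unvec_act matrix_transpose_mul matrix_mul_assoc)
  moreover have "transpose V ** V = mat 1" using V by (simp add: orthogonal_matrix_def)
  ultimately show ?thesis by (simp only: gram_def matrix_mul_assoc matrix_mul_rid)
qed

lemma gram_diag_vec:
  assumes "inj \<iota>"
  shows "gram (diag_vec \<iota> y) = diag_mat (\<lambda>i. (y $ i)\<^sup>2)"
proof -
  have "(\<Sum>k\<in>UNIV. (if k = \<iota> i then y $ i else 0) * (if k = \<iota> j then y $ j else 0)) =
    (if i = j then (y $ i)\<^sup>2 else 0)" for i j
  proof -
    have "(\<Sum>k\<in>UNIV. (if k = \<iota> i then y $ i else 0) * (if k = \<iota> j then y $ j else 0)) =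
      (\<Sum>k\<in>UNIV. if k = \<iota> i then (if \<iota> i = \<iota> j then y $ i * y $ j else 0) else 0)"
      by (intro sum.cong) auto
    then show ?thesis using assms by (auto simp: power2_eq_square inj_eq)
  qed
  then show ?thesis
    by (simp add: gram_def matrix_matrix_mult_def unvec_def diag_vec_def transpose_def diag_mat_def vec_eq_iff cong: if_cong)
qed

text \<open>Ryser's formula for the permanent, by inclusion-exclusion on the range of a map.\<close>

lemma permanent_inclusion_exclusion:
  fixes a :: "'n::finite \<Rightarrow> 'n \<Rightarrow> 'a::comm_ring_1"
  shows "(\<Sum>p | p permutes UNIV. \<Prod>j\<in>UNIV. a (p j) j) =
    (\<Sum>A\<in>Pow UNIV. (-1) ^ (CARD('n) - card A) * (\<Prod>j\<in>UNIV. \<Sum>i\<in>A. a i j))"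
proof -
  define f where "f T = (\<Sum>h | range h = T. \<Prod>j\<in>UNIV. a (h j) j)" for T :: "'n set"
  define g where "g T = (\<Prod>j\<in>(UNIV :: 'n set). \<Sum>i\<in>T. a i j)" for T :: "'n set"
  have "g T = sum f (Pow T)" if "finite T" for T
  proof -
    have "g T = (\<Sum>h\<in>PiE UNIV (\<lambda>_. T). \<Prod>j\<in>UNIV. a (h j) j)"
      unfolding g_def by (rule prod_sum_PiE) auto
    also have "PiE UNIV (\<lambda>_. T) = (\<Union>R\<in>Pow T. {h :: 'n \<Rightarrow> 'n. range h = R})" by auto
    also have "(\<Sum>h\<in>(\<Union>R\<in>Pow T. {h. range h = R}). \<Prod>j\<in>UNIV. a (h j) j) = sum f (Pow T)"
      unfolding f_def by (rule sum.UNION_disjoint) auto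
    finally show ?thesis .
  qed
  from inclusion_exclusion_mobius[OF this, of UNIV]
  have "f UNIV = (\<Sum>T\<in>Pow UNIV. (-1) ^ (card (UNIV :: 'n set) - card T) * g T)" by simp
  moreover have "{h :: 'n \<Rightarrow> 'n. range h = UNIV} = {p. p permutes UNIV}"
  proof (intro Collect_cong iffI)
    fix h :: "'n \<Rightarrow> 'n" assume h: "range h = UNIV"
    then have "bij h" using finite_UNIV_surj_inj[of h] by (simp add: bij_def)
    then show "h permutes UNIV" by (intro bij_imp_permutes) auto
  qed (rule permutes_surj)
  ultimately show ?thesis unfolding f_def g_def by simp
qed

text \<open>Summation over the sign of \<open>z\<close> leaves a polynomial in \<open>z\<^sup>2\<close>. The statement about the odd part
  carries the induction.\<close>

lemma even_part_poly:
  fixes p :: "'a::comm_ring_1 poly"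
  shows "\<exists>q r. (\<forall>z. poly p z + poly p (- z) = poly q (z\<^sup>2)) \<and> (\<forall>z. poly p z - poly p (- z) = z * poly r (z\<^sup>2))"
proof (induction p rule: pCons_induct)
  case 0
  show ?case by (intro exI[of _ 0]) auto
next
  case (pCons a p)
  then obtain q r where qr: "\<And>z. poly p z + poly p (- z) = poly q (z\<^sup>2)" "\<And>z. poly p z - poly p (- z) = z * poly r (z\<^sup>2)"
    by blast
  have "poly (pCons a p) z + poly (pCons a p) (- z) = poly (pCons (2 * a) r) (z\<^sup>2)" for z
  proof -
    have "poly (pCons a p) z + poly (pCons a p) (- z) = 2 * a + z * (poly p z - poly p (- z))"
      by (simp add: algebra_simps)
    then show ?thesis by (simp add: qr power2_eq_square mult.assoc)
  qed
  moreover have "poly (pCons a p) z - poly (pCons a p) (- z) = z * poly q (z\<^sup>2)" for z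
    by (simp add: qr(1)[symmetric] algebra_simps)
  ultimately show ?case by blast
qed

text \<open>Sums of products of polynomials in one variable each. For such a product the sum over all signed
  permutations factors into a permanent.\<close>

inductive tensor_sum :: "('a::field ^ 'n \<Rightarrow> 'a) \<Rightarrow> bool" where
  tensor_prod: "tensor_sum (\<lambda>x. \<Prod>i\<in>UNIV. poly (\<phi> i) (x $ i))"
| tensor_add: "tensor_sum f \<Longrightarrow> tensor_sum g \<Longrightarrow> tensor_sum (\<lambda>x. f x + g x)"

lemma tensor_sum_prod_mult:
  "tensor_sum g \<Longrightarrow> tensor_sum (\<lambda>x. (\<Prod>i\<in>UNIV. poly (\<phi> i) (x $ i)) * g x)"
proof (induction rule: tensor_sum.induct)
  case (tensor_prod \<psi>)
  have "tensor_sum (\<lambda>x. \<Prod>i\<in>UNIV. poly (\<phi> i * \<psi> i) (x $ i))" by (rule tensor_sum.tensor_prod)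
  then show ?case by (simp add: prod.distrib)
qed (simp add: distrib_left tensor_sum.tensor_add)

lemma tensor_sum_mult: "tensor_sum f \<Longrightarrow> tensor_sum g \<Longrightarrow> tensor_sum (\<lambda>x. f x * g x)"
  by (induction rule: tensor_sum.induct) (simp_all add: tensor_sum_prod_mult distrib_right tensor_sum.tensor_add)

lemma poly_fun_imp_tensor_sum:
  fixes f :: "'a::field ^ 'n \<Rightarrow> 'a"
  shows "poly_fun f \<Longrightarrow> tensor_sum f"
proof (induction rule: poly_fun.induct)
  case (poly_fun_const c)
  obtain i0 :: 'n where True by blast
  have "tensor_sum (\<lambda>x :: 'a ^ 'n. \<Prod>i\<in>UNIV. poly (if i = i0 then [:c:] else 1) (x $ i))" by (rule tensor_prod)
  also have "(\<lambda>x :: 'a ^ 'n. \<Prod>i\<in>UNIV. poly (if i = i0 then [:c:] else 1) (x $ i)) = (\<lambda>x. \<Prod>i\<in>UNIV. if i = i0 then c else 1)"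
    by (intro ext prod.cong) auto
  finally show ?case by simp
next
  case (poly_fun_coord i0)
  have "tensor_sum (\<lambda>x :: 'a ^ 'n. \<Prod>i\<in>UNIV. poly (if i = i0 then [:0, 1:] else 1) (x $ i))" by (rule tensor_prod)
  also have "(\<lambda>x :: 'a ^ 'n. \<Prod>i\<in>UNIV. poly (if i = i0 then [:0, 1:] else 1) (x $ i)) = (\<lambda>x. \<Prod>i\<in>UNIV. if i = i0 then x $ i0 else 1)"
    by (intro ext prod.cong) auto
  finally show ?case by simp
qed (auto intro: tensor_sum_mult tensor_add)

definition sperm :: "('n \<Rightarrow> 'a::field) \<Rightarrow> ('n \<Rightarrow> 'n) \<Rightarrow> 'a ^ 'n \<Rightarrow> 'a ^ 'n" where
  "sperm e p x = (\<chi> i. e i * x $ p i)"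

text \<open>The average of a polynomial over the signed permutations extends to a polynomial on matrices
  that is invariant under orthogonal matrices on both sides. For a product of polynomials in one
  variable the average is a permanent of values at the squares, that is at the eigenvalues of
  \<open>X X\<^sup>T\<close>, and Ryser's formula expresses it through determinants of polynomials in that matrix.\<close>

theorem invariant_extension:
  fixes f :: "'a::field_char_0 ^ 'n::finite \<Rightarrow> 'a" and \<iota> :: "'n \<Rightarrow> 't::finite"
  assumes f: "poly_fun f" and \<iota>: "inj \<iota>"
  shows "\<exists>F. poly_fun F \<and> (\<forall>U V x. orthogonal_matrix U \<and> orthogonal_matrix V \<longrightarrow>
    F (act U V (diag_vec \<iota> x)) = (\<Sum>e\<in>signs. \<Sum>p | p permutes UNIV. f (sperm e p x)))"
  using poly_fun_imp_tensor_sum[OF f]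
proof (induction rule: tensor_sum.induct)
  case (tensor_prod \<phi>)
  have "\<forall>i. \<exists>\<psi>. \<forall>z. poly (\<phi> i) z + poly (\<phi> i) (- z) = poly \<psi> (z\<^sup>2)" using even_part_poly by blast
  then obtain \<psi> where \<psi>: "\<And>i z. poly (\<phi> i) z + poly (\<phi> i) (- z) = poly (\<psi> i) (z\<^sup>2)" by metis
  define N where "N = (\<Sum>i\<in>UNIV. degree (\<psi> i))"
  have N: "degree (\<psi> i) \<le> N" for i unfolding N_def by (rule member_le_sum) auto
  define F where "F X = (\<Sum>A\<in>Pow UNIV. (-1) ^ (CARD('n) - card A) *
    det (\<chi> a b. \<Sum>i\<in>A. mat_poly N (\<psi> i) (gram X) $ a $ b))" for X :: "'a ^ ('n \<times> 't)"
  have "poly_fun F"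
    unfolding F_def
  proof (intro poly_fun_intros)
    fix A :: "'n set" and a b
    show "poly_fun (\<lambda>x. (\<chi> a b. \<Sum>i\<in>A. mat_poly N (\<psi> i) (gram x) $ a $ b) $ a $ b)"
      unfolding mat_poly_def vec_lambda_beta by (intro poly_fun_intros poly_fun_mat_pow poly_fun_gram)
  qed
  moreover have "F (act U V (diag_vec \<iota> x)) =
    (\<Sum>e\<in>signs. \<Sum>p | p permutes UNIV. \<Prod>i\<in>UNIV. poly (\<phi> i) (sperm e p x $ i))"
    if UV: "orthogonal_matrix U" "orthogonal_matrix V" for U V x
  proof -
    let ?d = "\<lambda>i. (x $ i)\<^sup>2"
    let ?W = "U ** diag_mat ?d ** transpose U"
    have W: "gram (act U V (diag_vec \<iota> x)) = ?W" by (simp add: gram_act UV gram_diag_vec[OF \<iota>])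
    have "(\<chi> a b. \<Sum>i\<in>A. mat_poly N (\<psi> i) ?W $ a $ b) =
      U ** diag_mat (\<lambda>j. \<Sum>i\<in>A. poly (\<psi> i) (?d j)) ** transpose U" for A
      by (simp add: vec_eq_iff mat_poly_conjugate[OF UV(1) N] conjugate_diag_component sum_distrib_left sum_distrib_right)
        (intro allI sum.swap)
    then have "F (act U V (diag_vec \<iota> x)) = (\<Sum>A\<in>Pow UNIV. (-1) ^ (CARD('n) - card A) *
      (\<Prod>j\<in>UNIV. \<Sum>i\<in>A. poly (\<psi> i) (?d j)))"
      by (simp add: F_def W det_orthogonal_conjugate[OF UV(1)])
    also have "\<dots> = (\<Sum>p | p permutes UNIV. \<Prod>j\<in>UNIV. poly (\<psi> (p j)) (?d j))"
      by (rule permanent_inclusion_exclusion[symmetric])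
    also have "\<dots> = (\<Sum>p | p permutes UNIV. \<Prod>j\<in>UNIV. poly (\<psi> (inv p j)) (?d j))"
      by (rule sum_permutations_inverse)
    also have "\<dots> = (\<Sum>p | p permutes UNIV. \<Prod>i\<in>UNIV. poly (\<psi> i) (?d (p i)))"
    proof (intro sum.cong refl)
      fix p :: "'n \<Rightarrow> 'n" assume "p \<in> {p. p permutes UNIV}"
      then have p: "p permutes UNIV" by simp
      have "(\<Prod>j\<in>UNIV. poly (\<psi> (inv p j)) (?d j)) = (\<Prod>j\<in>UNIV. poly (\<psi> (inv p (p j))) (?d (p j)))"
        using prod.permute[OF p, of "\<lambda>j. poly (\<psi> (inv p j)) (?d j)"] by (simp add: o_def)
      then show "(\<Prod>j\<in>UNIV. poly (\<psi> (inv p j)) (?d j)) = (\<Prod>i\<in>UNIV. poly (\<psi> i) (?d (p i)))"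
        by (simp add: permutes_inverses[OF p])
    qed
    also have "\<dots> = (\<Sum>p | p permutes UNIV. \<Sum>e\<in>signs. \<Prod>i\<in>UNIV. poly (\<phi> i) (sperm e p x $ i))"
    proof (intro sum.cong refl)
      fix p :: "'n \<Rightarrow> 'n"
      have "(\<Prod>i\<in>UNIV. poly (\<psi> i) (?d (p i))) = (\<Prod>i\<in>UNIV. \<Sum>e\<in>{1, -1}. poly (\<phi> i) (e * x $ p i))"
        by (intro prod.cong refl) (simp add: \<psi>[symmetric])
      also have "\<dots> = (\<Sum>e\<in>signs. \<Prod>i\<in>UNIV. poly (\<phi> i) (e i * x $ p i))"
        unfolding signs_PiE by (rule prod_sum_PiE) auto
      finally show "(\<Prod>i\<in>UNIV. poly (\<psi> i) (?d (p i))) = (\<Sum>e\<in>signs. \<Prod>i\<in>UNIV. poly (\<phi> i) (sperm e p x $ i))"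
        by (simp add: sperm_def)
    qed
    also have "\<dots> = (\<Sum>e\<in>signs. \<Sum>p | p permutes UNIV. \<Prod>i\<in>UNIV. poly (\<phi> i) (sperm e p x $ i))"
      by (rule sum.swap)
    finally show ?thesis .
  qed
  ultimately show ?case by blast
next
  case (tensor_add f g)
  then obtain F G where "poly_fun F" "poly_fun G"
    "\<forall>U V x. orthogonal_matrix U \<and> orthogonal_matrix V \<longrightarrow>
      F (act U V (diag_vec \<iota> x)) = (\<Sum>e\<in>signs. \<Sum>p | p permutes UNIV. f (sperm e p x))"
    "\<forall>U V x. orthogonal_matrix U \<and> orthogonal_matrix V \<longrightarrow>
      G (act U V (diag_vec \<iota> x)) = (\<Sum>e\<in>signs. \<Sum>p | p permutes UNIV. g (sperm e p x))"
    by blast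
  then show ?case
    by (intro exI[of _ "\<lambda>X. F X + G X"]) (auto simp: sum.distrib intro: poly_fun_add)
qed


section \<open>Singular value decompositions\<close>

definition elem_skew :: "'n \<Rightarrow> 'n \<Rightarrow> 'a::field ^ 'n ^ 'n" where
  "elem_skew a b = (\<chi> i j. (if i = a \<and> j = b then 1 else 0) - (if i = b \<and> j = a then 1 else 0))"

lemma skew_elem_skew: "skew (elem_skew a b)"
  unfolding skew_def elem_skew_def transpose_def vec_eq_iff vec_lambda_beta vector_uminus_component
  by (intro allI) (simp add: conj_commute)

lemma skew_0: "skew 0"
  by (simp add: skew_def transpose_def vec_eq_iff)

lemma bil_diag_vec: "bil (diag_vec \<iota> w) z = (\<Sum>i\<in>UNIV. w $ i * z $ (i, \<iota> i))"
  by (simp add: bil_pairs diag_vec_def if_distrib[of "\<lambda>x. x * _"] cong: if_cong)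

lemma lie_act_component:
  "lie_act A B x $ (i, j) = (\<Sum>k\<in>UNIV. A $ i $ k * x $ (k, j)) + (\<Sum>k\<in>UNIV. x $ (i, k) * B $ j $ k)"
  by (simp add: lie_act_def mat_vec_def matrix_matrix_mult_def unvec_def transpose_def)

lemma lie_act_elem_left:
  "lie_act (elem_skew a b) 0 x $ (i, j) = (if i = a then x $ (b, j) else 0) - (if i = b then x $ (a, j) else 0)"
  by (simp add: lie_act_component elem_skew_def left_diff_distrib sum_subtractf if_distrib[of "\<lambda>x. x * _"] if_distribR
      cong: if_cong)

lemma lie_act_elem_right:
  "lie_act 0 (elem_skew a b) x $ (i, j) = (if j = a then x $ (i, b) else 0) - (if j = b then x $ (i, a) else 0)"
  by (simp add: lie_act_component elem_skew_def right_diff_distrib sum_subtractf if_distrib[of "\<lambda>x. _ * x"] if_distribR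
      cong: if_cong)

text \<open>By skew-symmetry the hypotheses say that \<open>x\<close> is orthogonal to the orbit directions at the
  diagonal matrix of \<open>w\<close>. The generators for the rows and for the columns give two linear equations for
  the pair of entries at \<open>(a, \<iota> b)\<close> and \<open>(b, \<iota> a)\<close>, with determinant \<open>(w $ a)\<^sup>2 - (w $ b)\<^sup>2\<close> up to
  sign.\<close>

lemma diagonal_if_bil_lie_act_zero:
  fixes x :: "'a::field ^ ('n::finite \<times> 't::finite)"
  assumes \<iota>: "inj \<iota>" and w0: "\<And>i. w $ i \<noteq> 0" and w: "\<And>i j. i \<noteq> j \<Longrightarrow> (w $ i)\<^sup>2 \<noteq> (w $ j)\<^sup>2"
    and L: "\<And>a b. a \<noteq> b \<Longrightarrow> bil (diag_vec \<iota> w) (lie_act (elem_skew a b) 0 x) = 0"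
    and R: "\<And>a b. a \<noteq> b \<Longrightarrow> bil (diag_vec \<iota> w) (lie_act 0 (elem_skew a b) x) = 0"
  shows "x = diag_vec \<iota> (\<chi> i. x $ (i, \<iota> i))"
proof -
  have L': "w $ a * x $ (b, \<iota> a) = w $ b * x $ (a, \<iota> b)" if "a \<noteq> b" for a b
    using L[OF that] by (simp add: bil_diag_vec lie_act_elem_left right_diff_distrib sum_subtractf if_distrib[of "\<lambda>x. _ * x"] cong: if_cong)
  have R': "w $ a * x $ (a, \<iota> b) = w $ b * x $ (b, \<iota> a)" if "a \<noteq> b" for a b
    using R[of "\<iota> a" "\<iota> b"] that inj_eq[OF \<iota>]
    by (simp add: bil_diag_vec lie_act_elem_right right_diff_distrib sum_subtractf if_distrib[of "\<lambda>x. _ * x"] cong: if_cong)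
  have R'': "x $ (a, d) = 0" if "d \<notin> range \<iota>" for a d
  proof -
    have "\<iota> a \<noteq> d" "\<And>i. \<iota> i \<noteq> d" using that by auto
    then show ?thesis
      using R[of "\<iota> a" d] w0[of a] inj_eq[OF \<iota>]
      by (simp add: bil_diag_vec lie_act_elem_right right_diff_distrib sum_subtractf if_distrib[of "\<lambda>x. _ * x"] cong: if_cong)
  qed
  have *: "x $ (a, \<iota> b) = 0" if "a \<noteq> b" for a b
  proof -
    have "(w $ a)\<^sup>2 * x $ (a, \<iota> b) = w $ a * (w $ b * x $ (b, \<iota> a))"
      using R'[OF that] by (simp add: power2_eq_square mult.assoc)
    also have "\<dots> = w $ b * (w $ a * x $ (b, \<iota> a))" by simp
    also have "\<dots> = (w $ b)\<^sup>2 * x $ (a, \<iota> b)" by (simp add: L'[OF that] power2_eq_square mult.assoc)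
    finally have "((w $ a)\<^sup>2 - (w $ b)\<^sup>2) * x $ (a, \<iota> b) = 0" by (simp add: left_diff_distrib)
    then show ?thesis using w[OF that] by simp
  qed
  have eq: "x $ (i, j) = diag_vec \<iota> (\<chi> i. x $ (i, \<iota> i)) $ (i, j)" for i j
  proof (cases "j \<in> range \<iota>")
    case True
    then obtain b where b: "j = \<iota> b" by blast
    show ?thesis using * [of i b] b inj_eq[OF \<iota>, of b i] by (cases "b = i") (auto simp: diag_vec_def)
  next
    case False
    then show ?thesis using R''[of j i] by (auto simp: diag_vec_def)
  qed
  show ?thesis
    unfolding vec_eq_iff
  proof
    fix p show "x $ p = diag_vec \<iota> (\<chi> i. x $ (i, \<iota> i)) $ p"
      using eq[of "fst p" "snd p"] by (simp only: prod.collapse)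
  qed
qed

definition sperm_mat :: "('n \<Rightarrow> 'a::field) \<Rightarrow> ('n \<Rightarrow> 'n) \<Rightarrow> 'a ^ 'n ^ 'n" where
  "sperm_mat e p = (\<chi> i j. if j = p i then e i else 0)"

lemma sperm_mat_orthogonal:
  fixes e :: "'n::finite \<Rightarrow> 'a::field"
  assumes "e \<in> signs" "inj p"
  shows "orthogonal_matrix (sperm_mat e p)"
proof -
  have "(sperm_mat e p ** transpose (sperm_mat e p)) $ i $ j = (mat 1 :: 'a ^ 'n ^ 'n) $ i $ j" for i j
  proof -
    have "(sperm_mat e p ** transpose (sperm_mat e p)) $ i $ j =
      (\<Sum>k\<in>UNIV. if k = p i then (if p i = p j then e i * e j else 0) else 0)"
      unfolding matrix_matrix_mult_def transpose_def sperm_mat_def vec_lambda_beta by (rule sum.cong) auto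
    also have "\<dots> = (if i = j then e i * e i else 0)" using assms(2) by (auto simp: inj_eq)
    finally show ?thesis using sign_square[OF assms(1)] by (simp add: mat_def)
  qed
  then have "sperm_mat e p ** transpose (sperm_mat e p) = mat 1" unfolding vec_eq_iff by blast
  moreover from this have "transpose (sperm_mat e p) ** sperm_mat e p = mat 1"
    by (simp only: matrix_left_right_inverse)
  ultimately show ?thesis by (simp add: orthogonal_matrix_def)
qed

lemma diag_mat_eq_sperm_mat: "diag_mat d = sperm_mat d id"
  by (auto simp: diag_mat_def sperm_mat_def vec_eq_iff)

lemma act_sperm_mat: "act (sperm_mat e p) (sperm_mat f q) x $ (i, j) = e i * x $ (p i, q j) * f j"
  by (simp add: act_component sperm_mat_def if_distrib if_distribR cong: if_cong)

lemma act_sperm_mat_diag_vec: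
  assumes "inj q" "\<And>i. q (\<iota> i) = \<iota> (p i)"
  shows "act (sperm_mat e p) (sperm_mat f q) (diag_vec \<iota> y) = diag_vec \<iota> (sperm (\<lambda>i. e i * f (\<iota> i)) p y)"
proof -
  have "q j = \<iota> (p i) \<longleftrightarrow> j = \<iota> i" for i j using assms by (metis inj_eq)
  then show ?thesis by (simp add: vec_eq_iff act_sperm_mat diag_vec_def sperm_def split_paired_all)
qed

lemma extend_permutation:
  fixes \<iota> :: "'n::finite \<Rightarrow> 't::finite"
  assumes \<iota>: "inj \<iota>" and p: "inj p"
  obtains q where "inj q" "\<And>i. q (\<iota> i) = \<iota> (p i)"
proof
  define q where "q j = (if j \<in> range \<iota> then \<iota> (p (inv \<iota> j)) else j)" for j
  show "q (\<iota> i) = \<iota> (p i)" for i using \<iota> by (simp add: q_def)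
  show "inj q"
  proof (rule injI)
    fix x y assume xy: "q x = q y"
    show "x = y"
    proof (cases "x \<in> range \<iota>")
      case True
      then have "y \<in> range \<iota>" using xy by (auto simp: q_def split: if_splits)
      then show ?thesis using True xy \<iota> p by (auto simp: q_def inj_eq)
    next
      case False
      then have "y \<notin> range \<iota>" using xy by (auto simp: q_def split: if_splits)
      then show ?thesis using False xy by (simp add: q_def)
    qed
  qed
qed

lemma act_signed_permutation:
  fixes \<iota> :: "'n::finite \<Rightarrow> 't::finite"
  assumes \<iota>: "inj \<iota>" and p: "inj p" and e: "(e :: 'n \<Rightarrow> 'a::field) \<in> signs"
  obtains P Q where "orthogonal_matrix P" "orthogonal_matrix (Q :: 'a ^ 't ^ 't)"
    "\<And>y. act P Q (diag_vec \<iota> y) = diag_vec \<iota> (sperm e p y)"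
proof -
  obtain q where q: "inj q" "\<And>i. q (\<iota> i) = \<iota> (p i)" using extend_permutation[OF \<iota> p] by blast
  show ?thesis
  proof
    show "orthogonal_matrix (sperm_mat e p)" by (rule sperm_mat_orthogonal[OF e p])
    show "orthogonal_matrix (sperm_mat (\<lambda>_. 1) q :: 'a ^ 't ^ 't)"
      by (rule sperm_mat_orthogonal[OF _ q(1)]) (simp add: signs_def)
    show "act (sperm_mat e p) (sperm_mat (\<lambda>_. 1) q) (diag_vec \<iota> y) = diag_vec \<iota> (sperm e p y)" for y
      using act_sperm_mat_diag_vec[of q \<iota> p e "\<lambda>_. 1" y] q by simp
  qed
qed

subsection \<open>Real matrices\<close>

definition rotation :: "'n \<Rightarrow> 'n \<Rightarrow> real \<Rightarrow> real \<Rightarrow> real ^ 'n ^ 'n" where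
  "rotation a b c s = (\<chi> i. if i = a then c *\<^sub>R axis a 1 + s *\<^sub>R axis b 1
     else if i = b then c *\<^sub>R axis b 1 - s *\<^sub>R axis a 1 else axis i 1)"

lemma act_mat_1_left: "act (mat 1) V x $ (i, j) = (\<Sum>l\<in>UNIV. V $ j $ l * x $ (i, l))"
  and act_mat_1_right: "act U (mat 1) x $ (i, j) = (\<Sum>k\<in>UNIV. U $ i $ k * x $ (k, j))"
  unfolding act_def transpose_mat matrix_mul_lid matrix_mul_rid
  by (simp_all add: mat_vec_def matrix_matrix_mult_def unvec_def transpose_def mult.commute)

lemma rotation_orthogonal:
  assumes "a \<noteq> b" "c\<^sup>2 + s\<^sup>2 = 1"
  shows "orthogonal_matrix (rotation a b c s)"
proof -
  have cs: "c * c + s * s = 1" "s * s + c * c = 1" using assms(2) by (simp_all add: power2_eq_square)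
  have "rotation a b c s ** transpose (rotation a b c s) = mat 1"
    unfolding matrix_mult_transpose_dot_row
    using assms(1) cs
    by (auto simp: vec_eq_iff row_def rotation_def mat_def inner_add_left inner_add_right inner_diff_left
        inner_diff_right inner_axis_axis)
  then show ?thesis using matrix_left_right_inverse by (auto simp: orthogonal_matrix_def)
qed

lemma rotation_component:
  assumes "a \<noteq> b"
  shows "(\<Sum>k\<in>UNIV. rotation a b c s $ i $ k * f k) =
    f i + (if i = a then (c - 1) * f a + s * f b else 0) + (if i = b then (c - 1) * f b - s * f a else 0)"
proof -
  have ax: "(\<Sum>k\<in>UNIV. axis d (1::real) $ k * f k) = f d" for d
    by (simp add: axis_def if_distrib if_distribR cong: if_cong)
  consider "i = a" | "i = b" | "i \<noteq> a" "i \<noteq> b" by blast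
  then show ?thesis
  proof cases
    case 1
    have "(\<Sum>k\<in>UNIV. rotation a b c s $ i $ k * f k) = c * (\<Sum>k\<in>UNIV. axis a 1 $ k * f k) + s * (\<Sum>k\<in>UNIV. axis b 1 $ k * f k)"
      unfolding sum_distrib_left sum.distrib[symmetric] by (rule sum.cong) (auto simp: rotation_def 1 algebra_simps)
    then show ?thesis unfolding ax using assms by (simp add: 1 algebra_simps)
  next
    case 2
    have "(\<Sum>k\<in>UNIV. rotation a b c s $ i $ k * f k) = c * (\<Sum>k\<in>UNIV. axis b 1 $ k * f k) - s * (\<Sum>k\<in>UNIV. axis a 1 $ k * f k)"
      unfolding sum_distrib_left sum_subtractf[symmetric] by (rule sum.cong) (use assms in \<open>auto simp: rotation_def 2 algebra_simps\<close>)
    then show ?thesis unfolding ax using assms by (simp add: 2 algebra_simps)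
  next
    case 3
    then have "(\<Sum>k\<in>UNIV. rotation a b c s $ i $ k * f k) = (\<Sum>k\<in>UNIV. axis i 1 $ k * f k)"
      by (simp add: rotation_def)
    then show ?thesis using 3 by (simp add: ax)
  qed
qed

text \<open>Otherwise the rotation towards \<open>(\<gamma>, \<beta>)\<close> gives a positive value.\<close>

lemma zero_if_rotation_maximal:
  fixes \<beta> \<gamma> :: real
  assumes "\<And>c s. c\<^sup>2 + s\<^sup>2 = 1 \<Longrightarrow> (c - 1) * \<gamma> + s * \<beta> \<le> 0"
  shows "\<beta> = 0"
proof (rule ccontr)
  assume b: "\<beta> \<noteq> 0"
  define r where "r = sqrt (\<gamma>\<^sup>2 + \<beta>\<^sup>2)"
  have r2: "r\<^sup>2 = \<gamma>\<^sup>2 + \<beta>\<^sup>2" by (simp add: r_def)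
  have pos: "0 < \<gamma>\<^sup>2 + \<beta>\<^sup>2" using b by (simp add: sum_power2_gt_zero_iff)
  then have r: "r > 0" by (simp add: r_def)
  have "(\<gamma> / r)\<^sup>2 + (\<beta> / r)\<^sup>2 = 1"
    using r by (simp add: power_divide r2 flip: add_divide_distrib) (use pos in auto)
  from assms[OF this] have "(\<gamma>\<^sup>2 + \<beta>\<^sup>2) / r \<le> \<gamma>" by (simp add: algebra_simps power2_eq_square add_divide_distrib)
  moreover have "(\<gamma>\<^sup>2 + \<beta>\<^sup>2) / r = r" unfolding r2[symmetric] using r by (simp add: power2_eq_square)
  ultimately have "r \<le> \<gamma>" by simp
  then have "r\<^sup>2 \<le> \<gamma>\<^sup>2" using r by (intro power_mono) auto
  then show False using r2 b by (simp add: sum_power2_gt_zero_iff)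
qed

lemma compact_orthogonal_matrices: "compact {U :: real ^ 'n ^ 'n. orthogonal_matrix U}"
  unfolding compact_eq_bounded_closed
proof
  have "norm U \<le> real CARD('n)" if U: "orthogonal_matrix U" for U :: "real ^ 'n ^ 'n"
  proof -
    have "U ** transpose U = mat 1" using U by (simp add: orthogonal_matrix_def)
    then have "inner (row i U) (row i U) = 1" for i
      unfolding matrix_mult_transpose_dot_row by (simp add: vec_eq_iff mat_def)
    then have "norm (U $ i) = 1" for i by (simp add: row_def norm_eq_1)
    then show ?thesis using L2_set_le_sum[of UNIV "\<lambda>i. norm (U $ i)"] by (simp add: norm_vec_def)
  qed
  then show "bounded {U :: real ^ 'n ^ 'n. orthogonal_matrix U}" unfolding bounded_iff by blast
  have "{U :: real ^ 'n ^ 'n. orthogonal_matrix U} =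
    {U. \<forall>i j. (\<Sum>k\<in>UNIV. U $ k $ i * U $ k $ j) = (if i = j then 1 else 0)}"
    by (auto simp: orthogonal_matrix vec_eq_iff matrix_matrix_mult_def transpose_def mat_def)
  also have "closed \<dots>"
    by (intro closed_Collect_all closed_Collect_eq continuous_intros)
  finally show "closed {U :: real ^ 'n ^ 'n. orthogonal_matrix U}" .
qed

text \<open>Maximize a linear functional with distinct positive decreasing weights over the orbit:
  stationarity under rotations makes the maximizer diagonal, and comparison with signed
  permutations orders its diagonal.\<close>

theorem real_singular_value_decomposition:
  fixes x :: "real ^ ('n::{finite,linorder} \<times> 't::finite)"
  assumes \<iota>: "inj \<iota>"
  obtains U V s where "orthogonal_matrix U" "orthogonal_matrix V" "x = act U V (diag_vec \<iota> s)"
    "\<And>i. 0 \<le> s $ i" "\<And>i j. i \<le> j \<Longrightarrow> s $ j \<le> s $ i"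
proof -
  define w where "w = (\<chi> i::'n. real (card {i..}))"
  have wpos: "w $ i > 0" for i by (simp add: w_def card_gt_0_iff)
  have wdec: "w $ j < w $ i" if "i < j" for i j
    using that by (auto simp: w_def intro!: psubset_card_mono)
  have wsq: "(w $ i)\<^sup>2 \<noteq> (w $ j)\<^sup>2" if "i \<noteq> j" for i j
    using that wpos[of i] wpos[of j] wdec[of i j] wdec[of j i] by (metis less_irrefl neqE power2_eq_imp_eq less_imp_le)
  let ?\<phi> = "\<lambda>z. bil (diag_vec \<iota> w) z"
  let ?K = "{U :: real ^ 'n::{finite,linorder} ^ 'n::{finite,linorder}. orthogonal_matrix U} \<times> {V :: real ^ 't ^ 't. orthogonal_matrix V}"
  have "compact ?K" by (intro compact_Times compact_orthogonal_matrices)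
  moreover have "(mat 1, mat 1) \<in> ?K" by (simp add: orthogonal_matrix_id)
  then have "?K \<noteq> {}" by (metis empty_iff)
  moreover have "continuous_on ?K (\<lambda>UV. ?\<phi> (act (fst UV) (snd UV) x))"
    unfolding bil_diag_vec act_component by (intro continuous_intros)
  ultimately obtain UV where UV: "UV \<in> ?K" "\<And>UV'. UV' \<in> ?K \<Longrightarrow> ?\<phi> (act (fst UV') (snd UV') x) \<le> ?\<phi> (act (fst UV) (snd UV) x)"
    using continuous_attains_sup[of ?K "\<lambda>UV. ?\<phi> (act (fst UV) (snd UV) x)"] by blast
  define U V where "U = fst UV" and "V = snd UV"
  have orth: "orthogonal_matrix U" "orthogonal_matrix V" using UV(1) by (auto simp: U_def V_def)
  define D where "D = act U V x"
  have max: "?\<phi> (act P Q D) \<le> ?\<phi> D" if "orthogonal_matrix P" "orthogonal_matrix Q" for P Q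
    using UV(2)[of "(P ** U, Q ** V)"] that orth
    by (simp add: D_def act_act orthogonal_matrix_mult U_def[symmetric] V_def[symmetric])
  have L: "?\<phi> (lie_act (elem_skew a b) 0 D) = 0" if ab: "a \<noteq> b" for a b
  proof (rule zero_if_rotation_maximal)
    fix c s :: real assume cs: "c\<^sup>2 + s\<^sup>2 = 1"
    have comp: "act (rotation a b c s) (mat 1) D $ (i, j) = D $ (i, j) +
      (if i = a then (c - 1) * D $ (a, j) + s * D $ (b, j) else 0) +
      (if i = b then (c - 1) * D $ (b, j) - s * D $ (a, j) else 0)" for i j
      unfolding act_mat_1_right by (rule rotation_component[OF ab])
    have "?\<phi> (act (rotation a b c s) (mat 1) D) = ?\<phi> D + ((c - 1) *
      (\<Sum>i\<in>UNIV. w $ i * ((if i = a then D $ (a, \<iota> i) else 0) + (if i = b then D $ (b, \<iota> i) else 0))) +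
      s * ?\<phi> (lie_act (elem_skew a b) 0 D))"
      unfolding bil_diag_vec lie_act_elem_left comp sum_distrib_left sum.distrib[symmetric]
      by (rule sum.cong) (use ab in \<open>auto simp: algebra_simps\<close>)
    then show "(c - 1) * (\<Sum>i\<in>UNIV. w $ i * ((if i = a then D $ (a, \<iota> i) else 0) + (if i = b then D $ (b, \<iota> i) else 0))) +
      s * ?\<phi> (lie_act (elem_skew a b) 0 D) \<le> 0"
      using max[OF rotation_orthogonal[OF ab cs] orthogonal_matrix_id] by simp
  qed
  have R: "?\<phi> (lie_act 0 (elem_skew a b) D) = 0" if ab: "a \<noteq> b" for a b
  proof (rule zero_if_rotation_maximal)
    fix c s :: real assume cs: "c\<^sup>2 + s\<^sup>2 = 1"
    have comp: "act (mat 1) (rotation a b c s) D $ (i, j) = D $ (i, j) +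
      (if j = a then (c - 1) * D $ (i, a) + s * D $ (i, b) else 0) +
      (if j = b then (c - 1) * D $ (i, b) - s * D $ (i, a) else 0)" for i j
      unfolding act_mat_1_left by (rule rotation_component[OF ab])
    have "?\<phi> (act (mat 1) (rotation a b c s) D) = ?\<phi> D + ((c - 1) *
      (\<Sum>i\<in>UNIV. w $ i * ((if \<iota> i = a then D $ (i, a) else 0) + (if \<iota> i = b then D $ (i, b) else 0))) +
      s * ?\<phi> (lie_act 0 (elem_skew a b) D))"
      unfolding bil_diag_vec lie_act_elem_right comp sum_distrib_left sum.distrib[symmetric]
    proof (rule sum.cong[OF refl])
      fix i
      show "w $ i * (D $ (i, \<iota> i) + (if \<iota> i = a then (c - 1) * D $ (i, a) + s * D $ (i, b) else 0) +
          (if \<iota> i = b then (c - 1) * D $ (i, b) - s * D $ (i, a) else 0)) =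
        w $ i * D $ (i, \<iota> i) + ((c - 1) * (w $ i * ((if \<iota> i = a then D $ (i, a) else 0) + (if \<iota> i = b then D $ (i, b) else 0))) +
          s * (w $ i * ((if \<iota> i = a then D $ (i, b) else 0) - (if \<iota> i = b then D $ (i, a) else 0))))"
        by (cases "\<iota> i = a"; cases "\<iota> i = b") (simp_all add: algebra_simps)
    qed
    then show "(c - 1) * (\<Sum>i\<in>UNIV. w $ i * ((if \<iota> i = a then D $ (i, a) else 0) + (if \<iota> i = b then D $ (i, b) else 0))) +
      s * ?\<phi> (lie_act 0 (elem_skew a b) D) \<le> 0"
      using max[OF orthogonal_matrix_id rotation_orthogonal[OF ab cs]] by simp
  qed
  define d where "d = (\<chi> i. D $ (i, \<iota> i))"
  have D: "D = diag_vec \<iota> d"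
    unfolding d_def by (rule diagonal_if_bil_lie_act_zero[OF \<iota>, of w]) (use wpos wsq L R in \<open>auto simp: less_imp_neq[symmetric]\<close>)
  have \<phi>: "?\<phi> (diag_vec \<iota> y) = (\<Sum>i\<in>UNIV. w $ i * y $ i)" for y
    unfolding bil_diag_vec by (simp add: diag_vec_def)
  have sp: "(\<Sum>i\<in>UNIV. w $ i * sperm e p d $ i) \<le> (\<Sum>i\<in>UNIV. w $ i * d $ i)" if ep: "e \<in> signs" "inj p" for e p
  proof -
    obtain P and Q :: "real ^ 't ^ 't" where "orthogonal_matrix P" "orthogonal_matrix Q"
      "\<And>y. act P Q (diag_vec \<iota> y) = diag_vec \<iota> (sperm e p y)"
      using act_signed_permutation[OF \<iota> ep(2,1)] by blast
    then show ?thesis using max[of P Q] by (simp add: D \<phi>)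
  qed
  have d0: "0 \<le> d $ i" for i
  proof -
    have "(\<Sum>k\<in>UNIV. w $ k * (if k = i then - d $ k else d $ k)) \<le> (\<Sum>k\<in>UNIV. w $ k * d $ k)"
      using sp[of "\<lambda>k. if k = i then -1 else 1" id] by (simp add: sperm_def signs_def if_distrib if_distribR cong: if_cong)
    then have "0 \<le> (\<Sum>k\<in>UNIV. w $ k * d $ k - w $ k * (if k = i then - d $ k else d $ k))"
      by (simp add: sum_subtractf)
    also have "\<dots> = (\<Sum>k\<in>UNIV. if k = i then 2 * (w $ i * d $ i) else 0)" by (rule sum.cong) auto
    finally show ?thesis using wpos[of i] by (simp add: zero_le_mult_iff)
  qed
  have dd: "d $ j \<le> d $ i" if "i \<le> j" for i j
  proof (cases "i = j")
    case False
    then have ij: "i < j" using that by simp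
    let ?t = "\<lambda>k. if k = i then j else if k = j then i else k"
    have "inj ?t" by (auto simp: inj_def)
    then have "(\<Sum>k\<in>UNIV. w $ k * d $ (?t k)) \<le> (\<Sum>k\<in>UNIV. w $ k * d $ k)"
      using sp[of "\<lambda>_. 1" ?t] by (simp add: sperm_def signs_def)
    then have "0 \<le> (\<Sum>k\<in>UNIV. w $ k * d $ k - w $ k * d $ (?t k))" by (simp add: sum_subtractf)
    also have "\<dots> = (\<Sum>k\<in>UNIV. (if k = i then w $ i * (d $ i - d $ j) else 0) + (if k = j then w $ j * (d $ j - d $ i) else 0))"
      by (rule sum.cong) (use False in \<open>auto simp: algebra_simps\<close>)
    also have "\<dots> = (w $ i - w $ j) * (d $ i - d $ j)" by (simp add: sum.distrib algebra_simps)
    finally show ?thesis using wdec[OF ij] by (simp add: zero_le_mult_iff)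
  qed simp
  have "act (transpose U) (transpose V) D = x"
    using orth by (simp add: D_def act_act orthogonal_matrix_def)
  then show ?thesis using that[of "transpose U" "transpose V" d] orth d0 dd by (simp add: D)
qed


subsection \<open>Generic complex matrices\<close>

definition charpoly_mat :: "'a::field ^ 'n ^ 'n \<Rightarrow> 'a poly ^ 'n ^ 'n" where
  "charpoly_mat W = (\<chi> i j. if i = j then [:- W $ i $ j, 1:] else [:- W $ i $ j:])"

definition charpoly :: "'a::field ^ 'n ^ 'n \<Rightarrow> 'a poly" where
  "charpoly W = det (charpoly_mat W)"

lemma poly_charpoly: "poly (charpoly W) z = det (mat z - W)"
  by (simp add: charpoly_def charpoly_mat_def det_def poly_sum poly_prod mat_def if_distrib[of "\<lambda>p. poly p z"]
      cong: if_cong) (intro sum.cong arg_cong2[where f = "(*)"] prod.cong refl; auto)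

lemma degree_charpoly:
  fixes W :: "'a::field ^ 'n ^ 'n"
  shows "degree (charpoly W) = CARD('n)"
proof -
  let ?M = "charpoly_mat W"
  let ?t = "\<lambda>p. of_int (sign p) * (\<Prod>i\<in>UNIV. ?M $ i $ p i)"
  have fin: "finite {p. p permutes (UNIV :: 'n set)}" by (rule finite_permutations) simp
  have "charpoly W = ?t id + (\<Sum>p\<in>{p. p permutes UNIV} - {id}. ?t p)"
    unfolding charpoly_def det_def by (subst sum.remove[OF fin, of id]) (auto simp: permutes_id)
  moreover have "degree (?t id) = CARD('n)"
  proof -
    have "?t id = (\<Prod>i\<in>UNIV. [:- W $ i $ i, 1:])" by (simp add: charpoly_mat_def)
    also have "degree \<dots> = (\<Sum>i\<in>(UNIV :: 'n set). 1)" by (subst degree_prod_eq_sum_degree) auto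
    finally show ?thesis by simp
  qed
  moreover have "degree (\<Sum>p\<in>{p. p permutes UNIV} - {id}. ?t p) < CARD('n)"
  proof (rule degree_sum_less)
    fix p :: "'n \<Rightarrow> 'n" assume "p \<in> {p. p permutes UNIV} - {id}"
    then obtain i0 where i0: "p i0 \<noteq> i0" by (metis DiffE eq_id_iff singletonI)
    have "degree (?t p) \<le> degree (\<Prod>i\<in>UNIV. ?M $ i $ p i)"
      using degree_mult_le[of "of_int (sign p)" "\<Prod>i\<in>UNIV. ?M $ i $ p i"] by simp
    also have "\<dots> \<le> (\<Sum>i\<in>UNIV. degree (?M $ i $ p i))"
      using degree_prod_sum_le[of UNIV "\<lambda>i. ?M $ i $ p i"] by (simp add: o_def)
    also have "\<dots> \<le> (\<Sum>i\<in>UNIV. if p i = i then 1 else 0)"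
      by (rule sum_mono) (auto simp: charpoly_mat_def)
    also have "\<dots> = card {i. p i = i}" by (simp add: sum.If_cases Collect_conj_eq[symmetric])
    also have "\<dots> < CARD('n)" by (rule psubset_card_mono) (use i0 in auto)
    finally show "degree (?t p) < CARD('n)" .
  qed simp
  ultimately show ?thesis by (simp add: degree_add_eq_left)
qed

lemma poly_fun_coeff_charpoly:
  assumes "\<And>i j. poly_fun (\<lambda>x. W x $ i $ j)"
  shows "poly_fun (\<lambda>x. coeff (charpoly (W x)) k)"
proof -
  have mult: "\<forall>k. poly_fun (\<lambda>x. coeff (P x * Q x) k)"
    if "\<forall>k. poly_fun (\<lambda>x. coeff (P x) k)" "\<forall>k. poly_fun (\<lambda>x. coeff (Q x) k)" for P Q
    unfolding coeff_mult by (intro allI poly_fun_sum poly_fun_mult) (use that in auto)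
  have prod: "\<forall>k. poly_fun (\<lambda>x. coeff (\<Prod>a\<in>A. P a x) k)"
    if "\<And>a. \<forall>k. poly_fun (\<lambda>x. coeff (P a x) k)" for A and P :: "'i \<Rightarrow> _"
  proof (induction A rule: infinite_finite_induct)
    case (insert a A)
    then show ?case using mult[OF that[of a], of "\<lambda>x. \<Prod>a\<in>A. P a x"] by simp
  qed (auto intro: poly_fun_const)
  have ent: "\<forall>k. poly_fun (\<lambda>x. coeff (charpoly_mat (W x) $ i $ j) k)" for i j
  proof
    fix k
    show "poly_fun (\<lambda>x. coeff (charpoly_mat (W x) $ i $ j) k)"
      unfolding charpoly_mat_def by (cases "i = j"; cases k) (auto simp: coeff_pCons split: nat.split intro!: poly_fun_intros assms)
  qed
  have "\<forall>k. poly_fun (\<lambda>x. coeff (of_int (sign p) * (\<Prod>i\<in>UNIV. charpoly_mat (W x) $ i $ p i)) k)" for p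
  proof (rule mult[of "\<lambda>_. of_int (sign p)"])
    show "\<forall>k. poly_fun (\<lambda>x. coeff (of_int (sign p)) k)" by (simp add: poly_fun_const)
    show "\<forall>k. poly_fun (\<lambda>x. coeff (\<Prod>i\<in>UNIV. charpoly_mat (W x) $ i $ p i) k)" by (rule prod) (rule ent)
  qed
  then show ?thesis unfolding charpoly_def det_def coeff_sum by (intro poly_fun_sum) blast
qed

lemma eigenvector_exists:
  fixes W :: "'a::field ^ 'n ^ 'n"
  assumes "poly (charpoly W) c = 0"
  obtains u where "u \<noteq> 0" "W *v u = c *s u"
proof -
  have "det (mat c - W) = 0" using assms by (simp add: poly_charpoly)
  then have "\<not> (\<exists>B. B ** (mat c - W) = mat 1)"
    by (metis det_I det_mul mult_zero_right zero_neq_one)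
  then obtain u where u: "(mat c - W) *v u = 0" "u \<noteq> 0" using matrix_left_invertible_ker by blast
  have "mat c *v u = c *s u"
    by (simp add: matrix_vector_mult_def mat_def vec_eq_iff if_distrib if_distribR cong: if_cong)
  then have "W *v u = c *s u" using u(1) by (simp add: matrix_vector_mult_diff_rdistrib)
  then show ?thesis using that u by blast
qed

lemma mult_transpose_component:
  "(A ** transpose A) $ i $ j = (\<Sum>k\<in>UNIV. A $ i $ k * A $ j $ k)" for A :: "'a::field ^ 'n ^ 'm"
  by (simp add: matrix_matrix_mult_def transpose_def)

definition dotp :: "'a::field ^ 'n \<Rightarrow> 'a ^ 'n \<Rightarrow> 'a" where
  "dotp u v = (\<Sum>i\<in>UNIV. u $ i * v $ i)"

lemma dotp_commute: "dotp u v = dotp v u"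
  by (simp add: dotp_def mult.commute)

lemma dotp_scale: "dotp (c *s u) v = c * dotp u v" "dotp u (c *s v) = c * dotp u v"
  by (simp_all add: dotp_def sum_distrib_left mult_ac)

lemma dotp_add: "dotp (u + v) w = dotp u w + dotp v w" "dotp w (u + v) = dotp w u + dotp w v"
  by (simp_all add: dotp_def sum.distrib algebra_simps)

lemma dotp_diff: "dotp (u - v) w = dotp u w - dotp v w" "dotp w (u - v) = dotp w u - dotp w v"
  by (simp_all add: dotp_def sum_subtractf algebra_simps)

lemma dotp_matrix: "dotp (A *v u) v = dotp u (transpose A *v v)"
  unfolding dotp_def matrix_vector_mult_def transpose_def
  by (simp add: sum_distrib_left sum_distrib_right mult_ac) (rule sum.swap)

lemma dotp_orthogonal: "orthogonal_matrix H \<Longrightarrow> dotp (H *v u) (H *v v) = dotp u v"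
  unfolding dotp_matrix matrix_vector_mul_assoc by (simp only: orthogonal_matrix_def matrix_vector_mul_lid)

definition reflection :: "'a::field ^ 'n \<Rightarrow> 'a ^ 'n ^ 'n" where
  "reflection w = (\<chi> i j. (if i = j then 1 else 0) - 2 / dotp w w * w $ i * w $ j)"

lemma reflection_apply: "reflection w *v x = x - (2 / dotp w w * dotp w x) *s w"
proof -
  have "(\<Sum>j\<in>UNIV. ((if i = j then 1 else 0) - k * w $ i * w $ j) * x $ j) = x $ i - k * (\<Sum>j\<in>UNIV. w $ j * x $ j) * w $ i" for k i
  proof -
    have "(\<Sum>j\<in>UNIV. ((if i = j then 1 else 0) - k * w $ i * w $ j) * x $ j) =
      (\<Sum>j\<in>UNIV. (if i = j then x $ j else 0) - k * (w $ j * x $ j) * w $ i)"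
      by (rule sum.cong) (auto simp: algebra_simps)
    then show ?thesis by (simp add: sum_subtractf sum_distrib_left sum_distrib_right)
  qed
  then have "(reflection w *v x) $ i = x $ i - 2 / dotp w w * dotp w x * w $ i" for i
    unfolding reflection_def matrix_vector_mult_def vec_lambda_beta dotp_def[of w x] by blast
  then show ?thesis by (simp add: vec_eq_iff)
qed

lemma reflection_orthogonal:
  fixes w :: "'a::field ^ 'n"
  assumes "dotp w w \<noteq> 0"
  shows "orthogonal_matrix (reflection w)"
proof (rule orthogonal_matrixI)
  have tr: "transpose (reflection w) = reflection w"
    by (simp add: transpose_def reflection_def vec_eq_iff mult_ac)
  have "reflection w *v (reflection w *v x) = x" for x
  proof -
    have "dotp w (reflection w *v x) = - dotp w x"
      using assms by (simp add: reflection_apply dotp_diff dotp_scale)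
    then show ?thesis by (simp add: reflection_apply[of w "reflection w *v x"]) (simp add: reflection_apply)
  qed
  then show "transpose (reflection w) ** reflection w = mat 1"
    unfolding tr by (subst matrix_eq) (simp add: matrix_vector_mul_assoc[symmetric])
qed

text \<open>Unit vectors \<open>v\<close> and \<open>e\<close> are exchanged by the reflection along \<open>v - e\<close>; if that vector is
  isotropic, then \<open>v + e\<close> is not, and reflecting along it and along \<open>e\<close> maps \<open>v\<close> to \<open>e\<close>.\<close>

lemma unit_vector_reflection:
  fixes v e :: "'a::field_char_0 ^ 'n"
  assumes v: "dotp v v = 1" and e: "dotp e e = 1"
  obtains H where "orthogonal_matrix H" "H *v v = e"
    "\<And>x. dotp x v = 0 \<Longrightarrow> dotp x e = 0 \<Longrightarrow> H *v x = x"
proof (cases "dotp v e = 1")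
  case False
  let ?w = "v - e"
  have ww: "dotp ?w ?w = 2 - 2 * dotp v e" by (simp add: dotp_diff v e dotp_commute[of e v])
  then have nz: "dotp ?w ?w \<noteq> 0" using False by simp
  have "reflection ?w *v v = e"
  proof -
    have "dotp ?w v = 1 - dotp v e" by (simp add: dotp_diff v dotp_commute[of e v])
    then have "dotp ?w ?w = 2 * dotp ?w v" using ww by simp
    then have "2 / dotp ?w ?w * dotp ?w v = 1" using nz by (simp add: field_simps)
    then show ?thesis by (simp add: reflection_apply)
  qed
  moreover have "reflection ?w *v x = x" if "dotp x v = 0" "dotp x e = 0" for x
  proof -
    have "dotp ?w x = 0" unfolding dotp_diff dotp_commute[of v x] dotp_commute[of e x] using that by simp
    then show ?thesis by (simp add: reflection_apply)
  qed
  ultimately show ?thesis by (intro that[of "reflection ?w"] reflection_orthogonal nz) auto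
next
  case True
  let ?w = "v + e"
  have ww: "dotp ?w ?w = 4" by (simp add: dotp_add v e True dotp_commute[of e v])
  have 1: "reflection ?w *v v = - e"
  proof -
    have "dotp ?w v = 2" by (simp add: dotp_add v True dotp_commute[of e v])
    then show ?thesis using ww by (simp add: reflection_apply)
  qed
  have 2: "reflection e *v (- e) = e"
  proof -
    have "dotp e (- e) = -1" using e dotp_scale(2)[of e "-1" e] by simp
    then show ?thesis by (simp add: reflection_apply e vec_eq_iff)
  qed
  have orth: "orthogonal_matrix (reflection e)" "orthogonal_matrix (reflection ?w)"
    by (rule reflection_orthogonal, simp add: e ww)+
  show ?thesis
  proof (rule that[of "reflection e ** reflection ?w"])
    show "orthogonal_matrix (reflection e ** reflection ?w)" by (intro orthogonal_matrix_mult orth)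
    show "(reflection e ** reflection ?w) *v v = e" by (simp add: matrix_vector_mul_assoc[symmetric] 1 2)
    fix x assume x: "dotp x v = 0" "dotp x e = 0"
    have "dotp e x = 0" "dotp ?w x = 0"
      unfolding dotp_add dotp_commute[of v x] dotp_commute[of e x] using x by simp_all
    then show "(reflection e ** reflection ?w) *v x = x"
      by (simp add: matrix_vector_mul_assoc[symmetric] reflection_apply)
  qed
qed

text \<open>The vectors are moved to the axes one at a time; each new orthogonal matrix fixes the axes that
  are already in place, as they are orthogonal to both vectors that it exchanges.\<close>

lemma orthonormal_family_to_axes:
  fixes v :: "'n::finite \<Rightarrow> 'a::field_char_0 ^ 't" and \<iota> :: "'n \<Rightarrow> 't::finite"
  assumes \<iota>: "inj \<iota>" and v: "\<And>i j. dotp (v i) (v j) = (if i = j then 1 else 0)"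
  obtains H where "orthogonal_matrix H" "\<And>i. H *v v i = axis (\<iota> i) 1"
proof -
  have "\<exists>H. orthogonal_matrix H \<and> (\<forall>i\<in>I. H *v v i = axis (\<iota> i) 1)" if "finite I" for I
    using that
  proof (induction I rule: finite_induct)
    case empty
    show ?case by (rule exI[of _ "mat 1"]) (simp add: orthogonal_matrix_def transpose_mat)
  next
    case (insert k I)
    then obtain H where H: "orthogonal_matrix H" "\<forall>i\<in>I. H *v v i = axis (\<iota> i) 1" by blast
    have ax: "dotp (axis a 1) (axis b 1) = (if a = b then 1 else (0::'a))" for a b :: 't
      by (simp add: dotp_def axis_def if_distrib[of "\<lambda>x. x * _"] cong: if_cong)
    obtain H' where H': "orthogonal_matrix H'" "H' *v (H *v v k) = axis (\<iota> k) 1"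
      "\<And>x. dotp x (H *v v k) = 0 \<Longrightarrow> dotp x (axis (\<iota> k) 1) = 0 \<Longrightarrow> H' *v x = x"
      using unit_vector_reflection[of "H *v v k" "axis (\<iota> k) 1"] by (auto simp: dotp_orthogonal[OF H(1)] v ax)
    have "H' *v (H *v v i) = axis (\<iota> i) 1" if i: "i \<in> I" for i
    proof -
      have ik: "i \<noteq> k" using i insert.hyps by auto
      have "H' *v axis (\<iota> i) 1 = axis (\<iota> i) 1"
      proof (rule H'(3))
        have "dotp (H *v v i) (H *v v k) = 0" using ik by (simp add: dotp_orthogonal[OF H(1)] v)
        then show "dotp (axis (\<iota> i) 1) (H *v v k) = 0" using H(2) i by simp
        show "dotp (axis (\<iota> i) 1) (axis (\<iota> k) 1) = (0::'a)" using ik \<iota> by (simp add: ax inj_eq)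
      qed
      then show ?thesis using H(2) i by simp
    qed
    then show ?case
      using H'(1,2) H(1) by (intro exI[of _ "H' ** H"]) (auto simp: matrix_vector_mul_assoc[symmetric] orthogonal_matrix_mult)
  qed
  from this[of UNIV] show ?thesis using that by auto
qed

text \<open>A symmetric matrix with simple eigenvalues is diagonalized by an orthogonal matrix: the
  eigenvectors are orthogonal to each other, hence none of them is isotropic.\<close>

lemma complex_symmetric_diagonalization:
  fixes W :: "complex ^ 'n ^ 'n"
  assumes sym: "transpose W = W" and sf: "rsquarefree (charpoly W)"
  obtains U d where "orthogonal_matrix U" "W = U ** diag_mat d ** transpose U"
proof -
  let ?p = "charpoly W"
  have p0: "?p \<noteq> 0" using degree_charpoly[of W] by auto
  have "card {z. poly ?p z = 0} = CARD('n)"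
  proof -
    have "degree (smult (lead_coeff ?p) (\<Prod>z|poly ?p z = 0. [:-z, 1:])) = degree ?p"
      by (simp only: complex_poly_decompose_rsquarefree[OF sf])
    moreover have "lead_coeff ?p \<noteq> 0" using p0 by (simp only: leading_coeff_0_iff not_False_eq_True)
    ultimately have "degree (\<Prod>z|poly ?p z = 0. [:-z, 1:]) = degree ?p" by (simp only: degree_smult_eq if_False)
    then have "degree (\<Prod>z|poly ?p z = 0. [:-z, 1:]) = CARD('n)" by (simp only: degree_charpoly)
    moreover have "degree (\<Prod>z|poly ?p z = 0. [:-z, 1:]) = (\<Sum>z|poly ?p z = 0. 1)"
      by (subst degree_prod_eq_sum_degree) auto
    ultimately show ?thesis by simp
  qed
  then obtain lam where lam: "bij_betw lam (UNIV :: 'n set) {z. poly ?p z = 0}"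
    using finite_same_card_bij[of "UNIV :: 'n set" "{z. poly ?p z = 0}"] poly_roots_finite[OF p0] by auto
  have inj: "lam i = lam j \<longleftrightarrow> i = j" for i j using lam by (auto simp: bij_betw_def inj_on_def)
  have "\<forall>i\<in>UNIV. \<exists>u. u \<noteq> 0 \<and> W *v u = lam i *s u"
  proof
    fix i
    have "poly ?p (lam i) = 0" using lam by (auto simp: bij_betw_def)
    then show "\<exists>u. u \<noteq> 0 \<and> W *v u = lam i *s u" by (rule eigenvector_exists) blast
  qed
  from bchoice[OF this] obtain u where u: "\<And>i. u i \<noteq> 0" "\<And>i. W *v u i = lam i *s u i" by blast
  have orth: "dotp (u i) (u j) = 0" if "i \<noteq> j" for i j
  proof -
    have "lam i * dotp (u i) (u j) = dotp (W *v u i) (u j)" by (simp add: u dotp_scale)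
    also have "\<dots> = lam j * dotp (u i) (u j)" unfolding dotp_matrix sym by (simp add: u dotp_scale)
    finally have "(lam i - lam j) * dotp (u i) (u j) = 0" by (simp add: left_diff_distrib)
    then show ?thesis using that inj by auto
  qed
  define U0 :: "complex ^ 'n ^ 'n" where "U0 = (\<chi> a i. u i $ a)"
  have "c = 0" if c: "U0 *v c = 0" for c
  proof -
    have "c $ i = 0" for i
    proof -
      define q where "q = (\<Prod>j\<in>UNIV - {i}. [:- lam j, 1:])"
      have degq: "degree q \<le> CARD('n)"
      proof -
        have "degree q \<le> (\<Sum>j\<in>UNIV - {i}. degree [:- lam j, 1:])" 
          using degree_prod_sum_le[of "UNIV - {i}" "\<lambda>j. [:- lam j, 1:]"] by (simp add: o_def q_def)
        also have "\<dots> \<le> CARD('n)" by (simp add: card_Diff_subset)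
        finally show ?thesis .
      qed
      have q0: "poly q (lam j) = 0" if "j \<noteq> i" for j
        unfolding q_def poly_prod by (rule prod_zero) (use that in auto)
      have q1: "poly q (lam i) \<noteq> 0" unfolding q_def poly_prod using inj by auto
      have "(\<Sum>j\<in>UNIV. c $ j *s u j) = 0"
        using c by (simp add: U0_def matrix_vector_mult_def vec_eq_iff mult.commute)
      then have "mat_poly CARD('n) q W *v (\<Sum>j\<in>UNIV. c $ j *s u j) = 0" by simp
      then have "(\<Sum>j\<in>UNIV. c $ j *s (poly q (lam j) *s u j)) = 0"
        by (simp add: vec.sum vec.scale mat_poly_eigen[OF u(2) degq] vector_scalar_commute)
      moreover have "(\<Sum>j\<in>UNIV. c $ j *s (poly q (lam j) *s u j)) = (\<Sum>j\<in>UNIV. if j = i then c $ i *s (poly q (lam i) *s u i) else 0)"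
        by (rule sum.cong) (auto simp: q0)
      ultimately have "c $ i *s (poly q (lam i) *s u i) = 0" by simp
      then show ?thesis using q1 u(1)[of i] by simp
    qed
    then show ?thesis by (simp add: vec_eq_iff)
  qed
  then have "\<exists>B. B ** U0 = mat 1" using matrix_left_invertible_ker by blast
  then have "det U0 \<noteq> 0" by (metis det_I det_mul mult_zero_right zero_neq_one)
  then have "det (transpose U0 ** U0) \<noteq> 0" by (simp add: det_mul)
  moreover have "transpose U0 ** U0 = diag_mat (\<lambda>i. dotp (u i) (u i))"
    by (auto simp: U0_def matrix_matrix_mult_def transpose_def diag_mat_def vec_eq_iff orth[unfolded dotp_def] dotp_def)
  ultimately have "det (diag_mat (\<lambda>i. dotp (u i) (u i))) \<noteq> 0" by simp
  then have "(\<Prod>i\<in>UNIV. dotp (u i) (u i)) \<noteq> 0" by (subst (asm) det_diagonal) (auto simp: diag_mat_def)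
  then have nz: "dotp (u i) (u i) \<noteq> 0" for i by simp
  define r where "r i = csqrt (dotp (u i) (u i))" for i
  have r: "(r i)\<^sup>2 = dotp (u i) (u i)" for i by (simp add: r_def)
  have r0: "r i \<noteq> 0" for i using r[of i] nz[of i] by auto
  define U :: "complex ^ 'n ^ 'n" where "U = (\<chi> a i. u i $ a / r i)"
  have "(transpose U ** U) $ i $ j = (mat 1 :: complex ^ 'n ^ 'n) $ i $ j" for i j
  proof -
    have "(transpose U ** U) $ i $ j = dotp (u i) (u j) / (r i * r j)"
      by (simp add: U_def matrix_matrix_mult_def transpose_def dotp_def sum_divide_distrib)
    also have "\<dots> = mat 1 $ i $ j"
      using orth[of i j] r[of i] r0[of i] by (auto simp: mat_def power2_eq_square)
    finally show ?thesis .
  qed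
  then have "transpose U ** U = mat 1" unfolding vec_eq_iff by blast
  then have oU: "orthogonal_matrix U" by (rule orthogonal_matrixI)
  have "W ** U = U ** diag_mat lam"
  proof -
    have "(W ** U) $ a $ i = (W *v u i) $ a / r i" for a i
      by (simp add: U_def matrix_matrix_mult_def matrix_vector_mult_def sum_divide_distrib)
    then show ?thesis unfolding vec_eq_iff diag_mat_mult_right by (simp add: u U_def)
  qed
  then have "W ** (U ** transpose U) = U ** diag_mat lam ** transpose U" by (simp only: matrix_mul_assoc)
  then have "W = U ** diag_mat lam ** transpose U" using oU by (simp add: orthogonal_matrix_def)
  then show ?thesis using that oU by blast
qed

text \<open>Nonvanishing of \<open>det (\<chi>'(W)) * det W\<close>, where \<open>\<chi>\<close> is the characteristic polynomial of
  \<open>W = Y Y\<^sup>T\<close>, forces the eigenvalues of \<open>W\<close> to be simple and nonzero: at a multiple eigenvalue, an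
  eigenvector is in the kernel of \<open>\<chi>'(W)\<close>.\<close>

definition svd_discriminant :: "complex ^ ('n::finite \<times> 't::finite) \<Rightarrow> complex" where
  "svd_discriminant Y = det (mat_poly CARD('n) (pderiv (charpoly (gram Y))) (gram Y)) * det (gram Y)"

lemma poly_fun_svd_discriminant: "poly_fun svd_discriminant"
  unfolding svd_discriminant_def
proof (intro poly_fun_mult poly_fun_det poly_fun_gram)
  fix i j
  show "poly_fun (\<lambda>Y. mat_poly CARD('n) (pderiv (charpoly (gram Y))) (gram Y) $ i $ j)"
    unfolding mat_poly_def vec_lambda_beta coeff_pderiv
    by (intro poly_fun_intros poly_fun_mat_pow poly_fun_gram poly_fun_coeff_charpoly)
qed

theorem complex_singular_value_decomposition:
  fixes Y :: "complex ^ ('n::finite \<times> 't::finite)"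
  assumes \<iota>: "inj \<iota>" and disc: "svd_discriminant Y \<noteq> 0"
  obtains U V s where "orthogonal_matrix U" "orthogonal_matrix V" "Y = act U V (diag_vec \<iota> s)"
proof -
  let ?W = "gram Y"
  have dd: "det (mat_poly CARD('n) (pderiv (charpoly ?W)) ?W) \<noteq> 0" and dW: "det ?W \<noteq> 0"
    using disc by (auto simp: svd_discriminant_def)
  have "rsquarefree (charpoly ?W)"
    unfolding rsquarefree_roots
  proof (intro allI notI, elim conjE)
    fix c assume c: "poly (charpoly ?W) c = 0" "poly (pderiv (charpoly ?W)) c = 0"
    obtain u where u: "u \<noteq> 0" "?W *v u = c *s u" using eigenvector_exists[OF c(1)] by blast
    have "degree (pderiv (charpoly ?W)) \<le> CARD('n)" by (simp add: degree_pderiv degree_charpoly)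
    from mat_poly_eigen[OF u(2) this] have "mat_poly CARD('n) (pderiv (charpoly ?W)) ?W *v u = 0" by (simp add: c)
    moreover have "\<exists>B. B ** mat_poly CARD('n) (pderiv (charpoly ?W)) ?W = mat 1"
      using dd by (auto simp: invertible_det_nz[symmetric] invertible_def)
    ultimately show False using u(1) matrix_left_invertible_ker by blast
  qed
  moreover have "transpose ?W = ?W" by (simp add: gram_def matrix_transpose_mul)
  ultimately obtain U d where U: "orthogonal_matrix U" "?W = U ** diag_mat d ** transpose U"
    using complex_symmetric_diagonalization by blast
  have "(\<Prod>i\<in>UNIV. d i) \<noteq> 0" using dW unfolding U(2) det_orthogonal_conjugate[OF U(1)] .
  then have d0: "d i \<noteq> 0" for i by simp
  define s where "s i = csqrt (d i)" for i
  have s: "(s i)\<^sup>2 = d i" for i by (simp add: s_def)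
  have s0: "s i \<noteq> 0" for i using s[of i] d0[of i] by auto
  let ?Z = "transpose U ** unvec Y"
  have "?Z ** transpose ?Z = transpose U ** ?W ** U"
    by (simp add: gram_def matrix_transpose_mul matrix_mul_assoc)
  also have "\<dots> = (transpose U ** U) ** diag_mat d ** (transpose U ** U)"
    unfolding U(2) by (simp only: matrix_mul_assoc)
  also have "\<dots> = diag_mat d" using U(1) by (simp add: orthogonal_matrix_def)
  finally have ZZ: "?Z ** transpose ?Z = diag_mat d" .
  define v where "v i = (\<chi> j. ?Z $ i $ j / s i)" for i
  have "dotp (v i) (v j) = (if i = j then 1 else 0)" for i j
  proof -
    have "dotp (v i) (v j) = (?Z ** transpose ?Z) $ i $ j / (s i * s j)"
      unfolding mult_transpose_component by (simp add: v_def dotp_def sum_divide_distrib)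
    then show ?thesis using s[of i] s0[of i] unfolding ZZ by (auto simp: diag_mat_def power2_eq_square)
  qed
  then obtain H where H: "orthogonal_matrix H" "\<And>i. H *v v i = axis (\<iota> i) 1"
    using orthonormal_family_to_axes[OF \<iota>] by blast
  have vH: "v i = transpose H *v axis (\<iota> i) 1" for i
  proof -
    have "transpose H *v (H *v v i) = v i"
      unfolding matrix_vector_mul_assoc using H(1) by (simp only: orthogonal_matrix_def matrix_vector_mul_lid)
    then show ?thesis by (simp add: H(2))
  qed
  have "?Z = unvec (diag_vec \<iota> (\<chi> i. s i)) ** H"
  proof -
    have 1: "?Z $ i $ j = s i * v i $ j" for i j using s0[of i] by (simp add: v_def)
    have 2: "v i $ j = H $ \<iota> i $ j" for i j
      unfolding vH matrix_vector_mult_def transpose_def axis_def by (simp add: if_distrib cong: if_cong)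
    have 3: "(unvec (diag_vec \<iota> (\<chi> i. s i)) ** H) $ i $ j = s i * H $ \<iota> i $ j" for i j
      by (simp add: matrix_matrix_mult_def unvec_def diag_vec_def if_distrib[of "\<lambda>x. x * _"] cong: if_cong)
    show ?thesis unfolding vec_eq_iff 1 2 3 by simp
  qed
  then have "U ** ?Z = U ** unvec (diag_vec \<iota> (\<chi> i. s i)) ** H" by (simp add: matrix_mul_assoc)
  moreover have "U ** ?Z = unvec Y" using U(1) by (simp add: matrix_mul_assoc orthogonal_matrix_def)
  ultimately have "unvec Y = unvec (act U (transpose H) (diag_vec \<iota> (\<chi> i. s i)))" by (simp add: unvec_act)
  then show ?thesis using that[of U "transpose H"] U(1) H(1) by (simp add: unvec_inject)
qed

text \<open>At a diagonal matrix the discriminant is a product over the diagonal entries, which is nonzero for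
  distinct positive integers.\<close>

lemma svd_discriminant_nonzero:
  fixes \<iota> :: "'n::finite \<Rightarrow> 't::finite"
  assumes \<iota>: "inj \<iota>"
  shows "\<exists>Y :: complex ^ ('n \<times> 't). svd_discriminant Y \<noteq> 0"
proof -
  obtain idx :: "'n \<Rightarrow> nat" where idx: "inj idx" using finite_imp_inj_to_nat_seg[of "UNIV :: 'n set"] by auto
  define s :: "complex ^ 'n" where "s = (\<chi> i. of_nat (Suc (idx i)))"
  define d where "d i = (s $ i)\<^sup>2" for i
  have d_nat: "d i = of_nat ((Suc (idx i))\<^sup>2)" for i by (simp only: d_def s_def vec_lambda_beta of_nat_power)
  have inj: "d i = d j \<longleftrightarrow> i = j" for i j
    unfolding d_nat of_nat_eq_iff using idx by (simp add: inj_eq)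
  have d0: "d i \<noteq> 0" for i unfolding d_nat of_nat_eq_0_iff by simp
  let ?Y = "diag_vec \<iota> s"
  have W: "gram ?Y = mat 1 ** diag_mat d ** transpose (mat 1)"
    by (simp add: gram_diag_vec[OF \<iota>] transpose_mat d_def[symmetric])
  have id: "orthogonal_matrix (mat 1 :: complex ^ 'n ^ 'n)" by (simp add: orthogonal_matrix_def transpose_mat)
  let ?p = "charpoly (gram ?Y)"
  have p: "?p = (\<Prod>i\<in>UNIV. [:- d i, 1:])"
    unfolding charpoly_def W
    by (subst det_diagonal) (auto simp: charpoly_mat_def diag_mat_def transpose_mat intro!: prod.cong)
  have p': "poly (pderiv ?p) (d i) \<noteq> 0" for i
  proof -
    have "poly (pderiv ?p) (d i) = (\<Sum>j\<in>UNIV. \<Prod>k\<in>UNIV - {j}. d i - d k)"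
      by (simp add: p pderiv_prod poly_sum poly_prod pderiv_pCons)
    also have "\<dots> = (\<Sum>j\<in>UNIV. if j = i then \<Prod>k\<in>UNIV - {i}. d i - d k else 0)"
      by (rule sum.cong) (auto intro!: prod_zero)
    also have "\<dots> \<noteq> 0" using inj by auto
    finally show ?thesis .
  qed
  have "det (mat_poly CARD('n) (pderiv ?p) (gram ?Y)) \<noteq> 0"
  proof -
    have "degree (pderiv ?p) \<le> CARD('n)" by (simp add: degree_pderiv degree_charpoly)
    from mat_poly_conjugate[OF id this, of d]
    have "det (mat_poly CARD('n) (pderiv ?p) (gram ?Y)) = (\<Prod>i\<in>UNIV. poly (pderiv ?p) (d i))"
      unfolding W[symmetric] by (simp only: det_orthogonal_conjugate[OF id])
    then show ?thesis using p' by simp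
  qed
  moreover have "det (gram ?Y) \<noteq> 0" unfolding W det_orthogonal_conjugate[OF id] using d0 by simp
  ultimately show ?thesis unfolding svd_discriminant_def by (intro exI[of _ ?Y]) simp
qed


section \<open>Signed permutations\<close>

definition sperms :: "('a::field ^ 'n \<Rightarrow> 'a ^ 'n) set" where
  "sperms = {sperm e p |e p. e \<in> signs \<and> p permutes UNIV}"

lemma finite_signs: "finite (signs :: ('n::finite \<Rightarrow> 'a::field) set)"
  unfolding signs_PiE by (intro finite_PiE) auto

lemma finite_sperms: "finite (sperms :: ('a::field ^ 'n \<Rightarrow> 'a ^ 'n) set)"
proof -
  have "sperms = (\<lambda>(e, p). sperm e p) ` ((signs :: ('n \<Rightarrow> 'a) set) \<times> {p. p permutes UNIV})"
    by (auto simp: sperms_def)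
  also have "finite \<dots>"
    by (intro finite_imageI finite_cartesian_product finite_signs finite_permutations finite)
  finally show ?thesis .
qed

lemma sperm_comp: "sperm e p (sperm e' p' x) = sperm (\<lambda>i. e i * e' (p i)) (p' \<circ> p) x"
  by (simp add: sperm_def vec_eq_iff mult.assoc)

lemma signs_mult: "e \<in> signs \<Longrightarrow> e' \<in> signs \<Longrightarrow> (\<lambda>i. e i * e' (p i)) \<in> signs"
proof -
  assume "e \<in> signs" "e' \<in> signs"
  then have "(e i = 1 \<or> e i = -1)" "(e' (p i) = 1 \<or> e' (p i) = -1)" for i by (auto simp: signs_def)
  then show ?thesis unfolding signs_def by (smt (verit) mem_Collect_eq mult.right_neutral mult_minus1_right minus_minus)
qed

lemma sperms_comp: "g \<in> sperms \<Longrightarrow> h \<in> sperms \<Longrightarrow> g \<circ> h \<in> sperms"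
proof -
  assume "g \<in> sperms" "h \<in> sperms"
  then obtain e p e' p' where *: "g = sperm e p" "h = sperm e' p'" "e \<in> signs" "e' \<in> signs" "p permutes UNIV" "p' permutes UNIV"
    by (auto simp: sperms_def)
  have "g \<circ> h = sperm (\<lambda>i. e i * e' (p i)) (p' \<circ> p)" by (simp add: * fun_eq_iff sperm_comp)
  then show ?thesis using * signs_mult permutes_compose unfolding sperms_def by blast
qed

lemma sperms_inverse:
  assumes "g \<in> sperms" obtains h where "h \<in> sperms" "\<And>x. h (g x) = x" "\<And>x. g (h x) = x"
proof -
  obtain e p where g: "g = sperm e p" "e \<in> signs" "p permutes UNIV" using assms by (auto simp: sperms_def)
  let ?h = "sperm (\<lambda>i. e (inv p i)) (inv p)"
  show ?thesis
  proof
    show "?h \<in> sperms" using g permutes_inv[OF g(3)] unfolding sperms_def signs_def by blast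
    show "?h (g x) = x" "g (?h x) = x" for x
      using sign_square[OF g(2)] by (auto simp: g(1) sperm_def vec_eq_iff permutes_inverses[OF g(3)] mult.assoc[symmetric])
  qed
qed

lemma sperms_id: "id \<in> sperms"
proof -
  have "id = sperm (\<lambda>_. 1) id" by (simp add: sperm_def fun_eq_iff vec_eq_iff)
  moreover have "(\<lambda>_. 1) \<in> signs" by (simp add: signs_def)
  ultimately show ?thesis using permutes_id unfolding sperms_def by blast
qed

lemma sperm_sign_in_sperms: "e \<in> signs \<Longrightarrow> sperm e id \<in> sperms"
  using permutes_id unfolding sperms_def by blast

lemma linear_sperms: "g \<in> sperms \<Longrightarrow> Vector_Spaces.linear (*s) (*s) g"
  by unfold_locales (auto simp: sperms_def sperm_def vec_eq_iff algebra_simps)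

lemma poly_fun_sperms: "g \<in> sperms \<Longrightarrow> poly_fun (\<lambda>x. g x $ i)"
  by (clarsimp simp: sperms_def sperm_def) (rule poly_fun_mult[OF poly_fun_const poly_fun_coord])

text \<open>The product over the group is invariant, so it is a multiple of its average.\<close>

lemma invariant_product_extension:
  fixes H :: "'a::field_char_0 ^ 'n::finite \<Rightarrow> 'a" and \<iota> :: "'n \<Rightarrow> 't::finite"
  assumes H: "poly_fun H" and \<iota>: "inj \<iota>"
  shows "\<exists>F. poly_fun F \<and> (\<forall>U V x. orthogonal_matrix U \<and> orthogonal_matrix V \<longrightarrow>
    (F (act U V (diag_vec \<iota> x)) \<noteq> 0 \<longleftrightarrow> (\<forall>g\<in>sperms. H (g x) \<noteq> 0)))"
proof -
  define H' where "H' x = (\<Prod>g\<in>sperms. H (g x))" for x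
  have "poly_fun H'" unfolding H'_def by (intro poly_fun_prod poly_fun_compose[OF H] poly_fun_sperms)
  then obtain F where F: "poly_fun F" "\<forall>U V x. orthogonal_matrix U \<and> orthogonal_matrix V \<longrightarrow>
    F (act U V (diag_vec \<iota> x)) = (\<Sum>e\<in>signs. \<Sum>p | p permutes UNIV. H' (sperm e p x))"
    using invariant_extension[OF _ \<iota>] by blast
  have inv: "H' (h x) = H' x" if h: "h \<in> sperms" for h x
  proof -
    obtain h' where h': "h' \<in> sperms" "\<And>x. h (h' x) = x" using sperms_inverse[OF h] by metis
    have inj: "inj_on (\<lambda>g. g \<circ> h) sperms" by (rule inj_onI) (metis comp_apply ext h'(2))
    have "(\<lambda>g. g \<circ> h) ` sperms \<subseteq> sperms" using sperms_comp h by blast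
    then have img: "(\<lambda>g. g \<circ> h) ` sperms = sperms" by (rule endo_inj_surj[OF finite_sperms _ inj])
    have "H' (h x) = (\<Prod>g\<in>sperms. H ((g \<circ> h) x))" by (simp add: H'_def)
    also have "\<dots> = (\<Prod>g\<in>(\<lambda>g. g \<circ> h) ` sperms. H (g x))" by (subst prod.reindex[OF inj]) simp
    finally show ?thesis by (simp add: img H'_def)
  qed
  define N where "N = card (signs :: ('n \<Rightarrow> 'a) set) * card {p. p permutes (UNIV :: 'n set)}"
  have "(\<lambda>_. 1) \<in> (signs :: ('n \<Rightarrow> 'a) set)" by (simp add: signs_def)
  then have "card (signs :: ('n \<Rightarrow> 'a) set) \<noteq> 0" using finite_signs by (auto simp: card_eq_0_iff)
  moreover have "card {p. p permutes (UNIV :: 'n set)} \<noteq> 0" by (simp add: card_permutations)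
  ultimately have N: "N \<noteq> 0" by (simp add: N_def)
  have "F (act U V (diag_vec \<iota> x)) = of_nat N * H' x"
    if "orthogonal_matrix U" "orthogonal_matrix V" for U V x
  proof -
    have "(\<Sum>e\<in>signs. \<Sum>p | p permutes UNIV. H' (sperm e p x)) = (\<Sum>e\<in>(signs :: ('n \<Rightarrow> 'a) set). \<Sum>p | p permutes (UNIV :: 'n set). H' x)"
      by (intro sum.cong refl inv) (auto simp: sperms_def)
    then show ?thesis using F(2) that by (simp add: N_def)
  qed
  then show ?thesis using F(1) N by (intro exI[of _ F]) (simp add: H'_def finite_sperms)
qed

section \<open>The complex variety of an invariant arrangement\<close>

text \<open>A complement of the kernel.\<close>

lemma linear_injective_part:
  fixes f :: "'a::field ^ 'p \<Rightarrow> 'a ^ 'm"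
  assumes f: "Vector_Spaces.linear (*s) (*s) f"
  obtains Q where "vec.subspace Q" "inj_on f Q" "vec.dim Q = vec.dim (range f)"
proof -
  interpret f: Vector_Spaces.linear "(*s)" "(*s)" f by (rule f)
  obtain B where B: "B \<subseteq> range f" "vec.independent B" "card B = vec.dim (range f)" using vec.basis_exists by metis
  have "\<forall>b\<in>B. \<exists>v. f v = b" using B(1) by blast
  then obtain pre where pre: "\<forall>b\<in>B. f (pre b) = b" by (rule bchoice[THEN exE])
  have img: "f ` pre ` B = B" using pre by (force simp: image_image)
  have "inj_on f (pre ` B)" using pre by (auto simp: inj_on_def)
  then have inj: "inj_on f (vec.span (pre ` B))"
    using f.inj_on_span_iff_independent_image[of "pre ` B"] B(2) img by simp
  have sub: "vec.subspace (vec.span (pre ` B))" by simp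
  have "vec.dim (vec.span (pre ` B)) = vec.dim (f ` vec.span (pre ` B))" by (rule dim_image_inj[OF f sub inj, symmetric])
  also have "f ` vec.span (pre ` B) = vec.span B" using f.span_image[of "pre ` B"] img by simp
  also have "vec.dim (vec.span B) = vec.dim (range f)" using vec.dim_span_eq_card_independent[OF B(2)] B(3) by simp
  finally show ?thesis using that[OF sub inj] by blast
qed

lemma dim_injective_image_le:
  fixes f :: "'a::field ^ 'p \<Rightarrow> 'a ^ 'm"
  assumes f: "Vector_Spaces.linear (*s) (*s) f" and inj: "inj f" and T: "vec.subspace T" and sub: "f ` T \<subseteq> T'"
  shows "vec.dim T \<le> vec.dim T'"
  using dim_image_inj[OF f T inj_on_subset[OF inj]] vec.dim_subset[OF sub] by simp

lemma act_inj:
  assumes "orthogonal_matrix U" "orthogonal_matrix V" shows "inj (act U V)"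
proof (rule injI)
  fix x y assume "act U V x = act U V y"
  then have "act (transpose U) (transpose V) (act U V x) = act (transpose U) (transpose V) (act U V y)" by simp
  then show "x = y" using assms by (simp add: act_act orthogonal_matrix_def)
qed

lemma tangent_space_act:
  fixes W :: "(complex ^ ('n::finite \<times> 't::finite)) set"
  assumes W: "act U V ` W \<subseteq> W'" and v: "v \<in> tangent_space W x"
  shows "act U V v \<in> tangent_space W' (act U V x)"
  unfolding tangent_space_def
proof (clarify)
  fix f assume f: "poly_fun f" "\<forall>w\<in>W'. f w = 0"
  have "poly_fun (\<lambda>x. f (act U V x))" by (rule poly_fun_compose[OF f(1) poly_fun_act])
  moreover have "\<forall>w\<in>W. f (act U V w) = 0" using W f(2) by blast
  ultimately have "frechet_derivative (\<lambda>x. f (act U V x)) (at x) v = 0"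
    using v unfolding tangent_space_def by blast
  moreover have "frechet_derivative (\<lambda>x. f (act U V x)) (at x) v = frechet_derivative f (at (act U V x)) (jac (act U V) x v)"
    using poly_fun_chain_rule[OF f(1), of "act U V" x v] cdiff_poly_fun[OF poly_fun_act] by blast
  moreover have "jac (act U V) x v = act U V v"
  proof -
    have "frechet_derivative (\<lambda>x. act U V x $ p) (at x) v = act U V v $ p" for p
    proof -
      have "((\<lambda>x. act U V x $ p) has_derivative (\<lambda>v. act U V v $ p)) (at x)"
      proof (intro bounded_linear_imp_has_derivative linear_conv_bounded_linear[THEN iffD1] linearI)
        fix r :: real and x :: "complex ^ ('n \<times> 't)"
        show "act U V (r *\<^sub>R x) $ p = r *\<^sub>R act U V x $ p"
          by (simp add: act_component flip: scaleR_sum_right)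
      qed (simp add: act_add)
      from frechet_derivative_at[OF this] show ?thesis by metis
    qed
    then show ?thesis by (simp add: jac_def vec_eq_iff)
  qed
  ultimately show "frechet_derivative f (at (act U V x)) (act U V v) = 0" by simp
qed

lemma lie_act_act:
  assumes P: "orthogonal_matrix P" and Q: "orthogonal_matrix Q"
  shows "lie_act A B (act P Q z) = act P Q (lie_act (transpose P ** A ** P) (transpose Q ** B ** Q) z)"
proof -
  have "unvec (act P Q (lie_act (transpose P ** A ** P) (transpose Q ** B ** Q) z)) =
    (P ** transpose P) ** A ** P ** unvec z ** transpose Q + P ** unvec z ** transpose Q ** transpose B ** (Q ** transpose Q)"
    by (simp add: unvec_act lie_act_def matrix_mul_add_left matrix_mul_add_right matrix_transpose_mul matrix_mul_assoc)
  also have "\<dots> = unvec (lie_act A B (act P Q z))"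
    using P Q by (simp add: orthogonal_matrix_def lie_act_def unvec_act matrix_mul_assoc)
  finally show ?thesis by (simp add: unvec_inject)
qed

lemma skew_conjugate: "skew A \<Longrightarrow> skew (transpose P ** A ** P)"
  by (simp add: skew_def matrix_transpose_mul matrix_mul_assoc matrix_mul_uminus_left matrix_mul_uminus_right)

lemma diag_vec_add: "diag_vec \<iota> (x + y) = diag_vec \<iota> x + diag_vec \<iota> (y :: 'a::field ^ 'n)"
  and diag_vec_diff: "diag_vec \<iota> (x - y) = diag_vec \<iota> x - diag_vec \<iota> y"
  by (auto simp: diag_vec_def vec_eq_iff)

lemma diag_vec_inject: "diag_vec \<iota> x = diag_vec \<iota> y \<longleftrightarrow> x = y"
proof
  assume *: "diag_vec \<iota> x = diag_vec \<iota> y"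
  have "x $ i = y $ i" for i using arg_cong[OF *, of "\<lambda>z. z $ (i, \<iota> i)"] by (simp add: diag_vec_def)
  then show "x = y" by (simp add: vec_eq_iff)
qed simp

text \<open>A diagonal entry of \<open>lie_act A B\<close> at a diagonal matrix only involves diagonal entries of \<open>A\<close> and \<open>B\<close>,
  and these vanish.\<close>

lemma bil_diag_lie_act:
  fixes y s :: "'a::field_char_0 ^ 'n::finite"
  assumes "skew A" "skew B" "inj \<iota>"
  shows "bil (diag_vec \<iota> s) (lie_act A B (diag_vec \<iota> y)) = 0"
proof -
  have "A $ i $ i = 0" for i using skew_component[OF assms(1), of i i] by simp
  moreover have "B $ j $ j = 0" for j using skew_component[OF assms(2), of j j] by simp
  ultimately have "lie_act A B (diag_vec \<iota> y) $ (i, \<iota> i) = 0" for i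
    unfolding lie_act_component diag_vec_def
    using assms(3) by (simp add: inj_eq if_distrib[of "\<lambda>x. _ * x"] if_distrib[of "\<lambda>x. x * _"] cong: if_cong)
  then show ?thesis by (simp add: bil_diag_vec)
qed

lemma poly_fun_diag_vec:
  assumes "\<And>i. poly_fun (\<lambda>x. f x $ i)" shows "poly_fun (\<lambda>x. diag_vec \<iota> (f x) $ p)"
  unfolding diag_vec_def by (cases "snd p = \<iota> (fst p)") (auto intro: assms poly_fun_const)

text \<open>A proper inclusion of irreducible closed sets raises the transcendence degree.\<close>

lemma irreducible_eq_if_dim_eq:
  fixes Z Z' :: "(complex ^ 'm) set"
  assumes "zariski_irreducible Z" "closedin zariski Z" "zariski_irreducible Z'" "Z \<subseteq> Z'"
    and dim: "enat r \<le> variety_dim Z" and tr: "trdeg_le Z' r"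
  shows "Z = Z'"
proof (rule ccontr)
  assume "Z \<noteq> Z'"
  then obtain x where x: "x \<in> Z'" "x \<notin> Z" using assms(4) by auto
  obtain f where f: "poly_fun f" "\<forall>z\<in>Z. f z = 0" "f x \<noteq> 0"
    using closedin_zariski_separating_poly[OF assms(2) x(2)] .
  have "\<exists>fs. length fs = r \<and> (\<forall>f\<in>set fs. poly_fun f) \<and> alg_indep Z fs"
  proof (cases r)
    case 0
    then show ?thesis using alg_indep_Nil[of Z] assms(1) by (auto simp: zariski_irreducible_def)
  next
    case (Suc q)
    have "\<not> trdeg_le Z q"
    proof
      assume "trdeg_le Z q"
      from trdeg_le_imp_variety_dim_le[OF this] have "enat r \<le> enat q" using dim order_trans by blast
      then show False using Suc by simp
    qed
    then show ?thesis using Suc unfolding trdeg_le_def by blast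
  qed
  then obtain fs where fs: "length fs = r" "\<forall>f\<in>set fs. poly_fun f" "alg_indep Z fs" by blast
  have "alg_indep Z' (fs @ [f])"
  proof (rule alg_indep_snoc_vanishing[OF fs(3) assms(4)])
    show "x \<in> Z'" "f x \<noteq> 0" by (rule x f)+
    show "domain_on Z' {f. poly_fun f}" by (rule domain_on_poly_fun[OF assms(3)])
  qed (use f fs subalgebra_poly_fun in auto)
  then show False using tr fs f unfolding trdeg_le_def by (auto dest!: spec[of _ "fs @ [f]"])
qed


definition aff :: "'a::field ^ 'n \<Rightarrow> 'a ^ 'n ^ 'n \<Rightarrow> 'a ^ 'n \<Rightarrow> 'a ^ 'n" where
  "aff c Q s = c + Q *v s"

text \<open>The parameters at which both Cayley transforms are the identity.\<close>

definition embed_diag :: "complex ^ 'n::finite \<Rightarrow> complex ^ (('n \<times> 'n) + (('t::finite \<times> 't) + 'n))" where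
  "embed_diag s = (\<chi> p. case p of Inl _ \<Rightarrow> 0 | Inr (Inl _) \<Rightarrow> 0 | Inr (Inr i) \<Rightarrow> s $ i)"

lemma gen_embed_diag: "genA (embed_diag s) = 0" "genB (embed_diag s) = 0" "genY (embed_diag s) = s"
  by (simp_all add: embed_diag_def genA_def genB_def genY_def vec_eq_iff)

lemma poly_fun_embed_diag: "poly_fun (\<lambda>s. embed_diag s $ p)"
proof (cases p)
  case (Inr q)
  then show ?thesis by (cases q) (simp_all add: embed_diag_def poly_fun_const poly_fun_coord)
qed (simp add: embed_diag_def poly_fun_const)

lemma skew_sum_symmetric:
  fixes M :: "complex ^ 'k ^ 'k"
  assumes M: "skew M" and f: "\<And>i k. f i k = f k i"
  shows "(\<Sum>i\<in>UNIV. \<Sum>k\<in>UNIV. M $ i $ k * f i k) = 0"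
proof -
  let ?S = "\<Sum>i\<in>UNIV. \<Sum>k\<in>UNIV. M $ i $ k * f i k"
  have "?S = (\<Sum>k\<in>UNIV. \<Sum>i\<in>UNIV. M $ i $ k * f i k)" by (rule sum.swap)
  also have "\<dots> = (\<Sum>k\<in>UNIV. \<Sum>i\<in>UNIV. - (M $ k $ i * f k i))"
  proof (intro sum.cong refl)
    fix i k
    show "M $ i $ k * f i k = - (M $ k $ i * f k i)"
      using skew_component[OF M, of i k] f[of i k] by simp
  qed
  also have "\<dots> = - ?S" by (simp add: sum_negf)
  finally show ?thesis by simp
qed

text \<open>The orbit of \<open>x\<close> under orthogonal matrices stays on the quadric \<open>bil x x\<close> = constant, so its
  directions are orthogonal to \<open>x\<close>.\<close>

lemma skew_bil_lie_act:
  fixes x :: "complex ^ ('n::finite \<times> 't::finite)"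
  assumes "skew A" "skew B"
  shows "bil x (lie_act A B x) = 0"
proof -
  have "bil x (lie_act A B x) = (\<Sum>i\<in>UNIV. \<Sum>j\<in>UNIV. \<Sum>k\<in>UNIV. A $ i $ k * (x $ (i, j) * x $ (k, j))) +
    (\<Sum>i\<in>UNIV. \<Sum>j\<in>UNIV. \<Sum>k\<in>UNIV. B $ j $ k * (x $ (i, j) * x $ (i, k)))"
    unfolding bil_pairs lie_act_component distrib_left sum.distrib sum_distrib_left
    by (intro arg_cong2[where f = "(+)"] sum.cong refl) (simp_all add: mult_ac)
  also have "(\<Sum>i\<in>UNIV. \<Sum>j\<in>UNIV. \<Sum>k\<in>UNIV. A $ i $ k * (x $ (i, j) * x $ (k, j))) =
    (\<Sum>i\<in>UNIV. \<Sum>k\<in>UNIV. A $ i $ k * (\<Sum>j\<in>UNIV. x $ (i, j) * x $ (k, j)))"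
    unfolding sum_distrib_left by (intro sum.cong refl sum.swap)
  also have "\<dots> = 0" by (rule skew_sum_symmetric[OF assms(1)]) (simp add: mult.commute)
  also have "(\<Sum>i\<in>UNIV. \<Sum>j\<in>UNIV. \<Sum>k\<in>UNIV. B $ j $ k * (x $ (i, j) * x $ (i, k))) =
    (\<Sum>j\<in>UNIV. \<Sum>k\<in>UNIV. B $ j $ k * (\<Sum>i\<in>UNIV. x $ (i, j) * x $ (i, k)))"
    unfolding sum_distrib_left by (subst sum.swap) (intro sum.cong refl sum.swap)
  also have "\<dots> = 0" by (rule skew_sum_symmetric[OF assms(2)]) (simp add: mult.commute)
  finally show ?thesis by simp
qed

text \<open>The complexified arrangement: \<open>aff (c i) (Q i)\<close> is the orthogonal projection onto the \<open>i\<close>-th affine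
  subspace, which is its range. Thus \<open>c i\<close> is the point of the subspace closest to the origin, and
  \<open>Q i\<close> is the projection onto the direction space.\<close>

locale complex_arrangement =
  fixes \<iota> :: "'n::finite \<Rightarrow> 't::finite" and k :: nat
    and c :: "nat \<Rightarrow> complex ^ 'n" and Q :: "nat \<Rightarrow> complex ^ 'n ^ 'n"
  assumes inj_\<iota>: "inj \<iota>"
    and sym: "\<And>i. i \<in> {1..k} \<Longrightarrow> transpose (Q i) = Q i"
    and idem: "\<And>i. i \<in> {1..k} \<Longrightarrow> Q i ** Q i = Q i"
    and normal: "\<And>i. i \<in> {1..k} \<Longrightarrow> Q i *v c i = 0"
    and invariant: "\<And>i g. i \<in> {1..k} \<Longrightarrow> g \<in> sperms \<Longrightarrow>
      \<exists>l\<in>{1..k}. g ` range (aff (c i) (Q i)) = range (aff (c l) (Q l))"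
    and antichain: "\<And>i j. i \<in> {1..k} \<Longrightarrow> j \<in> {1..k} \<Longrightarrow>
      range (aff (c i) (Q i)) \<subseteq> range (aff (c j) (Q j)) \<Longrightarrow> i = j"
begin

abbreviation dg :: "complex ^ 'n \<Rightarrow> complex ^ ('n \<times> 't)" where "dg \<equiv> diag_vec \<iota>"
abbreviation P :: "nat \<Rightarrow> complex ^ 'n \<Rightarrow> complex ^ 'n" where "P i \<equiv> aff (c i) (Q i)"

definition G :: "nat \<Rightarrow> complex ^ 'n ^ ('n \<times> 't)" where
  "G i = (\<chi> p j. if snd p = \<iota> (fst p) then Q i $ fst p $ j else 0)"

lemma G_mult: "G i *v y = dg (Q i *v y)"
  by (auto simp: G_def matrix_vector_mult_def diag_vec_def vec_eq_iff)

abbreviation param :: "nat \<Rightarrow> complex ^ (('n \<times> 'n) + (('t \<times> 't) + 'n)) \<Rightarrow> complex ^ ('n \<times> 't)" where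
  "param i \<equiv> orbit_param (dg (c i)) (G i)"

text \<open>The closure of the set of all matrices with the \<open>i\<close>-th affine subspace as diagonals, moved around
  by orthogonal matrices.\<close>

definition Z :: "nat \<Rightarrow> (complex ^ ('n \<times> 't)) set" where
  "Z i = rational_param.variety (param i) orbit_den"

definition W :: "(complex ^ ('n \<times> 't)) set" where
  "W = (\<Union>i\<in>{1..k}. Z i)"

lemma dg_P: "dg (c i) + G i *v y = dg (P i y)"
  by (simp add: G_mult aff_def diag_vec_add)

lemma param_eq: "param i u = act (cayley (genA u)) (cayley (genB u)) (dg (P i (genY u)))"
  by (simp add: orbit_param_def dg_P)

text \<open>The closure of the image of a rational map. Its dimension is the generic rank of the
  differential: the rank bounds the transcendence degree from above, and chains of slices bound the
  dimension from below.\<close>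

lemma rational_param: "rational_param (param i) orbit_den"
  by (rule rational_param_orbit)

lemma params_iff:
  fixes u :: "complex ^ (('n \<times> 'n) + (('t \<times> 't) + 'n))"
  shows "u \<in> rational_param.params orbit_den \<longleftrightarrow> orbit_den u \<noteq> 0"
  unfolding rational_param.params_def[OF rational_param] by simp

lemma Z_irreducible: "zariski_irreducible (Z i)" and Z_closed: "closedin zariski (Z i)"
  unfolding Z_def by (rule rational_param.irreducible[OF rational_param] rational_param.closed[OF rational_param])+

lemma W_closed: "closedin zariski W"
  unfolding W_def by (intro closedin_Union) (auto simp: Z_closed)

lemma param_in_Z: "orbit_den u \<noteq> 0 \<Longrightarrow> param i u \<in> Z i"
  unfolding Z_def rational_param.variety_def[OF rational_param]
  by (rule subsetD[OF zariski_closure_subset]) (simp add: params_iff)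

lemma Z_invariant:
  assumes "skew A" "det (mat 2 - A) \<noteq> 0" "skew B" "det (mat 2 - B) \<noteq> 0" "x \<in> Z i"
  shows "act (cayley A) (cayley B) x \<in> Z i"
  using orbit_variety_invariant[OF assms(1-4)] assms(5) unfolding Z_def .

lemma act_cayley_inverse:
  fixes A :: "complex ^ 'n ^ 'n" and B :: "complex ^ 't ^ 't"
  assumes A: "skew A" "det (mat 2 - A) \<noteq> 0" and B: "skew B" "det (mat 2 - B) \<noteq> 0"
  shows "act (cayley (- A)) (cayley (- B)) (act (cayley A) (cayley B) x) = x"
    "act (cayley A) (cayley B) (act (cayley (- A)) (cayley (- B)) x) = x"
    "skew (- A)" "det (mat 2 - (- A)) \<noteq> 0" "skew (- B)" "det (mat 2 - (- B)) \<noteq> 0"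
  using cayley_uminus[OF A] cayley_uminus[OF B] skew_uminus A B skew_det[OF A(1)] skew_det[OF B(1)]
  by (simp_all add: act_act)

lemma Z_invariant_iff:
  assumes A: "skew A" "det (mat 2 - A) \<noteq> 0" and B: "skew B" "det (mat 2 - B) \<noteq> 0"
  shows "act (cayley A) (cayley B) x \<in> Z i \<longleftrightarrow> x \<in> Z i"
  using Z_invariant[OF A B] Z_invariant[OF act_cayley_inverse(3-6)[OF A B], of "act (cayley A) (cayley B) x"]
  by (auto simp: act_cayley_inverse[OF A B])

lemma embed_diag_den: "orbit_den (embed_diag s) \<noteq> 0"
  by (rule orbit_den_nonzero) (simp_all add: gen_embed_diag)

lemma diag_in_Z: "dg (P i s) \<in> Z i"
  using param_in_Z[OF embed_diag_den, of i s] by (simp add: param_eq gen_embed_diag cayley_0)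

text \<open>The image of the differential at a diagonal point; by the next lemma it is spanned by the orbit
  directions and the directions along the affine subspace.\<close>

definition E :: "nat \<Rightarrow> complex ^ 'n \<Rightarrow> (complex ^ ('n \<times> 't)) set" where
  "E i s = range (jac (param i) (embed_diag s))"

lemma E_iff: "z \<in> E i s \<longleftrightarrow> (\<exists>A B y. skew A \<and> skew B \<and> z = lie_act A B (dg (P i s)) + dg (Q i *v y))"
proof -
  have "jac (param i) (embed_diag s) v = lie_act (genA v) (genB v) (dg (P i s)) + dg (Q i *v genY v)" for v
    using jac_orbit_at_0[of "embed_diag s" "dg (c i)" "G i" v]
    unfolding dg_P G_mult[of i "genY v"] by (simp add: gen_embed_diag)
  note jac = this
  show ?thesis
  proof
    assume "z \<in> E i s"
    then obtain v where "z = jac (param i) (embed_diag s) v" unfolding E_def by blast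
    then show "\<exists>A B y. skew A \<and> skew B \<and> z = lie_act A B (dg (P i s)) + dg (Q i *v y)"
      unfolding jac
      by (intro exI[of _ "genA v"] exI[of _ "genB v"] exI[of _ "genY v"] conjI skew_genA skew_genB)
  next
    assume "\<exists>A B y. skew A \<and> skew B \<and> z = lie_act A B (dg (P i s)) + dg (Q i *v y)"
    then obtain A B y where AB: "skew A" "skew B" and z: "z = lie_act A B (dg (P i s)) + dg (Q i *v y)" by blast
    obtain v where v: "genA v = A" "genB v = B" "genY v = y" using gen_surj[OF AB] .
    then have "z = jac (param i) (embed_diag s) v" unfolding jac z by simp
    then show "z \<in> E i s" unfolding E_def by (rule range_eqI)
  qed
qed

lemma param_embed_diag: "param i (embed_diag s) = dg (P i s)"
  by (simp add: param_eq gen_embed_diag cayley_0)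

lemma E_subset_tangent_space: "E i s \<subseteq> tangent_space (Z i) (dg (P i s))"
  using rational_param.jac_in_tangent_space[OF rational_param, of "embed_diag s"]
  by (auto simp: E_def Z_def params_iff embed_diag_den param_embed_diag)

lemma cdiff_param: "orbit_den u \<noteq> 0 \<Longrightarrow> cdiff (\<lambda>u. param i u $ b) u"
  using rational_param.cdiff_param[OF rational_param] by (simp add: params_iff)

lemma E_subspace: "vec.subspace (E i s)"
proof -
  interpret J: Vector_Spaces.linear "(*s)" "(*s)" "jac (param i) (embed_diag s)"
    by (rule jac_linear[OF cdiff_param[OF embed_diag_den]])
  show ?thesis unfolding E_def by (rule J.subspace_image) simp
qed

text \<open>The rank at diagonal points. All other points of the image are translates of diagonal points, so
  this is the generic rank of the parametrization.\<close>

definition rk :: "nat \<Rightarrow> nat" where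
  "rk i = Max (range (\<lambda>s. vec.dim (E i s)))"

lemma finite_dims: "finite (range (\<lambda>s. vec.dim (E i s)))"
proof (rule finite_subset)
  show "range (\<lambda>s. vec.dim (E i s)) \<subseteq> {..vec.dim (UNIV :: (complex ^ ('n \<times> 't)) set)}"
    using vec.dim_subset[OF subset_UNIV] by auto
qed simp

lemma dim_E_le_rk: "vec.dim (E i s) \<le> rk i"
  unfolding rk_def by (rule Max_ge[OF finite_dims]) simp

lemma rk_attained: "\<exists>s. vec.dim (E i s) = rk i"
  using Max_in[OF finite_dims, of i] unfolding rk_def by auto

lemma Z_trdeg_le: "trdeg_le (Z i) (rk i)"
  unfolding Z_def
proof (rule rational_param.trdeg_le_rank[OF rational_param])
  fix u :: "complex ^ (('n \<times> 'n) + (('t \<times> 't) + 'n))"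
  assume "u \<in> rational_param.params orbit_den"
  then have u: "orbit_den u \<noteq> 0" by (simp add: params_iff)
  let ?act = "act (cayley (genA u)) (cayley (genB u))"
  have "range (jac (param i) u) \<subseteq> ?act ` E i (genY u)"
  proof (rule image_subsetI)
    fix v
    obtain A B where AB: "skew A" "skew B" "jac (param i) u v =
        ?act (lie_act A B (dg (c i) + G i *v genY u) + G i *v genY v)"
      using jac_orbit_general[OF u] by blast
    have "lie_act A B (dg (c i) + G i *v genY u) + G i *v genY v \<in> E i (genY u)"
      unfolding E_iff dg_P G_mult[of i "genY v"] using AB by blast
    then show "jac (param i) u v \<in> ?act ` E i (genY u)" using AB(3) by blast
  qed
  then have "vec.dim (range (jac (param i) u)) \<le> vec.dim (?act ` E i (genY u))" by (rule vec.dim_subset)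
  also have "\<dots> \<le> vec.dim (E i (genY u))" by (rule vec.dim_image_le[OF linear_act])
  also have "\<dots> \<le> rk i" by (rule dim_E_le_rk)
  finally show "vec.dim (range (jac (param i) u)) \<le> rk i" .
qed

lemma Z_variety_dim: "variety_dim (Z i) = enat (rk i)"
proof (rule antisym)
  show "variety_dim (Z i) \<le> enat (rk i)" by (rule trdeg_le_imp_variety_dim_le[OF Z_trdeg_le])
  obtain s where s: "vec.dim (E i s) = rk i" using rk_attained by blast
  show "enat (rk i) \<le> variety_dim (Z i)"
    unfolding Z_def
    by (rule rational_param.variety_dim_ge_rank[OF rational_param, of "embed_diag s"])
      (use s in \<open>auto simp: params_iff embed_diag_den E_def\<close>)
qed

text \<open>Where \<open>generic i s\<close> holds, the point \<open>dg (P i s)\<close> lies in no component other than \<open>Z i\<close> and is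
  regular there, with tangent space \<open>E i s\<close>.\<close>

definition generic :: "nat \<Rightarrow> complex ^ 'n \<Rightarrow> bool" where
  "generic i s \<longleftrightarrow> vec.dim (tangent_space (Z i) (dg (P i s))) \<le> rk i \<and> rk i \<le> vec.dim (E i s) \<and>
     (\<forall>j\<in>{1..k}. dg (P i s) \<in> Z j \<longrightarrow> Z i \<subseteq> Z j)"

lemma poly_fun_P: "poly_fun (\<lambda>s. P i s $ b)"
  unfolding aff_def matrix_vector_mult_def vector_add_component vec_lambda_beta by (intro poly_fun_intros)

text \<open>The image of the parametrization is a union of translates of the affine subspace of diagonal
  points, so a polynomial that does not vanish on \<open>Z i\<close> does not vanish on one of these translates.\<close>

lemma nonvanishing_on_diagonal:
  assumes q: "poly_fun q" "\<exists>x\<in>Z i. q x \<noteq> 0"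
  obtains A B where "skew A" "det (mat 2 - A) \<noteq> 0" "skew B" "det (mat 2 - B) \<noteq> 0"
    "poly_fun (\<lambda>s. q (act (cayley A) (cayley B) (dg (P i s))))" "\<exists>s. q (act (cayley A) (cayley B) (dg (P i s))) \<noteq> 0"
proof -
  obtain u where u: "u \<in> rational_param.params orbit_den" "q (param i u) \<noteq> 0"
    using rational_param.nonvanishing_pullback[OF rational_param q(1)] q(2) unfolding Z_def by blast
  have "poly_fun (\<lambda>s. q (act (cayley (genA u)) (cayley (genB u)) (dg (P i s))))"
    by (intro poly_fun_compose[OF poly_fun_compose[OF q(1) poly_fun_act]] poly_fun_diag_vec poly_fun_P)
  then show ?thesis
    using u by (intro that[of "genA u" "genB u"]) (auto simp: skew_genA skew_genB params_iff orbit_den_det param_eq)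
qed

text \<open>Small tangent spaces and avoidance of other components are generic on \<open>Z i\<close> and invariant under
  orthogonal matrices. So they can be tested on a translate of the diagonal points, where they are
  guaranteed by nonzero polynomials in \<open>s\<close>. Maximal rank is an open condition on the diagonal points
  themselves.\<close>

lemma generic_polynomial: "\<exists>h. poly_fun h \<and> (\<exists>s. h s \<noteq> 0) \<and> (\<forall>s. h s \<noteq> 0 \<longrightarrow> generic i s)"
proof -
  have "\<exists>h1. poly_fun h1 \<and> (\<exists>s. h1 s \<noteq> 0) \<and> (\<forall>s. h1 s \<noteq> 0 \<longrightarrow> vec.dim (tangent_space (Z i) (dg (P i s))) \<le> rk i)"
  proof -
    obtain h where h: "poly_fun h" "\<exists>x\<in>Z i. h x \<noteq> 0"
      "\<forall>x\<in>Z i. h x \<noteq> 0 \<longrightarrow> vec.dim (tangent_space (Z i) x) \<le> rk i"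
      using trdeg_le_imp_tangent_dim_le[OF Z_irreducible Z_trdeg_le] by blast
    obtain A and B :: "complex ^ 't ^ 't" where AB: "skew A" "det (mat 2 - A) \<noteq> 0" "skew B" "det (mat 2 - B) \<noteq> 0"
      and q: "poly_fun (\<lambda>s. h (act (cayley A) (cayley B) (dg (P i s))))" "\<exists>s. h (act (cayley A) (cayley B) (dg (P i s))) \<noteq> 0"
      using nonvanishing_on_diagonal[OF h(1,2)] by metis
    have "vec.dim (tangent_space (Z i) (dg (P i s))) \<le> rk i" if s: "h (act (cayley A) (cayley B) (dg (P i s))) \<noteq> 0" for s
    proof -
      let ?a = "act (cayley A) (cayley B)"
      have "vec.dim (tangent_space (Z i) (dg (P i s))) \<le> vec.dim (tangent_space (Z i) (?a (dg (P i s))))"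
      proof (rule dim_injective_image_le[OF linear_act _ tangent_space_subspace])
        show "inj ?a" by (intro act_inj cayley_orthogonal AB)
        have "?a ` Z i \<subseteq> Z i" using Z_invariant[OF AB] by blast
        then show "?a ` tangent_space (Z i) (dg (P i s)) \<subseteq> tangent_space (Z i) (?a (dg (P i s)))"
          using tangent_space_act by blast
      qed
      also have "\<dots> \<le> rk i" using h(3) s Z_invariant[OF AB diag_in_Z] by blast
      finally show ?thesis .
    qed
    then show ?thesis using q by blast
  qed
  then obtain h1 where h1: "poly_fun h1" "\<exists>s. h1 s \<noteq> 0"
    "\<And>s. h1 s \<noteq> 0 \<Longrightarrow> vec.dim (tangent_space (Z i) (dg (P i s))) \<le> rk i" by blast
  have "\<exists>h2. poly_fun h2 \<and> (\<exists>s. h2 s \<noteq> 0) \<and> (\<forall>s. h2 s \<noteq> 0 \<longrightarrow> rk i \<le> vec.dim (E i s))"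
  proof -
    obtain s0 where s0: "vec.dim (E i s0) = rk i" using rk_attained by blast
    let ?J = "\<lambda>s. jac (param i) (embed_diag s)"
    have lin: "Vector_Spaces.linear (*s) (*s) (?J s)" for s by (rule jac_linear[OF cdiff_param[OF embed_diag_den]])
    obtain R where R: "vec.subspace R" "inj_on (?J s0) R" "vec.dim R = rk i"
      using linear_injective_part[OF lin[of s0]] s0 unfolding E_def by metis
    obtain g where g: "rational_on orbit_den g" "g (embed_diag s0) \<noteq> 0"
      "\<forall>u\<in>rational_param.params orbit_den. g u \<noteq> 0 \<longrightarrow> inj_on (jac (param i) u) R"
      using rational_param.injective_jac_open[OF rational_param _ R(1,2)] by (auto simp: params_iff embed_diag_den)
    obtain N q where q: "poly_fun q" "\<forall>u. orbit_den u \<noteq> 0 \<longrightarrow> g u * orbit_den u ^ N = q u"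
      using g(1) unfolding rational_on_def by blast
    have qe: "q (embed_diag s) \<noteq> 0 \<longleftrightarrow> g (embed_diag s) \<noteq> 0" for s
      using q(2) embed_diag_den[of s] by (metis mult_eq_0_iff power_not_zero)
    have "rk i \<le> vec.dim (E i s)" if s: "q (embed_diag s) \<noteq> 0" for s
    proof -
      have "inj_on (?J s) R" using g(3) s qe by (auto simp: params_iff embed_diag_den)
      then have "rk i = vec.dim (?J s ` R)" using dim_image_inj[OF lin R(1)] R(3) by simp
      also have "\<dots> \<le> vec.dim (E i s)" unfolding E_def by (rule vec.dim_subset) auto
      finally show ?thesis .
    qed
    moreover have "poly_fun (\<lambda>s. q (embed_diag s))" by (rule poly_fun_compose[OF q(1) poly_fun_embed_diag])
    ultimately show ?thesis using g(2) qe by (intro exI[of _ "\<lambda>s. q (embed_diag s)"]) blast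
  qed
  then obtain h2 where h2: "poly_fun h2" "\<exists>s. h2 s \<noteq> 0" "\<And>s. h2 s \<noteq> 0 \<Longrightarrow> rk i \<le> vec.dim (E i s)" by blast
  have "\<exists>h. poly_fun h \<and> (\<exists>s. h s \<noteq> 0) \<and> (\<forall>s. h s \<noteq> 0 \<longrightarrow> dg (P i s) \<in> Z j \<longrightarrow> Z i \<subseteq> Z j)" for j
  proof (cases "Z i \<subseteq> Z j")
    case True
    then show ?thesis by (intro exI[of _ "\<lambda>_. 1"]) (auto intro: poly_fun_const)
  next
    case False
    then obtain x where x: "x \<in> Z i" "x \<notin> Z j" by blast
    obtain q where q: "poly_fun q" "\<forall>z\<in>Z j. q z = 0" "q x \<noteq> 0"
      using closedin_zariski_separating_poly[OF Z_closed x(2)] .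
    obtain A and B :: "complex ^ 't ^ 't" where AB: "skew A" "det (mat 2 - A) \<noteq> 0" "skew B" "det (mat 2 - B) \<noteq> 0"
      and h: "poly_fun (\<lambda>s. q (act (cayley A) (cayley B) (dg (P i s))))" "\<exists>s. q (act (cayley A) (cayley B) (dg (P i s))) \<noteq> 0"
      using nonvanishing_on_diagonal[OF q(1), of i] q(3) x(1) by metis
    show ?thesis
      by (rule exI[of _ "\<lambda>s. q (act (cayley A) (cayley B) (dg (P i s)))"]) (use h q(2) Z_invariant[OF AB] in blast)
  qed
  then obtain h3 where h3: "\<And>j. poly_fun (h3 j)" "\<And>j. \<exists>s. h3 j s \<noteq> 0"
    "\<And>j s. h3 j s \<noteq> 0 \<Longrightarrow> dg (P i s) \<in> Z j \<Longrightarrow> Z i \<subseteq> Z j" by metis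
  obtain a where a: "\<forall>j\<in>{1..k}. h3 j a \<noteq> 0"
    using poly_fun_nonzero_common[of "{1..k}" h3] h3(1,2) by blast
  have p3: "poly_fun (\<lambda>s. \<Prod>j\<in>{1..k}. h3 j s)" by (intro poly_fun_prod h3)
  have "(\<Prod>j\<in>{1..k}. h3 j a) \<noteq> 0" using a by simp
  then obtain b where b: "h1 b \<noteq> 0" "(\<Prod>j\<in>{1..k}. h3 j b) \<noteq> 0"
    using poly_fun_nonzero_common2[OF h1(1) _ p3] h1(2) by blast
  have p13: "poly_fun (\<lambda>s. h1 s * (\<Prod>j\<in>{1..k}. h3 j s))" by (intro poly_fun_mult h1 p3)
  have "h1 b * (\<Prod>j\<in>{1..k}. h3 j b) \<noteq> 0" using b by simp
  then obtain d where d: "h2 d \<noteq> 0" "h1 d * (\<Prod>j\<in>{1..k}. h3 j d) \<noteq> 0"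
    using poly_fun_nonzero_common2[OF h2(1) _ p13] h2(2) by blast
  show ?thesis
  proof (intro exI conjI allI impI)
    show "poly_fun (\<lambda>s. h2 s * (h1 s * (\<Prod>j\<in>{1..k}. h3 j s)))" by (intro poly_fun_mult h2(1) p13)
    show "h2 d * (h1 d * (\<Prod>j\<in>{1..k}. h3 j d)) \<noteq> 0" using d by simp
    fix s assume s: "h2 s * (h1 s * (\<Prod>j\<in>{1..k}. h3 j s)) \<noteq> 0"
    then have "h3 j s \<noteq> 0" if "j \<in> {1..k}" for j using that by auto
    then have "\<forall>j\<in>{1..k}. dg (P i s) \<in> Z j \<longrightarrow> Z i \<subseteq> Z j" using h3(3) by blast
    then show "generic i s" unfolding generic_def using s h1(3) h2(3) by auto
  qed
qed

lemma P_fixed: "i \<in> {1..k} \<Longrightarrow> y \<in> range (P i) \<longleftrightarrow> y = c i + Q i *v y"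
  by (auto simp: aff_def matrix_vector_right_distrib normal matrix_vector_mul_assoc idem)

text \<open>A diagonal matrix in \<open>Z j\<close> comes from the orbit of the \<open>j\<close>-th affine subspace under signed
  permutations: otherwise there is an invariant polynomial vanishing on this orbit and not at the
  given point, and its extension to matrices vanishes on \<open>Z j\<close>.\<close>

lemma diag_in_Z_imp:
  assumes j: "j \<in> {1..k}" and x: "dg x \<in> Z j"
  shows "\<exists>g\<in>sperms. x \<in> g ` range (P j)"
proof (rule ccontr)
  assume neg: "\<not> ?thesis"
  have "g x \<notin> range (P j)" if g: "g \<in> sperms" for g
  proof
    assume "g x \<in> range (P j)"
    obtain h where h: "h \<in> sperms" "\<And>x. h (g x) = x" "\<And>x. g (h x) = x" using sperms_inverse[OF g] by blast
    have "x \<in> h ` range (P j)" using \<open>g x \<in> range (P j)\<close> h(2)[of x] by (metis imageI)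
    then show False using neg h(1) by blast
  qed
  then have "\<forall>g\<in>sperms. \<exists>b. (g x - (c j + Q j *v g x)) $ b \<noteq> 0"
    unfolding P_fixed[OF j] by (auto simp: vec_eq_iff)
  from bchoice[OF this] obtain b where b: "\<And>g. g \<in> sperms \<Longrightarrow> (g x - (c j + Q j *v g x)) $ b g \<noteq> 0" by blast
  define l where "l g y = (y - (c j + Q j *v y)) $ b g" for g and y :: "complex ^ 'n"
  have l0: "l g y = 0" if "y \<in> range (P j)" for g y
  proof -
    have "y = c j + Q j *v y" using that P_fixed[OF j] by blast
    then have "y - (c j + Q j *v y) = 0" by simp
    then show ?thesis by (simp add: l_def)
  qed
  have lp: "poly_fun (l g)" for g
    unfolding l_def vector_minus_component vector_add_component matrix_vector_mult_def vec_lambda_beta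
    by (intro poly_fun_intros)
  define q0 where "q0 y = (\<Prod>g\<in>sperms. l g (g y))" for y
  have q0x: "q0 x \<noteq> 0" 
    unfolding q0_def prod_zero_iff[OF finite_sperms] using b unfolding l_def by blast
  have q0p: "poly_fun q0" unfolding q0_def by (intro poly_fun_prod poly_fun_compose[OF lp] poly_fun_sperms)
  have q0z: "q0 (g y) = 0" if g: "g \<in> sperms" and y: "y \<in> range (P j)" for g y
  proof -
    obtain h where h: "h \<in> sperms" "\<And>x. h (g x) = x" using sperms_inverse[OF g] by metis
    have "l h (h (g y)) = 0" using l0[OF y] h(2) by simp
    then show ?thesis unfolding q0_def using finite_sperms h(1) by (intro prod_zero) auto
  qed
  define V where "V = (\<lambda>g. g x) ` sperms - {x}"
  have finV: "finite V" unfolding V_def by (intro finite_Diff finite_imageI finite_sperms)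
  have "\<forall>w\<in>V. \<exists>a. x $ a \<noteq> w $ a" unfolding V_def by (auto simp: vec_eq_iff)
  from bchoice[OF this] obtain a where a: "\<And>w. w \<in> V \<Longrightarrow> x $ a w \<noteq> w $ a w" by blast
  define e where "e y = (\<Prod>w\<in>V. y $ a w - w $ a w)" for y
  have ex: "e x \<noteq> 0" unfolding e_def using a finV by simp
  have ez: "e w = 0" if "w \<in> V" for w unfolding e_def using that finV by (intro prod_zero) auto
  have ep: "poly_fun e" unfolding e_def by (intro poly_fun_intros)
  obtain F where F: "poly_fun F" "\<forall>U V x. orthogonal_matrix U \<and> orthogonal_matrix V \<longrightarrow>
    F (act U V (dg x)) = (\<Sum>e'\<in>signs. \<Sum>p | p permutes UNIV. q0 (sperm e' p x) * e (sperm e' p x))"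
    using invariant_extension[OF poly_fun_mult[OF q0p ep] inj_\<iota>] by blast
  have "F (param j u) = 0" if u: "orbit_den u \<noteq> 0" for u
  proof -
    have "orthogonal_matrix (cayley (genA u))" "orthogonal_matrix (cayley (genB u))"
      using u by (auto simp: orbit_den_det intro!: cayley_orthogonal skew_genA skew_genB)
    then have "F (param j u) = (\<Sum>e'\<in>signs. \<Sum>p | p permutes UNIV.
        q0 (sperm e' p (P j (genY u))) * e (sperm e' p (P j (genY u))))"
      using F(2) unfolding param_eq by blast
    also have "\<dots> = 0"
    proof (intro sum.neutral ballI)
      fix e' p assume "e' \<in> (signs :: ('n \<Rightarrow> complex) set)" "p \<in> {p. p permutes (UNIV :: 'n set)}"
      then have "sperm e' p \<in> sperms" by (auto simp: sperms_def)
      then show "q0 (sperm e' p (P j (genY u))) * e (sperm e' p (P j (genY u))) = 0" using q0z by simp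
    qed
    finally show ?thesis .
  qed
  then have "\<forall>z\<in>param j ` rational_param.params orbit_den. F z = 0" by (auto simp: params_iff)
  then have "F (dg x) = 0"
    using x vanishes_on_closure_iff[OF F(1)] unfolding Z_def rational_param.variety_def[OF rational_param] by blast
  moreover have "F (dg x) \<noteq> 0"
  proof -
    let ?S = "(signs :: ('n \<Rightarrow> complex) set) \<times> {p. p permutes (UNIV :: 'n set)}"
    have finS: "finite ?S" by (intro finite_cartesian_product finite_signs finite_permutations finite)
    have id: "orthogonal_matrix (mat 1 :: complex ^ 'k ^ 'k)" by (simp add: orthogonal_matrix_def transpose_mat)
    have "F (dg x) = F (act (mat 1) (mat 1) (dg x))" by simp
    also have "\<dots> = (\<Sum>e'\<in>signs. \<Sum>p | p permutes UNIV. q0 (sperm e' p x) * e (sperm e' p x))"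
      by (rule F(2)[rule_format, OF conjI[OF id id]])
    also have "\<dots> = (\<Sum>z\<in>?S. q0 (sperm (fst z) (snd z) x) * e (sperm (fst z) (snd z) x))"
      by (simp add: sum.cartesian_product split_def)
    also have "\<dots> = (\<Sum>z\<in>?S. if sperm (fst z) (snd z) x = x then q0 x * e x else 0)"
    proof (rule sum.cong[OF refl])
      fix z assume "z \<in> ?S"
      then have "sperm (fst z) (snd z) \<in> sperms"
        unfolding sperms_def by (intro CollectI exI[of _ "fst z"] exI[of _ "snd z"]) auto
      then have "sperm (fst z) (snd z) x \<noteq> x \<Longrightarrow> sperm (fst z) (snd z) x \<in> V" by (auto simp: V_def)
      then show "q0 (sperm (fst z) (snd z) x) * e (sperm (fst z) (snd z) x) =
        (if sperm (fst z) (snd z) x = x then q0 x * e x else 0)" using ez by auto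
    qed
    also have "\<dots> = of_nat (card {z\<in>?S. sperm (fst z) (snd z) x = x}) * (q0 x * e x)"
      using finS by (simp add: sum.inter_filter[symmetric])
    finally have *: "F (dg x) = of_nat (card {z\<in>?S. sperm (fst z) (snd z) x = x}) * (q0 x * e x)" .
    have "(\<lambda>_. 1, id) \<in> {z\<in>?S. sperm (fst z) (snd z) x = x}"
      by (simp add: signs_def permutes_id sperm_def)
    then have "{z\<in>?S. sperm (fst z) (snd z) x = x} \<noteq> {}" by blast
    moreover have "finite {z\<in>?S. sperm (fst z) (snd z) x = x}" using finS by (rule rev_finite_subset) blast
    ultimately have "card {z\<in>?S. sperm (fst z) (snd z) x = x} \<noteq> 0" by (simp only: card_eq_0_iff) blast
    then show ?thesis using * q0x ex by simp
  qed
  ultimately show False by simp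
qed

lemma diag_in_W_imp:
  assumes "dg x \<in> W" shows "\<exists>l\<in>{1..k}. x \<in> range (P l)"
proof -
  obtain j where j: "j \<in> {1..k}" "dg x \<in> Z j" using assms by (auto simp: W_def)
  obtain g where "g \<in> sperms" "x \<in> g ` range (P j)" using diag_in_Z_imp[OF j] by blast
  then show ?thesis using invariant[OF j(1)] by metis
qed

lemma range_P_closed: "j \<in> {1..k} \<Longrightarrow> closedin zariski (range (P j))"
proof -
  assume j: "j \<in> {1..k}"
  let ?F = "range (\<lambda>b y. (y - (c j + Q j *v y)) $ b)"
  have "\<forall>f\<in>?F. poly_fun f"
    unfolding vector_minus_component vector_add_component matrix_vector_mult_def vec_lambda_beta
    by (auto intro!: poly_fun_intros)
  moreover have "range (P j) = zero_set ?F"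
  proof (rule set_eqI)
    fix y
    have "y \<in> zero_set ?F \<longleftrightarrow> y - (c j + Q j *v y) = 0" by (auto simp: zero_set_def vec_eq_iff)
    then show "y \<in> range (P j) \<longleftrightarrow> y \<in> zero_set ?F" unfolding P_fixed[OF j] by simp
  qed
  ultimately show ?thesis unfolding closedin_zariski by blast
qed

lemma range_P_irreducible: "j \<in> {1..k} \<Longrightarrow> zariski_irreducible (range (P j))"
proof -
  assume j: "j \<in> {1..k}"
  have "zariski_irreducible (zariski closure_of range (P j))"
  proof (rule zariski_irreducible_closure)
    fix f g assume fg: "poly_fun f" "poly_fun g" "\<forall>x\<in>range (P j). f x * g x = 0"
    show "(\<forall>x\<in>range (P j). f x = 0) \<or> (\<forall>x\<in>range (P j). g x = 0)"
    proof (rule ccontr)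
      assume "\<not> ?thesis"
      then obtain s t where "f (P j s) \<noteq> 0" "g (P j t) \<noteq> 0" by blast
      then obtain u where "f (P j u) \<noteq> 0" "g (P j u) \<noteq> 0"
        using poly_fun_nonzero_common2[OF poly_fun_compose[OF fg(1) poly_fun_P] _ poly_fun_compose[OF fg(2) poly_fun_P]] by blast
      then show False using fg(3) by auto
    qed
  qed simp
  then show ?thesis using closure_of_closedin[OF range_P_closed[OF j]] by simp
qed

text \<open>Every diagonal point of \<open>Z i\<close> lies in the orbit of the \<open>j\<close>-th affine subspace under signed
  permutations. This orbit is a finite union, the \<open>i\<close>-th subspace is irreducible, and no member of the
  arrangement lies in another one.\<close>

lemma Z_subset_imp:
  assumes i: "i \<in> {1..k}" and j: "j \<in> {1..k}" and sub: "Z i \<subseteq> Z j"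
  shows "\<exists>g\<in>sperms. range (P i) = g ` range (P j)"
proof -
  define L where "L = {l\<in>{1..k}. \<exists>g\<in>sperms. g ` range (P j) = range (P l)}"
  have "range (P i) \<subseteq> (\<Union>l\<in>L. range (P l))"
  proof (rule image_subsetI)
    fix s
    have "dg (P i s) \<in> Z j" using diag_in_Z sub by blast
    then obtain g where g: "g \<in> sperms" "P i s \<in> g ` range (P j)" using diag_in_Z_imp[OF j] by blast
    obtain l where "l \<in> {1..k}" "g ` range (P j) = range (P l)" using invariant[OF j g(1)] by blast
    then show "P i s \<in> (\<Union>l\<in>L. range (P l))" using g by (auto simp: L_def)
  qed
  moreover have "closedin zariski (range (P l))" if "l \<in> L" for l
    using range_P_closed that by (simp add: L_def)
  ultimately obtain l where l: "l \<in> L" "range (P i) \<subseteq> range (P l)"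
    using zariski_irreducible_finite_union[OF range_P_irreducible[OF i], of L "\<lambda>l. range (P l)"] by (auto simp: L_def)
  then have il: "i = l" using antichain[OF i, of l] by (simp add: L_def)
  obtain g where g: "g \<in> sperms" "g ` range (P j) = range (P l)" using l(1) by (auto simp: L_def)
  then show ?thesis by (intro bexI[of _ g]) (simp_all add: g il)
qed

text \<open>A signed permutation of the diagonal is induced by orthogonal matrices, which carry \<open>E j s'\<close> to
  \<open>E i s\<close>.\<close>

lemma rk_le:
  assumes i: "i \<in> {1..k}" and g: "g \<in> sperms" and eq: "range (P i) = g ` range (P j)"
  shows "rk i \<le> rk j"
proof -
  obtain s where s: "vec.dim (E i s) = rk i" using rk_attained by blast
  interpret g: Vector_Spaces.linear "(*s)" "(*s)" g by (rule linear_sperms[OF g])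
  obtain ep p where ep: "g = sperm ep p" "ep \<in> signs" "p permutes UNIV" using g by (auto simp: sperms_def)
  have "inj p" using ep(3) by (rule permutes_inj)
  then obtain U and V :: "complex ^ 't ^ 't" where UV: "orthogonal_matrix U" "orthogonal_matrix V"
    "\<And>y. act U V (dg y) = dg (g y)"
    using act_signed_permutation[OF inj_\<iota> _ ep(2)] unfolding ep(1) by metis
  obtain s' where s': "P i s = g (P j s')" using eq by blast
  have "E i s \<subseteq> act U V ` E j s'"
  proof
    fix z assume "z \<in> E i s"
    then obtain A B y where z: "skew A" "skew B" "z = lie_act A B (dg (P i s)) + dg (Q i *v y)" unfolding E_iff by blast
    have "P i y \<in> g ` range (P j)" "P i 0 \<in> g ` range (P j)" using eq by blast+
    then obtain y1 y2 where y12: "P i y = g (P j y1)" "P i 0 = g (P j y2)" by blast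
    have "Q i *v y = P i y - P i 0" by (simp add: aff_def)
    also have "\<dots> = g (P j y1 - P j y2)" by (simp add: y12 g.diff)
    also have "P j y1 - P j y2 = Q j *v (y1 - y2)" by (simp add: aff_def matrix_vector_mult_diff_distrib)
    finally have y: "Q i *v y = g (Q j *v (y1 - y2))" .
    have "z = act U V (lie_act (transpose U ** A ** U) (transpose V ** B ** V) (dg (P j s')) + dg (Q j *v (y1 - y2)))"
      unfolding act_add z(3) y s' UV(3)[symmetric] lie_act_act[OF UV(1,2)] ..
    moreover have "lie_act (transpose U ** A ** U) (transpose V ** B ** V) (dg (P j s')) + dg (Q j *v (y1 - y2)) \<in> E j s'"
      unfolding E_iff
      by (intro exI[of _ "transpose U ** A ** U"] exI[of _ "transpose V ** B ** V"] exI[of _ "y1 - y2"]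
          conjI refl skew_conjugate z)
    ultimately show "z \<in> act U V ` E j s'" by blast
  qed
  then have "vec.dim (E i s) \<le> vec.dim (act U V ` E j s')" by (rule vec.dim_subset)
  also have "\<dots> \<le> vec.dim (E j s')" by (rule vec.dim_image_le[OF linear_act])
  also have "\<dots> \<le> rk j" by (rule dim_E_le_rk)
  finally show ?thesis using s by simp
qed

text \<open>The two affine subspaces differ by a signed permutation, so both varieties have the same
  dimension.\<close>

lemma Z_eq_if_subset:
  assumes i: "i \<in> {1..k}" and j: "j \<in> {1..k}" and sub: "Z i \<subseteq> Z j"
  shows "Z i = Z j"
proof -
  obtain g where g: "g \<in> sperms" "range (P i) = g ` range (P j)" using Z_subset_imp[OF assms] by blast
  obtain h where h: "h \<in> sperms" "\<And>x. h (g x) = x" using sperms_inverse[OF g(1)] by metis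
  have "range (P j) = h ` range (P i)" unfolding g(2) image_image h(2) by simp
  then have "rk j \<le> rk i" by (rule rk_le[OF j h(1)])
  then have "trdeg_le (Z j) (rk i)" using trdeg_le_mono[OF Z_trdeg_le] by blast
  then show ?thesis
    by (intro irreducible_eq_if_dim_eq[OF Z_irreducible Z_closed Z_irreducible sub, of "rk i"]) (auto simp: Z_variety_dim)
qed

lemma irreducible_components_W: "irreducible_components W = Z ` {1..k}"
proof -
  have sub: "\<exists>j\<in>{1..k}. Y \<subseteq> Z j" if "zariski_irreducible Y" "Y \<subseteq> W" for Y
    using zariski_irreducible_finite_union[OF that(1), of "{1..k}" Z] that(2) Z_closed by (auto simp: W_def)
  have ZW: "Z i \<subseteq> W" if "i \<in> {1..k}" for i using that by (auto simp: W_def)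
  show ?thesis
  proof (intro set_eqI iffI)
    fix Y assume Y: "Y \<in> irreducible_components W"
    then obtain j where "j \<in> {1..k}" "Y \<subseteq> Z j" using sub[of Y] unfolding irreducible_components_def by blast
    then show "Y \<in> Z ` {1..k}" using Y Z_irreducible ZW unfolding irreducible_components_def by blast
  next
    fix Y assume "Y \<in> Z ` {1..k}"
    then obtain i where i: "i \<in> {1..k}" "Y = Z i" by blast
    have "Y' = Z i" if Y': "zariski_irreducible Y'" "Z i \<subseteq> Y'" "Y' \<subseteq> W" for Y'
    proof -
      obtain j where j: "j \<in> {1..k}" "Y' \<subseteq> Z j" using sub Y' by blast
      then have "Z i = Z j" using Z_eq_if_subset[OF i(1)] Y'(2) by blast
      then show ?thesis using j Y'(2) by blast
    qed
    then show "Y \<in> irreducible_components W"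
      unfolding irreducible_components_def using i Z_irreducible ZW by blast
  qed
qed

text \<open>Multiplication by a polynomial that vanishes on the other components but not at \<open>x\<close> extends equations
  of \<open>Z i\<close> to equations of \<open>W\<close>, and it multiplies their derivatives at \<open>x\<close> by a nonzero number.\<close>

lemma tangent_space_W_subset:
  assumes i: "i \<in> {1..k}" and x: "x \<in> Z i" and only: "\<And>j. j \<in> {1..k} \<Longrightarrow> x \<in> Z j \<Longrightarrow> Z j = Z i"
  shows "tangent_space W x \<subseteq> tangent_space (Z i) x"
proof
  fix v assume v: "v \<in> tangent_space W x"
  have "\<forall>j\<in>{j\<in>{1..k}. Z j \<noteq> Z i}. \<exists>q. poly_fun q \<and> (\<forall>z\<in>Z j. q z = 0) \<and> q x \<noteq> 0"
  proof
    fix j assume "j \<in> {j\<in>{1..k}. Z j \<noteq> Z i}"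
    then have "x \<notin> Z j" using only by auto
    then show "\<exists>q. poly_fun q \<and> (\<forall>z\<in>Z j. q z = 0) \<and> q x \<noteq> 0"
      by (rule closedin_zariski_separating_poly[OF Z_closed]) blast
  qed
  from bchoice[OF this] obtain q where q: "\<forall>j\<in>{j\<in>{1..k}. Z j \<noteq> Z i}. poly_fun (q j) \<and> (\<forall>z\<in>Z j. q j z = 0) \<and> q j x \<noteq> 0"
    by blast
  define q' where "q' z = (\<Prod>j\<in>{j\<in>{1..k}. Z j \<noteq> Z i}. q j z)" for z
  have q'p: "poly_fun q'" unfolding q'_def by (intro poly_fun_prod) (use q in blast)
  have q'x: "q' x \<noteq> 0" unfolding q'_def using q by simp
  show "v \<in> tangent_space (Z i) x"
    unfolding tangent_space_def
  proof clarify
    fix f assume f: "poly_fun f" "\<forall>w\<in>Z i. f w = 0"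
    have "f w * q' w = 0" if "w \<in> W" for w
    proof -
      obtain j where j: "j \<in> {1..k}" "w \<in> Z j" using \<open>w \<in> W\<close> by (auto simp: W_def)
      show ?thesis
      proof (cases "Z j = Z i")
        case True
        then show ?thesis using f(2) j(2) by simp
      next
        case False
        then have "q' w = 0" unfolding q'_def using j q by (intro prod_zero) auto
        then show ?thesis by simp
      qed
    qed
    moreover have "poly_fun (\<lambda>w. f w * q' w)" by (intro poly_fun_mult f q'p)
    ultimately have "frechet_derivative (\<lambda>w. f w * q' w) (at x) v = 0"
      using v unfolding tangent_space_def by blast
    then have "frechet_derivative f (at x) v * q' x = 0"
      using cdiff_mult(2)[OF cdiff_poly_fun[OF f(1)] cdiff_poly_fun[OF q'p], of x v] f(2) x by simp
    then show "frechet_derivative f (at x) v = 0" using q'x by simp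
  qed
qed

lemma bil_diag_vec_diag_vec: "bil (dg a) (dg b) = (\<Sum>i\<in>UNIV. a $ i * b $ i)"
  unfolding bil_diag_vec by (simp add: diag_vec_def)

text \<open>The orthogonal matrices preserve \<open>W\<close> and the bilinear form, so the data point may be taken to be
  \<open>dg s\<close>. Let \<open>x\<close> be critical. The tangent space at \<open>x\<close> contains the orbit directions, and these are
  orthogonal to \<open>x\<close>; hence \<open>dg s\<close> is orthogonal to them as well, and \<open>x\<close> is diagonal because the squares of
  the entries of \<open>s\<close> are distinct. So \<open>x\<close> lies on some affine subspace of the arrangement, and
  orthogonality to its directions makes \<open>x\<close> the projection of \<open>s\<close>. Conversely, for generic \<open>s\<close> the
  projection is a regular point with tangent space \<open>E i s\<close>, to which \<open>dg s - dg (P i s)\<close> is orthogonal.\<close>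

theorem critical_points_W:
  assumes A: "skew A" "det (mat 2 - A) \<noteq> 0" and B: "skew B" "det (mat 2 - B) \<noteq> 0"
    and s0: "\<And>i. s $ i \<noteq> 0" and sq: "\<And>i j. i \<noteq> j \<Longrightarrow> (s $ i)\<^sup>2 \<noteq> (s $ j)\<^sup>2"
    and gen: "\<And>i. i \<in> {1..k} \<Longrightarrow> generic i s"
  shows "{x \<in> regular_points W. act (cayley A) (cayley B) (dg s) - x \<in> bilinear_perp (tangent_space W x)} =
    (\<lambda>i. act (cayley A) (cayley B) (dg (P i s))) ` {1..k}"
proof -
  let ?a = "act (cayley A) (cayley B)" and ?b = "act (cayley (- A)) (cayley (- B))"
  note inv = act_cayley_inverse[OF A B]
  have orth: "orthogonal_matrix (cayley A)" "orthogonal_matrix (cayley B)" by (intro cayley_orthogonal A B)+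
  have orth': "orthogonal_matrix (cayley (- A))" "orthogonal_matrix (cayley (- B))" by (intro cayley_orthogonal inv)+
  have aZ: "?a ` Z i \<subseteq> Z i" "?b ` Z i \<subseteq> Z i" for i using Z_invariant[OF A B] Z_invariant[OF inv(3-6)] by blast+
  have aW: "?a ` W \<subseteq> W" "?b ` W \<subseteq> W" using aZ unfolding W_def by blast+
  have bil_a: "bil (?a y) (?a z) = bil y z" for y z by (rule bil_act_act[OF orth])
  have perp: "v \<in> bilinear_perp T \<longleftrightarrow> (\<forall>w\<in>T. bil v w = 0)" for v :: "complex ^ ('n \<times> 't)" and T
    by (simp add: bilinear_perp_def bil_def)
  show ?thesis
  proof (intro set_eqI iffI)
    fix x assume "x \<in> {x \<in> regular_points W. ?a (dg s) - x \<in> bilinear_perp (tangent_space W x)}"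
    then have x: "x \<in> regular_points W" "\<And>v. v \<in> tangent_space W x \<Longrightarrow> bil (?a (dg s) - x) v = 0" by (auto simp: perp)
    have "x \<in> W" using x(1) unfolding regular_points_def regular_points_irreducible_def irreducible_components_def by blast
    define x' where "x' = ?b x"
    have xx': "x = ?a x'" by (simp add: x'_def inv)
    have x'W: "x' \<in> W" unfolding x'_def using aW(2) \<open>x \<in> W\<close> by blast
    have crit: "bil (dg s - x') v = 0" if "v \<in> tangent_space W x'" for v
    proof -
      have "?a v \<in> tangent_space W x" unfolding xx' by (rule tangent_space_act[OF aW(1) that])
      then have "bil (?a (dg s) - ?a x') (?a v) = 0" using x(2) xx' by simp
      then show ?thesis by (simp add: bil_a flip: act_diff)
    qed
    have lie: "bil (dg s) (lie_act A' B' x') = 0" if AB': "skew A'" "skew B'" for A' B'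
    proof -
      have "act (cayley A1) (cayley B1) x' \<in> W"
        if "skew A1" "skew B1" "det (mat 2 - A1) \<noteq> 0" "det (mat 2 - B1) \<noteq> 0" for A1 B1
        using x'W Z_invariant[OF that(1,3,2,4)] unfolding W_def by blast
      then have "lie_act A' B' x' \<in> tangent_space W x'"
        by (rule lie_act_in_tangent_space[OF W_closed _ AB'])
      from crit[OF this] show ?thesis by (simp add: bil_diff_left skew_bil_lie_act[OF AB'])
    qed
    define \<xi> where "\<xi> = (\<chi> i. x' $ (i, \<iota> i))"
    have x'dg: "x' = dg \<xi>"
      unfolding \<xi>_def
      by (rule diagonal_if_bil_lie_act_zero[OF inj_\<iota> s0 sq]) (auto intro!: lie skew_elem_skew skew_0)
    then obtain l where l: "l \<in> {1..k}" "\<xi> \<in> range (P l)" using diag_in_W_imp x'W by blast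
    then obtain y where y: "\<xi> = P l y" by blast
    have "Q l *v (s - \<xi>) = 0"
    proof -
      have "(Q l *v (s - \<xi>)) $ i = 0" for i
      proof -
        have "lie_act 0 0 (dg (P l y)) + dg (Q l *v axis i 1) \<in> E l y"
          unfolding E_iff by (intro exI[of _ 0] exI[of _ "axis i 1"] conjI refl skew_0)
        moreover have "lie_act 0 0 (dg (P l y)) = 0" by (simp add: lie_act_def mat_vec_def vec_eq_iff transpose_def matrix_matrix_mult_def)
        ultimately have "dg (Q l *v axis i 1) \<in> tangent_space (Z l) (dg \<xi>)" using E_subset_tangent_space y by auto
        moreover have "Z l \<subseteq> W" using l(1) by (auto simp: W_def)
        ultimately have "dg (Q l *v axis i 1) \<in> tangent_space W x'" using tangent_space_mono x'dg by blast
        from crit[OF this] have "bil (dg (s - \<xi>)) (dg (Q l *v axis i 1)) = 0" by (simp add: x'dg diag_vec_diff)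
        then have "(\<Sum>j\<in>UNIV. (s - \<xi>) $ j * Q l $ j $ i) = 0"
          by (simp add: bil_diag_vec_diag_vec matrix_vector_mult_def axis_def if_distrib cong: if_cong)
        moreover have "Q l $ j $ i = Q l $ i $ j" for j
          using arg_cong[OF sym[OF l(1)], of "\<lambda>M. M $ i $ j"] by (simp add: transpose_def)
        ultimately show ?thesis by (simp add: matrix_vector_mult_def mult.commute)
      qed
      then show ?thesis by (simp add: vec_eq_iff)
    qed
    then have "Q l *v s = Q l *v \<xi>" by (simp add: matrix_vector_mult_diff_distrib)
    then have "\<xi> = P l s" using P_fixed[OF l(1), of \<xi>] l(2) by (simp add: aff_def)
    then show "x \<in> (\<lambda>i. ?a (dg (P i s))) ` {1..k}" using xx' x'dg l(1) by blast
  next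
    fix x assume "x \<in> (\<lambda>i. ?a (dg (P i s))) ` {1..k}"
    then obtain i where i: "i \<in> {1..k}" "x = ?a (dg (P i s))" by blast
    let ?x = "dg (P i s)"
    have bx: "?b x = ?x" by (simp add: i inv)
    have xZ: "x \<in> Z i" unfolding i by (rule Z_invariant[OF A B diag_in_Z])
    have only: "Z j = Z i" if "j \<in> {1..k}" "x \<in> Z j" for j
    proof -
      have "?x \<in> Z j" using that(2) Z_invariant_iff[OF A B] unfolding i(2) by blast
      then have "Z i \<subseteq> Z j" using gen[OF i(1)] that(1) unfolding generic_def by blast
      then show ?thesis using Z_eq_if_subset i(1) that(1) by metis
    qed
    have Tdim: "vec.dim (tangent_space (Z i) ?x) \<le> rk i" "rk i \<le> vec.dim (E i s)"
      using gen[OF i(1)] unfolding generic_def by auto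
    have TE: "tangent_space (Z i) ?x = E i s"
      by (rule vec.subspace_dim_equal[OF E_subspace tangent_space_subspace E_subset_tangent_space, symmetric])
        (rule order_trans[OF Tdim])
    have "vec.dim (tangent_space (Z i) x) = rk i"
    proof (rule antisym)
      have "?b ` tangent_space (Z i) x \<subseteq> tangent_space (Z i) ?x"
        using tangent_space_act[OF aZ(2)] bx by (metis image_subsetI)
      then show "vec.dim (tangent_space (Z i) x) \<le> rk i"
        using dim_injective_image_le[OF linear_act act_inj[OF orth'] tangent_space_subspace] Tdim(1) by (meson order_trans)
      have "?a ` E i s \<subseteq> tangent_space (Z i) x" unfolding i(2) TE[symmetric] using tangent_space_act[OF aZ(1)] by blast
      then show "rk i \<le> vec.dim (tangent_space (Z i) x)"
        using dim_injective_image_le[OF linear_act act_inj[OF orth] E_subspace] Tdim(2) by (meson order_trans)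
    qed
    then have "x \<in> regular_points_irreducible (Z i)"
      using xZ by (simp add: regular_points_irreducible_def Z_variety_dim)
    then have "x \<in> regular_points W"
      unfolding regular_points_def irreducible_components_W using i(1) only by blast
    moreover have "bil (?a (dg s) - x) v = 0" if v: "v \<in> tangent_space W x" for v
    proof -
      have "v \<in> tangent_space (Z i) x" using tangent_space_W_subset[OF i(1) xZ only] v by blast
      then have "?b v \<in> tangent_space (Z i) (?b x)" by (rule tangent_space_act[OF aZ(2)])
      then have "?b v \<in> E i s" by (simp add: bx TE)
      then obtain A' B' y where bv: "skew A'" "skew B'" "?b v = lie_act A' B' ?x + dg (Q i *v y)" unfolding E_iff by blast
      have "bil (?a (dg s) - x) v = bil (?a (dg s - ?x)) (?a (?b v))" by (simp add: i(2) act_diff inv)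
      also have "\<dots> = bil (dg (s - P i s)) (lie_act A' B' ?x) + bil (dg (s - P i s)) (dg (Q i *v y))"
        unfolding bil_a by (simp add: bv(3) bil_add diag_vec_diff)
      also have "bil (dg (s - P i s)) (lie_act A' B' ?x) = 0" by (rule bil_diag_lie_act[OF bv(1,2) inj_\<iota>])
      also have "bil (dg (s - P i s)) (dg (Q i *v y)) = dotp (s - P i s) (Q i *v y)"
        by (simp add: bil_diag_vec_diag_vec dotp_def)
      also have "\<dots> = dotp (Q i *v (s - P i s)) y"
        by (simp add: dotp_matrix sym[OF i(1)])
      also have "Q i *v (s - P i s) = 0"
        by (simp add: aff_def matrix_vector_mult_diff_distrib matrix_vector_right_distrib normal[OF i(1)]
            matrix_vector_mul_assoc idem[OF i(1)])
      finally show ?thesis by (simp add: dotp_def)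
    qed
    ultimately show "x \<in> {x \<in> regular_points W. ?a (dg s) - x \<in> bilinear_perp (tangent_space W x)}" by (simp add: perp)
  qed
qed

end


section \<open>Complexification of real matrices\<close>

definition cm :: "real ^ 'm ^ 'n \<Rightarrow> complex ^ 'm ^ 'n" where
  "cm A = (\<chi> i j. complex_of_real (A $ i $ j))"

lemma cm_mult: "cm (A ** B) = cm A ** cm B"
  by (simp add: cm_def matrix_matrix_mult_def vec_eq_iff)

lemma cm_transpose: "cm (transpose A) = transpose (cm A)"
  by (simp add: cm_def transpose_def vec_eq_iff)

lemma cm_mat: "cm (mat c) = mat (complex_of_real c)"
  by (simp add: cm_def mat_def vec_eq_iff)

lemma cm_add: "cm (A + B) = cm A + cm B" and cm_diff: "cm (A - B) = cm A - cm B"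
  and cm_uminus: "cm (- A) = - cm A"
  by (simp_all add: cm_def vec_eq_iff)

text \<open>The determinant is a polynomial with integer coefficients in the entries.\<close>

lemma det_cm: "det (cm A) = complex_of_real (det A)"
  by (simp add: det_def cm_def)

lemma cm_skew: "skew A \<Longrightarrow> skew (cm A)"
  unfolding skew_def by (metis cm_transpose cm_uminus)

lemma det_two_minus_cm: "det (mat 2 - cm A) = complex_of_real (det (mat 2 - A))"
  using det_cm[of "mat 2 - A"] by (simp add: cm_diff cm_mat)

lemma cm_cayley:
  assumes "det (mat 2 - A) \<noteq> 0"
  shows "cm (cayley A) = cayley (cm A)"
proof (rule cayley_eqI)
  show "det (mat 2 - cm A) \<noteq> 0" using assms by (simp add: det_two_minus_cm)
  have "cm (cayley A ** (mat 2 - A)) = cm (mat 2 + A)" by (simp only: cayley_mult[OF assms])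
  then show "cm (cayley A) ** (mat 2 - cm A) = mat 2 + cm A"
    by (simp add: cm_mult cm_diff cm_add cm_mat)
qed

lemma complex_vec_component [simp]: "complex_vec x $ i = complex_of_real (x $ i)"
  by (simp add: complex_vec_def)

lemma complex_vec_inject: "complex_vec x = complex_vec y \<longleftrightarrow> x = y"
  by (simp add: vec_eq_iff)

lemma complex_vec_add: "complex_vec (x + y) = complex_vec x + complex_vec y"
  by (simp add: vec_eq_iff)

lemma complex_vec_matrix_mult: "complex_vec (A *v x) = cm A *v complex_vec x"
  by (simp add: vec_eq_iff cm_def matrix_vector_mult_def)

lemma complex_vec_aff: "complex_vec (aff c Q s) = aff (complex_vec c) (cm Q) (complex_vec s)"
  by (simp add: aff_def complex_vec_add complex_vec_matrix_mult)

lemma complex_vec_act: "complex_vec (act U V x) = act (cm U) (cm V) (complex_vec x)"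
  by (simp add: vec_eq_iff act_component cm_def)

lemma complex_vec_diag_vec: "complex_vec (diag_vec \<iota> x) = diag_vec \<iota> (complex_vec x)"
  by (simp add: vec_eq_iff diag_vec_def)

lemma complex_vec_sperm: "complex_vec (sperm e p x) = sperm (\<lambda>i. complex_of_real (e i)) p (complex_vec x)"
  by (simp add: vec_eq_iff sperm_def)

text \<open>Two polynomial maps that agree at the real points agree, as the real points are dense.\<close>

lemma complex_vec_identity_extends:
  assumes "\<And>b. poly_fun (\<lambda>z. F z $ b)" "\<And>b. poly_fun (\<lambda>z. G z $ b)"
    and "\<And>x. F (complex_vec x) = G (complex_vec x)"
  shows "F z = G z"
proof -
  have "F z $ b - G z $ b = 0" for b
    by (rule poly_fun_zero_on_reals[of "\<lambda>z. F z $ b - G z $ b"]) (intro poly_fun_diff assms, simp add: assms(3))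
  then show ?thesis by (simp add: vec_eq_iff)
qed

lemma poly_fun_sperm: "poly_fun (\<lambda>x. sperm e p x $ b)"
  unfolding sperm_def by (simp add: poly_fun_mult poly_fun_const poly_fun_coord)

lemma poly_fun_aff:
  assumes "\<And>b. poly_fun (\<lambda>x. f x $ b)" shows "poly_fun (\<lambda>x. aff c Q (f x) $ b)"
  unfolding aff_def matrix_vector_mult_def by (simp add: poly_fun_intros assms)

lemma complex_sperm:
  fixes g :: "complex ^ 'n \<Rightarrow> complex ^ 'n"
  assumes "g \<in> sperms"
  obtains e p where "g = sperm (\<lambda>i. complex_of_real (e i)) p" "e \<in> signs" "p permutes UNIV"
proof -
  obtain f p where g: "g = sperm f p" "f \<in> signs" "p permutes UNIV" using assms by (auto simp: sperms_def)
  define e where "e i = Re (f i)" for i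
  have "f i = complex_of_real (e i) \<and> (e i = 1 \<or> e i = -1)" for i
  proof -
    have "f i = 1 \<or> f i = -1" using g(2) by (simp add: signs_def)
    then show ?thesis by (auto simp: e_def complex_eq_iff)
  qed
  then have "f = (\<lambda>i. complex_of_real (e i))" "e \<in> signs" by (auto simp: signs_def)
  then show ?thesis using that g by blast
qed

section \<open>Real affine subspaces\<close>

lemma range_aff_iff:
  assumes "Q ** Q = Q" "Q *v c = 0"
  shows "x \<in> range (aff c Q) \<longleftrightarrow> aff c Q x = x"
proof
  assume "x \<in> range (aff c Q)"
  then obtain y where "x = aff c Q y" by blast
  then show "aff c Q x = x"
    by (simp add: aff_def matrix_vector_right_distrib matrix_vector_mul_assoc assms)
next
  assume "aff c Q x = x"
  then show "x \<in> range (aff c Q)" by (metis rangeI)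
qed

text \<open>The matrix of the orthogonal projection onto the direction space, written in an orthonormal
  basis, represents both the affine subspace and the projection onto it.\<close>

lemma affine_subspace_projection:
  fixes A :: "(real ^ 'n) set"
  assumes "affine A" "A \<noteq> {}"
  obtains c Q where "transpose Q = Q" "Q ** Q = Q" "Q *v c = 0" "A = range (aff c Q)"
    "\<And>x y. is_orthogonal_projection A y x \<longleftrightarrow> x = aff c Q y"
proof -
  obtain a where a: "a \<in> A" using assms(2) by blast
  define T where "T = (\<lambda>x. x - a) ` A"
  have T: "subspace T" unfolding T_def using affine_diffs_subspace_subtract assms(1) a by blast
  have TA: "t \<in> T \<longleftrightarrow> a + t \<in> A" for t unfolding T_def by (force simp: image_iff)
  obtain B where B: "B \<subseteq> T" "pairwise orthogonal B" "\<And>x. x \<in> B \<Longrightarrow> norm x = 1" "independent B"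
    "card B = dim T" "span B = T"
    using orthonormal_basis_subspace[OF T] by metis
  have finB: "finite B" using B(4) by (rule independent_imp_finite)
  define Q :: "real ^ 'n ^ 'n" where "Q = (\<chi> i j. \<Sum>b\<in>B. b $ i * b $ j)"
  have Q: "Q *v y = (\<Sum>b\<in>B. (b \<bullet> y) *\<^sub>R b)" for y
  proof -
    have "(Q *v y) $ i = (\<Sum>b\<in>B. (b \<bullet> y) *\<^sub>R b) $ i" for i
    proof -
      have "(Q *v y) $ i = (\<Sum>j\<in>UNIV. \<Sum>b\<in>B. b $ i * b $ j * y $ j)"
        by (simp add: Q_def matrix_vector_mult_def sum_distrib_right)
      also have "\<dots> = (\<Sum>b\<in>B. \<Sum>j\<in>UNIV. b $ i * b $ j * y $ j)" by (rule sum.swap)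
      also have "\<dots> = (\<Sum>b\<in>B. (b \<bullet> y) *\<^sub>R b) $ i"
        by (simp add: inner_vec_def sum_distrib_left sum_distrib_right mult_ac)
      finally show ?thesis .
    qed
    then show ?thesis by (simp add: vec_eq_iff)
  qed
  have QT: "Q *v y \<in> T" for y
    unfolding Q by (intro subspace_sum[OF T] subspace_scale[OF T]) (use B(1) in blast)
  have orthB: "b \<bullet> (y - Q *v y) = 0" if b: "b \<in> B" for b y
  proof -
    have "b \<bullet> (Q *v y) = (\<Sum>b'\<in>B. (b' \<bullet> y) * (b \<bullet> b'))" by (simp add: Q inner_sum_right)
    also have "\<dots> = (\<Sum>b'\<in>B. if b' = b then b \<bullet> y else 0)"
    proof (rule sum.cong[OF refl])
      fix b' assume b': "b' \<in> B"
      have "b \<bullet> b = 1" using B(3)[OF b] by (simp add: norm_eq_1)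
      moreover have "b' \<noteq> b \<Longrightarrow> b \<bullet> b' = 0"
        using B(2) b b' by (auto simp: pairwise_def orthogonal_def)
      ultimately show "(b' \<bullet> y) * (b \<bullet> b') = (if b' = b then b \<bullet> y else 0)" by auto
    qed
    also have "\<dots> = b \<bullet> y" using finB b by simp
    finally show ?thesis by (simp add: inner_diff_right)
  qed
  have orthT: "t \<bullet> (y - Q *v y) = 0" if "t \<in> T" for t y
  proof -
    have "t \<in> span B" using that B(6) by simp
    then show ?thesis
      by (induction rule: span_induct_alt) (simp_all add: inner_add_left orthB)
  qed
  have fixT: "Q *v t = t" if t: "t \<in> T" for t
  proof -
    have "t - Q *v t \<in> T" by (rule subspace_diff[OF T t QT])
    from orthT[OF this, of t] show ?thesis by simp
  qed
  define c where "c = a - Q *v a"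
  have aff: "aff c Q y = a + Q *v (y - a)" for y
    by (simp add: aff_def c_def matrix_vector_mult_diff_distrib)
  have inA: "aff c Q y \<in> A" for y using QT[of "y - a"] TA by (simp add: aff)
  have fixA: "aff c Q x = x" if "x \<in> A" for x
    using fixT[of "x - a"] TA[of "x - a"] that by (simp add: aff)
  have diffT: "x' - x \<in> T" if "x \<in> A" "x' \<in> A" for x x'
    using subspace_diff[OF T, of "x' - a" "x - a"] that TA[of "x - a"] TA[of "x' - a"] by simp
  have proj: "is_orthogonal_projection A y (aff c Q y)" for y
    unfolding is_orthogonal_projection_def
  proof (intro conjI ballI)
    fix z assume "z \<in> A"
    then have "z - aff c Q y \<in> T" using diffT inA by blast
    from orthT[OF this, of "y - a"] show "orthogonal (y - aff c Q y) (z - aff c Q y)"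
      by (simp add: orthogonal_def aff inner_commute algebra_simps)
  qed (rule inA)
  have uniq: "x = aff c Q y" if "is_orthogonal_projection A y x" for x y
  proof -
    let ?z = "aff c Q y"
    have "(y - x) \<bullet> (?z - x) = 0" "(y - ?z) \<bullet> (x - ?z) = 0"
      using that proj[of y] unfolding is_orthogonal_projection_def orthogonal_def by blast+
    then have "(?z - x) \<bullet> (?z - x) = 0" by (simp add: inner_diff_left inner_diff_right inner_commute)
    then show ?thesis by simp
  qed
  show ?thesis
  proof
    show "transpose Q = Q" by (simp add: Q_def transpose_def mult.commute)
    show "Q ** Q = Q" unfolding matrix_eq by (simp add: matrix_vector_mul_assoc[symmetric] fixT QT)
    show "Q *v c = 0" by (simp add: c_def matrix_vector_mult_diff_distrib fixT QT)
    show "A = range (aff c Q)" 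
    proof
      show "A \<subseteq> range (aff c Q)" by (rule subsetI) (metis fixA rangeI)
      show "range (aff c Q) \<subseteq> A" using inA by blast
    qed
    show "is_orthogonal_projection A y x \<longleftrightarrow> x = aff c Q y" for x y using proj uniq by blast
  qed
qed

text \<open>For each \<open>C i\<close> that does not contain \<open>A\<close>, some polynomial vanishes on \<open>C i\<close> but not on all of \<open>A\<close>.
  Finitely many such polynomials are simultaneously nonzero at a point of \<open>A\<close>.\<close>

lemma affine_subset_finite_union:
  fixes A :: "(real ^ 'n) set"
  assumes A: "affine A" "A \<noteq> {}" and "finite I" and C: "\<And>i. i \<in> I \<Longrightarrow> affine (C i) \<and> C i \<noteq> {}"
    and sub: "A \<subseteq> (\<Union>i\<in>I. C i)"
  shows "\<exists>i\<in>I. A \<subseteq> C i"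
proof (rule ccontr)
  assume neg: "\<not> (\<exists>i\<in>I. A \<subseteq> C i)"
  obtain c Q where cQ: "A = range (aff c Q)" by (rule affine_subspace_projection[OF A]) (rule that)
  have "\<exists>f. poly_fun f \<and> (\<exists>s. f s \<noteq> 0) \<and> (\<forall>s. aff c Q s \<in> C i \<longrightarrow> f s = 0)" if i: "i \<in> I" for i
  proof -
    have Ci: "affine (C i)" "C i \<noteq> {}" using C[OF i] by auto
    obtain c' Q' where P: "Q' ** Q' = Q'" "Q' *v c' = 0" "C i = range (aff c' Q')"
      by (rule affine_subspace_projection[OF Ci]) (rule that)
    have inC: "x \<in> C i \<longleftrightarrow> aff c' Q' x = x" for x
      unfolding P(3) by (rule range_aff_iff[OF P(1,2)])
    obtain s where "aff c Q s \<notin> C i" using neg i cQ by blast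
    then obtain b where b: "aff c' Q' (aff c Q s) $ b \<noteq> aff c Q s $ b" by (auto simp: inC vec_eq_iff)
    let ?f = "\<lambda>s. aff c' Q' (aff c Q s) $ b - aff c Q s $ b"
    have "poly_fun ?f" by (intro poly_fun_diff poly_fun_aff poly_fun_coord)
    moreover have "?f s \<noteq> 0" using b by simp
    moreover have "\<forall>s. aff c Q s \<in> C i \<longrightarrow> ?f s = 0" by (simp add: inC)
    ultimately show ?thesis by blast
  qed
  then have "\<forall>i\<in>I. \<exists>f. poly_fun f \<and> (\<exists>s. f s \<noteq> 0) \<and> (\<forall>s. aff c Q s \<in> C i \<longrightarrow> f s = 0)" by blast
  from bchoice[OF this] obtain f where
    f: "\<forall>i\<in>I. poly_fun (f i) \<and> (\<exists>s. f i s \<noteq> 0) \<and> (\<forall>s. aff c Q s \<in> C i \<longrightarrow> f i s = 0)" by blast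
  have "\<exists>s. \<forall>i\<in>I. f i s \<noteq> 0" by (rule poly_fun_nonzero_common[OF assms(3)]) (use f in blast)+
  then obtain s where s: "\<forall>i\<in>I. f i s \<noteq> 0" ..
  have "aff c Q s \<in> (\<Union>i\<in>I. C i)" using sub cQ by blast
  then show False using f s by blast
qed

section \<open>Singular values\<close>

text \<open>Both families are the multiset of roots of the same polynomial.\<close>

lemma permutes_if_same_roots:
  fixes f f' :: "'n::finite \<Rightarrow> real"
  assumes "\<And>z. (\<Prod>i\<in>UNIV. z - f i) = (\<Prod>i\<in>UNIV. z - f' i)"
  obtains p where "p permutes UNIV" "\<And>i. f i = f' (p i)"
proof -
  have roots: "proots (\<Prod>i\<in>UNIV. [:- f i, 1:]) = image_mset f (mset_set UNIV)" for f :: "'n \<Rightarrow> real"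
  proof -
    have "proots (\<Prod>i\<in>UNIV. [:- f i, 1:]) = (\<Sum>i\<in>UNIV. {#f i#})"
      by (subst proots_prod) auto
    also have "\<dots> = image_mset f (mset_set UNIV)"
      using finite[of "UNIV :: 'n set"] by (induction rule: finite_induct) simp_all
    finally show ?thesis .
  qed
  have "poly (\<Prod>i\<in>UNIV. [:- f i, 1:]) = poly (\<Prod>i\<in>UNIV. [:- f' i, 1:])"
  proof (rule ext)
    fix z
    show "poly (\<Prod>i\<in>UNIV. [:- f i, 1:]) z = poly (\<Prod>i\<in>UNIV. [:- f' i, 1:]) z"
      using assms[of z] by (simp add: poly_prod)
  qed
  then have "(\<Prod>i\<in>UNIV. [:- f i, 1:]) = (\<Prod>i\<in>UNIV. [:- f' i, 1:])"
    by (simp only: poly_eq_poly_eq_iff)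
  then have "image_mset f (mset_set UNIV) = image_mset f' (mset_set UNIV)"
    by (simp only: roots[symmetric])
  then obtain p where "p permutes UNIV" "\<forall>i\<in>UNIV. f i = f' (p i)"
    by (rule image_mset_eq_implies_permutes[OF finite])
  then show ?thesis by (intro that) auto
qed

lemma sorted_rearrangement_unique:
  fixes s s' :: "'n::{finite,linorder} \<Rightarrow> real"
  assumes "antimono s" "antimono s'" and p: "p permutes UNIV" "\<And>i. s i = s' (p i)"
  shows "s = s'"
proof -
  define xs where "xs = rev (sorted_list_of_set (UNIV :: 'n set))"
  have set: "set xs = UNIV" by (simp add: xs_def)
  have sort: "sorted (map s xs)" if "antimono s" for s :: "'n \<Rightarrow> real"
    unfolding xs_def rev_map[symmetric] sorted_wrt_rev sorted_wrt_map
    by (rule sorted_wrt_mono_rel[OF _ sorted_sorted_list_of_set]) (use that in \<open>auto simp: antimono_def\<close>)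
  have xs: "mset xs = mset_set UNIV"
    using mset_set_set[of xs] set by (simp add: xs_def)
  have "image_mset s (mset_set UNIV) = image_mset s' (image_mset p (mset_set UNIV))"
    by (simp add: multiset.map_comp comp_def flip: p(2))
  also have "image_mset p (mset_set UNIV) = mset_set UNIV"
    using p(1) by (simp add: image_mset_mset_set permutes_inj permutes_surj)
  finally have "mset (map s xs) = mset (map s' xs)" by (simp add: xs)
  then have "map s xs = map s' xs"
    using properties_for_sort[of "map s xs" "map s' xs"] properties_for_sort[of "map s' xs" "map s' xs"] sort assms by simp
  then show ?thesis using set by (auto simp: map_eq_conv)
qed

text \<open>The squares of the diagonal entries are the eigenvalues of \<open>X X\<^sup>T\<close>.\<close>

lemma det_gram:
  fixes x :: "'a::field ^ ('n::finite \<times> 't::finite)"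
  assumes U: "orthogonal_matrix U" and V: "orthogonal_matrix V" and \<iota>: "inj \<iota>"
  shows "det (mat z - gram (act U V (diag_vec \<iota> y))) = (\<Prod>i\<in>UNIV. z - (y $ i)\<^sup>2)"
proof -
  have z: "mat z = U ** mat z ** transpose U"
  proof -
    have "U ** mat z ** transpose U = mat z ** (U ** transpose U)"
      unfolding mat_commute[of z U, symmetric] matrix_mul_assoc ..
    then show ?thesis using U by (simp add: orthogonal_matrix_def)
  qed
  have "mat z - gram (act U V (diag_vec \<iota> y)) = U ** (mat z - diag_mat (\<lambda>i. (y $ i)\<^sup>2)) ** transpose U"
    unfolding gram_act[OF V] gram_diag_vec[OF \<iota>] matrix_mul_diff_left matrix_mul_diff_right
    by (simp add: z[symmetric])
  also have "mat z - diag_mat (\<lambda>i. (y $ i)\<^sup>2) = diag_mat (\<lambda>i. z - (y $ i)\<^sup>2)"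
    by (simp add: diag_mat_def mat_def vec_eq_iff)
  finally show ?thesis by (simp only: det_orthogonal_conjugate[OF U])
qed

lemma gram_mat_vec: "gram (mat_vec X) = X ** transpose X"
  by (simp add: gram_def)

lemma singular_values_eqI:
  fixes X :: "real ^ 't::finite ^ 'n::{finite,linorder}"
  assumes \<iota>: "inj \<iota>" and U: "orthogonal_matrix U" and V: "orthogonal_matrix V"
    and X: "mat_vec X = act U V (diag_vec \<iota> s)"
    and s: "\<And>i. 0 \<le> s $ i" "\<And>i j. i \<le> j \<Longrightarrow> s $ j \<le> s $ i"
  shows "singular_values X = s"
proof -
  have det: "det (mat z - X ** transpose X) = (\<Prod>i\<in>UNIV. z - (s $ i)\<^sup>2)" for z
    using det_gram[OF U V \<iota>, of z s] by (simp add: X[symmetric] gram_mat_vec)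
  show ?thesis
    unfolding singular_values_def
  proof (rule the_equality)
    show "(\<forall>i. 0 \<le> s $ i) \<and> (\<forall>i j. i \<le> j \<longrightarrow> s $ j \<le> s $ i) \<and>
        (\<forall>z. det (mat z - X ** transpose X) = (\<Prod>i\<in>UNIV. z - (s $ i)\<^sup>2))"
      using s det by simp
  next
    fix r :: "real ^ 'n::{finite,linorder}" assume r: "(\<forall>i. 0 \<le> r $ i) \<and> (\<forall>i j. i \<le> j \<longrightarrow> r $ j \<le> r $ i) \<and>
        (\<forall>z. det (mat z - X ** transpose X) = (\<Prod>i\<in>UNIV. z - (r $ i)\<^sup>2))"
    have eq: "(\<Prod>i\<in>UNIV. z - (r $ i)\<^sup>2) = (\<Prod>i\<in>UNIV. z - (s $ i)\<^sup>2)" for z using r det[of z] by simp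
    obtain p :: "'n \<Rightarrow> 'n" where p: "p permutes UNIV" "\<And>i. (r $ i)\<^sup>2 = (s $ p i)\<^sup>2"
      by (rule permutes_if_same_roots[OF eq]) blast
    have "r $ i = s $ p i" for i
      using p(2)[of i] r s(1)[of "p i"] by (simp add: power2_eq_iff_nonneg)
    then have "($) r = ($) s"
      by (intro sorted_rearrangement_unique[OF _ _ p(1)]) (use r s in \<open>auto simp: antimono_def\<close>)
    then show "r = s" by (simp add: vec_eq_iff)
  qed
qed

lemma singular_value_decomposition:
  fixes X :: "real ^ 't::finite ^ 'n::{finite,linorder}"
  assumes \<iota>: "inj \<iota>"
  obtains U V where "orthogonal_matrix U" "orthogonal_matrix V"
    "mat_vec X = act U V (diag_vec \<iota> (singular_values X))"
proof -
  obtain U V s where svd: "orthogonal_matrix U" "orthogonal_matrix V" "mat_vec X = act U V (diag_vec \<iota> s)"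
    and s: "\<And>i. 0 \<le> s $ i" "\<And>i j. i \<le> j \<Longrightarrow> s $ j \<le> s $ i"
    by (rule real_singular_value_decomposition[OF \<iota>, of "mat_vec X"]) blast
  have "singular_values X = s" by (rule singular_values_eqI[OF \<iota> svd s])
  then show ?thesis using that svd by blast
qed

text \<open>The squares of the singular values and of the entries of \<open>y\<close> are the same eigenvalues.\<close>

lemma singular_values_signed_permutation:
  fixes X :: "real ^ 't::finite ^ 'n::{finite,linorder}"
  assumes \<iota>: "inj \<iota>" and UV: "orthogonal_matrix U" "orthogonal_matrix V"
    and X: "mat_vec X = act U V (diag_vec \<iota> y)"
  shows "\<exists>g\<in>sperms. singular_values X = g y"
proof -
  let ?s = "singular_values X"
  obtain U' V' where svd: "orthogonal_matrix U'" "orthogonal_matrix V'" "mat_vec X = act U' V' (diag_vec \<iota> ?s)"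
    by (rule singular_value_decomposition[OF \<iota>])
  have eq: "(\<Prod>i\<in>UNIV. z - (?s $ i)\<^sup>2) = (\<Prod>i\<in>UNIV. z - (y $ i)\<^sup>2)" for z
    using det_gram[OF UV \<iota>, of z y] det_gram[OF svd(1,2) \<iota>, of z ?s] by (simp add: X[symmetric] svd(3)[symmetric])
  obtain p :: "'n \<Rightarrow> 'n" where p: "p permutes UNIV" "\<And>i. (?s $ i)\<^sup>2 = (y $ p i)\<^sup>2"
    by (rule permutes_if_same_roots[OF eq]) blast
  define e where "e i = (if ?s $ i = y $ p i then 1 else -1 :: real)" for i
  have "e \<in> signs" by (simp add: e_def signs_def)
  moreover have "?s = sperm e p y"
    unfolding vec_eq_iff sperm_def using p(2) by (auto simp: e_def power2_eq_iff)
  ultimately show ?thesis using p(1) unfolding sperms_def by blast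
qed

section \<open>Positions of diagonal entries\<close>

lemma inj_position: "inj (\<lambda>i :: 'a::{finite,linorder}. card {..<i})"
proof (rule linorder_injI)
  fix i j :: "'a::{finite,linorder}" assume "i < j"
  then have "{..<i} \<subset> {..<j}" by auto
  then show "card {..<i} \<noteq> card {..<j}" using psubset_card_mono[of "{..<j}" "{..<i}"] by simp
qed

lemma range_position: "range (\<lambda>i :: 'a::{finite,linorder}. card {..<i}) = {..<CARD('a)}"
proof (rule card_subset_eq)
  show "range (\<lambda>i :: 'a::{finite,linorder}. card {..<i}) \<subseteq> {..<CARD('a)}"
    by (auto intro!: psubset_card_mono)
  show "card (range (\<lambda>i :: 'a::{finite,linorder}. card {..<i})) = card {..<CARD('a)}"
    by (simp add: card_image[OF inj_position])
qed simp

lemma diagonal_positions: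
  assumes "CARD('n::{finite,linorder}) \<le> CARD('t::{finite,linorder})"
  obtains \<iota> :: "'n::{finite,linorder} \<Rightarrow> 't::{finite,linorder}" where "inj \<iota>"
    "\<And>x :: real ^ 'n::{finite,linorder}.
      mat_vec (Diag x :: real ^ 't::{finite,linorder} ^ 'n::{finite,linorder}) = diag_vec \<iota> x"
proof -
  have "\<exists>j :: 't::{finite,linorder}. card {..<j} = card {..<i}" for i :: "'n::{finite,linorder}"
  proof -
    have "card {..<i} \<in> range (\<lambda>j :: 't::{finite,linorder}. card {..<j})"
      using range_position[where 'a = 'n] rangeI[of "\<lambda>i :: 'n::{finite,linorder}. card {..<i}" i] assms
      unfolding range_position[where 'a = 't] by auto
    then show ?thesis by (metis imageE)
  qed
  then obtain \<iota> :: "'n::{finite,linorder} \<Rightarrow> 't::{finite,linorder}" where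
    \<iota>: "\<And>i. card {..<\<iota> i} = card {..<i}" by metis
  show ?thesis
  proof
    show "inj \<iota>"
    proof (rule injI)
      fix i j assume "\<iota> i = \<iota> j"
      then have "card {..<i} = card {..<j}" using \<iota>[of i] \<iota>[of j] by simp
      then show "i = j" by (rule injD[OF inj_position])
    qed
    have "card {..<i} = card {..<j} \<longleftrightarrow> j = \<iota> i" for i :: "'n::{finite,linorder}" and j :: "'t::{finite,linorder}"
      using \<iota>[of i] injD[OF inj_position, of j "\<iota> i"] by auto
    then show "mat_vec (Diag x :: real ^ 't::{finite,linorder} ^ 'n::{finite,linorder}) = diag_vec \<iota> x"
      for x :: "real ^ 'n::{finite,linorder}"
      by (simp add: vec_eq_iff mat_vec_def Diag_def diag_vec_def)
  qed
qed


section \<open>Real arrangements\<close>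

lemma signed_permutations_eq_sperms: "signed_permutations = (sperms :: (real ^ 'n \<Rightarrow> real ^ 'n) set)"
proof -
  have "bij p \<longleftrightarrow> p permutes UNIV" for p :: "'n \<Rightarrow> 'n"
    by (simp add: bij_iff permutes_def)
  then show ?thesis
    unfolding signed_permutations_def sperms_def signs_def sperm_def by auto
qed

lemma sperm_inner:
  fixes x y :: "real ^ 'n"
  assumes "g \<in> sperms" shows "g x \<bullet> g y = x \<bullet> y"
proof -
  obtain e p where g: "g = sperm e p" "e \<in> signs" "p permutes UNIV" using assms by (auto simp: sperms_def)
  have "g x \<bullet> g y = (\<Sum>i\<in>UNIV. x $ p i * y $ p i)"
    unfolding g(1) inner_vec_def sperm_def
    by (rule sum.cong) (use sign_square[OF g(2)] in \<open>auto simp: algebra_simps\<close>)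
  also have "\<dots> = (\<Sum>i\<in>UNIV. x $ i * y $ i)" by (rule sum.permute[OF g(3), unfolded comp_def, symmetric])
  finally show ?thesis by (simp add: inner_vec_def)
qed

lemma sperms_combination:
  fixes x y :: "real ^ 'n"
  assumes "g \<in> sperms" shows "g (u *\<^sub>R x + v *\<^sub>R y) = u *\<^sub>R g x + v *\<^sub>R g y" "g (x - y) = g x - g y"
  using assms by (auto simp: sperms_def sperm_def vec_eq_iff algebra_simps)

lemma is_orthogonal_projection_sperm:
  assumes g: "g \<in> sperms" and x: "is_orthogonal_projection A y x"
  shows "is_orthogonal_projection (g ` A) (g y) (g x)"
  unfolding is_orthogonal_projection_def
proof (intro conjI ballI)
  show "g x \<in> g ` A" using x unfolding is_orthogonal_projection_def by blast
  fix b assume "b \<in> g ` A"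
  then obtain a where a: "a \<in> A" "b = g a" by blast
  have "g (y - x) \<bullet> g (a - x) = 0"
    using x a(1) by (simp add: sperm_inner[OF g] is_orthogonal_projection_def orthogonal_def)
  then show "orthogonal (g y - g x) (b - g x)"
    by (simp add: orthogonal_def a(2) sperms_combination(2)[OF g])
qed

text \<open>The sign matrices that Cayley transforms leave over act on diagonal matrices by sign changes.\<close>

lemma orthogonal_cayley_form:
  fixes \<iota> :: "'n::finite \<Rightarrow> 't::finite"
  assumes \<iota>: "inj \<iota>" and U: "orthogonal_matrix (U :: 'a::field_char_0 ^ 'n ^ 'n)" and V: "orthogonal_matrix V"
  obtains A B g where "skew A" "det (mat 2 - A) \<noteq> 0" "skew B" "det (mat 2 - B) \<noteq> 0" "g \<in> sperms"
    "\<And>x. act U V (diag_vec \<iota> x) = act (cayley A) (cayley B) (diag_vec \<iota> (g x))"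
proof -
  obtain A d where A: "skew A" "det (mat 2 - A) \<noteq> 0" "d \<in> signs" "U = cayley A ** diag_mat d"
    by (rule orthogonal_cayley_signs[OF U])
  obtain B d' where B: "skew B" "det (mat 2 - B) \<noteq> 0" "d' \<in> signs" "V = cayley B ** diag_mat d'"
    by (rule orthogonal_cayley_signs[OF V])
  let ?g = "sperm (\<lambda>i. d i * d' (\<iota> i)) id"
  have "(\<lambda>i. d i * d' (\<iota> i)) \<in> signs" by (rule signs_mult[OF A(3)]) (use B(3) in \<open>simp add: signs_def\<close>)
  then have "?g \<in> sperms" by (rule sperm_sign_in_sperms)
  moreover have "act U V (diag_vec \<iota> x) = act (cayley A) (cayley B) (diag_vec \<iota> (?g x))" for x
  proof -
    have "act (diag_mat d) (diag_mat d') (diag_vec \<iota> x) = diag_vec \<iota> (?g x)"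
      unfolding diag_mat_eq_sperm_mat by (rule act_sperm_mat_diag_vec) simp_all
    then show ?thesis by (simp add: A(4) B(4) act_act[symmetric])
  qed
  ultimately show ?thesis by (rule that[OF A(1,2) B(1,2)])
qed

text \<open>The inclusion says that the projection \<open>aff c' Q'\<close> fixes the image points, which is an identity of polynomials.\<close>

lemma complex_affine_inclusion:
  assumes Q': "Q' ** Q' = Q'" "Q' *v c' = 0"
    and sub: "sperm e p ` range (aff c Q) \<subseteq> range (aff c' Q')"
  shows "sperm (\<lambda>i. complex_of_real (e i)) p ` range (aff (complex_vec c) (cm Q))
    \<subseteq> range (aff (complex_vec c') (cm Q'))"
proof -
  let ?g = "sperm (\<lambda>i. complex_of_real (e i)) p" and ?P = "aff (complex_vec c) (cm Q)"
    and ?P' = "aff (complex_vec c') (cm Q')"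
  have "?P' (?g (?P z)) = ?g (?P z)" for z
  proof (rule complex_vec_identity_extends[of "\<lambda>z. ?P' (?g (?P z))" "\<lambda>z. ?g (?P z)"])
    fix b
    show *: "poly_fun (\<lambda>z. ?g (?P z) $ b)" for b
      by (rule poly_fun_compose[OF poly_fun_sperm]) (rule poly_fun_aff[OF poly_fun_coord])
    show "poly_fun (\<lambda>z. ?P' (?g (?P z)) $ b)" by (rule poly_fun_aff[OF *])
  next
    fix x
    have "aff c' Q' (sperm e p (aff c Q x)) = sperm e p (aff c Q x)"
      using sub range_aff_iff[OF Q'] by blast
    then show "?P' (?g (?P (complex_vec x))) = ?g (?P (complex_vec x))"
      by (simp add: complex_vec_aff[symmetric] complex_vec_sperm[symmetric])
  qed
  then show ?thesis by (auto intro: range_eqI[OF sym])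
qed

text \<open>The real arrangement, with a description of its components by orthogonal projections.\<close>

locale signed_arrangement =
  fixes \<iota> :: "'n::{finite,linorder} \<Rightarrow> 't::finite" and S :: "(real ^ 'n::{finite,linorder}) set" and k :: nat
    and C :: "nat \<Rightarrow> (real ^ 'n::{finite,linorder}) set"
    and c :: "nat \<Rightarrow> real ^ 'n::{finite,linorder}"
    and Q :: "nat \<Rightarrow> real ^ 'n::{finite,linorder} ^ 'n::{finite,linorder}"
  assumes inj_\<iota>: "inj \<iota>" and arrangement: "subspace_arrangement S k C" and signed_invariant: "signed_perm_invariant S"
    and real_sym: "\<And>i. i \<in> {1..k} \<Longrightarrow> transpose (Q i) = Q i"
    and real_idem: "\<And>i. i \<in> {1..k} \<Longrightarrow> Q i ** Q i = Q i"
    and real_normal: "\<And>i. i \<in> {1..k} \<Longrightarrow> Q i *v c i = 0"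
    and range_C: "\<And>i. i \<in> {1..k} \<Longrightarrow> C i = range (aff (c i) (Q i))"
    and projection_C: "\<And>i x y. i \<in> {1..k} \<Longrightarrow> is_orthogonal_projection (C i) y x \<longleftrightarrow> x = aff (c i) (Q i) y"
begin

lemma S_eq: "S = (\<Union>i\<in>{1..k}. C i)" and C_affine: "i \<in> {1..k} \<Longrightarrow> affine (C i) \<and> C i \<noteq> {}"
  and C_antichain: "i \<in> {1..k} \<Longrightarrow> j \<in> {1..k} \<Longrightarrow> C i \<subseteq> C j \<Longrightarrow> i = j"
  using arrangement unfolding subspace_arrangement_def by blast+

lemma C_fixed: "i \<in> {1..k} \<Longrightarrow> x \<in> C i \<longleftrightarrow> aff (c i) (Q i) x = x"
  by (simp add: range_C range_aff_iff real_idem real_normal)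

lemma sperms_image_S: "g \<in> sperms \<Longrightarrow> g ` S = S"
  using signed_invariant unfolding signed_perm_invariant_def signed_permutations_eq_sperms by blast

lemma sperms_in_S_iff:
  assumes g: "g \<in> sperms" shows "g y \<in> S \<longleftrightarrow> y \<in> S"
proof -
  obtain h where h: "h \<in> sperms" "\<And>x. h (g x) = x" by (rule sperms_inverse[OF g]) (rule that)
  show ?thesis using sperms_image_S[OF g] sperms_image_S[OF h(1)] h(2)[of y] by (metis image_eqI)
qed

lemma sperms_image_C_subset:
  assumes i: "i \<in> {1..k}" and g: "g \<in> sperms"
  shows "\<exists>l\<in>{1..k}. g ` C i \<subseteq> C l"
proof (rule affine_subset_finite_union)
  show "affine (g ` C i)"
    unfolding affine_def
  proof (intro ballI allI impI)
    fix x y and u v :: real assume xy: "x \<in> g ` C i" "y \<in> g ` C i" and uv: "u + v = 1"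
    then obtain x' y' where x': "x' \<in> C i" "x = g x'" and y': "y' \<in> C i" "y = g y'" by blast
    have "u *\<^sub>R x' + v *\<^sub>R y' \<in> C i"
      using C_affine[OF i] x'(1) y'(1) uv unfolding affine_def by blast
    then have "g (u *\<^sub>R x' + v *\<^sub>R y') \<in> g ` C i" by (rule imageI)
    then show "u *\<^sub>R x + v *\<^sub>R y \<in> g ` C i" by (simp only: x'(2) y'(2) sperms_combination(1)[OF g])
  qed
  show "g ` C i \<noteq> {}" using C_affine[OF i] by blast
  show "g ` C i \<subseteq> (\<Union>l\<in>{1..k}. C l)" using sperms_image_S[OF g] i unfolding S_eq by blast
qed (use C_affine in auto)

text \<open>A signed permutation and its inverse map affine components into affine components. As no component lies in another one,
  both inclusions are equalities.\<close>

lemma sperms_image_C: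
  assumes i: "i \<in> {1..k}" and g: "g \<in> sperms"
  shows "\<exists>l\<in>{1..k}. g ` C i = C l"
proof -
  obtain h where h: "h \<in> sperms" "\<And>x. h (g x) = x" "\<And>x. g (h x) = x" by (rule sperms_inverse[OF g]) (rule that)
  obtain l where l: "l \<in> {1..k}" "g ` C i \<subseteq> C l" using sperms_image_C_subset[OF i g] by blast
  obtain m where m: "m \<in> {1..k}" "h ` C l \<subseteq> C m" using sperms_image_C_subset[OF l(1) h(1)] by blast
  have "x \<in> C m" if "x \<in> C i" for x
  proof -
    have "g x \<in> C l" using l(2) that by blast
    then have "h (g x) \<in> C m" using m(2) by blast
    then show ?thesis by (simp only: h(2))
  qed
  then have "i = m" by (intro C_antichain[OF i m(1)] subsetI)
  have "x \<in> g ` C i" if "x \<in> C l" for x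
  proof -
    have "h x \<in> C i" using m(2) that \<open>i = m\<close> by blast
    then have "g (h x) \<in> g ` C i" by (rule imageI)
    then show ?thesis by (simp only: h(3))
  qed
  then have "g ` C i = C l" using l(2) by blast
  then show ?thesis using l(1) by blast
qed

sublocale cx: complex_arrangement \<iota> k "\<lambda>i. complex_vec (c i)" "\<lambda>i. cm (Q i)"
proof
  show "inj \<iota>" by (rule inj_\<iota>)
next
  fix i assume i: "i \<in> {1..k}"
  show "transpose (cm (Q i)) = cm (Q i)" by (simp only: cm_transpose[symmetric] real_sym[OF i])
  show "cm (Q i) ** cm (Q i) = cm (Q i)" by (simp only: cm_mult[symmetric] real_idem[OF i])
  show "cm (Q i) *v complex_vec (c i) = 0"
    unfolding complex_vec_matrix_mult[symmetric] real_normal[OF i] by (simp add: vec_eq_iff)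
next
  fix i and g :: "complex ^ 'n::{finite,linorder} \<Rightarrow> complex ^ 'n::{finite,linorder}"
  assume i: "i \<in> {1..k}" and g: "g \<in> sperms"
  let ?P = "\<lambda>i. aff (complex_vec (c i)) (cm (Q i))"
  obtain e p where e: "g = sperm (\<lambda>i. complex_of_real (e i)) p" "e \<in> signs" "p permutes UNIV"
    by (rule complex_sperm[OF g]) (rule that)
  have g': "sperm e p \<in> sperms" using e(2,3) unfolding sperms_def by blast
  obtain l where l: "l \<in> {1..k}" "sperm e p ` C i = C l" using sperms_image_C[OF i g'] by blast
  obtain h where h: "h \<in> sperms" "\<And>x. h (sperm e p x) = x" "\<And>x. sperm e p (h x) = x"
    by (rule sperms_inverse[OF g']) (rule that)
  obtain e' p' where e': "h = sperm e' p'" using h(1) unfolding sperms_def by blast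
  let ?h = "sperm (\<lambda>i. complex_of_real (e' i)) p'"
  have "g ` range (?P i) \<subseteq> range (?P l)"
    unfolding e(1) by (rule complex_affine_inclusion[OF real_idem[OF l(1)] real_normal[OF l(1)]])
      (use l(2) in \<open>simp only: range_C[OF i] range_C[OF l(1)] subset_refl\<close>)
  moreover have "range (?P l) \<subseteq> g ` range (?P i)"
  proof
    fix x assume x: "x \<in> range (?P l)"
    have "h ` C l \<subseteq> C i" unfolding l(2)[symmetric] by (auto simp: h(2))
    then have "?h ` range (?P l) \<subseteq> range (?P i)"
      unfolding e' by (intro complex_affine_inclusion[OF real_idem[OF i] real_normal[OF i]])
        (simp only: range_C[OF i] range_C[OF l(1)])
    then have "?h x \<in> range (?P i)" using x by blast
    moreover have "g (?h x) = x"
    proof (rule complex_vec_identity_extends[of "\<lambda>x. g (?h x)" "\<lambda>x. x"])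
      show "poly_fun (\<lambda>z. g (?h z) $ b)" for b
        unfolding e(1) by (rule poly_fun_compose[OF poly_fun_sperm poly_fun_sperm])
      show "g (?h (complex_vec y)) = complex_vec y" for y
        unfolding e(1) complex_vec_sperm[symmetric] e'[symmetric] h(3) ..
    qed (rule poly_fun_coord)
    ultimately show "x \<in> g ` range (?P i)" by (metis imageI)
  qed
  ultimately show "\<exists>l\<in>{1..k}. g ` range (?P i) = range (?P l)" using l(1) by blast
next
  fix i j assume i: "i \<in> {1..k}" and j: "j \<in> {1..k}"
    and sub: "range (aff (complex_vec (c i)) (cm (Q i))) \<subseteq> range (aff (complex_vec (c j)) (cm (Q j)))"
  have cxj: "cm (Q j) ** cm (Q j) = cm (Q j)" "cm (Q j) *v complex_vec (c j) = 0"
    by (simp only: cm_mult[symmetric] real_idem[OF j])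
      (simp add: complex_vec_matrix_mult[symmetric] real_normal[OF j], simp add: vec_eq_iff)
  show "i = j"
  proof (rule C_antichain[OF i j], rule subsetI)
    fix x assume "x \<in> C i"
    then have "complex_vec x = aff (complex_vec (c i)) (cm (Q i)) (complex_vec x)"
      by (simp add: C_fixed[OF i] complex_vec_aff[symmetric])
    then have "complex_vec x \<in> range (aff (complex_vec (c j)) (cm (Q j)))" using sub by (metis rangeI subsetD)
    then have "complex_vec (aff (c j) (Q j) x) = complex_vec x"
      unfolding range_aff_iff[OF cxj] complex_vec_aff .
    then show "x \<in> C j" by (simp add: complex_vec_inject C_fixed[OF j])
  qed
qed

abbreviation Mset :: "(real ^ 't ^ 'n::{finite,linorder}) set" where "Mset \<equiv> singular_values -` S"

text \<open>Diagonal matrices whose entries differ by a signed permutation have the same singular values, and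
  \<open>S\<close> is invariant under signed permutations.\<close>

lemma in_M_iff:
  assumes UV: "orthogonal_matrix U" "orthogonal_matrix V" and X: "mat_vec X = act U V (diag_vec \<iota> y)"
  shows "X \<in> Mset \<longleftrightarrow> y \<in> S"
proof -
  obtain g where "g \<in> sperms" "singular_values X = g y"
    using singular_values_signed_permutation[OF inj_\<iota> UV X] by blast
  then show ?thesis by (simp add: sperms_in_S_iff)
qed

lemma complex_P: "complex_vec (aff (c i) (Q i) s) = cx.P i (complex_vec s)"
  by (rule complex_vec_aff)

lemma complex_cayley_act:
  assumes "det (mat 2 - A) \<noteq> 0" "det (mat 2 - B) \<noteq> 0"
  shows "complex_vec (act (cayley A) (cayley B) (diag_vec \<iota> y)) =
    act (cayley (cm A)) (cayley (cm B)) (cx.dg (complex_vec y))"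
  by (simp add: complex_vec_act cm_cayley assms complex_vec_diag_vec)

text \<open>Decompose a real matrix and write the orthogonal factors as Cayley transforms times signs; the signs
  move the singular values within \<open>S\<close>.\<close>

lemma real_points_in_W: "complex_vec ` mat_vec ` Mset \<subseteq> cx.W"
proof clarify
  fix X :: "real ^ 't ^ 'n::{finite,linorder}" assume X: "singular_values X \<in> S"
  obtain U V where UV: "orthogonal_matrix U" "orthogonal_matrix V"
    "mat_vec X = act U V (diag_vec \<iota> (singular_values X))"
    by (rule singular_value_decomposition[OF inj_\<iota>])
  obtain A B g where AB: "skew A" "det (mat 2 - A) \<noteq> 0" "skew B" "det (mat 2 - B) \<noteq> 0" and g: "g \<in> sperms"
    "\<And>x. act U V (diag_vec \<iota> x) = act (cayley A) (cayley B) (diag_vec \<iota> (g x))"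
    by (rule orthogonal_cayley_form[OF inj_\<iota> UV(1,2)]) (rule that)
  let ?y = "g (singular_values X)"
  have "?y \<in> S" using X sperms_in_S_iff[OF g(1)] by blast
  then obtain i where i: "i \<in> {1..k}" "?y \<in> C i" unfolding S_eq by blast
  have y: "complex_vec ?y = cx.P i (complex_vec ?y)"
    using i(2) by (simp add: complex_P[symmetric] C_fixed[OF i(1)])
  have "complex_vec (mat_vec X) = act (cayley (cm A)) (cayley (cm B)) (cx.dg (complex_vec ?y))"
    unfolding UV(3) g(2) by (rule complex_cayley_act[OF AB(2,4)])
  moreover have "act (cayley (cm A)) (cayley (cm B)) (cx.dg (complex_vec ?y)) \<in> cx.Z i"
    by (subst y, rule cx.Z_invariant)
      (simp_all add: AB cm_skew det_two_minus_cm cx.diag_in_Z)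
  ultimately show "complex_vec (mat_vec X) \<in> cx.W" unfolding cx.W_def using i(1) by auto
qed

text \<open>The real parameters are Zariski-dense among the complex ones.\<close>

lemma W_subset_complexification: "cx.W \<subseteq> complexification (mat_vec ` Mset)"
proof -
  have "f z = 0" if f: "poly_fun f" "\<forall>x\<in>complex_vec ` mat_vec ` Mset. f x = 0" and i: "i \<in> {1..k}" and z: "z \<in> cx.Z i" for f i z
  proof -
    have "rational_on orbit_den (\<lambda>u. f (cx.param i u))"
      by (rule rational_on_compose[OF poly_fun_orbit_den f(1)]) (rule rational_param.rational[OF cx.rational_param])
    then obtain N e where N: "poly_fun N" "\<And>u. orbit_den u \<noteq> 0 \<Longrightarrow> f (cx.param i u) * orbit_den u ^ e = N u"
      unfolding rational_on_def by blast
    have "N (complex_vec u) * orbit_den (complex_vec u) = 0" for u :: "real ^ (('n \<times> 'n) + (('t \<times> 't) + 'n))"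
    proof (cases "orbit_den (complex_vec u) = 0")
      case False
      have gen: "genA (complex_vec u) = cm (genA u)" "genB (complex_vec u) = cm (genB u)"
        "genY (complex_vec u) = complex_vec (genY u)"
        by (simp_all add: genA_def genB_def genY_def cm_def vec_eq_iff)
      have det: "det (mat 2 - genA u) \<noteq> 0" "det (mat 2 - genB u) \<noteq> 0"
        using False by (simp_all add: orbit_den_det gen det_two_minus_cm)
      let ?y = "aff (c i) (Q i) (genY u)"
      let ?x = "act (cayley (genA u)) (cayley (genB u)) (diag_vec \<iota> ?y)"
      have "cx.param i (complex_vec u) = complex_vec ?x"
        unfolding complex_cayley_act[OF det] cx.param_eq gen complex_P ..
      moreover have "?y \<in> S" unfolding S_eq using i range_C[OF i] by blast
      then have "unvec ?x \<in> Mset"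
        by (intro iffD2[OF in_M_iff[OF cayley_orthogonal[OF skew_genA det(1)] cayley_orthogonal[OF skew_genB det(2)]]]) simp_all
      then have "complex_vec (mat_vec (unvec ?x)) \<in> complex_vec ` mat_vec ` Mset" by blast
      from bspec[OF f(2) this] have "f (complex_vec ?x) = 0" by simp
      ultimately have "f (cx.param i (complex_vec u)) = 0" by simp
      then show ?thesis using N(2)[OF False] by simp
    qed simp
    then have "N u * orbit_den u = 0" for u
      by (rule poly_fun_zero_on_reals[OF poly_fun_mult[OF N(1) poly_fun_orbit_den]])
    then have "f (cx.param i u) = 0" if "orbit_den u \<noteq> 0" for u
      using N(2)[OF that] that \<open>\<And>u. N u * orbit_den u = 0\<close>[of u] by auto
    then have "\<forall>x\<in>cx.param i ` rational_param.params orbit_den. f x = 0"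
      by (auto simp: cx.params_iff)
    then show ?thesis
      using z vanishes_on_closure_iff[OF f(1)] unfolding cx.Z_def rational_param.variety_def[OF cx.rational_param] by blast
  qed
  then show ?thesis unfolding complexification_def zariski_closure_of_eq cx.W_def by blast
qed

lemma complexification_M: "complexification (mat_vec ` Mset) = cx.W"
proof
  show "complexification (mat_vec ` Mset) \<subseteq> cx.W"
    unfolding complexification_def by (rule closure_of_minimal[OF real_points_in_W cx.W_closed])
qed (rule W_subset_complexification)

section \<open>The critical points\<close>

text \<open>The conditions under which the critical points of the data point \<open>dg s\<close> are known and distinct. Two
  projections onto different components do not coincide identically, as the components are different.\<close>

lemma generic_diagonal_polynomial:
  obtains H where "poly_fun H" "\<exists>s. H s \<noteq> 0" "\<And>s j. H s \<noteq> 0 \<Longrightarrow> s $ j \<noteq> 0"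
    "\<And>s j l. H s \<noteq> 0 \<Longrightarrow> j \<noteq> l \<Longrightarrow> (s $ j)\<^sup>2 \<noteq> (s $ l)\<^sup>2"
    "\<And>s i. H s \<noteq> 0 \<Longrightarrow> i \<in> {1..k} \<Longrightarrow> cx.generic i s"
    "\<And>s. H s \<noteq> 0 \<Longrightarrow> inj_on (\<lambda>i. cx.P i s) {1..k}"
proof -
  have "\<forall>i. \<exists>h. poly_fun h \<and> (\<exists>s. h s \<noteq> 0) \<and> (\<forall>s. h s \<noteq> 0 \<longrightarrow> cx.generic i s)"
    using cx.generic_polynomial by blast
  from choice[OF this] obtain h where
    h: "\<forall>i. poly_fun (h i) \<and> (\<exists>s. h i s \<noteq> 0) \<and> (\<forall>s. h i s \<noteq> 0 \<longrightarrow> cx.generic i s)" by blast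
  let ?J = "{ij \<in> {1..k} \<times> {1..k}. fst ij \<noteq> snd ij}"
  have "\<exists>sb. cx.P (fst ij) (fst sb) $ snd sb \<noteq> cx.P (snd ij) (fst sb) $ snd sb" if ij: "ij \<in> ?J" for ij
  proof (rule ccontr)
    assume "\<not> ?thesis"
    then have "cx.P (fst ij) s = cx.P (snd ij) s" for s by (auto simp: vec_eq_iff)
    then have "range (cx.P (fst ij)) \<subseteq> range (cx.P (snd ij))" by auto
    then show False using cx.antichain[of "fst ij" "snd ij"] ij by auto
  qed
  then have "\<forall>ij\<in>?J. \<exists>sb. cx.P (fst ij) (fst sb) $ snd sb \<noteq> cx.P (snd ij) (fst sb) $ snd sb" by blast
  from bchoice[OF this] obtain b where
    b: "\<forall>ij\<in>?J. cx.P (fst ij) (fst (b ij)) $ snd (b ij) \<noteq> cx.P (snd ij) (fst (b ij)) $ snd (b ij)" by blast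
  define d where "d ij s = cx.P (fst ij) s $ snd (b ij) - cx.P (snd ij) s $ snd (b ij)" for ij s
  let ?F1 = "range (\<lambda>j (s :: complex ^ 'n::{finite,linorder}). s $ j)"
  let ?F2 = "(\<lambda>(j, l) (s :: complex ^ 'n::{finite,linorder}). (s $ j)\<^sup>2 - (s $ l)\<^sup>2) ` {(j, l). j \<noteq> l}"
  let ?F = "?F1 \<union> ?F2 \<union> h ` {1..k} \<union> d ` ?J"
  define H where "H s = (\<Prod>f\<in>?F. f s)" for s
  have fin: "finite ?F" by simp
  have poly: "poly_fun f" if "f \<in> ?F" for f
    using that h by (auto simp: d_def[abs_def] intro!: poly_fun_intros cx.poly_fun_P)
  have nz: "\<exists>s. f s \<noteq> 0" if f: "f \<in> ?F" for f
  proof -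
    consider (1) "f \<in> ?F1" | (2) "f \<in> ?F2" | (3) "f \<in> h ` {1..k}" | (4) "f \<in> d ` ?J" using f by blast
    then show ?thesis
    proof cases
      case 1
      then obtain j where "f = (\<lambda>s. s $ j)" by blast
      then have "f (\<chi> i. 1) \<noteq> 0" by simp
      then show ?thesis ..
    next
      case 2
      then obtain j l where "j \<noteq> l" "f = (\<lambda>s. (s $ j)\<^sup>2 - (s $ l)\<^sup>2)" by auto
      then have "f (axis j 1) \<noteq> 0" by (simp add: axis_def)
      then show ?thesis ..
    next
      case 3
      then show ?thesis using h by blast
    next
      case 4
      then obtain ij where ij: "ij \<in> ?J" "f = d ij" by blast
      then have "f (fst (b ij)) \<noteq> 0" using bspec[OF b ij(1)] by (simp add: d_def)
      then show ?thesis ..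
    qed
  qed
  have HF: "f s \<noteq> 0" if "H s \<noteq> 0" "f \<in> ?F" for f s
  proof
    assume "f s = 0"
    then have "\<exists>f\<in>?F. f s = 0" using that(2) by (rule bexI)
    then have "H s = 0" unfolding H_def prod_zero_iff[OF fin] .
    then show False using that(1) by simp
  qed
  show ?thesis
  proof
    show "poly_fun H" unfolding H_def by (intro poly_fun_prod poly)
    have "\<exists>s. \<forall>f\<in>?F. f s \<noteq> 0" by (rule poly_fun_nonzero_common[OF fin poly nz])
    then obtain s where "\<forall>f\<in>?F. f s \<noteq> 0" ..
    then have "H s \<noteq> 0" unfolding H_def prod_zero_iff[OF fin] by (simp only: bex_simps not_False_eq_True)
    then show "\<exists>s. H s \<noteq> 0" ..
  next
    fix s :: "complex ^ 'n::{finite,linorder}" assume Hs: "H s \<noteq> 0"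
    show "s $ j \<noteq> 0" for j using HF[OF Hs, of "\<lambda>s. s $ j"] by blast
    show "(s $ j)\<^sup>2 \<noteq> (s $ l)\<^sup>2" if "j \<noteq> l" for j l
    proof -
      have "(\<lambda>s. (s $ j)\<^sup>2 - (s $ l)\<^sup>2) \<in> ?F2" using that by (intro image_eqI[of _ _ "(j, l)"]) auto
      then show ?thesis using HF[OF Hs, of "\<lambda>s. (s $ j)\<^sup>2 - (s $ l)\<^sup>2"] by simp
    qed
    show "cx.generic i s" if i: "i \<in> {1..k}" for i
    proof -
      have "h i s \<noteq> 0" by (rule HF[OF Hs UnI1[OF UnI2[OF imageI[OF i]]]])
      then show ?thesis using h by blast
    qed
    show "inj_on (\<lambda>i. cx.P i s) {1..k}"
    proof (rule inj_onI, rule ccontr)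
      fix i j assume ij: "i \<in> {1..k}" "j \<in> {1..k}" "cx.P i s = cx.P j s" "i \<noteq> j"
      then have "(i, j) \<in> ?J" by simp
      then have "d (i, j) s \<noteq> 0" by (intro HF[OF Hs UnI2] imageI)
      then show False by (simp add: d_def ij(3))
    qed
  qed
qed

lemma critical_points_at_cayley:
  assumes "skew A" "det (mat 2 - A) \<noteq> 0" "skew B" "det (mat 2 - B) \<noteq> 0"
    and "\<And>j. s $ j \<noteq> 0" "\<And>j l. j \<noteq> l \<Longrightarrow> (s $ j)\<^sup>2 \<noteq> (s $ l)\<^sup>2"
    and "\<And>i. i \<in> {1..k} \<Longrightarrow> cx.generic i s"
  shows "ED_critical_points (mat_vec ` Mset) (act (cayley A) (cayley B) (cx.dg s)) =
    (\<lambda>i. act (cayley A) (cayley B) (cx.dg (cx.P i s))) ` {1..k}"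
  unfolding ED_critical_points_def complexification_M by (rule cx.critical_points_W[OF assms])

text \<open>Signed permutations are isometries that permute the components, so they commute with the
  family of all projections.\<close>

lemma projections_of_signed_permutation:
  assumes g: "g \<in> sperms"
  shows "(\<lambda>i. aff (c i) (Q i) (g s)) ` {1..k} = g ` {x. \<exists>i\<in>{1..k}. is_orthogonal_projection (C i) s x}"
proof -
  have sub: "g x \<in> (\<lambda>i. aff (c i) (Q i) (g s)) ` {1..k}"
    if g: "g \<in> sperms" and i: "i \<in> {1..k}" "x = aff (c i) (Q i) s" for g x i s
  proof -
    have "is_orthogonal_projection (C i) s x" using projection_C[OF i(1)] i(2) by blast
    then have "is_orthogonal_projection (g ` C i) (g s) (g x)" by (rule is_orthogonal_projection_sperm[OF g])
    moreover obtain l where l: "l \<in> {1..k}" "g ` C i = C l" using sperms_image_C[OF i(1) g] by blast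
    ultimately have "g x = aff (c l) (Q l) (g s)" using projection_C[OF l(1)] by simp
    then show ?thesis using l(1) by blast
  qed
  obtain h where h: "h \<in> sperms" "\<And>x. h (g x) = x" "\<And>x. g (h x) = x" by (rule sperms_inverse[OF g]) (rule that)
  show ?thesis
  proof (intro subset_antisym subsetI)
    fix y assume "y \<in> (\<lambda>i. aff (c i) (Q i) (g s)) ` {1..k}"
    then obtain i where i: "i \<in> {1..k}" "y = aff (c i) (Q i) (g s)" by blast
    have "h y \<in> (\<lambda>i. aff (c i) (Q i) (h (g s))) ` {1..k}" by (rule sub[OF h(1) i])
    then obtain l where "l \<in> {1..k}" "h y = aff (c l) (Q l) s" unfolding h(2) by blast
    then have "h y \<in> {x. \<exists>i\<in>{1..k}. is_orthogonal_projection (C i) s x}" using projection_C by blast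
    then have "g (h y) \<in> g ` {x. \<exists>i\<in>{1..k}. is_orthogonal_projection (C i) s x}" by (rule imageI)
    then show "y \<in> g ` {x. \<exists>i\<in>{1..k}. is_orthogonal_projection (C i) s x}" by (simp only: h(3))
  next
    fix y assume "y \<in> g ` {x. \<exists>i\<in>{1..k}. is_orthogonal_projection (C i) s x}"
    then obtain x i where "y = g x" "i \<in> {1..k}" "is_orthogonal_projection (C i) s x" by blast
    then show "y \<in> (\<lambda>i. aff (c i) (Q i) (g s)) ` {1..k}" using sub[OF g] projection_C by blast
  qed
qed

text \<open>The polynomial \<open>R\<close> that cuts out the exceptional data points is a product of two invariant
  ones: where the first does not vanish there is a complex singular value decomposition, and where
  the second does not vanish the singular values are generic.\<close>

lemma critical_points_of_generic_data:
  obtains R where "poly_fun R" "\<exists>y. R y \<noteq> 0"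
    "\<And>y. R y \<noteq> 0 \<Longrightarrow> finite (ED_critical_points (mat_vec ` Mset) y) \<and> card (ED_critical_points (mat_vec ` Mset) y) = k"
    "\<And>Y U V s. R (complex_vec Y) \<noteq> 0 \<Longrightarrow> orthogonal_matrix U \<Longrightarrow> orthogonal_matrix V \<Longrightarrow>
      Y = act U V (diag_vec \<iota> s) \<Longrightarrow> ED_critical_points (mat_vec ` Mset) (complex_vec Y) =
      {complex_vec (act U V (diag_vec \<iota> x)) |x. \<exists>i\<in>{1..k}. is_orthogonal_projection (C i) s x}"
proof -
  obtain H where H: "poly_fun H" "\<exists>s. H s \<noteq> 0" "\<And>s j. H s \<noteq> 0 \<Longrightarrow> s $ j \<noteq> 0"
    "\<And>s j l. H s \<noteq> 0 \<Longrightarrow> j \<noteq> l \<Longrightarrow> (s $ j)\<^sup>2 \<noteq> (s $ l)\<^sup>2"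
    "\<And>s i. H s \<noteq> 0 \<Longrightarrow> i \<in> {1..k} \<Longrightarrow> cx.generic i s"
    "\<And>s. H s \<noteq> 0 \<Longrightarrow> inj_on (\<lambda>i. cx.P i s) {1..k}"
    by (rule generic_diagonal_polynomial) (rule that)
  obtain F where F: "poly_fun F" "\<forall>U V x. orthogonal_matrix U \<and> orthogonal_matrix V \<longrightarrow>
    (F (act U V (cx.dg x)) \<noteq> 0 \<longleftrightarrow> (\<forall>g\<in>sperms. H (g x) \<noteq> 0))"
    using invariant_product_extension[OF H(1) inj_\<iota>] by blast
  have FH: "H (g s) \<noteq> 0" if "orthogonal_matrix U" "orthogonal_matrix V" "F (act U V (cx.dg s)) \<noteq> 0" "g \<in> sperms" for U V g s
    using F(2) that by blast
  define R where "R y = svd_discriminant y * F y" for y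
  show ?thesis
  proof
    show "poly_fun R" unfolding R_def by (intro poly_fun_mult poly_fun_svd_discriminant F(1))
    have "\<exists>s. \<forall>g\<in>sperms. H (g s) \<noteq> 0"
    proof (rule poly_fun_nonzero_common[OF finite_sperms])
      fix g :: "complex ^ 'n::{finite,linorder} \<Rightarrow> complex ^ 'n::{finite,linorder}" assume g: "g \<in> sperms"
      show "poly_fun (\<lambda>s. H (g s))" by (rule poly_fun_compose[OF H(1) poly_fun_sperms[OF g]])
      obtain h where h: "\<And>x. g (h x) = x" by (rule sperms_inverse[OF g]) (rule that)
      obtain s where "H s \<noteq> 0" using H(2) by blast
      then have "H (g (h s)) \<noteq> 0" by (simp only: h not_False_eq_True)
      then show "\<exists>s. H (g s) \<noteq> 0" by blast
    qed
    then obtain s where s: "\<forall>g\<in>sperms. H (g s) \<noteq> 0" by blast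
    have id: "orthogonal_matrix (mat 1 :: complex ^ 'k ^ 'k)" by (simp add: orthogonal_matrix_def transpose_mat)
    have "F (act (mat 1) (mat 1) (cx.dg s)) \<noteq> 0"
      by (rule iffD2[OF F(2)[rule_format, OF conjI[OF id id]] s])
    moreover obtain y0 :: "complex ^ ('n \<times> 't)" where "svd_discriminant y0 \<noteq> 0" using svd_discriminant_nonzero[OF inj_\<iota>] by blast
    ultimately show "\<exists>y. R y \<noteq> 0"
      using poly_fun_nonzero_common2[OF poly_fun_svd_discriminant _ F(1)] unfolding R_def mult_eq_0_iff de_Morgan_disj by blast
  next
    fix y assume "R y \<noteq> 0"
    then have y: "svd_discriminant y \<noteq> 0" "F y \<noteq> 0" by (auto simp: R_def)
    obtain U V s where svd: "orthogonal_matrix U" "orthogonal_matrix V" "y = act U V (cx.dg s)"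
      by (rule complex_singular_value_decomposition[OF inj_\<iota> y(1)])
    obtain A B g where AB: "skew A" "det (mat 2 - A) \<noteq> 0" "skew B" "det (mat 2 - B) \<noteq> 0" and g: "g \<in> sperms"
      "\<And>x. act U V (cx.dg x) = act (cayley A) (cayley B) (cx.dg (g x))"
      by (rule orthogonal_cayley_form[OF inj_\<iota> svd(1,2)]) (rule that)
    have Hg: "H (g s) \<noteq> 0" using FH svd y(2) g(1) by blast
    have crit: "ED_critical_points (mat_vec ` Mset) y = (\<lambda>i. act (cayley A) (cayley B) (cx.dg (cx.P i (g s)))) ` {1..k}"
      unfolding svd(3) g(2) by (rule critical_points_at_cayley[OF AB H(3,4,5)[OF Hg]])
    have "inj_on (\<lambda>i. act (cayley A) (cayley B) (cx.dg (cx.P i (g s)))) {1..k}"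
    proof (rule inj_onI)
      fix i j assume ij: "i \<in> {1..k}" "j \<in> {1..k}"
        and eq: "act (cayley A) (cayley B) (cx.dg (cx.P i (g s))) = act (cayley A) (cayley B) (cx.dg (cx.P j (g s)))"
      have "cx.dg (cx.P i (g s)) = cx.dg (cx.P j (g s))"
        by (rule injD[OF act_inj[OF cayley_orthogonal[OF AB(1,2)] cayley_orthogonal[OF AB(3,4)]] eq])
      then have "cx.P i (g s) = cx.P j (g s)" by (simp only: diag_vec_inject)
      then show "i = j" using inj_onD[OF H(6)[OF Hg]] ij by blast
    qed
    then show "finite (ED_critical_points (mat_vec ` Mset) y) \<and> card (ED_critical_points (mat_vec ` Mset) y) = k"
      unfolding crit by (simp add: card_image)
  next
    fix Y U V s
    assume RY: "R (complex_vec Y) \<noteq> 0" and UV: "orthogonal_matrix U" "orthogonal_matrix V"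
      and Y: "Y = act U V (diag_vec \<iota> s)"
    obtain A B g where AB: "skew A" "det (mat 2 - A) \<noteq> 0" "skew B" "det (mat 2 - B) \<noteq> 0" and g: "g \<in> sperms"
      "\<And>x. act U V (diag_vec \<iota> x) = act (cayley A) (cayley B) (diag_vec \<iota> (g x))"
      by (rule orthogonal_cayley_form[OF inj_\<iota> UV]) (rule that)
    note cay = complex_cayley_act[OF AB(2,4)]
    have cAB: "skew (cm A)" "det (mat 2 - cm A) \<noteq> 0" "skew (cm B)" "det (mat 2 - cm B) \<noteq> 0"
      using AB by (simp_all add: cm_skew det_two_minus_cm)
    have Yc: "complex_vec Y = act (cayley (cm A)) (cayley (cm B)) (cx.dg (complex_vec (g s)))"
      unfolding Y g(2) by (rule cay)
    have "F (act (cayley (cm A)) (cayley (cm B)) (cx.dg (complex_vec (g s)))) \<noteq> 0"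
      using RY unfolding Yc R_def by simp
    from FH[OF cayley_orthogonal[OF cAB(1,2)] cayley_orthogonal[OF cAB(3,4)] this sperms_id]
    have Hg: "H (complex_vec (g s)) \<noteq> 0" by simp
    have "ED_critical_points (mat_vec ` Mset) (complex_vec Y) =
      (\<lambda>i. act (cayley (cm A)) (cayley (cm B)) (cx.dg (cx.P i (complex_vec (g s))))) ` {1..k}"
      unfolding Yc by (rule critical_points_at_cayley[OF cAB H(3,4,5)[OF Hg]])
    also have "\<dots> = (\<lambda>x. complex_vec (act (cayley A) (cayley B) (diag_vec \<iota> x))) ` (\<lambda>i. aff (c i) (Q i) (g s)) ` {1..k}"
      by (simp only: image_image cay complex_P)
    also have "\<dots> = (\<lambda>x. complex_vec (act U V (diag_vec \<iota> x))) ` {x. \<exists>i\<in>{1..k}. is_orthogonal_projection (C i) s x}"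
      by (simp only: projections_of_signed_permutation[OF g(1)] image_image g(2))
    also have "\<dots> = {complex_vec (act U V (diag_vec \<iota> x)) |x. \<exists>i\<in>{1..k}. is_orthogonal_projection (C i) s x}" by blast
    finally show "ED_critical_points (mat_vec ` Mset) (complex_vec Y) =
      {complex_vec (act U V (diag_vec \<iota> x)) |x. \<exists>i\<in>{1..k}. is_orthogonal_projection (C i) s x}" .
  qed
qed

end


section \<open>The Euclidean distance degree\<close>

theorem corollary5p1:
  fixes S :: "(real ^ 'n::{finite,linorder}) set"
    and C :: "nat \<Rightarrow> (real ^ 'n::{finite,linorder}) set"
    and k :: nat
    and M :: "(real ^ 't::{finite,linorder} ^ 'n::{finite,linorder}) set"
  assumes "CARD('n) \<le> CARD('t)"
    and "subspace_arrangement S k C"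
    and "signed_perm_invariant S"
    and "M = singular_values -` S"
  shows "EDdegree (mat_vec ` M) = k \<and>
    generic_in UNIV (\<lambda>y. \<forall>Y :: real ^ 't::{finite,linorder} ^ 'n::{finite,linorder}. y = mat_vec Y \<longrightarrow>
      (let Crit = ED_critical_points (mat_vec ` M) (complex_vec (mat_vec Y)) in
        finite Crit \<and> card Crit = k \<and>
        (\<forall>(U :: real ^ 'n::{finite,linorder} ^ 'n::{finite,linorder}) (V :: real ^ 't::{finite,linorder} ^ 't::{finite,linorder}).
          orthogonal_matrix U \<and> orthogonal_matrix V \<and>
          Y = U ** Diag (singular_values Y) ** transpose V \<longrightarrow>
          Crit = {complex_vec (mat_vec (U ** Diag x ** transpose V)) |x.
                    \<exists>i\<in>{1..k}. is_orthogonal_projection (C i) (singular_values Y) x}) \<and>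
        Crit \<subseteq> range complex_vec))"
proof -
  obtain \<iota> :: "'n::{finite,linorder} \<Rightarrow> 't::{finite,linorder}" where \<iota>: "inj \<iota>"
    and Diag: "\<And>x :: real ^ 'n::{finite,linorder}.
      mat_vec (Diag x :: real ^ 't::{finite,linorder} ^ 'n::{finite,linorder}) = diag_vec \<iota> x"
    by (rule diagonal_positions[OF assms(1)]) (rule that)
  have "\<exists>cQ. transpose (snd cQ) = snd cQ \<and> snd cQ ** snd cQ = snd cQ \<and> snd cQ *v fst cQ = 0 \<and>
      C i = range (aff (fst cQ) (snd cQ)) \<and>
      (\<forall>x y. is_orthogonal_projection (C i) y x \<longleftrightarrow> x = aff (fst cQ) (snd cQ) y)" if i: "i \<in> {1..k}" for i
  proof -
    have Ci: "affine (C i)" "C i \<noteq> {}" using assms(2) i unfolding subspace_arrangement_def by blast+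
    obtain c Q where "transpose Q = Q" "Q ** Q = Q" "Q *v c = 0" "C i = range (aff c Q)"
      "\<And>x y. is_orthogonal_projection (C i) y x \<longleftrightarrow> x = aff c Q y"
      by (rule affine_subspace_projection[OF Ci]) (rule that)
    then show ?thesis by (intro exI[of _ "(c, Q)"]) simp
  qed
  then have "\<forall>i\<in>{1..k}. \<exists>cQ. transpose (snd cQ) = snd cQ \<and> snd cQ ** snd cQ = snd cQ \<and> snd cQ *v fst cQ = 0 \<and>
      C i = range (aff (fst cQ) (snd cQ)) \<and>
      (\<forall>x y. is_orthogonal_projection (C i) y x \<longleftrightarrow> x = aff (fst cQ) (snd cQ) y)" by (rule ballI)
  from bchoice[OF this] obtain cQ where
    cQ: "\<forall>i\<in>{1..k}. transpose (snd (cQ i)) = snd (cQ i) \<and> snd (cQ i) ** snd (cQ i) = snd (cQ i) \<and>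
      snd (cQ i) *v fst (cQ i) = 0 \<and> C i = range (aff (fst (cQ i)) (snd (cQ i))) \<and>
      (\<forall>x y. is_orthogonal_projection (C i) y x \<longleftrightarrow> x = aff (fst (cQ i)) (snd (cQ i)) y)" ..
  interpret signed_arrangement \<iota> S k C "\<lambda>i. fst (cQ i)" "\<lambda>i. snd (cQ i)"
    by (rule signed_arrangement.intro[OF \<iota> assms(2,3)]) (use cQ in blast)+
  let ?crit = "ED_critical_points (mat_vec ` M)"
  obtain R where R: "poly_fun R" "\<exists>y. R y \<noteq> 0"
    and complex: "\<And>y. R y \<noteq> 0 \<Longrightarrow> finite (?crit y) \<and> card (?crit y) = k"
    and real: "\<And>Y U V s. R (complex_vec Y) \<noteq> 0 \<Longrightarrow> orthogonal_matrix U \<Longrightarrow> orthogonal_matrix V \<Longrightarrow>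
      Y = act U V (diag_vec \<iota> s) \<Longrightarrow> ?crit (complex_vec Y) =
      {complex_vec (act U V (diag_vec \<iota> x)) |x. \<exists>i\<in>{1..k}. is_orthogonal_projection (C i) s x}"
    by (rule critical_points_of_generic_data[folded assms(4)]) (rule that)
  have generic: "generic_in UNIV (\<lambda>y. finite (?crit y) \<and> card (?crit y) = k)"
  proof -
    obtain y0 where "R y0 \<noteq> 0" using R(2) ..
    then show ?thesis by (rule generic_in_UNIV_I[OF R(1) _ complex])
  qed
  have "EDdegree (mat_vec ` M) = k"
    unfolding EDdegree_def
  proof (rule the_equality)
    fix d assume "generic_in UNIV (\<lambda>y. finite (?crit y) \<and> card (?crit y) = d)"
    from generic_in_UNIV_common[OF this generic] show "d = k" by auto
  qed (rule generic)
  obtain a b where ab: "poly_fun a" "poly_fun b" "\<forall>x. R (complex_vec x) = Complex (a x) (b x)"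
    using poly_fun_real_and_imaginary_part[OF R(1)] by blast
  \<comment> \<open>The real polynomial \<open>a\<^sup>2 + b\<^sup>2\<close> vanishes exactly where \<open>R\<close> vanishes at a real point.\<close>
  define q where "q x = a x * a x + b x * b x" for x
  have q: "q x = 0 \<longleftrightarrow> R (complex_vec x) = 0" for x
    using ab(3) by (simp add: q_def sum_squares_eq_zero_iff complex_eq_iff)
  have q_poly: "poly_fun q" unfolding q_def by (intro poly_fun_add poly_fun_mult ab)
  obtain y0 where y0: "q y0 \<noteq> 0" using poly_fun_zero_on_reals[OF R(1)] R(2) q by blast
  have main: "let Crit = ?crit (complex_vec (mat_vec Y)) in
        finite Crit \<and> card Crit = k \<and>
        (\<forall>(U :: real ^ 'n::{finite,linorder} ^ 'n::{finite,linorder}) (V :: real ^ 't::{finite,linorder} ^ 't::{finite,linorder}).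
          orthogonal_matrix U \<and> orthogonal_matrix V \<and>
          Y = U ** Diag (singular_values Y) ** transpose V \<longrightarrow>
          Crit = {complex_vec (mat_vec (U ** Diag x ** transpose V)) |x.
                    \<exists>i\<in>{1..k}. is_orthogonal_projection (C i) (singular_values Y) x}) \<and>
        Crit \<subseteq> range complex_vec"
    if "q (mat_vec Y) \<noteq> 0" for Y :: "real ^ 't::{finite,linorder} ^ 'n::{finite,linorder}"
  proof -
    have RY: "R (complex_vec (mat_vec Y)) \<noteq> 0" using that q by simp
    have Diag_act: "mat_vec (U ** Diag x ** transpose V) = act U V (diag_vec \<iota> x)"
      for U :: "real ^ 'n::{finite,linorder} ^ 'n::{finite,linorder}"
        and V :: "real ^ 't::{finite,linorder} ^ 't::{finite,linorder}" and x
      by (simp add: act_def Diag[symmetric])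
    have crit: "?crit (complex_vec (mat_vec Y)) = {complex_vec (mat_vec (U ** Diag x ** transpose V)) |x.
                    \<exists>i\<in>{1..k}. is_orthogonal_projection (C i) (singular_values Y) x}"
      if UV: "orthogonal_matrix U" "orthogonal_matrix V" and Y: "Y = U ** Diag (singular_values Y) ** transpose V"
      for U :: "real ^ 'n::{finite,linorder} ^ 'n::{finite,linorder}"
        and V :: "real ^ 't::{finite,linorder} ^ 't::{finite,linorder}"
    proof -
      have "mat_vec Y = act U V (diag_vec \<iota> (singular_values Y))" unfolding Diag_act[symmetric] Y[symmetric] ..
      from real[OF RY UV this] show ?thesis unfolding Diag_act .
    qed
    obtain U V where svd: "orthogonal_matrix U" "orthogonal_matrix V"
      "mat_vec Y = act U V (diag_vec \<iota> (singular_values Y))"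
      by (rule singular_value_decomposition[OF \<iota>])
    have "?crit (complex_vec (mat_vec Y)) \<subseteq> range complex_vec" unfolding real[OF RY svd] by blast
    then show ?thesis unfolding Let_def using complex[OF RY] crit by blast
  qed
  have "generic_in UNIV (\<lambda>y. \<forall>Y :: real ^ 't::{finite,linorder} ^ 'n::{finite,linorder}. y = mat_vec Y \<longrightarrow>
      (let Crit = ?crit (complex_vec (mat_vec Y)) in
        finite Crit \<and> card Crit = k \<and>
        (\<forall>(U :: real ^ 'n::{finite,linorder} ^ 'n::{finite,linorder}) (V :: real ^ 't::{finite,linorder} ^ 't::{finite,linorder}).
          orthogonal_matrix U \<and> orthogonal_matrix V \<and>
          Y = U ** Diag (singular_values Y) ** transpose V \<longrightarrow>
          Crit = {complex_vec (mat_vec (U ** Diag x ** transpose V)) |x.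
                    \<exists>i\<in>{1..k}. is_orthogonal_projection (C i) (singular_values Y) x}) \<and>
        Crit \<subseteq> range complex_vec))"
    by (intro generic_in_UNIV_I[OF q_poly y0] allI impI main) simp
  then show ?thesis using \<open>EDdegree (mat_vec ` M) = k\<close> by (intro conjI)
qed

end
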